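(* Let $V=(M_\psi\otimes K^* )\mathscr V(M_\psi\otimes K)$ with $\nu_0>3$, $0\le\mathscr V\in\mathcal B(\ell^2(\mathbb Z_h,\mathcal G))$ and $K\in\mathfrak S_2(\mathcal G)$. Then for all non-degenerate thresholds $\mu_s$ and $\frac4{h^2}+\mu_s$ in $\mathscr E_Q$, $s\in I_Q$: (i) As $\lambda\nearrow\mu_s$, $$\xi(\lambda;H^+,H_Q)=\mathcal O(1),\qquad \xi(\lambda;H^-,H_Q)\sim-\mathrm{Tr}\,\mathbf 1_{(1,+\infty)}(\omega_s(\lambda)).$$ (ii) As $\lambda\searrow\frac4{h^2}+\mu_s$, $$-\xi(\lambda;H^+,H_Q)\sim-\mathrm{Tr}\,\mathbf 1_{(1,+\infty)}(-\omega_{4,s}(\lambda)),\qquad \xi(\lambda;H^-,H_Q)=\mathcal O(1).$$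
   Context: Let $h>0$, $\mathbb Z_h=\{hn:n\in\mathbb Z\}$, and let $\mathcal G$ be a separable complex Hilbert space. $\ell^2(\mathbb Z_h)=\ell^2(\mathbb Z_h,\mathbb C)$ has scalar product $\langle\varphi,\phi\rangle=\sum_{n\in\mathbb Z}\overline{\varphi(hn)}\phi(hn)$, and $\ell^2(\mathbb Z_h,\mathcal G)$ is identified with $\ell^2(\mathbb Z_h)\otimes\mathcal G$. On $\ell^2(\mathbb Z_h)$, $(-\Delta_h\phi)(hn)=h^{-2}\big(2\phi(hn)-\phi(h(n+1))-\phi(h(n-1))\big)$, whose spectrum is $[0,4/h^2]$. $Q$ is a self-adjoint operator on $\mathcal G$ such that either $Q=0$, or $Q\ne0$ and $\mathcal G=\bigoplus_{s=1}^d\mathrm{Ker}(Q-\mu_s)$ with $d<+\infty$ and $\mu_1,\dots,\mu_d$ the distinct (real) eigenvalues of $Q$. If $Q=0$ put $I_Q=\{0\}$, $\mu_0=0$, $\pi_0=I_{\mathcal G}$; if $Q\neq0$ put $I_Q=\{1,\dots,d\}$ and let $\pi_s$ be the orthogonal projection onto $\mathrm{Ker}(Q-\mu_s)$. $H_Q=-\Delta_h\otimes I_{\mathcal G}+I_{\ell^2(\mathbb Z_h)}\otimes Q$; the threshold set is $\mathscr E_Q=\{\mu_s,\mu_s+4/h^2\}_{s\in I_Q}$. If $Q\ne0$, $\mu_s$ (resp. $\frac4{h^2}+\mu_s$) is non-degenerate if $\mu_s\ne\frac4{h^2}+\mu_{s'}$ (resp. $\frac4{h^2}+\mu_s\neq\mu_{s'}$)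 for all $s'\ne s$; if $Q=0$ both thresholds $0,4/h^2$ count as non-degenerate. $\mathfrak S_p$ denotes the Schatten class. $\langle n\rangle=(1+n^2)^{1/2}$, $\psi(hn)=\langle n\rangle^{-\nu_0/2}$, $M_\psi$ is multiplication by $\psi$ on $\ell^2(\mathbb Z_h)$. $H^\pm=H_Q\pm V$. Spectral shift function: put $\mathscr M=\mathscr V^{1/2}(M_\psi\otimes K)\in\mathfrak S_2$ (so $V=\mathscr M^*\mathscr M$) and $T(z)=\mathscr M(H_Q-z)^{-1}\mathscr M^*$. For each $\lambda\in\mathbb R\setminus\mathscr E_Q$ the limit $T(\lambda+i0)=\lim_{\varepsilon\searrow0}T(\lambda+i\varepsilon)$ exists in $\mathfrak S_2$; $A(\lambda+i0)$ and $B(\lambda+i0)$ are its real and imaginary (self-adjoint) parts, $0\le B(\lambda+i0)\in\mathfrak S_1$. For compact self-adjoint $S$ and $r>0$, $\mathscr N_\pm(r,S)=\mathrm{Rank}\,\mathbf 1_{(r,\infty)}(\pm S)$. The SSF is identified with its representative $\xi(\lambda;H^\pm,H_Q)=\pm\frac1\pi\int_{\mathbb R}\mathscr N_\mp(1,A(\lambda+i0)+tB(\lambda+i0))\frac{dt}{1+t^2}$, $\lambda\in\mathbb R\setminus\mathscr E_Q$. Effective operators: $\langle\psi|:\ell^2(\mathbb Z_h)\to\mathbb C$, $\phi\mapsto\langle\psi,\phi\rangle$; $(J\varphi)(hn)=(-1)^n\varphi(hn)$; $P_s=\langle\psi|\otimes\pi_s:\ell^2(\mathbb Z_h)\otimes\mathcal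 G\to\mathbb C\otimes\mathcal G$; $\mathbf V=(I\otimes K^* )\mathscr V(I\otimes K)$; $\mathbf V_J=(J\otimes I_{\mathcal G})^*\mathbf V(J\otimes I_{\mathcal G})$; $$\omega_s(\lambda)=\frac h2\frac{P_s\mathbf VP_s^*}{\sqrt{|\lambda-\mu_s|}},\qquad \omega_{4,s}(\lambda)=-\frac h2\frac{P_s\mathbf V_JP_s^*}{\sqrt{|4/h^2+\mu_s-\lambda|}}.$$ Notation $\sim$: for real functionals $F_1(V,\lambda),F_2(V,\lambda)$, $F_1(V,\lambda)\sim F_2(V,\lambda)$ as $\lambda\to\lambda_0$ means that for every $\varepsilon\in(0,1)$, $$F_2((1-\varepsilon)^{-1}V,\lambda)+\mathcal O_\varepsilon(1)\le F_1(V,\lambda)\le F_2((1+\varepsilon)^{-1}V,\lambda)+\mathcal O_\varepsilon(1),\quad\lambda\to\lambda_0,$$ where $F(cV,\lambda)$ is $F$ with $\mathscr V$ replaced by $c\mathscr V$ ($\nu_0$, $K$ fixed). *)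

theory Defs
  imports "HOL-Analysis.Analysis" "HOL-Library.Landau_Symbols"
begin

section \<open>Complex Hilbert spaces\<close>

text \<open>
  The scalar product is antilinear in the first argument. The underlying real scalar product is
  its real part, so that norm and topology are those of the library class \<^class>\<open>real_inner\<close>.
\<close>

class complex_inner = real_inner +
  fixes scaleC :: "complex \<Rightarrow> 'a \<Rightarrow> 'a"  (infixr \<open>*\<^sub>C\<close> 75)
    and cinner :: "'a \<Rightarrow> 'a \<Rightarrow> complex"
  assumes scaleC_add_right: "c *\<^sub>C (x + y) = c *\<^sub>C x + c *\<^sub>C y"
    and scaleC_add_left: "(b + c) *\<^sub>C x = b *\<^sub>C x + c *\<^sub>C x"
    and scaleC_scaleC: "b *\<^sub>C (c *\<^sub>C x) = (b * c) *\<^sub>C x"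
    and scaleC_of_real: "complex_of_real r *\<^sub>C x = r *\<^sub>R x"
    and cinner_commute: "cinner x y = cnj (cinner y x)"
    and cinner_add_right: "cinner x (y + z) = cinner x y + cinner x z"
    and cinner_scaleC_right: "cinner x (c *\<^sub>C y) = c * cinner x y"
    and Re_cinner: "Re (cinner x y) = inner x y"

class chilbert_space = complex_inner + banach

global_interpretation complex_vector: vector_space "scaleC :: complex \<Rightarrow> 'a \<Rightarrow> 'a :: complex_inner"
  defines cspan = complex_vector.span
    and cdim = complex_vector.dim
proof
  fix x :: 'a
  show "1 *\<^sub>C x = x"
    using scaleC_of_real[of 1 x] by simp
qed (simp_all add: scaleC_add_right scaleC_add_left scaleC_scaleC)

instantiation complex :: chilbert_space
begin

definition scaleC_complex :: "complex \<Rightarrow> complex \<Rightarrow> complex"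
  where "scaleC_complex c x = c * x"

definition cinner_complex :: "complex \<Rightarrow> complex \<Rightarrow> complex"
  where "cinner_complex x y = cnj x * y"

instance
  by standard
    (simp_all add: scaleC_complex_def cinner_complex_def algebra_simps scaleR_conv_of_real
      inner_complex_def)

end

lemma norm_cinner_le: "cmod (cinner x y) \<le> norm x * norm (y :: 'a :: complex_inner)"
proof (cases "cinner x y = 0")
  case False
  define c where "c = cnj (cinner x y) / cmod (cinner x y)"
  have nc: "cmod c = 1"
    using False by (simp add: c_def norm_divide)
  have "cinner x (c *\<^sub>C y) = of_real (cmod (cinner x y))"
    using False
    by (simp add: c_def cinner_scaleC_right complex_norm_square[symmetric] power2_eq_square
        mult.commute[of "cnj _"])
  then have 1: "cmod (cinner x y) = inner x (c *\<^sub>C y)"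
    by (metis Re_complex_of_real Re_cinner)
  have "cinner (c *\<^sub>C y) (c *\<^sub>C y) = (c * cnj c) * cinner y y"
    by (metis cinner_commute cinner_scaleC_right complex_cnj_mult mult.assoc complex_cnj_cnj)
  also have "c * cnj c = 1"
    using nc by (metis complex_norm_square of_real_1 one_power2)
  finally have "inner (c *\<^sub>C y) (c *\<^sub>C y) = inner y y"
    by (metis Re_cinner mult_1)
  then have "norm (c *\<^sub>C y) = norm y"
    by (simp add: norm_eq_sqrt_inner)
  then show ?thesis
    using 1 norm_cauchy_schwarz[of x "c *\<^sub>C y"] by simp
qed simp

lemma norm_scaleC: "norm (c *\<^sub>C x) = cmod c * norm (x :: 'a :: complex_inner)"
proof -
  have "cinner (c *\<^sub>C x) (c *\<^sub>C x) = (c * cnj c) * cinner x x"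
    by (metis cinner_commute cinner_scaleC_right complex_cnj_mult mult.assoc complex_cnj_cnj)
  also have "\<dots> = of_real ((cmod c)\<^sup>2) * cinner x x"
    using complex_norm_square[of c] by simp
  finally have "inner (c *\<^sub>C x) (c *\<^sub>C x) = (cmod c)\<^sup>2 * inner x x"
    by (simp flip: Re_cinner)
  then show ?thesis
    by (simp add: norm_eq_sqrt_inner real_sqrt_mult)
qed


section \<open>The space of square-summable functions on the lattice\<close>

text \<open>
  The index \<open>n\<close> stands for the lattice point \<open>h n\<close>, so this type is both
  \<open>\<ell>\<^sup>2(\<int>\<^sub>h, \<G>)\<close> and \<open>\<ell>\<^sup>2(\<int>\<^sub>h) \<otimes> \<G>\<close>, where \<open>\<phi> \<otimes> g\<close> is the function
  \<open>n \<mapsto> \<phi>(h n) g\<close>. The scalar product does not depend on \<open>h\<close>.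
\<close>

typedef (overloaded) 'g ell2 =
  "{u :: int \<Rightarrow> 'g :: chilbert_space. (\<lambda>n. (norm (u n))\<^sup>2) summable_on UNIV}"
  by (rule exI[of _ "\<lambda>_. 0"]) simp

setup_lifting type_definition_ell2

lemma square_summable_add:
  fixes u v :: "int \<Rightarrow> 'g :: chilbert_space"
  assumes "(\<lambda>n. (norm (u n))\<^sup>2) summable_on UNIV" "(\<lambda>n. (norm (v n))\<^sup>2) summable_on UNIV"
  shows "(\<lambda>n. (norm (u n + v n))\<^sup>2) summable_on UNIV"
proof (rule summable_on_comparison_test)
  show "(\<lambda>n. 2 * (norm (u n))\<^sup>2 + 2 * (norm (v n))\<^sup>2) summable_on UNIV"
    by (intro summable_on_add summable_on_cmult_right assms)
  fix n
  have "(norm (u n + v n))\<^sup>2 \<le> (norm (u n) + norm (v n))\<^sup>2"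
    by (intro power_mono norm_triangle_ineq) simp
  also have "\<dots> \<le> 2 * (norm (u n))\<^sup>2 + 2 * (norm (v n))\<^sup>2"
    using sum_squares_bound[of "norm (u n)" "norm (v n)"] by (simp add: power2_sum)
  finally show "(norm (u n + v n))\<^sup>2 \<le> 2 * (norm (u n))\<^sup>2 + 2 * (norm (v n))\<^sup>2" .
qed simp

lemma square_summable_scaleC:
  fixes u :: "int \<Rightarrow> 'g :: chilbert_space"
  assumes "(\<lambda>n. (norm (u n))\<^sup>2) summable_on UNIV"
  shows "(\<lambda>n. (norm (c *\<^sub>C u n))\<^sup>2) summable_on UNIV"
  using summable_on_cmult_right[OF assms, of "(cmod c)\<^sup>2"]
  by (simp add: norm_scaleC power_mult_distrib)

lemma summable_cinner:
  fixes u v :: "int \<Rightarrow> 'g :: chilbert_space"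
  assumes "(\<lambda>n. (norm (u n))\<^sup>2) summable_on UNIV" "(\<lambda>n. (norm (v n))\<^sup>2) summable_on UNIV"
  shows "(\<lambda>n. cinner (u n) (v n)) summable_on UNIV"
proof (rule abs_summable_summable, rule summable_on_comparison_test)
  show "(\<lambda>n. (norm (u n))\<^sup>2 + (norm (v n))\<^sup>2) summable_on UNIV"
    by (intro summable_on_add assms)
  fix n
  have "cmod (cinner (u n) (v n)) \<le> norm (u n) * norm (v n)"
    by (rule norm_cinner_le)
  also have "\<dots> \<le> (norm (u n))\<^sup>2 + (norm (v n))\<^sup>2"
    using sum_squares_bound[of "norm (u n)" "norm (v n)"]
      mult_nonneg_nonneg[OF norm_ge_zero[of "u n"] norm_ge_zero[of "v n"]] by linarith
  finally show "norm (cinner (u n) (v n)) \<le> (norm (u n))\<^sup>2 + (norm (v n))\<^sup>2" .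
qed simp

instantiation ell2 :: (chilbert_space) complex_inner
begin

lift_definition zero_ell2 :: "'a ell2" is "\<lambda>_. 0" by simp

lift_definition plus_ell2 :: "'a ell2 \<Rightarrow> 'a ell2 \<Rightarrow> 'a ell2" is "\<lambda>u v n. u n + v n"
  by (rule square_summable_add)

lift_definition uminus_ell2 :: "'a ell2 \<Rightarrow> 'a ell2" is "\<lambda>u n. - u n" by simp

lift_definition minus_ell2 :: "'a ell2 \<Rightarrow> 'a ell2 \<Rightarrow> 'a ell2" is "\<lambda>u v n. u n - v n"
  using square_summable_add[of _ "\<lambda>n. - _ n"] by simp

lift_definition scaleC_ell2 :: "complex \<Rightarrow> 'a ell2 \<Rightarrow> 'a ell2" is "\<lambda>c u n. c *\<^sub>C u n"
  by (rule square_summable_scaleC)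

lift_definition scaleR_ell2 :: "real \<Rightarrow> 'a ell2 \<Rightarrow> 'a ell2" is "\<lambda>r u n. r *\<^sub>R u n"
  using square_summable_scaleC[of _ "complex_of_real _"] by (simp add: scaleC_of_real)

lift_definition cinner_ell2 :: "'a ell2 \<Rightarrow> 'a ell2 \<Rightarrow> complex"
  is "\<lambda>u v. \<Sum>\<^sub>\<infinity>n. cinner (u n) (v n)" .

definition inner_ell2 :: "'a ell2 \<Rightarrow> 'a ell2 \<Rightarrow> real"
  where "inner_ell2 u v = Re (cinner u v)"

lemma Re_cinner_ell2:
  "Re (cinner u v) = (\<Sum>\<^sub>\<infinity>n. inner (Rep_ell2 u n) (Rep_ell2 v n))" for u v :: "'a ell2"
proof -
  have "(\<lambda>n. cinner (Rep_ell2 u n) (Rep_ell2 v n)) summable_on UNIV"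
    using Rep_ell2[of u] Rep_ell2[of v] by (intro summable_cinner) auto
  from infsum_Re[OF this] show ?thesis
    by (simp add: cinner_ell2.rep_eq Re_cinner)
qed

definition norm_ell2 :: "'a ell2 \<Rightarrow> real"
  where "norm_ell2 u = sqrt (inner u u)"

definition dist_ell2 :: "'a ell2 \<Rightarrow> 'a ell2 \<Rightarrow> real"
  where "dist_ell2 u v = norm (u - v)"

definition sgn_ell2 :: "'a ell2 \<Rightarrow> 'a ell2"
  where "sgn_ell2 u = inverse (norm u) *\<^sub>R u"

definition uniformity_ell2 :: "('a ell2 \<times> 'a ell2) filter"
  where "uniformity_ell2 = (INF e\<in>{0<..}. principal {(x, y). dist x y < e})"

definition open_ell2 :: "'a ell2 set \<Rightarrow> bool"
  where "open_ell2 U \<longleftrightarrow> (\<forall>x\<in>U. \<forall>\<^sub>F (x', y) in uniformity. x' = x \<longrightarrow> y \<in> U)"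

instance
proof
  fix x y z :: "'a ell2" and a b :: real and c e :: complex
  show "x + y + z = x + (y + z)" by transfer (simp add: add.assoc)
  show "x + y = y + x" by transfer (simp add: add.commute)
  show "0 + x = x" by transfer simp
  show "- x + x = 0" by transfer simp
  show "x - y = x + - y" by transfer simp
  show "a *\<^sub>R (x + y) = a *\<^sub>R x + a *\<^sub>R y" by transfer (simp add: scaleR_add_right)
  show "(a + b) *\<^sub>R x = a *\<^sub>R x + b *\<^sub>R x" by transfer (simp add: scaleR_add_left)
  show "a *\<^sub>R b *\<^sub>R x = (a * b) *\<^sub>R x" by transfer simp
  show "1 *\<^sub>R x = x" by transfer simp
  show "sgn x = inverse (norm x) *\<^sub>R x" by (rule sgn_ell2_def)
  show "dist x y = norm (x - y)" by (rule dist_ell2_def)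
  show "(uniformity :: ('a ell2 \<times> 'a ell2) filter) =
      (INF e\<in>{0<..}. principal {(x, y). dist x y < e})"
    by (rule uniformity_ell2_def)
  show "open U \<longleftrightarrow> (\<forall>x\<in>U. \<forall>\<^sub>F (x', y) in uniformity. x' = x \<longrightarrow> y \<in> U)" for U :: "'a ell2 set"
    by (rule open_ell2_def)
  show comm: "cinner x y = cnj (cinner y x)" for x y :: "'a ell2"
    unfolding cinner_ell2.rep_eq infsum_cnj[symmetric]
    by (rule infsum_cong) (rule cinner_commute)
  show add: "cinner x (y + z) = cinner x y + cinner x z" for x y z :: "'a ell2"
    by transfer (simp add: cinner_add_right infsum_add summable_cinner)
  show sc: "cinner x (c *\<^sub>C y) = c * cinner x y" for c and x y :: "'a ell2"
    by transfer (simp add: cinner_scaleC_right infsum_cmult_right')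
  show ofr: "complex_of_real a *\<^sub>C x = a *\<^sub>R x" for a and x :: "'a ell2"
    by transfer (simp add: scaleC_of_real)
  show "c *\<^sub>C (x + y) = c *\<^sub>C x + c *\<^sub>C y" by transfer (simp add: scaleC_add_right)
  show "(c + e) *\<^sub>C x = c *\<^sub>C x + e *\<^sub>C x" by transfer (simp add: scaleC_add_left)
  show "c *\<^sub>C e *\<^sub>C x = (c * e) *\<^sub>C x" by transfer (simp add: scaleC_scaleC)
  show "Re (cinner x y) = inner x y" by (simp add: inner_ell2_def)
  show comm': "inner x y = inner y x" for x y :: "'a ell2"
    unfolding inner_ell2_def by (subst comm) simp
  show "inner (x + y) z = inner x z + inner y z"
    unfolding comm'[of _ z] by (simp add: inner_ell2_def add)
  show "inner (a *\<^sub>R x) y = a * inner x y"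
    unfolding comm'[of _ y] by (simp add: inner_ell2_def sc flip: ofr)
  have xx: "inner x x = (\<Sum>\<^sub>\<infinity>n. (norm (Rep_ell2 x n))\<^sup>2)"
    by (simp add: inner_ell2_def Re_cinner_ell2 power2_norm_eq_inner)
  show "0 \<le> inner x x"
    unfolding xx by (intro infsum_nonneg) simp
  show "inner x x = 0 \<longleftrightarrow> x = 0"
  proof
    assume "inner x x = 0"
    then have "(norm (Rep_ell2 x n))\<^sup>2 = 0" for n
      unfolding xx
      by (intro nonneg_infsum_le_0D[where A = UNIV]) (use Rep_ell2[of x] in auto)
    then show "x = 0"
      by transfer auto
  next
    assume "x = 0"
    then show "inner x x = 0"
      unfolding xx by (simp add: zero_ell2.rep_eq)
  qed
  show "norm x = sqrt (inner x x)" by (rule norm_ell2_def)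
qed

end

lemma square_summable_Rep_ell2: "(\<lambda>n. (norm (Rep_ell2 u n))\<^sup>2) summable_on UNIV"
  using Rep_ell2[of u] by blast

lemma norm_ell2_square: "(norm u)\<^sup>2 = (\<Sum>\<^sub>\<infinity>n. (norm (Rep_ell2 u n))\<^sup>2)"
  by (simp add: power2_norm_eq_inner inner_ell2_def Re_cinner_ell2)

lemma sum_le_norm_ell2_square:
  "finite F \<Longrightarrow> (\<Sum>n\<in>F. (norm (Rep_ell2 u n))\<^sup>2) \<le> (norm u)\<^sup>2"
  unfolding norm_ell2_square by (rule finite_sum_le_infsum[OF square_summable_Rep_ell2]) simp_all

lemma norm_Rep_ell2_le: "norm (Rep_ell2 u n) \<le> norm u"
  using sum_le_norm_ell2_square[of "{n}" u] by (simp add: power2_le_iff_abs_le)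

instance ell2 :: (chilbert_space) chilbert_space
proof
  fix X :: "nat \<Rightarrow> 'a ell2"
  assume X: "Cauchy X"
  have "Cauchy (\<lambda>m. Rep_ell2 (X m) n)" for n
  proof (rule CauchyI)
    fix e :: real
    assume "0 < e"
    then obtain M where M: "\<forall>m\<ge>M. \<forall>k\<ge>M. norm (X m - X k) < e"
      using CauchyD[OF X] by blast
    show "\<exists>M. \<forall>m\<ge>M. \<forall>k\<ge>M. norm (Rep_ell2 (X m) n - Rep_ell2 (X k) n) < e"
    proof (intro exI allI impI)
      fix m k
      assume "M \<le> m" "M \<le> k"
      then have "norm (X m - X k) < e"
        using M by blast
      with norm_Rep_ell2_le[of "X m - X k" n]
      show "norm (Rep_ell2 (X m) n - Rep_ell2 (X k) n) < e"
        unfolding minus_ell2.rep_eq by linarith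
    qed
  qed
  then have "\<forall>n. \<exists>l. (\<lambda>m. Rep_ell2 (X m) n) \<longlonglongrightarrow> l"
    by (auto simp: Cauchy_convergent_iff convergent_def)
  from choice[OF this] obtain f where f: "\<And>n. (\<lambda>m. Rep_ell2 (X m) n) \<longlonglongrightarrow> f n"
    by blast
  have bound: "(\<Sum>n\<in>F. (norm (Rep_ell2 (X m) n - f n))\<^sup>2) \<le> e\<^sup>2"
    if "finite F" "0 < e" and M: "\<forall>k\<ge>M. norm (X m - X k) < e" for F m M and e :: real
  proof (rule LIMSEQ_le_const2)
    show "(\<lambda>k. \<Sum>n\<in>F. (norm (Rep_ell2 (X m) n - Rep_ell2 (X k) n))\<^sup>2)
        \<longlonglongrightarrow> (\<Sum>n\<in>F. (norm (Rep_ell2 (X m) n - f n))\<^sup>2)"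
      by (intro tendsto_intros f)
    have "(\<Sum>n\<in>F. (norm (Rep_ell2 (X m) n - Rep_ell2 (X k) n))\<^sup>2) \<le> e\<^sup>2" if "k \<ge> M" for k
    proof -
      have "(norm (X m - X k))\<^sup>2 \<le> e\<^sup>2"
        using M that by (intro power_mono) (auto intro: less_imp_le)
      then show ?thesis
        using sum_le_norm_ell2_square[OF \<open>finite F\<close>, of "X m - X k"]
        by (simp add: minus_ell2.rep_eq)
    qed
    then show "\<exists>N. \<forall>k\<ge>N. (\<Sum>n\<in>F. (norm (Rep_ell2 (X m) n - Rep_ell2 (X k) n))\<^sup>2) \<le> e\<^sup>2"
      by blast
  qed
  have diff: "(\<lambda>n. (norm (Rep_ell2 (X m) n - f n))\<^sup>2) summable_on UNIV \<and>
      (\<Sum>\<^sub>\<infinity>n. (norm (Rep_ell2 (X m) n - f n))\<^sup>2) \<le> e\<^sup>2"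
    if "0 < e" and M: "\<forall>k\<ge>M. norm (X m - X k) < e" for m M and e :: real
  proof
    show *: "(\<lambda>n. (norm (Rep_ell2 (X m) n - f n))\<^sup>2) summable_on UNIV"
      by (rule nonneg_bdd_above_summable_on)
        (auto intro!: bdd_aboveI2[where M = "e\<^sup>2"] bound[OF _ that])
    show "(\<Sum>\<^sub>\<infinity>n. (norm (Rep_ell2 (X m) n - f n))\<^sup>2) \<le> e\<^sup>2"
      using * by (rule infsum_le_finite_sums) (auto intro: bound[OF _ that])
  qed
  obtain M where "\<forall>m\<ge>M. \<forall>k\<ge>M. norm (X m - X k) < 1"
    using CauchyD[OF X, of 1] by auto
  then have "(\<lambda>n. (norm (Rep_ell2 (X M) n - f n))\<^sup>2) summable_on UNIV"
    using diff[of 1 M M] by simp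
  then have "(\<lambda>n. (norm (f n - Rep_ell2 (X M) n))\<^sup>2) summable_on UNIV"
    by (simp add: norm_minus_commute)
  then have sf: "(\<lambda>n. (norm (f n))\<^sup>2) summable_on UNIV"
    using square_summable_add[OF _ square_summable_Rep_ell2[of "X M"],
        of "\<lambda>n. f n - Rep_ell2 (X M) n"]
    by simp
  have "X \<longlonglongrightarrow> Abs_ell2 f"
  proof (rule LIMSEQ_I)
    fix e :: real
    assume e: "0 < e"
    then obtain M where M: "\<forall>m\<ge>M. \<forall>k\<ge>M. norm (X m - X k) < e / 2"
      using CauchyD[OF X, of "e / 2"] by auto
    have "norm (X m - Abs_ell2 f) < e" if "m \<ge> M" for m
    proof -
      have "(norm (X m - Abs_ell2 f))\<^sup>2 \<le> (e / 2)\<^sup>2"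
        unfolding norm_ell2_square
        using diff[of "e / 2" M m] e M that sf by (simp add: minus_ell2.rep_eq Abs_ell2_inverse)
      then have "norm (X m - Abs_ell2 f) \<le> e / 2"
        by (rule power2_le_imp_le) (use e in simp)
      then show ?thesis
        using e by simp
    qed
    then show "\<exists>M. \<forall>m\<ge>M. norm (X m - Abs_ell2 f) < e"
      by blast
  qed
  then show "convergent X"
    by (auto simp: convergent_def)
qed

section \<open>Operators\<close>

definition bounded_clinear :: "('a :: complex_inner \<Rightarrow> 'b :: complex_inner) \<Rightarrow> bool"
  where "bounded_clinear A \<longleftrightarrow> bounded_linear A \<and> (\<forall>c x. A (c *\<^sub>C x) = c *\<^sub>C A x)"

definition adj :: "('a :: chilbert_space \<Rightarrow> 'b :: chilbert_space) \<Rightarrow> 'b \<Rightarrow> 'a"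
  where "adj A = (THE B. \<forall>x y. cinner (B y) x = cinner y (A x))"

definition self_adjoint :: "('a :: chilbert_space \<Rightarrow> 'a) \<Rightarrow> bool"
  where "self_adjoint A \<longleftrightarrow> bounded_clinear A \<and> (\<forall>x y. cinner (A x) y = cinner x (A y))"

definition positive_op :: "('a :: chilbert_space \<Rightarrow> 'a) \<Rightarrow> bool"
  where "positive_op A \<longleftrightarrow>
    bounded_clinear A \<and> (\<forall>x. cinner x (A x) \<in> \<real> \<and> 0 \<le> Re (cinner x (A x)))"

definition op_sqrt :: "('a :: chilbert_space \<Rightarrow> 'a) \<Rightarrow> 'a \<Rightarrow> 'a"
  where "op_sqrt A = (THE R. positive_op R \<and> R \<circ> R = A)"

definition eigenspace :: "('a :: chilbert_space \<Rightarrow> 'a) \<Rightarrow> real \<Rightarrow> 'a set"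
  where "eigenspace A \<kappa> = {x. A x = \<kappa> *\<^sub>R x}"

definition orth_proj :: "'a :: chilbert_space set \<Rightarrow> 'a \<Rightarrow> 'a"
  where "orth_proj S x = (THE p. p \<in> S \<and> (\<forall>y\<in>S. cinner y (x - p) = 0))"

definition is_onb :: "'a :: chilbert_space set \<Rightarrow> bool"
  where "is_onb E \<longleftrightarrow>
    (\<forall>e\<in>E. \<forall>f\<in>E. cinner e f = (if e = f then 1 else 0)) \<and> closure (cspan E) = UNIV"

definition trace_op :: "('a :: chilbert_space \<Rightarrow> 'a) \<Rightarrow> complex"
  where "trace_op A = (\<Sum>\<^sub>\<infinity>e\<in>(SOME E. is_onb E). cinner e (A e))"

text \<open>The Schatten class of exponent 2: the trace of \<open>|A|\<^sup>2 = A\<^sup>* A\<close> is finite.\<close>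

definition schatten2 :: "('a :: chilbert_space \<Rightarrow> 'b :: chilbert_space) \<Rightarrow> bool"
  where "schatten2 A \<longleftrightarrow>
    bounded_clinear A \<and> (\<exists>E. is_onb E \<and> (\<lambda>e. cinner e (adj A (A e))) summable_on E)"

definition schatten2_norm :: "('a :: chilbert_space \<Rightarrow> 'b :: chilbert_space) \<Rightarrow> real"
  where "schatten2_norm A = sqrt (Re (trace_op (adj A \<circ> A)))"

text \<open>
  The spectral projection \<open>\<one>\<^bsub>(r,\<infinity>)\<^esub>(A)\<close> of a compact self-adjoint operator \<open>A\<close>, for \<open>r > 0\<close>.
  By the spectral theorem it projects onto the closed span of the eigenvectors with
  eigenvalue in \<open>(r,\<infinity>)\<close>. All operators to which it is applied below are compact.
\<close>

definition spectral_proj_above :: "real \<Rightarrow> ('a :: chilbert_space \<Rightarrow> 'a) \<Rightarrow> 'a \<Rightarrow> 'a"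
  where "spectral_proj_above r A = orth_proj (closure (cspan (\<Union>\<kappa>\<in>{r<..}. eigenspace A \<kappa>)))"

definition counting_pos :: "real \<Rightarrow> ('a :: chilbert_space \<Rightarrow> 'a) \<Rightarrow> nat"
  where "counting_pos r A = cdim (range (spectral_proj_above r A))"

definition counting_neg :: "real \<Rightarrow> ('a :: chilbert_space \<Rightarrow> 'a) \<Rightarrow> nat"
  where "counting_neg r A = counting_pos r (\<lambda>x. - A x)"


section \<open>The unperturbed operator and its thresholds\<close>

text \<open>
  \<open>M\<^sub>f \<otimes> L\<close>, for a bounded function \<open>f\<close> on the lattice and a bounded operator \<open>L\<close> on \<open>\<G>\<close>.
\<close>

definition mult_tensor ::
    "(int \<Rightarrow> complex) \<Rightarrow> ('g :: chilbert_space \<Rightarrow> 'g) \<Rightarrow> 'g ell2 \<Rightarrow> 'g ell2"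
  where "mult_tensor f L u = Abs_ell2 (\<lambda>n. f n *\<^sub>C L (Rep_ell2 u n))"

text \<open>\<open>-\<Delta>\<^sub>h \<otimes> I\<close>\<close>

definition neg_laplacian :: "real \<Rightarrow> 'g :: chilbert_space ell2 \<Rightarrow> 'g ell2"
  where "neg_laplacian h u = Abs_ell2 (\<lambda>n.
    (1 / h\<^sup>2) *\<^sub>R (2 *\<^sub>R Rep_ell2 u n - Rep_ell2 u (n + 1) - Rep_ell2 u (n - 1)))"

definition H_Q :: "real \<Rightarrow> ('g :: chilbert_space \<Rightarrow> 'g) \<Rightarrow> 'g ell2 \<Rightarrow> 'g ell2"
  where "H_Q h Q u = neg_laplacian h u + mult_tensor (\<lambda>_. 1) Q u"

definition I_Q :: "('g :: chilbert_space \<Rightarrow> 'g) \<Rightarrow> nat \<Rightarrow> nat set"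
  where "I_Q Q d = (if Q = (\<lambda>_. 0) then {0} else {1..d})"

text \<open>
  Either \<open>Q = 0\<close> and \<open>\<mu> 0 = 0\<close>, or \<open>\<mu> 1, \<dots>, \<mu> d\<close> are the distinct eigenvalues of \<open>Q\<close> and
  \<open>\<G>\<close> is the sum of the eigenspaces; since \<open>Q\<close> is self-adjoint, the sum is then orthogonal.
\<close>

definition eigenvalue_enum ::
    "('g :: chilbert_space \<Rightarrow> 'g) \<Rightarrow> nat \<Rightarrow> (nat \<Rightarrow> real) \<Rightarrow> bool"
  where "eigenvalue_enum Q d \<mu> \<longleftrightarrow>
    (if Q = (\<lambda>_. 0) then \<mu> 0 = 0
     else bij_betw \<mu> {1..d} {\<kappa>. eigenspace Q \<kappa> \<noteq> {0}} \<and>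
       (\<forall>x. \<exists>v. (\<forall>s\<in>{1..d}. v s \<in> eigenspace Q (\<mu> s)) \<and> x = (\<Sum>s\<in>{1..d}. v s)))"

definition eigenproj ::
    "('g :: chilbert_space \<Rightarrow> 'g) \<Rightarrow> (nat \<Rightarrow> real) \<Rightarrow> nat \<Rightarrow> 'g \<Rightarrow> 'g"
  where "eigenproj Q \<mu> s = (if Q = (\<lambda>_. 0) then id else orth_proj (eigenspace Q (\<mu> s)))"

text \<open>For \<open>Q = 0\<close> the next two conditions are vacuous, so both thresholds are non-degenerate.\<close>

definition nondegenerate_lower ::
    "real \<Rightarrow> ('g :: chilbert_space \<Rightarrow> 'g) \<Rightarrow> nat \<Rightarrow> (nat \<Rightarrow> real) \<Rightarrow> nat \<Rightarrow> bool"
  where "nondegenerate_lower h Q d \<mu> s \<longleftrightarrow>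
    (\<forall>s'\<in>I_Q Q d. s' \<noteq> s \<longrightarrow> \<mu> s \<noteq> 4 / h\<^sup>2 + \<mu> s')"

definition nondegenerate_upper ::
    "real \<Rightarrow> ('g :: chilbert_space \<Rightarrow> 'g) \<Rightarrow> nat \<Rightarrow> (nat \<Rightarrow> real) \<Rightarrow> nat \<Rightarrow> bool"
  where "nondegenerate_upper h Q d \<mu> s \<longleftrightarrow>
    (\<forall>s'\<in>I_Q Q d. s' \<noteq> s \<longrightarrow> 4 / h\<^sup>2 + \<mu> s \<noteq> \<mu> s')"


section \<open>The spectral shift function\<close>

definition psi :: "real \<Rightarrow> int \<Rightarrow> real"
  where "psi \<nu> n = sqrt (1 + (of_int n)\<^sup>2) powr (- \<nu> / 2)"

text \<open>
  \<open>\<M> = \<V>\<^bsup>1/2\<^esup> (M\<^sub>\<psi> \<otimes> K)\<close>, a factor of the perturbation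
  \<open>V = (M\<^sub>\<psi> \<otimes> K\<^sup>*) \<V> (M\<^sub>\<psi> \<otimes> K) = \<M>\<^sup>* \<M>\<close>.
\<close>

definition perturbation_factor ::
    "real \<Rightarrow> ('g :: chilbert_space \<Rightarrow> 'g) \<Rightarrow> ('g ell2 \<Rightarrow> 'g ell2) \<Rightarrow> 'g ell2 \<Rightarrow> 'g ell2"
  where "perturbation_factor \<nu> K W = op_sqrt W \<circ> mult_tensor (\<lambda>n. of_real (psi \<nu> n)) K"

definition resolvent :: "('a :: chilbert_space \<Rightarrow> 'a) \<Rightarrow> complex \<Rightarrow> 'a \<Rightarrow> 'a"
  where "resolvent A z = inv (\<lambda>u. A u - z *\<^sub>C u)"

definition sandwiched_resolvent ::
    "('a :: chilbert_space \<Rightarrow> 'a) \<Rightarrow> ('a \<Rightarrow> 'a) \<Rightarrow> complex \<Rightarrow> 'a \<Rightarrow> 'a"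
  where "sandwiched_resolvent H M z = M \<circ> resolvent H z \<circ> adj M"

text \<open>\<open>T(lam + i0)\<close>; the limit is taken in the Schatten norm of exponent 2.\<close>

definition boundary_value ::
    "('a :: chilbert_space \<Rightarrow> 'a) \<Rightarrow> ('a \<Rightarrow> 'a) \<Rightarrow> real \<Rightarrow> 'a \<Rightarrow> 'a"
  where "boundary_value H M lam = (THE L. schatten2 L \<and>
    (\<forall>\<^sub>F \<epsilon> in at_right 0. schatten2 (sandwiched_resolvent H M (Complex lam \<epsilon>))) \<and>
    ((\<lambda>\<epsilon>. schatten2_norm (\<lambda>u. sandwiched_resolvent H M (Complex lam \<epsilon>) u - L u)) \<longlongrightarrow> 0)
      (at_right 0))"

definition re_op :: "('a :: chilbert_space \<Rightarrow> 'a) \<Rightarrow> 'a \<Rightarrow> 'a"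
  where "re_op T u = (1 / 2) *\<^sub>C (T u + adj T u)"

definition im_op :: "('a :: chilbert_space \<Rightarrow> 'a) \<Rightarrow> 'a \<Rightarrow> 'a"
  where "im_op T u = (1 / (2 * \<i>)) *\<^sub>C (T u - adj T u)"

definition pencil ::
    "('a :: chilbert_space \<Rightarrow> 'a) \<Rightarrow> ('a \<Rightarrow> 'a) \<Rightarrow> real \<Rightarrow> real \<Rightarrow> 'a \<Rightarrow> 'a"
  where "pencil H M lam t u =
    re_op (boundary_value H M lam) u + t *\<^sub>R im_op (boundary_value H M lam) u"

text \<open>
  \<open>\<xi>(lam; H + M\<^sup>*M, H)\<close> and \<open>\<xi>(lam; H - M\<^sup>*M, H)\<close>, through the representative given by Pushnitski's
  formula.
\<close>

definition ssf_plus :: "('a :: chilbert_space \<Rightarrow> 'a) \<Rightarrow> ('a \<Rightarrow> 'a) \<Rightarrow> real \<Rightarrow> real"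
  where "ssf_plus H M lam =
    (1 / pi) * (LINT t|lborel. real (counting_neg 1 (pencil H M lam t)) / (1 + t\<^sup>2))"

definition ssf_minus :: "('a :: chilbert_space \<Rightarrow> 'a) \<Rightarrow> ('a \<Rightarrow> 'a) \<Rightarrow> real \<Rightarrow> real"
  where "ssf_minus H M lam =
    - (1 / pi) * (LINT t|lborel. real (counting_pos 1 (pencil H M lam t)) / (1 + t\<^sup>2))"

text \<open>\<open>\<xi>(lam; H\<^sup>\<plusminus>, H\<^sub>Q)\<close> as functionals of \<open>\<V>\<close> and \<open>lam\<close>.\<close>

definition xi_plus ::
    "real \<Rightarrow> ('g :: chilbert_space \<Rightarrow> 'g) \<Rightarrow> real \<Rightarrow> ('g \<Rightarrow> 'g) \<Rightarrow> ('g ell2 \<Rightarrow> 'g ell2) \<Rightarrow> real \<Rightarrow> real"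
  where "xi_plus h Q \<nu> K W = ssf_plus (H_Q h Q) (perturbation_factor \<nu> K W)"

definition xi_minus ::
    "real \<Rightarrow> ('g :: chilbert_space \<Rightarrow> 'g) \<Rightarrow> real \<Rightarrow> ('g \<Rightarrow> 'g) \<Rightarrow> ('g ell2 \<Rightarrow> 'g ell2) \<Rightarrow> real \<Rightarrow> real"
  where "xi_minus h Q \<nu> K W = ssf_minus (H_Q h Q) (perturbation_factor \<nu> K W)"


section \<open>The effective operators\<close>

text \<open>\<open>P\<^sub>s = \<langle>\<psi>| \<otimes> \<pi>\<^sub>s\<close>, with \<open>\<complex> \<otimes> \<G>\<close> identified with \<open>\<G>\<close>.\<close>

definition P_op ::
    "real \<Rightarrow> ('g :: chilbert_space \<Rightarrow> 'g) \<Rightarrow> (nat \<Rightarrow> real) \<Rightarrow> nat \<Rightarrow> 'g ell2 \<Rightarrow> 'g"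
  where "P_op \<nu> Q \<mu> s u = (\<Sum>\<^sub>\<infinity>n. psi \<nu> n *\<^sub>R eigenproj Q \<mu> s (Rep_ell2 u n))"

text \<open>\<open>J \<otimes> I\<close>\<close>

definition J_op :: "'g :: chilbert_space ell2 \<Rightarrow> 'g ell2"
  where "J_op = mult_tensor (\<lambda>n. (-1) powi n) id"

definition V_eff :: "('g :: chilbert_space \<Rightarrow> 'g) \<Rightarrow> ('g ell2 \<Rightarrow> 'g ell2) \<Rightarrow> 'g ell2 \<Rightarrow> 'g ell2"
  where "V_eff K W = mult_tensor (\<lambda>_. 1) (adj K) \<circ> W \<circ> mult_tensor (\<lambda>_. 1) K"

definition V_eff_J :: "('g :: chilbert_space \<Rightarrow> 'g) \<Rightarrow> ('g ell2 \<Rightarrow> 'g ell2) \<Rightarrow> 'g ell2 \<Rightarrow> 'g ell2"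
  where "V_eff_J K W = adj J_op \<circ> V_eff K W \<circ> J_op"

definition omega_lower ::
    "real \<Rightarrow> ('g :: chilbert_space \<Rightarrow> 'g) \<Rightarrow> (nat \<Rightarrow> real) \<Rightarrow> real \<Rightarrow> ('g \<Rightarrow> 'g) \<Rightarrow> nat \<Rightarrow>
      ('g ell2 \<Rightarrow> 'g ell2) \<Rightarrow> real \<Rightarrow> 'g \<Rightarrow> 'g"
  where "omega_lower h Q \<mu> \<nu> K s W lam g =
    (h / 2 / sqrt \<bar>lam - \<mu> s\<bar>) *\<^sub>R P_op \<nu> Q \<mu> s (V_eff K W (adj (P_op \<nu> Q \<mu> s) g))"

definition omega_upper ::
    "real \<Rightarrow> ('g :: chilbert_space \<Rightarrow> 'g) \<Rightarrow> (nat \<Rightarrow> real) \<Rightarrow> real \<Rightarrow> ('g \<Rightarrow> 'g) \<Rightarrow> nat \<Rightarrow>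
      ('g ell2 \<Rightarrow> 'g ell2) \<Rightarrow> real \<Rightarrow> 'g \<Rightarrow> 'g"
  where "omega_upper h Q \<mu> \<nu> K s W lam g =
    - (h / 2 / sqrt \<bar>4 / h\<^sup>2 + \<mu> s - lam\<bar>) *\<^sub>R P_op \<nu> Q \<mu> s (V_eff_J K W (adj (P_op \<nu> Q \<mu> s) g))"

definition trace_above_one :: "('g :: chilbert_space \<Rightarrow> 'g) \<Rightarrow> real"
  where "trace_above_one A = Re (trace_op (spectral_proj_above 1 A))"


section \<open>Asymptotic comparison\<close>

text \<open>
  \<open>F\<^sub>1(V, lam) \<sim> F\<^sub>2(V, lam)\<close> along the filter \<open>flt\<close> in \<open>lam\<close>, for functionals of \<open>\<V>\<close> (here \<open>W\<close>);
  the \<open>\<O>\<^sub>\<epsilon>(1)\<close> terms may depend on \<open>\<epsilon>\<close>.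
\<close>

definition functional_sim ::
    "real filter \<Rightarrow> (('a :: complex_inner \<Rightarrow> 'a) \<Rightarrow> real \<Rightarrow> real) \<Rightarrow>
      (('a \<Rightarrow> 'a) \<Rightarrow> real \<Rightarrow> real) \<Rightarrow> ('a \<Rightarrow> 'a) \<Rightarrow> bool"
  where "functional_sim flt F1 F2 W \<longleftrightarrow>
    (\<forall>\<epsilon>\<in>{0<..<1}. \<exists>r1\<in>O[flt](\<lambda>_. 1). \<exists>r2\<in>O[flt](\<lambda>_. 1). \<forall>\<^sub>F lam in flt.
      F2 (\<lambda>u. inverse (1 - \<epsilon>) *\<^sub>R W u) lam + r1 lam \<le> F1 W lam \<and>
      F1 W lam \<le> F2 (\<lambda>u. inverse (1 + \<epsilon>) *\<^sub>R W u) lam + r2 lam)"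

end

theory Submission
  imports Defs
begin

text \<open>
  The Green function \<open>h\<^sup>2 k\<^bsup>|n - m|\<^esup> / (1/k - k)\<close> of the discrete Laplacian, where \<open>k + 1/k = 2 - z h\<^sup>2\<close>
  and \<open>|k| < 1\<close>, gives the boundary values \<open>T(lam + i0)\<close> explicitly. The condition \<open>\<nu>\<^sub>0 > 3\<close> makes
  \<open>(1 + |n|) \<psi>(n)\<close> square summable, so that kernels of size \<open>\<psi>(n) \<psi>(m) (1 + |n - m|)\<close> are harmless. As
  \<open>lam\<close> approaches a non-degenerate threshold, \<open>T(lam + i0)\<close> is therefore a rank one kernel in one
  channel, with coefficient of order \<open>h / (2 \<surd>|lam - lam\<^sub>0|)\<close>, plus a remainder that is bounded in
  Hilbert-Schmidt norm and whose imaginary part is positive with bounded trace. The singular part is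
  \<open>Y\<^sup>* Y\<close> times a scalar with \<open>Y Y\<^sup>*\<close> the effective operator. By Weyl's inequality the remainder changes
  the counting functions by \<open>O(1)\<close>; the trace bound makes the average over \<open>t\<close> of the counting
  function of the imaginary part finite.
\<close>

section \<open>Hilbert spaces\<close>

text \<open>The limits are taken from outside the band of the critical channel, where the root k is
  real, so the divergent rank one term sits in the real part of T(lam + i0) alone. The imaginary
  part comes only from channels whose band contains lam; there |k| = 1, and the entry cos(theta (n -
  m)) is a sum of two products, which yields positivity and the trace bound at once. Non-degeneracy
  keeps the coefficients of these other channels bounded. The sign of the divergent term is that of
  k at the threshold: k tends to 1 at a lower edge and to -1 at an upper edge, where the powers of
  -1 produce J. So for one sign of the perturbation the count follows the effective operator, and
  for the other it only sees the remainder. Dividing V by r turns the count of the effective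
  operator above 1 into its count above r, hence the relation asks for bounds by counts above 1 -
  epsilon and 1 + epsilon; half of epsilon pays for the remainder of the real part and half for the
  average over t.\<close>

lemma bounded_bilinear_cinner:
  "bounded_bilinear (cinner :: 'a :: complex_inner \<Rightarrow> 'a \<Rightarrow> complex)"
proof
  fix x y z :: 'a and r :: real
  show add: "cinner x (y + z) = cinner x y + cinner x z" for x y z :: 'a
    by (rule cinner_add_right)
  show "cinner (x + y) z = cinner x z + cinner y z"
    by (metis add cinner_commute complex_cnj_add)
  show scale: "cinner x (r *\<^sub>R y) = r *\<^sub>R cinner x y" for x y :: 'a
    by (metis cinner_scaleC_right scaleC_of_real scaleR_conv_of_real)
  show "cinner (r *\<^sub>R x) y = r *\<^sub>R cinner x y"
    by (metis scale cinner_commute complex_cnj_scaleR)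
  show "\<exists>K. \<forall>x y :: 'a. norm (cinner x y) \<le> norm x * norm y * K"
    using norm_cinner_le by (metis mult.right_neutral)
qed

text \<open>Over the reals the antilinear-linear form is bilinear, so limits, continuity and finite
  sums of scalar products come from the general theory of bounded bilinear maps.\<close>

interpretation cinner: bounded_bilinear "cinner :: 'a :: complex_inner \<Rightarrow> 'a \<Rightarrow> complex"
  by (rule bounded_bilinear_cinner)

declare cinner.zero_left [simp] cinner.zero_right [simp]

lemma cinner_scaleC_left: "cinner (c *\<^sub>C x) y = cnj c * cinner x (y :: 'a :: complex_inner)"
  by (metis cinner_commute cinner_scaleC_right complex_cnj_mult)

lemma cinner_self: "cinner x x = complex_of_real ((norm (x :: 'a :: complex_inner))\<^sup>2)"
proof (rule complex_eqI)
  show "Im (cinner x x) = Im (complex_of_real ((norm x)\<^sup>2))"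
    by (metis Im_complex_of_real cinner_commute cnj.simps(2) neg_equal_zero)
qed (simp add: Re_cinner power2_norm_eq_inner)

lemma Re_cinner_self [simp]: "Re (cinner x x) = (norm (x :: 'a :: complex_inner))\<^sup>2"
  by (simp add: Re_cinner power2_norm_eq_inner)

lemma bounded_bilinear_scaleC:
  "bounded_bilinear (scaleC :: complex \<Rightarrow> 'a :: complex_inner \<Rightarrow> 'a)"
proof
  fix a :: complex and x :: 'a and r :: real
  show "(r *\<^sub>R a) *\<^sub>C x = r *\<^sub>R a *\<^sub>C x"
    by (simp add: scaleC_scaleC scaleR_conv_of_real flip: scaleC_of_real)
  show "a *\<^sub>C (r *\<^sub>R x) = r *\<^sub>R a *\<^sub>C x"
    by (simp add: scaleC_scaleC mult.commute flip: scaleC_of_real)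
  show "\<exists>K. \<forall>a (x :: 'a). norm (a *\<^sub>C x) \<le> norm a * norm x * K"
    using norm_scaleC by (metis mult.right_neutral order_refl)
qed (simp_all add: scaleC_add_left scaleC_add_right)

interpretation scaleC: bounded_bilinear "scaleC :: complex \<Rightarrow> 'a :: complex_inner \<Rightarrow> 'a"
  by (rule bounded_bilinear_scaleC)

declare scaleC.zero_left [simp] scaleC.zero_right [simp]

lemma scaleC_1 [simp]: "1 *\<^sub>C x = (x :: 'a :: complex_inner)"
  using scaleC_of_real[of 1 x] by simp

lemma cinner_eqI: "(\<And>y. cinner y a = cinner y b) \<Longrightarrow> a = (b :: 'a :: complex_inner)"
  using cinner_self[of "a - b"] by (simp add: cinner.diff_right)

lemma cinner_eqI': "(\<And>y. cinner a y = cinner b y) \<Longrightarrow> a = (b :: 'a :: complex_inner)"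
  by (rule cinner_eqI) (metis cinner_commute)

lemma cinner_eq_zero_commute: "cinner x y = 0 \<longleftrightarrow> cinner y (x :: 'a :: complex_inner) = 0"
  by (metis cinner_commute complex_cnj_zero_iff)


subsection \<open>Bounded operators and adjoints\<close>

lemma bounded_clinearI:
  assumes "\<And>x y. A (x + y) = A x + A y" "\<And>c x. A (c *\<^sub>C x) = c *\<^sub>C A x"
    "\<And>x. norm (A x) \<le> C * norm x"
  shows "bounded_clinear A"
  unfolding bounded_clinear_def
proof (intro conjI allI bounded_linear_intro)
  show "A (r *\<^sub>R x) = r *\<^sub>R A x" for r x
    using assms(2)[of "complex_of_real r" x] by (simp add: scaleC_of_real)
  show "norm (A x) \<le> norm x * C" for x
    using assms(3)[of x] by (simp add: mult.commute)
qed (simp_all add: assms(1,2))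

lemma
  assumes "bounded_clinear A"
  shows bounded_clinear_bounded_linear: "bounded_linear A"
    and bounded_clinear_plus: "A (x + y) = A x + A y"
    and bounded_clinear_minus: "A (x - y) = A x - A y"
    and bounded_clinear_scaleC: "A (c *\<^sub>C x) = c *\<^sub>C A x"
    and bounded_clinear_scaleR: "A (r *\<^sub>R x) = r *\<^sub>R A x"
    and bounded_clinear_zero: "A 0 = 0"
    and bounded_clinear_sum: "A (\<Sum>i\<in>I. f i) = (\<Sum>i\<in>I. A (f i))"
proof -
  show A: "bounded_linear A"
    using assms by (simp add: bounded_clinear_def)
  then interpret bounded_linear A .
  show "A (x + y) = A x + A y" "A (x - y) = A x - A y" "A (r *\<^sub>R x) = r *\<^sub>R A x"
    "A 0 = 0" "A (\<Sum>i\<in>I. f i) = (\<Sum>i\<in>I. A (f i))"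
    by (simp_all add: add diff scaleR zero sum)
  show "A (c *\<^sub>C x) = c *\<^sub>C A x"
    using assms by (simp add: bounded_clinear_def)
qed

lemma bounded_clinear_bound:
  assumes "bounded_clinear A"
  obtains C where "C > 0" "\<And>x. norm (A x) \<le> C * norm x"
  using bounded_linear.pos_bounded[OF bounded_clinear_bounded_linear[OF assms]]
  by (metis mult.commute)

lemma bounded_clinear_id: "bounded_clinear (\<lambda>x. x)"
  by (rule bounded_clinearI[where C = 1]) auto

lemma bounded_clinear_const_0: "bounded_clinear (\<lambda>x. 0)"
  by (rule bounded_clinearI[where C = 1]) auto

lemma bounded_clinear_compose:
  assumes "bounded_clinear A" "bounded_clinear B"
  shows "bounded_clinear (\<lambda>x. A (B x))"
  using assms bounded_linear_compose[of A B] by (simp add: bounded_clinear_def)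

lemma bounded_clinear_add:
  assumes "bounded_clinear A" "bounded_clinear B"
  shows "bounded_clinear (\<lambda>x. A x + B x)"
  using assms bounded_linear_add[of A B] by (simp add: bounded_clinear_def scaleC_add_right)

lemma bounded_clinear_cmult:
  assumes "bounded_clinear A"
  shows "bounded_clinear (\<lambda>x. c *\<^sub>C A x)"
proof -
  have "bounded_clinear (\<lambda>x :: 'b. c *\<^sub>C x)"
    by (rule bounded_clinearI[where C = "cmod c"])
      (simp_all add: scaleC_add_right scaleC_scaleC mult.commute norm_scaleC)
  from bounded_clinear_compose[OF this assms] show ?thesis .
qed

lemma bounded_clinear_rmult:
  assumes "bounded_clinear A"
  shows "bounded_clinear (\<lambda>x. r *\<^sub>R A x)"
  using bounded_clinear_cmult[OF assms, of "complex_of_real r"] by (simp add: scaleC_of_real)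

lemma bounded_clinear_neg:
  assumes "bounded_clinear A"
  shows "bounded_clinear (\<lambda>x. - A x)"
  using bounded_clinear_rmult[OF assms, of "- 1"] by simp

lemma bounded_clinear_diff:
  assumes "bounded_clinear A" "bounded_clinear B"
  shows "bounded_clinear (\<lambda>x. A x - B x)"
  using bounded_clinear_add[OF assms(1) bounded_clinear_neg[OF assms(2)]] by simp

section \<open>Orthogonal projections and the Riesz representation\<close>

lemma parallelogram:
  "(norm (x - y))\<^sup>2 = 2 * (norm x)\<^sup>2 + 2 * (norm y)\<^sup>2 - (norm (x + y :: 'a :: real_inner))\<^sup>2"
  by (simp add: power2_norm_eq_inner inner_simps inner_commute)

lemma norm_diff_sq:
  "(norm (x - y))\<^sup>2 = (norm x)\<^sup>2 - 2 * Re (cinner y x) + (norm (y :: 'a :: complex_inner))\<^sup>2"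
  by (simp add: power2_norm_eq_inner inner_simps inner_commute Re_cinner)

lemma csubspace_scaleR:
  assumes "complex_vector.subspace (S :: 'a :: complex_inner set)" "x \<in> S"
  shows "r *\<^sub>R x \<in> S"
  using complex_vector.subspace_scale[OF assms, of "complex_of_real r"]
  by (simp add: scaleC_of_real)

text \<open>By the parallelogram law a minimizing sequence for the distance from \<open>x\<close> to
  \<open>S\<close> is Cauchy, because midpoints stay in \<open>S\<close>. Its limit \<open>p\<close>
  is a nearest point, and varying \<open>p\<close> along \<open>y\<close> gives
  orthogonality.\<close>

lemma orth_proj_exists:
  fixes S :: "'a :: chilbert_space set"
  assumes S: "complex_vector.subspace S" and "closed S"
  shows "\<exists>p\<in>S. \<forall>y\<in>S. cinner y (x - p) = 0"
proof -
  define d where "d = Inf ((\<lambda>y. (norm (x - y))\<^sup>2) ` S)"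
  have bdd: "bdd_below ((\<lambda>y. (norm (x - y))\<^sup>2) ` S)"
    by (rule bdd_belowI2[where m = 0]) simp
  have dle: "d \<le> (norm (x - y))\<^sup>2" if "y \<in> S" for y
    unfolding d_def using bdd that by (rule cINF_lower)
  have ne: "S \<noteq> {}"
    using complex_vector.subspace_0[OF S] by blast
  have "\<exists>y\<in>S. (norm (x - y))\<^sup>2 < d + inverse (real (Suc n))" for n
    using cInf_lessD[of "(\<lambda>y. (norm (x - y))\<^sup>2) ` S" "d + inverse (real (Suc n))"] ne
    unfolding d_def by auto
  then obtain Y where YS: "\<And>n. Y n \<in> S"
    and Y: "\<And>n. (norm (x - Y n))\<^sup>2 < d + inverse (real (Suc n))"
    by metis
  have diff: "(norm (Y m - Y n))\<^sup>2 \<le> 2 * inverse (real (Suc m)) + 2 * inverse (real (Suc n))"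
    for m n
  proof -
    have "(1 / 2) *\<^sub>R (Y m + Y n) \<in> S"
      by (intro csubspace_scaleR S complex_vector.subspace_add YS)
    then have "d \<le> (norm (x - (1 / 2) *\<^sub>R (Y m + Y n)))\<^sup>2"
      by (rule dle)
    also have "x - (1 / 2) *\<^sub>R (Y m + Y n) = (1 / 2) *\<^sub>R ((x - Y m) + (x - Y n))"
      by (simp add: algebra_simps flip: scaleR_add_left)
    finally have "4 * d \<le> (norm ((x - Y m) + (x - Y n)))\<^sup>2"
      by (simp add: power_divide)
    moreover have "norm (Y m - Y n) = norm ((x - Y m) - (x - Y n))"
      by (simp add: norm_minus_commute)
    ultimately show ?thesis
      using parallelogram[of "x - Y m" "x - Y n"] Y[of m] Y[of n] by simp
  qed
  have "Cauchy Y"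
  proof (rule CauchyI)
    fix e :: real
    assume e: "0 < e"
    then obtain M where M: "inverse (real (Suc M)) < e\<^sup>2 / 4"
      using reals_Archimedean[of "e\<^sup>2 / 4"] by auto
    show "\<exists>M. \<forall>m\<ge>M. \<forall>n\<ge>M. norm (Y m - Y n) < e"
    proof (intro exI allI impI)
      fix m n
      assume "M \<le> m" "M \<le> n"
      then have "inverse (real (Suc m)) \<le> inverse (real (Suc M))"
        "inverse (real (Suc n)) \<le> inverse (real (Suc M))"
        by auto
      with diff[of m n] M have "(norm (Y m - Y n))\<^sup>2 < e\<^sup>2"
        by linarith
      then show "norm (Y m - Y n) < e"
        using e by (simp add: power2_less_imp_less)
    qed
  qed
  then obtain p where p: "Y \<longlonglongrightarrow> p"
    using Cauchy_convergent_iff convergent_def by blast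
  have pS: "p \<in> S"
    using closed_sequentially[OF \<open>closed S\<close>] YS p by blast
  have "(\<lambda>n. (norm (x - Y n))\<^sup>2) \<longlonglongrightarrow> (norm (x - p))\<^sup>2"
    by (intro tendsto_intros p)
  moreover have "(\<lambda>n. d + inverse (real (Suc n))) \<longlonglongrightarrow> d + 0"
    by (intro tendsto_intros LIMSEQ_inverse_real_of_nat)
  ultimately have pd: "(norm (x - p))\<^sup>2 \<le> d"
    using LIMSEQ_le[of _ _ _ "d + 0"] less_imp_le[OF Y] by auto
  have "cinner y (x - p) = 0" if y: "y \<in> S" for y
  proof (cases "y = 0")
    case False
    define c where "c = cinner y (x - p) / (norm y)\<^sup>2"
    have ny: "(norm y)\<^sup>2 > 0"
      using False by simp
    have "p + c *\<^sub>C y \<in> S"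
      by (intro complex_vector.subspace_add[OF S] complex_vector.subspace_scale[OF S] pS y)
    from dle[OF this] have "(norm (x - p))\<^sup>2 \<le> (norm ((x - p) - c *\<^sub>C y))\<^sup>2"
      using pd unfolding diff_diff_eq by linarith
    moreover have "(norm ((x - p) - c *\<^sub>C y))\<^sup>2 =
        (norm (x - p))\<^sup>2 - 2 * Re (cnj c * cinner y (x - p)) + (cmod c)\<^sup>2 * (norm y)\<^sup>2"
      by (simp add: norm_diff_sq cinner_scaleC_left norm_scaleC power_mult_distrib)
    moreover have "cnj c * cinner y (x - p) = complex_of_real ((cmod (cinner y (x - p)))\<^sup>2 / (norm y)\<^sup>2)"
      unfolding of_real_divide complex_norm_square c_def by (simp add: mult.commute)
    moreover have "(cmod c)\<^sup>2 * (norm y)\<^sup>2 = (cmod (cinner y (x - p)))\<^sup>2 / (norm y)\<^sup>2"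
      using ny by (simp add: c_def norm_divide power_divide field_simps norm_power)
    ultimately have "(cmod (cinner y (x - p)))\<^sup>2 / (norm y)\<^sup>2 \<le> 0"
      by simp
    then show ?thesis
      using ny by (simp add: divide_le_0_iff)
  qed simp
  with pS show ?thesis by blast
qed

lemma orth_proj_eqI:
  fixes S :: "'a :: chilbert_space set"
  assumes S: "complex_vector.subspace S" and p: "p \<in> S" "\<And>y. y \<in> S \<Longrightarrow> cinner y (x - p) = 0"
  shows "orth_proj S x = p"
  unfolding orth_proj_def
proof (rule the_equality)
  show "p \<in> S \<and> (\<forall>y\<in>S. cinner y (x - p) = 0)"
    using p by blast
  fix q
  assume q: "q \<in> S \<and> (\<forall>y\<in>S. cinner y (x - q) = 0)"
  have "q - p \<in> S"
    using q p complex_vector.subspace_diff[OF S] by blast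
  then have "cinner (q - p) ((x - p) - (x - q)) = 0"
    using q p by (simp add: cinner.diff_right)
  then show "q = p"
    by (simp add: cinner_self)
qed

lemma
  fixes S :: "'a :: chilbert_space set"
  assumes "complex_vector.subspace S" "closed S"
  shows orth_proj_in: "orth_proj S x \<in> S"
    and orth_proj_orth: "y \<in> S \<Longrightarrow> cinner y (x - orth_proj S x) = 0"
proof -
  obtain p where p: "p \<in> S" "\<forall>y\<in>S. cinner y (x - p) = 0"
    using orth_proj_exists[OF assms] by blast
  then have "orth_proj S x = p"
    by (intro orth_proj_eqI assms) auto
  with p show "orth_proj S x \<in> S" "y \<in> S \<Longrightarrow> cinner y (x - orth_proj S x) = 0"
    by auto
qed

lemma riesz_representation:
  fixes f :: "'a :: chilbert_space \<Rightarrow> complex"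
  assumes f: "bounded_clinear f"
  shows "\<exists>w. \<forall>x. f x = cinner w x"
proof (cases "\<forall>x. f x = 0")
  case True
  then show ?thesis by (intro exI[of _ 0]) simp
next
  case False
  then obtain x0 where x0: "f x0 \<noteq> 0" by blast
  note lin = bounded_clinear_plus[OF f] bounded_clinear_minus[OF f] bounded_clinear_scaleC[OF f]
    bounded_clinear_zero[OF f]
  define S where "S = {x. f x = 0}"
  have sub: "complex_vector.subspace S"
    by (auto simp: S_def complex_vector.subspace_def lin scaleC_complex_def)
  have "closed S"
    unfolding S_def using bounded_clinear_bounded_linear[OF f]
    by (intro closed_Collect_eq continuous_intros linear_continuous_on) auto
  then obtain p where p: "p \<in> S" "\<forall>y\<in>S. cinner y (x0 - p) = 0"
    using orth_proj_exists[OF sub] by blast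
  define u where "u = x0 - p"
  have fu: "f u \<noteq> 0"
    using p(1) x0 by (simp add: u_def S_def lin)
  then have nu: "norm u \<noteq> 0"
    using lin(4) by auto
  have "f x = cinner ((cnj (f u) / (norm u)\<^sup>2) *\<^sub>C u) x" for x
  proof -
    have "x - (f x / f u) *\<^sub>C u \<in> S"
      using fu by (simp add: S_def lin scaleC_complex_def)
    then have "cinner (x - (f x / f u) *\<^sub>C u) u = 0"
      using p(2) by (simp add: u_def)
    then have "cinner u (x - (f x / f u) *\<^sub>C u) = 0"
      by (subst cinner_eq_zero_commute)
    then have "cinner u x = (f x / f u) * (norm u)\<^sup>2"
      by (simp add: cinner.diff_right cinner_scaleC_right cinner_self)
    then show ?thesis
      using fu nu by (simp add: cinner_scaleC_left)
  qed
  then show ?thesis by blast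
qed

section \<open>Adjoints and self-adjoint operators\<close>

lemma adj_eqI:
  assumes "\<And>x y. cinner (B y) x = cinner y (A x)"
  shows "adj A = B"
  unfolding adj_def
proof (rule the_equality)
  fix B'
  assume "\<forall>x y. cinner (B' y) x = cinner y (A x)"
  then show "B' = B"
    by (metis assms cinner_eqI' ext)
qed (simp add: assms)

text \<open>\<open>adj\<close> is a definite description; for bounded operators the Riesz
  representation supplies the object and \<open>adj_eqI\<close> its uniqueness.\<close>

lemma cinner_adj_left:
  fixes A :: "'a :: chilbert_space \<Rightarrow> 'b :: chilbert_space"
  assumes A: "bounded_clinear A"
  shows "cinner (adj A y) x = cinner y (A x)"
proof -
  have "bounded_clinear (\<lambda>x. cinner y (A x))" for y
    unfolding bounded_clinear_def
    using bounded_linear_compose[OF cinner.bounded_linear_right bounded_clinear_bounded_linear[OF A]]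
    by (simp add: bounded_clinear_scaleC[OF A] cinner_scaleC_right scaleC_complex_def)
  then have "\<forall>y. \<exists>w. \<forall>x. cinner y (A x) = cinner w x"
    using riesz_representation by blast
  then obtain B where "\<And>x y. cinner (B y) x = cinner y (A x)"
    by metis
  then show ?thesis
    using adj_eqI[of B A] by simp
qed

lemma cinner_adj_right:
  fixes A :: "'a :: chilbert_space \<Rightarrow> 'b :: chilbert_space"
  assumes A: "bounded_clinear A"
  shows "cinner x (adj A y) = cinner (A x) y"
  by (metis A cinner_adj_left cinner_commute)

lemma norm_le_of_cinner:
  assumes "\<And>x. cmod (cinner y x) \<le> C * norm x" "0 \<le> C"
  shows "norm (y :: 'a :: complex_inner) \<le> C"
proof (cases "y = 0")
  case False
  have "norm y * norm y \<le> C * norm y"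
    using assms(1)[of y] by (simp add: cinner_self power2_eq_square norm_mult)
  then show ?thesis
    using False by simp
qed (use assms in simp)

lemma norm_adj_le:
  fixes A :: "'a :: chilbert_space \<Rightarrow> 'b :: chilbert_space"
  assumes A: "bounded_clinear A" and C: "0 \<le> C" "\<And>x. norm (A x) \<le> C * norm x"
  shows "norm (adj A y) \<le> C * norm y"
proof (rule norm_le_of_cinner)
  fix x
  have "cmod (cinner (adj A y) x) \<le> norm y * norm (A x)"
    by (simp add: cinner_adj_left[OF A] norm_cinner_le)
  also have "\<dots> \<le> norm y * (C * norm x)"
    using C by (intro mult_left_mono) auto
  finally show "cmod (cinner (adj A y) x) \<le> C * norm y * norm x"
    by (simp add: mult_ac)
qed (use C in simp)

lemma bounded_clinear_adj:
  fixes A :: "'a :: chilbert_space \<Rightarrow> 'b :: chilbert_space"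
  assumes A: "bounded_clinear A"
  shows "bounded_clinear (adj A)"
proof -
  obtain C where "C > 0" "\<And>x. norm (A x) \<le> C * norm x"
    using bounded_clinear_bound[OF A] by blast
  then have "norm (adj A x) \<le> C * norm x" for x
    by (intro norm_adj_le A) auto
  then show ?thesis
    by (rule bounded_clinearI[rotated 2]; intro cinner_eqI'[where 'a = 'a])
      (simp_all add: cinner_adj_left[OF A] cinner.add_left cinner_scaleC_left)
qed

lemma adj_adj:
  fixes A :: "'a :: chilbert_space \<Rightarrow> 'b :: chilbert_space"
  assumes "bounded_clinear A"
  shows "adj (adj A) = A"
  by (rule adj_eqI) (simp add: cinner_adj_right[OF assms])

lemma adj_compose:
  fixes A :: "'b :: chilbert_space \<Rightarrow> 'c :: chilbert_space"
    and B :: "'a :: chilbert_space \<Rightarrow> 'b"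
  assumes "bounded_clinear A" "bounded_clinear B"
  shows "adj (\<lambda>x. A (B x)) = (\<lambda>x. adj B (adj A x))"
  by (rule adj_eqI) (simp add: cinner_adj_left assms)

lemma
  assumes "self_adjoint A"
  shows self_adjoint_bounded_clinear: "bounded_clinear A"
    and self_adjoint_cinner: "cinner (A x) y = cinner x (A y)"
  using assms by (auto simp: self_adjoint_def)

lemma self_adjoint_adj: "self_adjoint A \<Longrightarrow> adj A = A"
  by (rule adj_eqI) (simp add: self_adjoint_cinner)

lemma self_adjoint_add:
  "self_adjoint A \<Longrightarrow> self_adjoint B \<Longrightarrow> self_adjoint (\<lambda>x. A x + B x)"
  by (simp add: self_adjoint_def bounded_clinear_add cinner.add_left cinner.add_right)

lemma self_adjoint_scaleR: "self_adjoint A \<Longrightarrow> self_adjoint (\<lambda>x. r *\<^sub>R A x)"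
  by (simp add: self_adjoint_def bounded_clinear_rmult cinner.scaleR_left cinner.scaleR_right)

lemma self_adjoint_uminus: "self_adjoint A \<Longrightarrow> self_adjoint (\<lambda>x. - A x)"
  using self_adjoint_scaleR[of A "- 1"] by simp

lemma self_adjoint_adj_comp:
  fixes A :: "'a :: chilbert_space \<Rightarrow> 'b :: chilbert_space"
  assumes "bounded_clinear A"
  shows "self_adjoint (\<lambda>x. adj A (A x))"
  by (simp add: self_adjoint_def bounded_clinear_compose bounded_clinear_adj assms
      cinner_adj_left cinner_adj_right)

lemma Re_cinner_adj_comp:
  fixes A :: "'a :: chilbert_space \<Rightarrow> 'b :: chilbert_space"
  assumes "bounded_clinear A"
  shows "Re (cinner x (adj A (A x))) = (norm (A x))\<^sup>2"
  by (simp add: cinner_adj_right assms)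

lemma self_adjoint_orth_proj:
  fixes S :: "'a :: chilbert_space set"
  assumes S: "complex_vector.subspace S" "closed S"
  shows "self_adjoint (orth_proj S)" "norm (orth_proj S x) \<le> norm x"
    and "orth_proj S (orth_proj S x) = orth_proj S x"
proof -
  note in_S = orth_proj_in[OF S] and orth = orth_proj_orth[OF S]
  have sa: "cinner (orth_proj S x) y = cinner x (orth_proj S y)" for x y
  proof -
    have "cinner (orth_proj S x) (y - orth_proj S y) = 0"
      by (intro orth in_S)
    moreover have "cinner (x - orth_proj S x) (orth_proj S y) = 0"
      by (subst cinner_eq_zero_commute) (intro orth in_S)
    ultimately show ?thesis
      by (simp add: cinner.diff_left cinner.diff_right)
  qed
  show idem: "orth_proj S (orth_proj S x) = orth_proj S x" for x
    by (rule orth_proj_eqI) (auto intro: S in_S)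
  show bound: "norm (orth_proj S x) \<le> norm x" for x
  proof -
    have "cinner (orth_proj S x) (orth_proj S x) = cinner x (orth_proj S x)"
      by (simp add: sa idem)
    then have "(norm (orth_proj S x))\<^sup>2 = cmod (cinner x (orth_proj S x))"
      by (metis cinner_self norm_of_real abs_power2)
    also have "\<dots> \<le> norm x * norm (orth_proj S x)"
      by (rule norm_cinner_le)
    finally show ?thesis
      by (cases "norm (orth_proj S x) = 0") (simp_all add: power2_eq_square)
  qed
  have "bounded_clinear (orth_proj S)"
    by (rule bounded_clinearI[where C = 1]; (rule cinner_eqI')?)
      (simp_all add: bound sa cinner.add_left cinner_scaleC_left)
  with sa show "self_adjoint (orth_proj S)"
    by (simp add: self_adjoint_def)
qed


subsection \<open>Square roots of positive operators\<close>

lemma self_adjoint_cinner_real: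
  assumes "self_adjoint A"
  shows "cinner x (A x) = complex_of_real (Re (cinner x (A x)))"
proof (rule complex_eqI)
  have "cnj (cinner x (A x)) = cinner x (A x)"
    by (metis assms cinner_commute self_adjoint_cinner)
  then show "Im (cinner x (A x)) = Im (complex_of_real (Re (cinner x (A x))))"
    by (metis Im_complex_of_real cnj.simps(2) neg_equal_zero)
qed simp

lemma positive_opI:
  assumes "self_adjoint A" "\<And>x. 0 \<le> Re (cinner x (A x))"
  shows "positive_op A"
  using assms self_adjoint_cinner_real[OF assms(1)]
  by (auto simp: positive_op_def self_adjoint_def intro: Reals_of_real)
     (metis Reals_of_real)

text \<open>Polarization: the sesquilinear form \<open>\<langle>x, A y\<rangle> - \<langle>A x, y\<rangle>\<close> vanishes on the diagonal.\<close>

lemma positive_op_self_adjoint: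
  assumes "positive_op A"
  shows "self_adjoint A"
proof -
  have A: "bounded_clinear A" and real: "\<And>x. cinner x (A x) \<in> \<real>"
    using assms by (auto simp: positive_op_def)
  note lin = bounded_clinear_plus[OF A] bounded_clinear_scaleC[OF A]
  define D where "D x y = cinner x (A y) - cinner (A x) y" for x y
  have D0: "D x x = 0" for x
    using real[of x] by (metis D_def Reals_cnj_iff cinner_commute right_minus_eq)
  have anti: "D x y = - D y x" for x y
  proof -
    have "D x y + D y x = D (x + y) (x + y) - D x x - D y y"
      by (simp add: D_def lin cinner.add_left cinner.add_right)
    then show ?thesis
      by (simp add: D0 eq_neg_iff_add_eq_0)
  qed
  have "D x (\<i> *\<^sub>C y) = \<i> * D x y" "D (\<i> *\<^sub>C y) x = - \<i> * D y x" for x y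
    by (simp_all add: D_def lin cinner_scaleC_left cinner_scaleC_right algebra_simps)
  \<comment> \<open>Antisymmetry at \<open>\<i> *\<^sub>C y\<close>, with \<open>D\<close>
    antilinear on the left, makes \<open>D\<close> symmetric as well, hence zero.\<close>
  then have "\<i> * D x y = \<i> * D y x" for x y
    using anti[of x "\<i> *\<^sub>C y"] by simp
  then have "D x y = 0" for x y
    using anti[of x y] by simp
  then show ?thesis
    using A by (simp add: self_adjoint_def D_def)
qed

lemma positive_op_Re: "positive_op A \<Longrightarrow> 0 \<le> Re (cinner x (A x))"
  by (simp add: positive_op_def)

text \<open>The form of \<open>P\<close> at the trial vector
  \<open>x - (1 / C) *\<^sub>R P x\<close> is at most the form at \<open>x\<close> minus
  \<open>(norm (P x))\<^sup>2 / C\<close>. Positivity is assumed at this vector alone, so that the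
  estimate also serves operators that are positive only on an invariant subspace.\<close>

lemma norm_sq_le_form:
  assumes P: "self_adjoint P" and C: "0 < C" "\<And>y. norm (P y) \<le> C * norm y"
    and pos: "0 \<le> Re (cinner (x - (1 / C) *\<^sub>R P x) (P (x - (1 / C) *\<^sub>R P x)))"
  shows "(norm (P x))\<^sup>2 \<le> C * Re (cinner x (P x))"
proof -
  have A: "bounded_clinear P"
    using P by (rule self_adjoint_bounded_clinear)
  define y where "y = P x"
  define q where "q = Re (cinner x (P x))"
  have 1: "Re (cinner x (P y)) = (norm y)\<^sup>2"
    by (metis Re_cinner_self self_adjoint_cinner[OF P] y_def)
  have 2: "Re (cinner y (P x)) = (norm y)\<^sup>2"
    by (simp add: y_def)
  have "Re (cinner y (P y)) \<le> norm y * norm (P y)"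
    using complex_Re_le_cmod norm_cinner_le order_trans by blast
  also have "\<dots> \<le> norm y * (C * norm y)"
    using C(2) by (intro mult_left_mono) auto
  finally have 3: "Re (cinner y (P y)) \<le> C * (norm y)\<^sup>2"
    by (simp add: power2_eq_square mult_ac)
  have "Re (cinner (x - (1 / C) *\<^sub>R y) (P (x - (1 / C) *\<^sub>R y))) =
      q - 2 * (norm y)\<^sup>2 / C + Re (cinner y (P y)) / C\<^sup>2"
    using C(1)
    by (simp add: bounded_clinear_minus[OF A] bounded_clinear_scaleR[OF A] cinner.diff_left
        cinner.diff_right cinner.scaleR_left cinner.scaleR_right q_def 1 2 power2_eq_square field_simps)
  also have "\<dots> \<le> q - 2 * (norm y)\<^sup>2 / C + C * (norm y)\<^sup>2 / C\<^sup>2"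
    using 3 by (intro add_left_mono divide_right_mono) auto
  also have "\<dots> = q - (norm y)\<^sup>2 / C"
    using C(1) by (simp add: power2_eq_square field_simps)
  finally have "(norm y)\<^sup>2 / C \<le> q"
    using pos by (simp add: y_def)
  then show ?thesis
    using C(1) by (simp add: y_def q_def field_simps)
qed

lemma positive_op_norm_sq_le:
  assumes P: "positive_op P" and C: "0 < C" "\<And>y. norm (P y) \<le> C * norm y"
  shows "(norm (P x))\<^sup>2 \<le> C * Re (cinner x (P x))"
  using assms by (intro norm_sq_le_form positive_op_self_adjoint positive_op_Re)

lemma positive_op_norm_le:
  assumes P: "positive_op P" and le: "\<And>x. Re (cinner x (P x)) \<le> (norm x)\<^sup>2"
  shows "norm (P x) \<le> norm x"
proof -
  obtain C where C: "0 < C" "\<And>y. norm (P y) \<le> C * norm y"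
    using bounded_clinear_bound[of P] P by (auto simp: positive_op_def)
  have sa: "self_adjoint P"
    using P by (rule positive_op_self_adjoint)
  text \<open>Cauchy-Schwarz for the form of \<open>P\<close>, with the test parameter \<open>1\<close> instead of \<open>1 / C\<close>.\<close>
  have "0 \<le> Re (cinner (x - P x) (P (x - P x)))"
    using P by (rule positive_op_Re)
  moreover have "Re (cinner x (P (P x))) = (norm (P x))\<^sup>2"
    by (metis Re_cinner_self self_adjoint_cinner[OF sa])
  then have "Re (cinner (x - P x) (P (x - P x))) =
      Re (cinner x (P x)) - 2 * (norm (P x))\<^sup>2 + Re (cinner (P x) (P (P x)))"
    by (simp add: bounded_clinear_minus[OF self_adjoint_bounded_clinear[OF sa]] cinner.diff_left
        cinner.diff_right)
  ultimately have "(norm (P x))\<^sup>2 \<le> (norm x)\<^sup>2"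
    using le[of x] le[of "P x"] by linarith
  then show ?thesis
    by (rule power2_le_imp_le) simp
qed

text \<open>
  For \<open>0 \<le> A \<le> 1\<close> the iteration \<open>Y \<mapsto> (1 - A + Y\<^sup>2) / 2\<close> from \<open>0\<close> converges to \<open>1 - A\<^bsup>1/2\<^esup>\<close>; it is
  dominated in norm by the scalar iteration \<open>y \<mapsto> (1 + y\<^sup>2) / 2\<close>.
\<close>

primrec sqrt_iter :: "('a :: chilbert_space \<Rightarrow> 'a) \<Rightarrow> nat \<Rightarrow> 'a \<Rightarrow> 'a" where
  "sqrt_iter B 0 x = 0"
| "sqrt_iter B (Suc n) x = (1 / 2) *\<^sub>R (B x + sqrt_iter B n (sqrt_iter B n x))"

primrec sqrt_majorant :: "nat \<Rightarrow> real" where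
  "sqrt_majorant 0 = 0"
| "sqrt_majorant (Suc n) = (1 + (sqrt_majorant n)\<^sup>2) / 2"

lemma sqrt_majorant_bounds: "0 \<le> sqrt_majorant n \<and> sqrt_majorant n \<le> 1"
  by (induction n) (auto simp: power2_eq_square intro: mult_le_one)

lemma sqrt_majorant_Suc: "sqrt_majorant n \<le> sqrt_majorant (Suc n)"
  using sum_squares_bound[of "sqrt_majorant n" 1] by simp

lemma self_adjoint_sqrt_iter:
  assumes "self_adjoint B"
  shows "self_adjoint (sqrt_iter B n)"
proof (induction n)
  case 0
  show ?case
    by (simp add: self_adjoint_def bounded_clinear_const_0 fun_eq_iff[symmetric])
next
  case (Suc n)
  then have "self_adjoint (\<lambda>x. sqrt_iter B n (sqrt_iter B n x))"
    by (simp add: self_adjoint_def bounded_clinear_compose)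
  then have "self_adjoint (\<lambda>x. (1 / 2) *\<^sub>R (B x + sqrt_iter B n (sqrt_iter B n x)))"
    by (intro self_adjoint_scaleR self_adjoint_add assms)
  then show ?case
    by (simp add: sqrt_iter.simps(2)[abs_def])
qed

lemma norm_sqrt_iter_le:
  assumes "\<And>x. norm (B x) \<le> norm x"
  shows "norm (sqrt_iter B n x) \<le> sqrt_majorant n * norm x"
proof (induction n arbitrary: x)
  case (Suc n)
  have "norm (sqrt_iter B n (sqrt_iter B n x)) \<le> sqrt_majorant n * norm (sqrt_iter B n x)"
    by (rule Suc)
  also have "\<dots> \<le> sqrt_majorant n * (sqrt_majorant n * norm x)"
    using sqrt_majorant_bounds by (intro mult_left_mono Suc) auto
  finally have "norm (B x + sqrt_iter B n (sqrt_iter B n x)) \<le> norm x + (sqrt_majorant n)\<^sup>2 * norm x"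
    using norm_triangle_ineq[of "B x" "sqrt_iter B n (sqrt_iter B n x)"] assms[of x]
    by (simp add: power2_eq_square mult.assoc)
  then show ?case
    by (simp add: distrib_right)
qed simp

text \<open>The identity Z Z - Y Y = Z (Z - Y) + (Z - Y) Y holds for operators that may not commute,
  and the norm bounds of its two terms add up to (z - y)(z + y), exactly the step of the scalar
  iteration.\<close>

lemma norm_sqrt_iter_Suc_diff_le:
  assumes B: "self_adjoint B" "\<And>x. norm (B x) \<le> norm x"
  shows "norm (sqrt_iter B (Suc n) x - sqrt_iter B n x) \<le>
    (sqrt_majorant (Suc n) - sqrt_majorant n) * norm x"
proof (induction n arbitrary: x)
  case 0
  show ?case using B(2)[of x] by simp
next
  case (Suc n)
  define Y where "Y = sqrt_iter B n"
  define Z where "Z = sqrt_iter B (Suc n)"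
  define y where "y = sqrt_majorant n"
  define z where "z = sqrt_majorant (Suc n)"
  have IH: "norm (Z x - Y x) \<le> (z - y) * norm x" for x
    using Suc unfolding Y_def Z_def y_def z_def .
  have Z: "norm (Z x) \<le> z * norm x" and Y: "norm (Y x) \<le> y * norm x" for x
    unfolding Y_def Z_def y_def z_def by (rule norm_sqrt_iter_le[OF B(2)])+
  have yz: "0 \<le> y" "0 \<le> z" "y \<le> z"
    using sqrt_majorant_bounds sqrt_majorant_Suc[of n] unfolding y_def z_def by auto
  have lin: "Z (u - v) = Z u - Z v" for u v
    unfolding Z_def
    by (intro bounded_clinear_minus self_adjoint_bounded_clinear self_adjoint_sqrt_iter B)
  have "sqrt_iter B (Suc (Suc n)) x - sqrt_iter B (Suc n) x = (1 / 2) *\<^sub>R (Z (Z x) - Y (Y x))"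
    unfolding Y_def Z_def by (simp only: sqrt_iter.simps) (simp add: algebra_simps)
  also have "Z (Z x) - Y (Y x) = Z (Z x - Y x) + (Z (Y x) - Y (Y x))"
    by (simp add: lin)
  finally have "norm (sqrt_iter B (Suc (Suc n)) x - sqrt_iter B (Suc n) x) \<le>
      (1 / 2) * (norm (Z (Z x - Y x)) + norm (Z (Y x) - Y (Y x)))"
    by (simp add: norm_triangle_ineq)
  also have "\<dots> \<le> (1 / 2) * (z * ((z - y) * norm x) + (z - y) * (y * norm x))"
    using yz by (intro mult_left_mono add_mono order_trans[OF Z] order_trans[OF IH] Y IH) auto
  also have "\<dots> = (z\<^sup>2 - y\<^sup>2) / 2 * norm x"
    by (simp add: power2_eq_square field_simps)
  also have "(z\<^sup>2 - y\<^sup>2) / 2 = sqrt_majorant (Suc (Suc n)) - sqrt_majorant (Suc n)"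
    by (simp only: sqrt_majorant.simps z_def y_def) (simp add: field_simps)
  finally show ?case .
qed

lemma norm_sqrt_iter_diff_le:
  assumes B: "self_adjoint B" "\<And>x. norm (B x) \<le> norm x" and "m \<le> n"
  shows "norm (sqrt_iter B n x - sqrt_iter B m x) \<le> (sqrt_majorant n - sqrt_majorant m) * norm x"
  using \<open>m \<le> n\<close>
proof (induction n rule: dec_induct)
  case (step n)
  have "norm (sqrt_iter B (Suc n) x - sqrt_iter B m x) \<le>
      norm (sqrt_iter B (Suc n) x - sqrt_iter B n x) + norm (sqrt_iter B n x - sqrt_iter B m x)"
    by (rule order_trans[OF _ norm_triangle_ineq]) simp
  also have "\<dots> \<le> (sqrt_majorant (Suc n) - sqrt_majorant n) * norm x +
      (sqrt_majorant n - sqrt_majorant m) * norm x"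
    by (intro add_mono norm_sqrt_iter_Suc_diff_le B step)
  finally show ?case
    by (simp add: algebra_simps)
qed simp

lemma convergent_sqrt_iter:
  assumes B: "self_adjoint B" "\<And>x. norm (B x) \<le> norm x"
  shows "\<exists>l. (\<lambda>n. sqrt_iter B n x) \<longlonglongrightarrow> l"
proof -
  have "incseq sqrt_majorant"
    using sqrt_majorant_Suc by (rule incseq_SucI)
  moreover have "Bseq sqrt_majorant"
    using sqrt_majorant_bounds by (intro BseqI'[where K = 1]) simp
  ultimately have "convergent sqrt_majorant"
    by (intro Bseq_mono_convergent) (auto dest: incseqD)
  then have Cy: "Cauchy sqrt_majorant"
    by (simp add: Cauchy_convergent_iff)
  have "Cauchy (\<lambda>n. sqrt_iter B n x)"
  proof (rule CauchyI)
    fix e :: real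
    assume e: "0 < e"
    define e' where "e' = e / (norm x + 1)"
    have "0 < e'"
      using e by (simp add: e'_def add_nonneg_pos)
    then obtain M where M: "\<And>m n. m \<ge> M \<Longrightarrow> n \<ge> M \<Longrightarrow> norm (sqrt_majorant m - sqrt_majorant n) < e'"
      using CauchyD[OF Cy] by blast
    have ordered: "norm (sqrt_iter B n x - sqrt_iter B m x) < e" if "M \<le> m" "m \<le> n" for m n
    proof -
      have "norm (sqrt_iter B n x - sqrt_iter B m x) \<le> (sqrt_majorant n - sqrt_majorant m) * norm x"
        by (rule norm_sqrt_iter_diff_le[OF B \<open>m \<le> n\<close>])
      also have "\<dots> \<le> e' * norm x"
        using M[of n m] that by (intro mult_right_mono) (auto simp: abs_if split: if_splits)
      also have "\<dots> < e' * (norm x + 1)"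
        using \<open>0 < e'\<close> by simp
      also have "\<dots> = e"
        by (simp add: e'_def add_nonneg_eq_0_iff)
      finally show ?thesis .
    qed
    show "\<exists>M. \<forall>m\<ge>M. \<forall>n\<ge>M. norm (sqrt_iter B m x - sqrt_iter B n x) < e"
      using ordered by (metis nle_le norm_minus_commute)
  qed
  then show ?thesis
    by (simp add: Cauchy_convergent_iff convergent_def)
qed

text \<open>The clause on operators commuting with \<open>A\<close> is carried along because
  uniqueness of the square root will rest on it; it passes from the iterates, which are built from
  \<open>A\<close>, to their limit.\<close>

lemma sqrt_exists_contraction:
  fixes A :: "'a :: chilbert_space \<Rightarrow> 'a"
  assumes A: "positive_op A" and le: "\<And>x. Re (cinner x (A x)) \<le> (norm x)\<^sup>2"
  shows "\<exists>R. positive_op R \<and> R \<circ> R = A \<and>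
    (\<forall>C. bounded_clinear C \<longrightarrow> (\<forall>x. C (A x) = A (C x)) \<longrightarrow> (\<forall>x. C (R x) = R (C x)))"
proof -
  define B where "B = (\<lambda>x. x - A x)"
  have saA: "self_adjoint A"
    using A by (rule positive_op_self_adjoint)
  have saB: "self_adjoint B"
    using saA self_adjoint_bounded_clinear[OF saA]
    by (simp add: B_def self_adjoint_def bounded_clinear_diff bounded_clinear_id cinner.diff_left
        cinner.diff_right)
  have "positive_op B"
    using le by (intro positive_opI saB)
      (simp add: B_def cinner.diff_right)
  then have B: "norm (B x) \<le> norm x" for x
    by (rule positive_op_norm_le)
      (simp add: B_def cinner.diff_right positive_op_Re[OF A])
  define Y where "Y = sqrt_iter B"
  have saY: "self_adjoint (Y n)" for n
    unfolding Y_def by (rule self_adjoint_sqrt_iter[OF saB])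
  note bY = self_adjoint_bounded_clinear[OF saY]
  have nY: "norm (Y n x) \<le> norm x" for n x
    using norm_sqrt_iter_le[OF B, of n x] sqrt_majorant_bounds[of n]
    by (simp add: Y_def) (meson dual_order.trans mult_left_le_one_le norm_ge_zero)
  obtain Z where Z: "\<And>x. (\<lambda>n. Y n x) \<longlonglongrightarrow> Z x"
    using convergent_sqrt_iter[OF saB B] unfolding Y_def by metis
  have nZ: "norm (Z x) \<le> norm x" for x
    by (rule LIMSEQ_le_const2[OF tendsto_norm[OF Z]]) (use nY in auto)
  have bZ: "bounded_clinear Z"
  proof (rule bounded_clinearI[where C = 1])
    show "Z (x + y) = Z x + Z y" for x y
      using LIMSEQ_unique[OF Z[of "x + y"]] tendsto_add[OF Z[of x] Z[of y]]
      by (simp add: bounded_clinear_plus[OF bY])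
    show "Z (c *\<^sub>C x) = c *\<^sub>C Z x" for c x
      using LIMSEQ_unique[OF Z[of "c *\<^sub>C x"]]
        bounded_linear.tendsto[OF scaleC.bounded_linear_right Z[of x]]
      by (simp add: bounded_clinear_scaleC[OF bY])
  qed (simp add: nZ)
  have saZ: "self_adjoint Z"
    unfolding self_adjoint_def
  proof (intro conjI allI bZ)
    fix x y
    have "(\<lambda>n. cinner (Y n x) y) \<longlonglongrightarrow> cinner (Z x) y" "(\<lambda>n. cinner x (Y n y)) \<longlonglongrightarrow> cinner x (Z y)"
      by (intro cinner.tendsto Z tendsto_const)+
    then show "cinner (Z x) y = cinner x (Z y)"
      using LIMSEQ_unique by (simp add: self_adjoint_cinner[OF saY])
  qed
  have YY: "(\<lambda>n. Y n (Y n x)) \<longlonglongrightarrow> Z (Z x)" for x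
  proof (rule LIM_zero_cancel, rule Lim_null_comparison)
    show "(\<lambda>n. norm (Y n x - Z x) + norm (Y n (Z x) - Z (Z x))) \<longlonglongrightarrow> 0"
      using tendsto_add[OF tendsto_norm_zero[OF LIM_zero[OF Z[of x]]]
          tendsto_norm_zero[OF LIM_zero[OF Z[of "Z x"]]]] by simp
    have "norm (Y n (Y n x) - Z (Z x)) \<le> norm (Y n x - Z x) + norm (Y n (Z x) - Z (Z x))" for n
    proof -
      have "Y n (Y n x) - Z (Z x) = Y n (Y n x - Z x) + (Y n (Z x) - Z (Z x))"
        by (simp add: bounded_clinear_minus[OF bY])
      then have "norm (Y n (Y n x) - Z (Z x)) \<le> norm (Y n (Y n x - Z x)) + norm (Y n (Z x) - Z (Z x))"
        by (metis norm_triangle_ineq)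
      then show ?thesis
        using nY[of n "Y n x - Z x"] by linarith
    qed
    then show "\<forall>\<^sub>F n in sequentially. norm (Y n (Y n x) - Z (Z x)) \<le>
        norm (Y n x - Z x) + norm (Y n (Z x) - Z (Z x))"
      by simp
  qed
  \<comment> \<open>The fixed point equation 2 Z = 1 - A + Z^2 says (1 - Z)^2 = A.\<close>
  have fixpoint: "Z x = (1 / 2) *\<^sub>R (B x + Z (Z x))" for x
  proof (rule LIMSEQ_unique)
    show "(\<lambda>n. Y (Suc n) x) \<longlonglongrightarrow> Z x"
      using Z by (rule LIMSEQ_Suc)
    show "(\<lambda>n. Y (Suc n) x) \<longlonglongrightarrow> (1 / 2) *\<^sub>R (B x + Z (Z x))"
      unfolding Y_def sqrt_iter.simps(2) unfolding Y_def[symmetric]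
      by (intro tendsto_intros YY)
  qed
  define R where "R = (\<lambda>x. x - Z x)"
  have "self_adjoint R"
    using saZ bZ
    by (simp add: R_def self_adjoint_def bounded_clinear_diff bounded_clinear_id cinner.diff_left
        cinner.diff_right)
  moreover have "0 \<le> Re (cinner x (R x))" for x
  proof -
    have "Re (cinner x (Z x)) \<le> norm x * norm (Z x)"
      using complex_Re_le_cmod norm_cinner_le order_trans by blast
    also have "\<dots> \<le> norm x * norm x"
      by (intro mult_left_mono nZ) simp
    finally show ?thesis
      by (simp add: R_def cinner.diff_right power2_eq_square)
  qed
  ultimately have "positive_op R"
    by (rule positive_opI)
  moreover have "R (R x) = A x" for x
  proof -
    have "R (R x) = x - 2 *\<^sub>R Z x + Z (Z x)"
      by (simp add: R_def bounded_clinear_minus[OF bZ] scaleR_2)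
    also have "2 *\<^sub>R Z x = B x + Z (Z x)"
      by (subst fixpoint) simp
    finally show ?thesis
      by (simp add: B_def)
  qed
  moreover have "C (R x) = R (C x)"
    if C: "bounded_clinear C" and comm: "\<And>x. C (A x) = A (C x)" for C x
  proof -
    have "C (Y n x) = Y n (C x)" for n x
      unfolding Y_def
      by (induction n arbitrary: x)
        (simp_all add: bounded_clinear_zero[OF C] bounded_clinear_scaleR[OF C]
          bounded_clinear_plus[OF C] B_def bounded_clinear_minus[OF C] comm)
    then have "(\<lambda>n. Y n (C x)) \<longlonglongrightarrow> C (Z x)"
      using bounded_linear.tendsto[OF bounded_clinear_bounded_linear[OF C] Z[of x]] by simp
    then have "C (Z x) = Z (C x)"
      using LIMSEQ_unique Z by blast
    then show ?thesis
      by (simp add: R_def bounded_clinear_minus[OF C])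
  qed
  ultimately show ?thesis
    by (intro exI[of _ R]) (auto simp: fun_eq_iff)
qed

lemma positive_op_scaleR: "positive_op A \<Longrightarrow> 0 \<le> r \<Longrightarrow> positive_op (\<lambda>x. r *\<^sub>R A x)"
  by (rule positive_opI)
    (simp_all add: self_adjoint_scaleR positive_op_self_adjoint cinner.scaleR_right positive_op_Re)

lemma sqrt_exists:
  fixes A :: "'a :: chilbert_space \<Rightarrow> 'a"
  assumes A: "positive_op A"
  shows "\<exists>R. positive_op R \<and> R \<circ> R = A \<and>
    (\<forall>C. bounded_clinear C \<longrightarrow> (\<forall>x. C (A x) = A (C x)) \<longrightarrow> (\<forall>x. C (R x) = R (C x)))"
proof -
  obtain c where c: "0 < c" "\<And>x. norm (A x) \<le> c * norm x"
    using bounded_clinear_bound[of A] A by (auto simp: positive_op_def)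
  have "positive_op (\<lambda>x. (1 / c) *\<^sub>R A x)"
    using A c by (intro positive_op_scaleR) auto
  moreover have "Re (cinner x ((1 / c) *\<^sub>R A x)) \<le> (norm x)\<^sup>2" for x
  proof -
    have "Re (cinner x (A x)) \<le> norm x * norm (A x)"
      using complex_Re_le_cmod norm_cinner_le order_trans by blast
    also have "\<dots> \<le> norm x * (c * norm x)"
      by (intro mult_left_mono c) simp
    finally show ?thesis
      using c by (simp add: cinner.scaleR_right field_simps power2_eq_square)
  qed
  ultimately obtain R where R: "positive_op R" "R \<circ> R = (\<lambda>x. (1 / c) *\<^sub>R A x)"
    and comm: "\<And>C. bounded_clinear C \<Longrightarrow> (\<forall>x. C ((1 / c) *\<^sub>R A x) = (1 / c) *\<^sub>R A (C x)) \<Longrightarrow>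
        (\<forall>x. C (R x) = R (C x))"
    using sqrt_exists_contraction[of "\<lambda>x. (1 / c) *\<^sub>R A x"] by auto
  have bR: "bounded_clinear R"
    using R by (simp add: positive_op_def)
  have "R (R x) = (1 / c) *\<^sub>R A x" for x
    using R(2) by (metis comp_apply)
  then have "(\<lambda>x. sqrt c *\<^sub>R R x) \<circ> (\<lambda>x. sqrt c *\<^sub>R R x) = A"
    using c by (auto simp: fun_eq_iff bounded_clinear_scaleR[OF bR])
  moreover have "C (sqrt c *\<^sub>R R x) = sqrt c *\<^sub>R R (C x)"
    if C: "bounded_clinear C" "\<forall>x. C (A x) = A (C x)" for C x
    using comm[OF C(1)] C(2) by (simp add: bounded_clinear_scaleR[OF C(1)])
  ultimately show ?thesis
    using c R by (intro exI[of _ "\<lambda>x. sqrt c *\<^sub>R R x"]) (auto intro: positive_op_scaleR)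
qed

lemma positive_op_form_zero:
  assumes P: "positive_op P" and "Re (cinner x (P x)) = 0"
  shows "P x = 0"
proof -
  obtain C where C: "0 < C" "\<And>y. norm (P y) \<le> C * norm y"
    using bounded_clinear_bound[of P] P by (auto simp: positive_op_def)
  then have "(norm (P x))\<^sup>2 \<le> C * 0"
    using positive_op_norm_sq_le[OF P C, of x] assms(2) by simp
  then show ?thesis by simp
qed

text \<open>Any positive root \<open>S\<close> commutes with \<open>A\<close>, hence with the
  constructed root \<open>R\<close>, so \<open>R + S\<close> annihilates
  \<open>y = R x - S x\<close>. Both forms are nonnegative, so they vanish at \<open>y\<close>; this
  gives \<open>R y = S y = 0\<close> and then \<open>cinner y y = 0\<close>.\<close>

lemma
  fixes A :: "'a :: chilbert_space \<Rightarrow> 'a"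
  assumes A: "positive_op A"
  shows positive_op_sqrt: "positive_op (op_sqrt A)"
    and op_sqrt_op_sqrt: "op_sqrt A (op_sqrt A x) = A x"
proof -
  obtain R where R: "positive_op R" "R \<circ> R = A"
    and comm: "\<And>C. bounded_clinear C \<Longrightarrow> (\<forall>x. C (A x) = A (C x)) \<Longrightarrow> (\<forall>x. C (R x) = R (C x))"
    using sqrt_exists[OF A] by blast
  have "S = R" if S: "positive_op S" "S \<circ> S = A" for S
  proof
    fix x
    have bS: "bounded_clinear S" and bR: "bounded_clinear R"
      using S R by (auto simp: positive_op_def)
    have SS: "S (S x) = A x" and RR: "R (R x) = A x" for x
      using S R by (metis comp_apply)+
    have SR: "S (R x) = R (S x)" for x
      using comm[OF bS] SS by metis
    define y where "y = R x - S x"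
    have "R y + S y = 0"
      by (simp add: y_def bounded_clinear_minus[OF bS] bounded_clinear_minus[OF bR] SS RR SR)
    then have "Re (cinner y (R y)) + Re (cinner y (S y)) = 0"
      by (metis cinner.add_right cinner.zero_right plus_complex.simps(1) zero_complex.simps(1))
    then have "Re (cinner y (R y)) = 0" "Re (cinner y (S y)) = 0"
      using positive_op_Re[OF R(1), of y] positive_op_Re[OF S(1), of y] by linarith+
    then have "R y = 0" "S y = 0"
      using positive_op_form_zero R S by blast+
    then have "cinner y y = 0"
      using self_adjoint_cinner[OF positive_op_self_adjoint[OF R(1)], of x y]
        self_adjoint_cinner[OF positive_op_self_adjoint[OF S(1)], of x y]
      by (simp add: y_def cinner.diff_left)
    then show "S x = R x"
      by (simp add: y_def cinner_self)
  qed
  then have "op_sqrt A = R"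
    unfolding op_sqrt_def using R by (intro the_equality) blast+
  with R show "positive_op (op_sqrt A)" "op_sqrt A (op_sqrt A x) = A x"
    by (metis comp_apply)+
qed


subsection \<open>Orthonormal sets\<close>

definition orthonormal :: "'a :: complex_inner set \<Rightarrow> bool"
  where "orthonormal F \<longleftrightarrow> (\<forall>e\<in>F. \<forall>f\<in>F. cinner e f = (if e = f then 1 else 0))"

lemma is_onb_iff: "is_onb E \<longleftrightarrow> orthonormal E \<and> closure (cspan E) = UNIV"
  by (simp add: is_onb_def orthonormal_def)

lemma orthonormal_subset: "orthonormal E \<Longrightarrow> F \<subseteq> E \<Longrightarrow> orthonormal F"
  unfolding orthonormal_def by blast

lemma orthonormal_norm: "orthonormal F \<Longrightarrow> f \<in> F \<Longrightarrow> norm f = 1"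
  using Re_cinner_self[of f] unfolding orthonormal_def by (simp add: abs_square_eq_1)

lemma orthonormal_insert:
  assumes "orthonormal F" "norm x = 1" "\<And>f. f \<in> F \<Longrightarrow> cinner f x = 0"
  shows "orthonormal (insert x F)" "x \<notin> F"
proof -
  have "cinner x f = 0" if "f \<in> F" for f
    using assms(3)[OF that] by (subst cinner_eq_zero_commute)
  moreover have xx: "cinner x x = 1"
    using assms(2) by (simp add: cinner_self)
  ultimately show "orthonormal (insert x F)"
    using assms(1,3) by (auto simp: orthonormal_def)
  show "x \<notin> F"
    using xx assms(3) by force
qed

lemma cinner_orthonormal_comb:
  assumes "finite F" "orthonormal F" "f \<in> F"
  shows "cinner f (\<Sum>e\<in>F. c e *\<^sub>C e) = c f"
proof -
  have "cinner f (\<Sum>e\<in>F. c e *\<^sub>C e) = (\<Sum>e\<in>F. if e = f then c e else 0)"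
    unfolding cinner.sum_right
    by (rule sum.cong) (use assms in \<open>auto simp: cinner_scaleC_right orthonormal_def\<close>)
  then show ?thesis
    using assms by simp
qed

lemma norm_orthonormal_comb:
  assumes "finite F" "orthonormal F"
  shows "(norm (\<Sum>e\<in>F. c e *\<^sub>C e))\<^sup>2 = (\<Sum>e\<in>F. (cmod (c e))\<^sup>2)"
proof -
  have "cinner (\<Sum>e\<in>F. c e *\<^sub>C e) (\<Sum>e\<in>F. c e *\<^sub>C e) = (\<Sum>f\<in>F. cnj (c f) * c f)"
    unfolding cinner.sum_left[of "\<lambda>e. c e *\<^sub>C e" F]
    by (intro sum.cong refl)
      (simp add: cinner_scaleC_left cinner_orthonormal_comb[OF assms])
  also have "\<dots> = (\<Sum>f\<in>F. complex_of_real ((cmod (c f))\<^sup>2))"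
    by (intro sum.cong refl) (metis complex_norm_square mult.commute)
  finally have "Re (cinner (\<Sum>e\<in>F. c e *\<^sub>C e) (\<Sum>e\<in>F. c e *\<^sub>C e)) = (\<Sum>e\<in>F. (cmod (c e))\<^sup>2)"
    by simp
  then show ?thesis
    by simp
qed

lemma cspan_orthonormal_iff:
  assumes "finite F" "orthonormal F"
  shows "x \<in> cspan F \<longleftrightarrow> x = (\<Sum>e\<in>F. cinner e x *\<^sub>C e)"
proof
  assume "x \<in> cspan F"
  then obtain c where c: "x = (\<Sum>e\<in>F. c e *\<^sub>C e)"
    unfolding complex_vector.span_finite[OF assms(1)] by auto
  show "x = (\<Sum>e\<in>F. cinner e x *\<^sub>C e)"
    by (subst c, rule sum.cong) (simp_all add: c cinner_orthonormal_comb[OF assms])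
next
  assume "x = (\<Sum>e\<in>F. cinner e x *\<^sub>C e)"
  then show "x \<in> cspan F"
    by (metis (no_types, lifting) complex_vector.span_base complex_vector.span_scale
        complex_vector.span_sum)
qed

lemma orthonormal_independent:
  assumes "finite F" "orthonormal F"
  shows "complex_vector.independent F"
proof (rule complex_vector.independent_if_scalars_zero[OF assms(1)])
  fix c f
  assume "(\<Sum>x\<in>F. c x *\<^sub>C x) = 0" "f \<in> F"
  then show "c f = 0"
    using cinner_orthonormal_comb[OF assms, of f c] by simp
qed

lemma closed_cspan_orthonormal:
  assumes "finite F" "orthonormal (F :: 'a :: complex_inner set)"
  shows "closed (cspan F)"
proof -
  have "closed {x. x = (\<Sum>e\<in>F. cinner e x *\<^sub>C e)}"
    by (intro closed_Collect_eq continuous_on_sum continuous_on_id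
        scaleC.continuous_on cinner.continuous_on continuous_on_const)
  also have "{x. x = (\<Sum>e\<in>F. cinner e x *\<^sub>C e)} = cspan F"
    using cspan_orthonormal_iff[OF assms] by blast
  finally show ?thesis .
qed

lemma orth_proj_cspan_orthonormal:
  fixes F :: "'a :: chilbert_space set"
  assumes F: "finite F" "orthonormal F"
  shows "orth_proj (cspan F) x = (\<Sum>e\<in>F. cinner e x *\<^sub>C e)"
proof (rule orth_proj_eqI)
  show "(\<Sum>e\<in>F. cinner e x *\<^sub>C e) \<in> cspan F"
    by (intro complex_vector.span_sum complex_vector.span_scale complex_vector.span_base)
  fix y
  assume "y \<in> cspan F"
  then have y: "y = (\<Sum>e\<in>F. cinner e y *\<^sub>C e)"
    using cspan_orthonormal_iff[OF F] by blast
  have "cinner (cinner f y *\<^sub>C f) (x - (\<Sum>e\<in>F. cinner e x *\<^sub>C e)) = 0" if "f \<in> F" for f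
    using that by (simp add: cinner_scaleC_left cinner.diff_right cinner_orthonormal_comb[OF F])
  then show "cinner y (x - (\<Sum>e\<in>F. cinner e x *\<^sub>C e)) = 0"
    by (subst y, subst cinner.sum_left) (rule sum.neutral, blast)
qed simp

lemma orthonormal_complement:
  fixes x :: "'a :: complex_inner"
  assumes F: "finite F" "orthonormal F"
  defines "p \<equiv> \<Sum>e\<in>F. cinner e x *\<^sub>C e"
  shows "\<And>f. f \<in> F \<Longrightarrow> cinner f (x - p) = 0"
    and "(norm x)\<^sup>2 = (\<Sum>e\<in>F. (cmod (cinner e x))\<^sup>2) + (norm (x - p))\<^sup>2"
    and "\<And>y. y \<in> cspan F \<Longrightarrow> norm (x - p) \<le> norm (x - y)"
proof -
  show orth: "cinner f (x - p) = 0" if "f \<in> F" for f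
    using that by (simp add: p_def cinner.diff_right cinner_orthonormal_comb[OF F])
  have pyth: "(norm (x - y))\<^sup>2 = (norm (x - p))\<^sup>2 + (norm (p - y))\<^sup>2" if "y \<in> cspan F" for y
  proof -
    have "p - y \<in> cspan F"
      unfolding p_def
      by (intro complex_vector.span_diff[OF _ that] complex_vector.span_sum
          complex_vector.span_scale complex_vector.span_base)
    then have "p - y = (\<Sum>e\<in>F. cinner e (p - y) *\<^sub>C e)"
      by (simp only: cspan_orthonormal_iff[OF F])
    then have "cinner (p - y) (x - p) = cinner (\<Sum>e\<in>F. cinner e (p - y) *\<^sub>C e) (x - p)"
      by (rule arg_cong)
    also have "\<dots> = 0"
      by (simp add: cinner.sum_left cinner_scaleC_left orth)
    finally show ?thesis
      using norm_diff_sq[of "x - p" "y - p"]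
      by (simp add: norm_minus_commute cinner.diff_left)
  qed
  show "norm (x - p) \<le> norm (x - y)" if "y \<in> cspan F" for y
    by (rule power2_le_imp_le) (simp_all add: pyth[OF that])
  show "(norm x)\<^sup>2 = (\<Sum>e\<in>F. (cmod (cinner e x))\<^sup>2) + (norm (x - p))\<^sup>2"
    using pyth[of 0] by (simp add: complex_vector.span_zero p_def norm_orthonormal_comb[OF F])
qed

lemma bessel:
  assumes "finite F" "orthonormal F"
  shows "(\<Sum>e\<in>F. (cmod (cinner e x))\<^sup>2) \<le> (norm x)\<^sup>2"
  using orthonormal_complement(2)[OF assms, of x] by simp

lemma csubspace_closure:
  assumes S: "complex_vector.subspace (S :: 'a :: complex_inner set)"
  shows "complex_vector.subspace (closure S)"
  unfolding complex_vector.subspace_def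
proof (intro conjI ballI allI)
  show "0 \<in> closure S"
    using complex_vector.subspace_0[OF S] closure_subset by blast
next
  fix x y
  assume "x \<in> closure S" "y \<in> closure S"
  then obtain X Y where "\<forall>n. X n \<in> S" "X \<longlonglongrightarrow> x" "\<forall>n. Y n \<in> S" "Y \<longlonglongrightarrow> y"
    by (auto simp: closure_sequential)
  then show "x + y \<in> closure S"
    unfolding closure_sequential
    by (intro exI[of _ "\<lambda>n. X n + Y n"]) (auto intro: tendsto_add complex_vector.subspace_add[OF S])
next
  fix x c
  assume "x \<in> closure S"
  then obtain X where "\<forall>n. X n \<in> S" "X \<longlonglongrightarrow> x"
    by (auto simp: closure_sequential)
  then show "c *\<^sub>C x \<in> closure S"
    unfolding closure_sequential
    by (intro exI[of _ "\<lambda>n. c *\<^sub>C X n"])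
      (auto intro: scaleC.tendsto tendsto_const complex_vector.subspace_scale[OF S])
qed

lemma onb_exists: "\<exists>E :: 'a :: chilbert_space set. is_onb E"
proof -
  define \<A> where "\<A> = {F :: 'a set. orthonormal F}"
  have "\<exists>M\<in>\<A>. \<forall>X\<in>\<A>. M \<subseteq> X \<longrightarrow> X = M"
  proof (rule subset_Zorn')
    fix C
    assume C: "subset.chain \<A> C"
    show "\<Union>C \<in> \<A>"
      unfolding \<A>_def orthonormal_def mem_Collect_eq
    proof (intro ballI)
      fix e f
      assume "e \<in> \<Union>C" "f \<in> \<Union>C"
      then obtain X where "X \<in> C" "e \<in> X" "f \<in> X"
        using C unfolding subset.chain_def by blast
      moreover have "orthonormal X"
        using C \<open>X \<in> C\<close> by (auto simp: subset.chain_def \<A>_def)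
      ultimately show "cinner e f = (if e = f then 1 else 0)"
        by (simp add: orthonormal_def)
    qed
  qed
  then obtain M where "M \<in> \<A>" and max': "\<forall>X\<in>\<A>. M \<subseteq> X \<longrightarrow> X = M" ..
  then have M: "orthonormal M" and max: "\<And>X. orthonormal X \<Longrightarrow> M \<subseteq> X \<Longrightarrow> X = M"
    by (auto simp: \<A>_def)
  define S where "S = closure (cspan M)"
  have S: "complex_vector.subspace S" "closed S"
    unfolding S_def by (auto intro: csubspace_closure complex_vector.subspace_span)
  have "x \<in> S" for x
  proof (rule ccontr)
    assume "x \<notin> S"
    define u where "u = x - orth_proj S x"
    have u: "u \<noteq> 0"
      using orth_proj_in[OF S, of x] \<open>x \<notin> S\<close> by (auto simp: u_def)
    have orth: "cinner f u = 0" if "f \<in> M" for f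
      unfolding u_def
      by (rule orth_proj_orth[OF S])
        (use that complex_vector.span_base closure_subset in \<open>auto simp: S_def\<close>)
    have "orthonormal (insert ((1 / norm u) *\<^sub>R u) M)" "(1 / norm u) *\<^sub>R u \<notin> M"
      by (rule orthonormal_insert[OF M]; use u orth in \<open>simp add: cinner.scaleR_right\<close>)+
    then show False
      using max by blast
  qed
  then have "closure (cspan M) = UNIV"
    by (auto simp: S_def)
  with M show ?thesis
    by (auto simp: is_onb_iff)
qed

text \<open>One inequality is Bessel. For the other, a finite combination near \<open>x\<close>
  involves finitely many basis vectors, and the projection onto their span is at least as
  near.\<close>

lemma parseval:
  assumes E: "is_onb E"
  shows "((\<lambda>e. (cmod (cinner e x))\<^sup>2) has_sum (norm x)\<^sup>2) E"
proof -
  let ?f = "\<lambda>e. (cmod (cinner e x))\<^sup>2"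
  have oE: "orthonormal E" and dense: "closure (cspan E) = UNIV"
    using E by (auto simp: is_onb_iff)
  have bes: "sum ?f F \<le> (norm x)\<^sup>2" if "finite F" "F \<subseteq> E" for F
    using that oE by (intro bessel) (auto intro: orthonormal_subset)
  have summ: "?f summable_on E"
    by (rule nonneg_bdd_above_summable_on) (auto intro!: bdd_aboveI2[where M = "(norm x)\<^sup>2"] bes)
  have "(norm x)\<^sup>2 \<le> infsum ?f E"
  proof (rule field_le_epsilon)
    fix e :: real
    assume "0 < e"
    then obtain y where y: "y \<in> cspan E" "dist y x < sqrt e"
      using closure_approachable[of x "cspan E"] dense by (metis UNIV_I real_sqrt_gt_0_iff)
    then obtain F c where F: "finite F" "F \<subseteq> E" and "y = (\<Sum>a\<in>F. c a *\<^sub>C a)"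
      unfolding complex_vector.span_explicit by blast
    then have yF: "y \<in> cspan F"
      by (auto intro: complex_vector.span_sum complex_vector.span_scale complex_vector.span_base)
    have oF: "orthonormal F"
      using oE F by (rule_tac orthonormal_subset)
    define p where "p = (\<Sum>e\<in>F. cinner e x *\<^sub>C e)"
    have "norm (x - p) \<le> sqrt e"
      using orthonormal_complement(3)[OF F(1) oF yF, of x] y(2)
      by (simp add: p_def dist_norm norm_minus_commute)
    then have "(norm (x - p))\<^sup>2 \<le> e"
      using \<open>0 < e\<close> by (metis norm_ge_zero power_mono real_sqrt_pow2 less_imp_le)
    moreover have "sum ?f F \<le> infsum ?f E"
      using F summ by (intro finite_sum_le_infsum) auto
    ultimately show "(norm x)\<^sup>2 \<le> infsum ?f E + e"
      using orthonormal_complement(2)[OF F(1) oF, of x] by (simp add: p_def)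
  qed
  moreover have "infsum ?f E \<le> (norm x)\<^sup>2"
    using summ bes by (rule infsum_le_finite_sums)
  ultimately show ?thesis
    using summ by (simp add: has_sum_infsum order_antisym)
qed


subsection \<open>Hilbert-Schmidt operators\<close>

text \<open>\<open>hs A C\<close> means that the Hilbert-Schmidt norm is at most \<open>C\<close>.
  Testing all finite orthonormal families avoids a choice of basis, \<open>L2_set\<close> gives the
  triangle inequality, and explicit constants keep the bounds uniform in the spectral
  parameter.\<close>

definition hs :: "('a :: complex_inner \<Rightarrow> 'b :: complex_inner) \<Rightarrow> real \<Rightarrow> bool"
  where "hs A C \<longleftrightarrow> bounded_clinear A \<and> 0 \<le> C \<and>
    (\<forall>F. finite F \<longrightarrow> orthonormal F \<longrightarrow> L2_set (\<lambda>f. norm (A f)) F \<le> C)"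

lemma
  assumes "hs A C"
  shows hs_bounded_clinear: "bounded_clinear A" and hs_nonneg: "0 \<le> C"
    and hs_L2: "finite F \<Longrightarrow> orthonormal F \<Longrightarrow> L2_set (\<lambda>f. norm (A f)) F \<le> C"
  using assms by (auto simp: hs_def)

lemma L2_set_le_iff:
  assumes "0 \<le> C"
  shows "L2_set f F \<le> C \<longleftrightarrow> (\<Sum>i\<in>F. (f i)\<^sup>2) \<le> C\<^sup>2"
proof -
  have "L2_set f F \<le> C \<longleftrightarrow> (L2_set f F)\<^sup>2 \<le> C\<^sup>2"
    using assms by (simp add: L2_set_nonneg power2_le_iff_abs_le)
  also have "(L2_set f F)\<^sup>2 = (\<Sum>i\<in>F. (f i)\<^sup>2)"
    by (simp add: L2_set_def sum_nonneg)
  finally show ?thesis .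
qed

lemma hs_sum_le: "hs A C \<Longrightarrow> finite F \<Longrightarrow> orthonormal F \<Longrightarrow> (\<Sum>f\<in>F. (norm (A f))\<^sup>2) \<le> C\<^sup>2"
  by (rule L2_set_le_iff[THEN iffD1, OF hs_nonneg]) (auto intro: hs_L2)

lemma hsI:
  assumes "bounded_clinear A" "0 \<le> C"
    and "\<And>F. finite F \<Longrightarrow> orthonormal F \<Longrightarrow> (\<Sum>f\<in>F. (norm (A f))\<^sup>2) \<le> C\<^sup>2"
  shows "hs A C"
  using assms by (simp add: hs_def L2_set_le_iff)

lemma hs_norm_le:
  assumes "hs A C"
  shows "norm (A x) \<le> C * norm x"
proof (cases "x = 0")
  case True
  then show ?thesis
    using bounded_clinear_zero[OF hs_bounded_clinear[OF assms]] by simp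
next
  case False
  define f where "f = (1 / norm x) *\<^sub>R x"
  have "orthonormal {f}"
    using False by (auto simp: orthonormal_def f_def cinner.scaleR_left cinner.scaleR_right
        cinner_self power2_eq_square)
  then have "norm (A f) \<le> C"
    using hs_L2[OF assms, of "{f}"] by (simp add: L2_set_def)
  then show ?thesis
    using False
    by (simp add: f_def bounded_clinear_scaleR[OF hs_bounded_clinear[OF assms]] field_simps)
qed

lemma hs_add:
  assumes "hs A C" "hs B D"
  shows "hs (\<lambda>x. A x + B x) (C + D)"
  unfolding hs_def
proof (intro conjI allI impI)
  fix F :: "'a set"
  assume F: "finite F" "orthonormal F"
  have "L2_set (\<lambda>f. norm (A f + B f)) F \<le> L2_set (\<lambda>f. norm (A f) + norm (B f)) F"
    by (intro L2_set_mono norm_triangle_ineq) auto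
  also have "\<dots> \<le> L2_set (\<lambda>f. norm (A f)) F + L2_set (\<lambda>f. norm (B f)) F"
    by (rule L2_set_triangle_ineq)
  also have "\<dots> \<le> C + D"
    by (intro add_mono hs_L2 assms F)
  finally show "L2_set (\<lambda>f. norm (A f + B f)) F \<le> C + D" .
qed (use assms in \<open>auto simp: hs_def intro: bounded_clinear_add\<close>)

lemma hs_compose_left:
  assumes B: "bounded_clinear B" "\<And>x. norm (B x) \<le> b * norm x" "0 \<le> b" and A: "hs A C"
  shows "hs (\<lambda>x. B (A x)) (b * C)"
proof (rule hsI)
  fix F :: "'c set"
  assume F: "finite F" "orthonormal F"
  have "(\<Sum>f\<in>F. (norm (B (A f)))\<^sup>2) \<le> (\<Sum>f\<in>F. b\<^sup>2 * (norm (A f))\<^sup>2)"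
    using B(2) by (intro sum_mono) (metis norm_ge_zero power_mono power_mult_distrib)
  also have "\<dots> = b\<^sup>2 * (\<Sum>f\<in>F. (norm (A f))\<^sup>2)"
    by (simp add: sum_distrib_left)
  also have "\<dots> \<le> b\<^sup>2 * C\<^sup>2"
    by (intro mult_left_mono hs_sum_le[OF A] F) simp
  finally show "(\<Sum>f\<in>F. (norm (B (A f)))\<^sup>2) \<le> (b * C)\<^sup>2"
    by (simp add: power_mult_distrib)
qed (use assms hs_nonneg[OF A] hs_bounded_clinear[OF A] in \<open>auto intro: bounded_clinear_compose\<close>)

lemma hs_cmult:
  assumes "hs A C"
  shows "hs (\<lambda>x. c *\<^sub>C A x) (cmod c * C)"
  by (rule hs_compose_left[OF bounded_clinear_cmult[OF bounded_clinear_id] _ _ assms])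
    (simp_all add: norm_scaleC)

lemma hs_rmult: "hs A C \<Longrightarrow> hs (\<lambda>x. r *\<^sub>R A x) (\<bar>r\<bar> * C)"
  using hs_cmult[of A C "complex_of_real r"] by (simp add: scaleC_of_real)

lemma hs_uminus: "hs A C \<Longrightarrow> hs (\<lambda>x. - A x) C"
  using hs_rmult[of A C "- 1"] by simp

lemma hs_diff: "hs A C \<Longrightarrow> hs B D \<Longrightarrow> hs (\<lambda>x. A x - B x) (C + D)"
  using hs_add[OF _ hs_uminus] by force

lemma hs_0: "hs (\<lambda>x. 0) 0"
  by (rule hsI) (auto intro: bounded_clinear_const_0)

lemma hs_setsum:
  assumes "\<And>i. i \<in> I \<Longrightarrow> hs (A i) (C i)"
  shows "hs (\<lambda>x. \<Sum>i\<in>I. A i x) (\<Sum>i\<in>I. C i)"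
  using assms
  by (induction I rule: infinite_finite_induct) (auto intro: hs_0 hs_add)

text \<open>The squares of \<open>cmod (cinner g (A e))\<close> are summed in both orders: Parseval
  along the basis recovers the norms of \<open>adj A g\<close>, Bessel along \<open>G\<close> bounds
  the sum for fixed \<open>e\<close> by \<open>(norm (A e))\<^sup>2\<close>.\<close>

lemma hs_adj_of_onb:
  fixes A :: "'a :: chilbert_space \<Rightarrow> 'b :: chilbert_space"
  assumes E: "is_onb E" and A: "bounded_clinear A" and C: "0 \<le> C"
    and bound: "\<And>F. finite F \<Longrightarrow> F \<subseteq> E \<Longrightarrow> (\<Sum>e\<in>F. (norm (A e))\<^sup>2) \<le> C\<^sup>2"
  shows "hs (adj A) C"
proof (rule hsI)
  fix G :: "'b set"
  assume G: "finite G" "orthonormal G"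
  have "((\<lambda>F. \<Sum>g\<in>G. \<Sum>e\<in>F. (cmod (cinner e (adj A g)))\<^sup>2) \<longlongrightarrow> (\<Sum>g\<in>G. (norm (adj A g))\<^sup>2))
      (finite_subsets_at_top E)"
    using parseval[OF E] unfolding has_sum_def by (intro tendsto_sum)
  then show "(\<Sum>g\<in>G. (norm (adj A g))\<^sup>2) \<le> C\<^sup>2"
  proof (rule tendsto_upperbound)
    have "(\<Sum>g\<in>G. \<Sum>e\<in>F. (cmod (cinner e (adj A g)))\<^sup>2) \<le> C\<^sup>2" if F: "finite F" "F \<subseteq> E" for F
    proof -
      have "(\<Sum>g\<in>G. \<Sum>e\<in>F. (cmod (cinner e (adj A g)))\<^sup>2) =
          (\<Sum>e\<in>F. \<Sum>g\<in>G. (cmod (cinner g (A e)))\<^sup>2)"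
        by (subst sum.swap, intro sum.cong refl)
          (metis A cinner_adj_right cinner_commute complex_mod_cnj)
      also have "\<dots> \<le> (\<Sum>e\<in>F. (norm (A e))\<^sup>2)"
        by (intro sum_mono bessel G)
      also have "\<dots> \<le> C\<^sup>2"
        by (rule bound[OF F])
      finally show ?thesis .
    qed
    then show "\<forall>\<^sub>F F in finite_subsets_at_top E.
        (\<Sum>g\<in>G. \<Sum>e\<in>F. (cmod (cinner e (adj A g)))\<^sup>2) \<le> C\<^sup>2"
      by (intro eventually_finite_subsets_at_top_weakI)
  qed simp
qed (use A C in \<open>auto intro: bounded_clinear_adj\<close>)

lemma hs_adj:
  fixes A :: "'a :: chilbert_space \<Rightarrow> 'b :: chilbert_space"
  assumes A: "hs A C"
  shows "hs (adj A) C"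
proof -
  obtain E :: "'a set" where E: "is_onb E"
    using onb_exists by blast
  show ?thesis
    by (rule hs_adj_of_onb[OF E hs_bounded_clinear[OF A] hs_nonneg[OF A]])
      (use E in \<open>auto intro: hs_sum_le[OF A] orthonormal_subset simp: is_onb_iff\<close>)
qed

text \<open>Passing to the adjoint twice turns a bound on one basis into a bound on all orthonormal
  families.\<close>

lemma hs_of_onb:
  fixes A :: "'a :: chilbert_space \<Rightarrow> 'b :: chilbert_space"
  assumes "is_onb E" "bounded_clinear A" "0 \<le> C"
    and "\<And>F. finite F \<Longrightarrow> F \<subseteq> E \<Longrightarrow> (\<Sum>e\<in>F. (norm (A e))\<^sup>2) \<le> C\<^sup>2"
  shows "hs A C"
  using hs_adj[OF hs_adj_of_onb[OF assms]] by (simp add: adj_adj[OF assms(2)])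

lemma hs_compose_right:
  fixes A :: "'b :: chilbert_space \<Rightarrow> 'c :: chilbert_space"
    and B :: "'a :: chilbert_space \<Rightarrow> 'b"
  assumes B: "bounded_clinear B" "\<And>x. norm (B x) \<le> b * norm x" "0 \<le> b" and A: "hs A C"
  shows "hs (\<lambda>x. A (B x)) (b * C)"
proof -
  have bA: "bounded_clinear A"
    by (rule hs_bounded_clinear[OF A])
  have "hs (\<lambda>x. adj B (adj A x)) (b * C)"
    by (intro hs_compose_left bounded_clinear_adj norm_adj_le hs_adj assms)
  then have "hs (adj (\<lambda>x. A (B x))) (b * C)"
    by (simp add: adj_compose[OF bA B(1)])
  from hs_adj[OF this] show ?thesis
    by (simp add: adj_adj bounded_clinear_compose[OF bA B(1)])
qed

lemma cinner_adj_comp_self: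
  fixes A :: "'a :: chilbert_space \<Rightarrow> 'b :: chilbert_space"
  assumes "bounded_clinear A"
  shows "cinner e (adj A (A e)) = complex_of_real ((norm (A e))\<^sup>2)"
  by (simp only: cinner_adj_right[OF assms] cinner_self)

lemma hs_summable:
  assumes A: "hs A C" and E: "orthonormal E"
  shows "(\<lambda>e. (norm (A e))\<^sup>2) summable_on E" "(\<Sum>\<^sub>\<infinity>e\<in>E. (norm (A e))\<^sup>2) \<le> C\<^sup>2"
proof -
  have b: "(\<Sum>e\<in>F. (norm (A e))\<^sup>2) \<le> C\<^sup>2" if "finite F" "F \<subseteq> E" for F
    using that E by (intro hs_sum_le[OF A]) (auto intro: orthonormal_subset)
  then show s: "(\<lambda>e. (norm (A e))\<^sup>2) summable_on E"
    by (intro nonneg_bdd_above_summable_on) (auto intro!: bdd_aboveI2[where M = "C\<^sup>2"])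
  show "(\<Sum>\<^sub>\<infinity>e\<in>E. (norm (A e))\<^sup>2) \<le> C\<^sup>2"
    using s b by (rule infsum_le_finite_sums)
qed

lemma schatten2_iff_hs:
  fixes A :: "'a :: chilbert_space \<Rightarrow> 'b :: chilbert_space"
  shows "schatten2 A \<longleftrightarrow> (\<exists>C. hs A C)"
proof
  assume "schatten2 A"
  then obtain E where A: "bounded_clinear A" and E: "is_onb E"
    and summ: "(\<lambda>e. cinner e (adj A (A e))) summable_on E"
    by (auto simp: schatten2_def)
  let ?S = "\<Sum>\<^sub>\<infinity>e\<in>E. (norm (A e))\<^sup>2"
  have "(\<lambda>e. (norm (A e))\<^sup>2) summable_on E"
    using summable_on_Re[OF summ] by (simp add: Re_cinner_adj_comp[OF A])
  then have "(\<Sum>e\<in>F. (norm (A e))\<^sup>2) \<le> ?S" if "finite F" "F \<subseteq> E" for F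
    using that by (intro finite_sum_le_infsum) auto
  moreover have "0 \<le> ?S"
    by (rule infsum_nonneg) simp
  ultimately have "hs A (sqrt ?S)"
    by (intro hs_of_onb[OF E A]) auto
  then show "\<exists>C. hs A C" ..
next
  assume "\<exists>C. hs A C"
  then obtain C where C: "hs A C" ..
  obtain E :: "'a set" where E: "is_onb E"
    using onb_exists by blast
  have "(\<lambda>e. complex_of_real ((norm (A e))\<^sup>2)) summable_on E"
    by (rule summable_on_of_real, rule hs_summable[OF C]) (use E in \<open>simp add: is_onb_iff\<close>)
  then show "schatten2 A"
    using E hs_bounded_clinear[OF C] by (auto simp: schatten2_def cinner_adj_comp_self)
qed

lemma is_onb_some: "is_onb (SOME E :: 'a :: chilbert_space set. is_onb E)"
  using onb_exists by (rule someI_ex)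

lemma is_onb_orthonormal: "is_onb E \<Longrightarrow> orthonormal E"
  by (simp add: is_onb_iff)

lemma schatten2_norm_eq:
  fixes A :: "'a :: chilbert_space \<Rightarrow> 'b :: chilbert_space"
  assumes A: "hs A C"
  shows "schatten2_norm A = sqrt (\<Sum>\<^sub>\<infinity>e\<in>(SOME E. is_onb E). (norm (A e))\<^sup>2)"
proof -
  have s: "(\<lambda>e. (norm (A e))\<^sup>2) summable_on (SOME E :: 'a set. is_onb E)"
    by (intro hs_summable[OF A] is_onb_orthonormal is_onb_some)
  have "trace_op (adj A \<circ> A) = complex_of_real (\<Sum>\<^sub>\<infinity>e\<in>(SOME E. is_onb E). (norm (A e))\<^sup>2)"
    unfolding trace_op_def comp_def cinner_adj_comp_self[OF hs_bounded_clinear[OF A]]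
    by (rule infsumI, rule has_sum_of_real, rule has_sum_infsum[OF s])
  then show ?thesis
    by (simp add: schatten2_norm_def)
qed

lemma schatten2_norm_le:
  fixes A :: "'a :: chilbert_space \<Rightarrow> 'b :: chilbert_space"
  assumes A: "hs A C"
  shows "schatten2_norm A \<le> C"
  unfolding schatten2_norm_eq[OF A]
  by (intro real_le_lsqrt hs_nonneg[OF A] hs_summable[OF A] is_onb_orthonormal is_onb_some)

lemma hs_schatten2_norm:
  fixes A :: "'a :: chilbert_space \<Rightarrow> 'b :: chilbert_space"
  assumes "schatten2 A"
  shows "hs A (schatten2_norm A)"
proof -
  obtain C where A: "hs A C"
    using assms by (auto simp: schatten2_iff_hs)
  have nonneg: "0 \<le> (\<Sum>\<^sub>\<infinity>e\<in>(SOME E. is_onb E). (norm (A e))\<^sup>2)"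
    by (rule infsum_nonneg) simp
  show ?thesis
  proof (rule hs_of_onb[OF is_onb_some hs_bounded_clinear[OF A]])
    show "0 \<le> schatten2_norm A"
      using nonneg by (simp add: schatten2_norm_eq[OF A])
    fix F
    assume "finite F" "F \<subseteq> (SOME E :: 'a set. is_onb E)"
    then show "(\<Sum>e\<in>F. (norm (A e))\<^sup>2) \<le> (schatten2_norm A)\<^sup>2"
      using nonneg unfolding schatten2_norm_eq[OF A]
      by (simp add: finite_sum_le_infsum[OF hs_summable(1)[OF A is_onb_orthonormal[OF is_onb_some]]])
  qed
qed


subsection \<open>Compactness\<close>

lemma compact_scaleC_comb:
  assumes "finite F"
  shows "compact {\<Sum>e\<in>F. c e *\<^sub>C (a e :: 'a :: complex_inner) | c. \<forall>e\<in>F. cmod (c e) \<le> 1}"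
  using assms
proof (induction F rule: finite_induct)
  case (insert x F)
  let ?K = "\<lambda>F. {\<Sum>e\<in>F. c e *\<^sub>C a e | c. \<forall>e\<in>F. cmod (c e) \<le> 1}"
  have "compact ((\<lambda>(z, y). z *\<^sub>C a x + y) ` (cball 0 1 \<times> ?K F))"
    using insert.IH unfolding case_prod_beta
    by (intro compact_continuous_image compact_Times continuous_intros scaleC.continuous_on) auto
  also have "(\<lambda>(z, y). z *\<^sub>C a x + y) ` (cball 0 1 \<times> ?K F) = ?K (insert x F)"
  proof (intro subset_antisym subsetI)
    fix y
    assume "y \<in> (\<lambda>(z, y). z *\<^sub>C a x + y) ` (cball 0 1 \<times> ?K F)"
    then obtain z c where z: "cmod z \<le> 1" "\<forall>e\<in>F. cmod (c e) \<le> 1"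
      and y: "y = z *\<^sub>C a x + (\<Sum>e\<in>F. c e *\<^sub>C a e)"
      by auto
    have "(\<Sum>e\<in>F. (c(x := z)) e *\<^sub>C a e) = (\<Sum>e\<in>F. c e *\<^sub>C a e)"
      using insert.hyps by (intro sum.cong) auto
    then have "y = (\<Sum>e\<in>insert x F. (c(x := z)) e *\<^sub>C a e)"
      using insert.hyps y by simp
    moreover have "\<forall>e\<in>insert x F. cmod ((c(x := z)) e) \<le> 1"
      using z by simp
    ultimately show "y \<in> ?K (insert x F)"
      by blast
  next
    fix y
    assume "y \<in> ?K (insert x F)"
    then obtain c where "\<forall>e\<in>insert x F. cmod (c e) \<le> 1" "y = (\<Sum>e\<in>insert x F. c e *\<^sub>C a e)"
      by blast
    then show "y \<in> (\<lambda>(z, y). z *\<^sub>C a x + y) ` (cball 0 1 \<times> ?K F)"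
      using insert.hyps by (intro image_eqI[of _ _ "(c x, \<Sum>e\<in>F. c e *\<^sub>C a e)"]) auto
  qed
  finally show ?case .
qed simp

text \<open>\<open>F\<close> almost maximizes the sum of \<open>(norm (A f))\<^sup>2\<close> over
  finite orthonormal families. A unit vector orthogonal to \<open>F\<close> can be adjoined, so its
  image cannot have norm above \<open>e\<close>.\<close>

lemma hs_small_complement:
  assumes A: "hs A C" and "0 < e"
  obtains F where "finite F" "orthonormal F"
    "\<And>x. (\<And>f. f \<in> F \<Longrightarrow> cinner f x = 0) \<Longrightarrow> norm (A x) \<le> e * norm x"
proof -
  define \<F> where "\<F> = {F :: 'a set. finite F \<and> orthonormal F}"
  define S where "S F = (\<Sum>f\<in>F. (norm (A f))\<^sup>2)" for F
  have bdd: "bdd_above (S ` \<F>)"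
    by (rule bdd_aboveI2[where M = "C\<^sup>2"]) (auto simp: S_def \<F>_def intro: hs_sum_le[OF A])
  have "{} \<in> \<F>"
    by (simp add: \<F>_def orthonormal_def)
  then obtain F where F: "F \<in> \<F>" "Sup (S ` \<F>) - e\<^sup>2 < S F"
    using less_cSupD[of "S ` \<F>" "Sup (S ` \<F>) - e\<^sup>2"] \<open>0 < e\<close> by auto
  have "norm (A x) \<le> e * norm x" if orth: "\<And>f. f \<in> F \<Longrightarrow> cinner f x = 0" for x
  proof (cases "x = 0")
    case True
    then show ?thesis
      using bounded_clinear_zero[OF hs_bounded_clinear[OF A]] by simp
  next
    case False
    define u where "u = (1 / norm x) *\<^sub>R x"
    have "orthonormal F" "norm u = 1" "\<And>f. f \<in> F \<Longrightarrow> cinner f u = 0"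
      using F(1) False orth by (auto simp: \<F>_def u_def cinner.scaleR_right)
    note ins = orthonormal_insert[OF this]
    then have "insert u F \<in> \<F>"
      using F(1) by (simp add: \<F>_def)
    then have "S (insert u F) \<le> Sup (S ` \<F>)"
      using bdd by (intro cSUP_upper)
    then have "(norm (A u))\<^sup>2 \<le> e\<^sup>2"
      using F ins(2) by (simp add: S_def \<F>_def)
    then have "norm (A u) \<le> e"
      using \<open>0 < e\<close> by (simp add: power2_le_iff_abs_le)
    then show ?thesis
      using False
      by (simp add: u_def bounded_clinear_scaleR[OF hs_bounded_clinear[OF A]] field_simps)
  qed
  with F(1) show ?thesis
    by (intro that[of F]) (auto simp: \<F>_def)
qed

text \<open>The part of \<open>x\<close> in the span of \<open>F\<close> has its image in a compact
  set of combinations of finitely many vectors; the rest has a small image.\<close>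

lemma hs_compact:
  fixes A :: "'a :: chilbert_space \<Rightarrow> 'b :: chilbert_space"
  assumes A: "hs A C"
  shows "compact (closure (A ` cball 0 1))"
  unfolding compact_eq_totally_bounded
proof (intro conjI allI impI)
  show "complete (closure (A ` cball 0 1))"
    by (simp add: complete_eq_closed)
  fix e :: real
  assume e: "0 < e"
  note bA = hs_bounded_clinear[OF A]
  obtain F where F: "finite F" "orthonormal F"
    and small: "\<And>x. (\<And>f. f \<in> F \<Longrightarrow> cinner f x = 0) \<Longrightarrow> norm (A x) \<le> e / 4 * norm x"
    using hs_small_complement[OF A, of "e / 4"] e by auto
  define K where "K = {\<Sum>f\<in>F. c f *\<^sub>C A f | c. \<forall>f\<in>F. cmod (c f) \<le> 1}"
  have "compact K"
    unfolding K_def by (rule compact_scaleC_comb[OF F(1)])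
  then obtain k where k: "finite k" "K \<subseteq> (\<Union>y\<in>k. ball y (e / 4))"
    unfolding compact_eq_totally_bounded using e by (meson zero_less_divide_iff zero_less_numeral)
  have "A x \<in> (\<Union>y\<in>k. cball y (e / 2))" if x: "norm x \<le> 1" for x
  proof -
    define p where "p = (\<Sum>f\<in>F. cinner f x *\<^sub>C f)"
    have "cmod (cinner f x) \<le> 1" if "f \<in> F" for f
      using norm_cinner_le[of f x] orthonormal_norm[OF F(2) that] x by simp
    then have "A p \<in> K"
      unfolding K_def p_def by (auto simp: bounded_clinear_sum[OF bA] bounded_clinear_scaleC[OF bA])
    then obtain y where y: "y \<in> k" "dist y (A p) < e / 4"
      using k(2) by auto
    have "norm (x - p) \<le> norm (x - 0)"
      unfolding p_def by (rule orthonormal_complement(3)[OF F complex_vector.span_zero])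
    then have "norm (x - p) \<le> 1"
      using x by simp
    have "norm (A (x - p)) \<le> e / 4 * norm (x - p)"
      by (rule small) (simp add: p_def orthonormal_complement(1)[OF F])
    also have "\<dots> \<le> e / 4 * 1"
      using e \<open>norm (x - p) \<le> 1\<close> by (intro mult_left_mono) auto
    finally have "dist (A p) (A x) \<le> e / 4"
      by (simp add: dist_norm norm_minus_commute bounded_clinear_minus[OF bA])
    then have "dist y (A x) \<le> e / 2"
      using y(2) dist_triangle[of y "A x" "A p"] by simp
    with y(1) show ?thesis by auto
  qed
  then have "A ` cball 0 1 \<subseteq> (\<Union>y\<in>k. cball y (e / 2))"
    by auto
  then have "closure (A ` cball 0 1) \<subseteq> (\<Union>y\<in>k. cball y (e / 2))"
    using k(1) by (intro closure_minimal) auto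
  also have "\<dots> \<subseteq> (\<Union>y\<in>k. ball y e)"
    using e by (intro UN_mono) auto
  finally show "\<exists>k. finite k \<and> closure (A ` cball 0 1) \<subseteq> (\<Union>x\<in>k. ball x e)"
    using k(1) by blast
qed

text \<open>
  A maximizing sequence \<open>x\<^sub>n\<close> of the quadratic form satisfies \<open>A x\<^sub>n - m x\<^sub>n \<rightarrow> 0\<close> by Cauchy-Schwarz
  for the form of \<open>m - A\<close>, so that compactness of \<open>A\<close> yields a limit point, which is an eigenvector.
\<close>

lemma hs_eigenvector_exists:
  fixes A :: "'a :: chilbert_space \<Rightarrow> 'a"
  assumes A: "hs A C" and sa: "self_adjoint A"
    and S: "complex_vector.subspace S" "closed S" and inv: "\<And>x. x \<in> S \<Longrightarrow> A x \<in> S"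
    and x0: "x0 \<in> S" "r * (norm x0)\<^sup>2 < Re (cinner x0 (A x0))" and "0 \<le> r"
  obtains m x where "r < m" "x \<in> S" "norm x = 1" "A x = m *\<^sub>R x"
proof -
  note bA = self_adjoint_bounded_clinear[OF sa]
  define q where "q x = Re (cinner x (A x))" for x
  define U where "U = {x \<in> S. norm x = 1}"
  have q_scale: "q (t *\<^sub>R x) = t\<^sup>2 * q x" for t x
    by (simp add: q_def bounded_clinear_scaleR[OF bA] cinner.scaleR_left cinner.scaleR_right
        power2_eq_square)
  have "q x \<le> C" if "x \<in> U" for x
  proof -
    have "q x \<le> norm x * norm (A x)"
      unfolding q_def using complex_Re_le_cmod norm_cinner_le order_trans by blast
    then show ?thesis
      using hs_norm_le[OF A, of x] that by (simp add: U_def)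
  qed
  then have bdd: "bdd_above (q ` U)"
    by (rule bdd_aboveI2)
  define m where "m = Sup (q ` U)"
  have "x0 \<noteq> 0"
    using x0 by (auto simp: bounded_clinear_zero[OF bA])
  have normalize: "(1 / norm x) *\<^sub>R x \<in> U" if "x \<in> S" "x \<noteq> 0" for x
    using that csubspace_scaleR[OF S(1)] by (simp add: U_def)
  have le_m: "q x \<le> m * (norm x)\<^sup>2" if "x \<in> S" for x
  proof (cases "x = 0")
    case True
    then show ?thesis by (simp add: q_def)
  next
    case False
    then have "q ((1 / norm x) *\<^sub>R x) \<le> m"
      unfolding m_def using bdd normalize[OF that] by (intro cSUP_upper)
    then show ?thesis
      using False by (simp add: q_scale power_divide field_simps)
  qed
  have rm: "r < m"
  proof -
    have "r * (norm x0)\<^sup>2 < m * (norm x0)\<^sup>2"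
      using x0 le_m[OF x0(1)] by (simp add: q_def)
    then show ?thesis
      by (simp add: mult_less_cancel_right)
  qed
  have "\<exists>x\<in>U. m - inverse (real (Suc n)) < q x" for n
    using less_cSupD[of "q ` U" "m - inverse (real (Suc n))"] normalize[OF x0(1) \<open>x0 \<noteq> 0\<close>]
    unfolding m_def by auto
  then obtain X where XU: "\<And>n. X n \<in> U" and X: "\<And>n. m - inverse (real (Suc n)) < q (X n)"
    by metis
  have XS: "X n \<in> S" and X1: "norm (X n) = 1" for n
    using XU[of n] by (auto simp: U_def)
  define P where "P x = m *\<^sub>R x - A x" for x
  have saP: "self_adjoint P"
    using self_adjoint_add[OF self_adjoint_scaleR[of "\<lambda>x. x" m] self_adjoint_uminus[OF sa]]
    unfolding P_def by (simp add: self_adjoint_def bounded_clinear_id)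
  define D where "D = m + C + 1"
  have D: "0 < D"
    using rm \<open>0 \<le> r\<close> hs_nonneg[OF A] by (simp add: D_def)
  have PD: "norm (P y) \<le> D * norm y" for y
  proof -
    have "norm (P y) \<le> norm (m *\<^sub>R y) + norm (A y)"
      unfolding P_def by (rule norm_triangle_ineq4)
    also have "\<dots> \<le> m * norm y + C * norm y"
      using rm \<open>0 \<le> r\<close> hs_norm_le[OF A, of y] by simp
    finally show ?thesis
      using norm_ge_zero[of y] unfolding D_def distrib_right by linarith
  qed
  have qP: "Re (cinner x (P x)) = m * (norm x)\<^sup>2 - q x" for x
    by (simp add: P_def q_def cinner.diff_right cinner.scaleR_right)
  have PS: "P x \<in> S" if "x \<in> S" for x
    unfolding P_def using that
    by (intro complex_vector.subspace_diff[OF S(1)] csubspace_scaleR[OF S(1)] inv)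
  have "(norm (P (X n)))\<^sup>2 \<le> D * inverse (real (Suc n))" for n
  proof -
    \<comment> \<open>\<open>P\<close> is known to be positive on \<open>S\<close> only, so the
      trial vector of \<open>norm_sq_le_form\<close> has to lie in \<open>S\<close>.\<close>
    have "X n - (1 / D) *\<^sub>R P (X n) \<in> S"
      by (intro complex_vector.subspace_diff[OF S(1)] csubspace_scaleR[OF S(1)] PS XS)
    then have "0 \<le> Re (cinner (X n - (1 / D) *\<^sub>R P (X n)) (P (X n - (1 / D) *\<^sub>R P (X n))))"
      using le_m by (simp add: qP)
    then have "(norm (P (X n)))\<^sup>2 \<le> D * Re (cinner (X n) (P (X n)))"
      by (rule norm_sq_le_form[OF saP D PD])
    also have "Re (cinner (X n) (P (X n))) \<le> inverse (real (Suc n))"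
      using X[of n] by (simp add: qP X1)
    finally show ?thesis
      using D by simp
  qed
  moreover have "(\<lambda>n. D * inverse (real (Suc n))) \<longlonglongrightarrow> D * 0"
    by (intro tendsto_intros LIMSEQ_inverse_real_of_nat)
  ultimately have "(\<lambda>n. (norm (P (X n)))\<^sup>2) \<longlonglongrightarrow> 0"
    by (intro Lim_null_comparison[of "\<lambda>n. (norm (P (X n)))\<^sup>2"]) auto
  then have "(\<lambda>n. sqrt ((norm (P (X n)))\<^sup>2)) \<longlonglongrightarrow> sqrt 0"
    by (rule tendsto_real_sqrt)
  then have P0: "(\<lambda>n. P (X n)) \<longlonglongrightarrow> 0"
    by (simp add: tendsto_norm_zero_iff)
  have "\<forall>n. A (X n) \<in> closure (A ` cball 0 1)"
    using X1 by (intro allI subsetD[OF closure_subset] imageI) simp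
  then obtain y \<rho> where \<rho>: "strict_mono \<rho>" "((\<lambda>n. A (X n)) \<circ> \<rho>) \<longlonglongrightarrow> y"
    using hs_compact[OF A] unfolding compact_def by metis
  \<comment> \<open>Since \<open>m\<close> is positive, x = (P x + A x) / m: the first term tends to
    0 and the second converges along the subsequence, hence so does \<open>X\<close>.\<close>
  have "(\<lambda>n. (1 / m) *\<^sub>R (P (X (\<rho> n)) + A (X (\<rho> n)))) \<longlonglongrightarrow> (1 / m) *\<^sub>R (0 + y)"
    using \<rho> LIMSEQ_subseq_LIMSEQ[OF P0 \<rho>(1)] unfolding comp_def by (intro tendsto_intros)
  moreover have "(1 / m) *\<^sub>R (P x + A x) = x" for x
    using rm \<open>0 \<le> r\<close> by (simp add: P_def)
  ultimately have lim: "(\<lambda>n. X (\<rho> n)) \<longlonglongrightarrow> (1 / m) *\<^sub>R y"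
    by simp
  define x where "x = (1 / m) *\<^sub>R y"
  have "x \<in> S"
    using closed_sequentially[OF S(2), of "\<lambda>n. X (\<rho> n)" x] XS lim by (simp add: x_def)
  moreover have "norm x = 1"
    using tendsto_norm[OF lim] by (simp only: X1 LIMSEQ_const_iff x_def)
  moreover have "A x = m *\<^sub>R x"
  proof -
    have "(\<lambda>n. A (X (\<rho> n))) \<longlonglongrightarrow> A x"
      unfolding x_def using bounded_linear.tendsto[OF bounded_clinear_bounded_linear[OF bA] lim] .
    then have "A x = y"
      using LIMSEQ_unique \<rho>(2) by (auto simp: comp_def)
    then show ?thesis
      using rm \<open>0 \<le> r\<close> by (simp add: x_def)
  qed
  ultimately show ?thesis
    using that rm by blast
qed


section \<open>Eigenvalue counting functions\<close>

text \<open>Gaussian elimination, one equation at a time: if equation \<open>j\<close> has a nonzero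
  coefficient at \<open>i0\<close>, it is solved for that unknown and substituted into the
  others.\<close>

lemma homogeneous_system_nontrivial:
  fixes m :: "'j \<Rightarrow> 'i \<Rightarrow> complex"
  assumes "finite J" "finite I" "card J < card I"
  shows "\<exists>c. (\<exists>i\<in>I. c i \<noteq> 0) \<and> (\<forall>j\<in>J. (\<Sum>i\<in>I. m j i * c i) = 0)"
  using assms
proof (induction J arbitrary: I m rule: finite_induct)
  case empty
  then obtain i where "i \<in> I" by fastforce
  then show ?case by (intro exI[of _ "\<lambda>_. 1"]) auto
next
  case (insert j J)
  show ?case
  proof (cases "\<forall>i\<in>I. m j i = 0")
    case True
    have "card J < card I"
      using insert.prems insert.hyps by simp
    from insert.IH[OF insert.prems(1) this] obtain c
      where "\<exists>i\<in>I. c i \<noteq> 0" "\<forall>k\<in>J. (\<Sum>i\<in>I. m k i * c i) = 0"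
      by blast
    with True show ?thesis by (intro exI[of _ c]) simp
  next
    case False
    then obtain i0 where i0: "i0 \<in> I" "m j i0 \<noteq> 0" by blast
    let ?I = "I - {i0}"
    have "finite ?I" "card J < card ?I"
      using insert.prems insert.hyps i0 by auto
    from insert.IH[OF this, of "\<lambda>k i. m k i - m k i0 * m j i / m j i0"] obtain c
      where c: "\<exists>i\<in>?I. c i \<noteq> 0"
        "\<forall>k\<in>J. (\<Sum>i\<in>?I. (m k i - m k i0 * m j i / m j i0) * c i) = 0"
      by blast
    define s where "s = (\<Sum>i\<in>?I. m j i * c i)"
    define c' where "c' = c(i0 := - s / m j i0)"
    have sum_c': "(\<Sum>i\<in>I. m k i * c' i) = m k i0 * c' i0 + (\<Sum>i\<in>?I. m k i * c i)" for k
      by (subst sum.remove[OF insert.prems(1) i0(1)]) (simp add: c'_def)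
    have "(\<Sum>i\<in>I. m k i * c' i) = 0" if "k \<in> insert j J" for k
    proof (cases "k = j")
      case True
      then show ?thesis
        using i0 by (simp add: sum_c' s_def[symmetric]) (simp add: c'_def)
    next
      case False
      with that c(2) have "(\<Sum>i\<in>?I. (m k i - m k i0 * m j i / m j i0) * c i) = 0"
        by blast
      moreover have "(\<Sum>i\<in>?I. (m k i - m k i0 * m j i / m j i0) * c i) =
          (\<Sum>i\<in>?I. m k i * c i) - m k i0 / m j i0 * s"
        by (simp add: s_def left_diff_distrib sum_subtractf sum_distrib_left mult.assoc)
      ultimately show ?thesis
        unfolding sum_c' by (simp add: c'_def)
    qed
    moreover have "\<exists>i\<in>I. c' i \<noteq> 0"
      using c(1) by (auto simp: c'_def)
    ultimately show ?thesis by blast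
  qed
qed

text \<open>The elements of \<open>F\<close> are arbitrary vectors that cut out a subspace of
  codimension at most \<open>card F\<close>; this permits unions and images under an
  adjoint.\<close>

definition form_le :: "real \<Rightarrow> ('a :: chilbert_space \<Rightarrow> 'a) \<Rightarrow> 'a set \<Rightarrow> bool"
  where "form_le r A F \<longleftrightarrow>
    (\<forall>x. (\<forall>f\<in>F. cinner f x = 0) \<longrightarrow> Re (cinner x (A x)) \<le> r * (norm x)\<^sup>2)"

lemma form_leD:
  "form_le r A F \<Longrightarrow> (\<And>f. f \<in> F \<Longrightarrow> cinner f x = 0) \<Longrightarrow> Re (cinner x (A x)) \<le> r * (norm x)\<^sup>2"
  by (simp add: form_le_def)

definition hsa :: "('a :: chilbert_space \<Rightarrow> 'a) \<Rightarrow> bool"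
  where "hsa A \<longleftrightarrow> self_adjoint A \<and> (\<exists>C. hs A C)"

lemma hsa_self_adjoint: "hsa A \<Longrightarrow> self_adjoint A"
  by (simp add: hsa_def)

lemma hsa_add: "hsa A \<Longrightarrow> hsa B \<Longrightarrow> hsa (\<lambda>x. A x + B x)"
  unfolding hsa_def using self_adjoint_add hs_add by blast

lemma hsa_scaleR: "hsa A \<Longrightarrow> hsa (\<lambda>x. r *\<^sub>R A x)"
  unfolding hsa_def using self_adjoint_scaleR hs_rmult by blast

lemma hsa_uminus: "hsa A \<Longrightarrow> hsa (\<lambda>x. - A x)"
  unfolding hsa_def using self_adjoint_uminus hs_uminus by blast

lemma hsa_adj_comp:
  fixes Y :: "'a :: chilbert_space \<Rightarrow> 'b :: chilbert_space"
  assumes "hs Y C"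
  shows "hsa (\<lambda>x. adj Y (Y x))"
proof -
  have "hs (\<lambda>x. adj Y (Y x)) (C * C)"
    using hs_bounded_clinear[OF assms] hs_norm_le[OF hs_adj[OF assms]] hs_nonneg[OF assms]
    by (intro hs_compose_left bounded_clinear_adj assms) auto
  then show ?thesis
    using self_adjoint_adj_comp[OF hs_bounded_clinear[OF assms]] by (auto simp: hsa_def)
qed

definition eigenset :: "real \<Rightarrow> ('a :: chilbert_space \<Rightarrow> 'a) \<Rightarrow> 'a set \<Rightarrow> bool"
  where "eigenset r A F \<longleftrightarrow> finite F \<and> orthonormal F \<and> (\<forall>f\<in>F. \<exists>\<kappa>>r. A f = \<kappa> *\<^sub>R f)"

text \<open>Each eigenvector with eigenvalue above \<open>r\<close> contributes at least
  \<open>r\<^sup>2\<close> to the squared Hilbert-Schmidt norm. This later gives the O(1) bound for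
  the remainder.\<close>

lemma eigenset_card_le:
  assumes A: "hs A C" and F: "eigenset r A F" and r: "0 < r"
  shows "real (card F) * r\<^sup>2 \<le> C\<^sup>2"
proof -
  have "real (card F) * r\<^sup>2 = (\<Sum>f\<in>F. r\<^sup>2)"
    by simp
  also have "\<dots> \<le> (\<Sum>f\<in>F. (norm (A f))\<^sup>2)"
  proof (rule sum_mono)
    fix f
    assume f: "f \<in> F"
    then obtain \<kappa> where "\<kappa> > r" "A f = \<kappa> *\<^sub>R f"
      using F by (auto simp: eigenset_def)
    moreover have "norm f = 1"
      using F f by (auto simp: eigenset_def intro: orthonormal_norm)
    ultimately show "r\<^sup>2 \<le> (norm (A f))\<^sup>2"
      using r by (simp add: power_mono)
  qed
  also have "\<dots> \<le> C\<^sup>2"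
    using F by (intro hs_sum_le[OF A]) (auto simp: eigenset_def)
  finally show ?thesis .
qed

text \<open>\<open>F\<close> is an eigenset of maximal cardinality.\<close>

lemma eigenset_exists:
  assumes A: "hsa A" and r: "0 < r"
  obtains F where "eigenset r A F" "form_le r A F"
proof -
  have sa: "self_adjoint A"
    using A by (rule hsa_self_adjoint)
  obtain C where C: "hs A C"
    using A by (auto simp: hsa_def)
  have "eigenset r A {}"
    by (simp add: eigenset_def orthonormal_def)
  moreover have "\<forall>F. eigenset r A F \<longrightarrow> card F < Suc (nat \<lceil>C\<^sup>2 / r\<^sup>2\<rceil>)"
  proof (intro allI impI)
    fix F
    assume "eigenset r A F"
    from eigenset_card_le[OF C this r] have "real (card F) \<le> C\<^sup>2 / r\<^sup>2"
      using r by (simp add: field_simps)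
    then show "card F < Suc (nat \<lceil>C\<^sup>2 / r\<^sup>2\<rceil>)"
      by linarith
  qed
  ultimately have "\<exists>F. eigenset r A F \<and> (\<forall>G. eigenset r A G \<longrightarrow> card G \<le> card F)"
    by (rule Lattices_Big.ex_has_greatest_nat)
  then obtain F where F: "eigenset r A F"
    and max: "\<And>G. eigenset r A G \<Longrightarrow> card G \<le> card F"
    by blast
  have fin: "finite F" and on: "orthonormal F" and eig: "\<And>f. f \<in> F \<Longrightarrow> \<exists>\<kappa>>r. A f = \<kappa> *\<^sub>R f"
    using F by (auto simp: eigenset_def)
  \<comment> \<open>The orthogonal complement of the eigenvectors is closed and invariant. If the
    form exceeded \<open>r\<close> somewhere on it, it would contain a further eigenvector, against
    maximality.\<close>
  define S where "S = {x. \<forall>f\<in>F. cinner f x = 0}"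
  have S: "complex_vector.subspace S"
    by (auto simp: S_def complex_vector.subspace_def cinner.add_right cinner_scaleC_right)
  have "S = (\<Inter>f\<in>F. {x. cinner f x = 0})"
    by (auto simp: S_def)
  then have "closed S"
    by (simp add: closed_INT closed_Collect_eq cinner.continuous_on)
  have inv: "A x \<in> S" if "x \<in> S" for x
    unfolding S_def
  proof (intro CollectI ballI)
    fix f
    assume "f \<in> F"
    then obtain \<kappa> where "A f = \<kappa> *\<^sub>R f" using eig by blast
    then show "cinner f (A x) = 0"
      using that \<open>f \<in> F\<close> by (simp add: S_def cinner.scaleR_left flip: self_adjoint_cinner[OF sa])
  qed
  have "form_le r A F"
    unfolding form_le_def
  proof (intro allI impI, rule ccontr)
    fix x0
    assume x0: "\<forall>f\<in>F. cinner f x0 = 0" and "\<not> Re (cinner x0 (A x0)) \<le> r * (norm x0)\<^sup>2"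
    then obtain m x where "r < m" "x \<in> S" "norm x = 1" "A x = m *\<^sub>R x"
      using hs_eigenvector_exists[OF C sa S \<open>closed S\<close> inv, of x0 r] r by (auto simp: S_def)
    moreover from this have "orthonormal (insert x F)" "x \<notin> F"
      using orthonormal_insert[OF on, of x] by (auto simp: S_def)
    ultimately have "eigenset r A (insert x F)"
      using fin eig by (auto simp: eigenset_def)
    from max[OF this] show False
      using fin \<open>x \<notin> F\<close> by simp
  qed
  with F show ?thesis by (rule that)
qed

text \<open>The component \<open>w\<close> of \<open>v\<close> orthogonal to \<open>F\<close>
  satisfies \<open>cinner w (A w) = \<kappa> *\<^sub>R cinner w w\<close>, since \<open>A\<close>
  maps the span of \<open>F\<close> to itself; this exceeds the form bound \<open>r\<close> unless
  \<open>w = 0\<close>.\<close>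

lemma eigenvector_in_cspan:
  assumes sa: "self_adjoint A" and F: "eigenset r A F" "form_le r A F"
    and v: "A v = \<kappa> *\<^sub>R v" "r < \<kappa>"
  shows "v \<in> cspan F"
proof -
  have fin: "finite F" and on: "orthonormal F" and eig: "\<And>f. f \<in> F \<Longrightarrow> \<exists>\<kappa>>r. A f = \<kappa> *\<^sub>R f"
    using F by (auto simp: eigenset_def)
  note bA = self_adjoint_bounded_clinear[OF sa]
  define p where "p = (\<Sum>f\<in>F. cinner f v *\<^sub>C f)"
  define w where "w = v - p"
  have orth: "cinner f w = 0" if "f \<in> F" for f
    unfolding w_def p_def using orthonormal_complement(1)[OF fin on that] .
  have "cinner w (A p) = cinner w p * \<kappa>"
  proof -
    have "cinner w (A f) = 0" "cinner w f = 0" if f: "f \<in> F" for f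
    proof -
      show "cinner w f = 0"
        using orth[OF f] by (simp add: cinner_eq_zero_commute)
      then show "cinner w (A f) = 0"
        using eig[OF f] by (auto simp: cinner.scaleR_right)
    qed
    then show ?thesis
      by (simp add: p_def bounded_clinear_sum[OF bA] bounded_clinear_scaleC[OF bA]
          cinner.sum_right cinner_scaleC_right)
  qed
  then have "cinner w (A w) = \<kappa> *\<^sub>R cinner w w"
    unfolding w_def bounded_clinear_minus[OF bA] v(1)
    by (simp add: cinner.diff_right cinner.scaleR_right scaleR_conv_of_real algebra_simps)
  then have "\<kappa> * (norm w)\<^sup>2 \<le> r * (norm w)\<^sup>2"
    using form_leD[OF F(2), of w] orth by simp
  then have "w = 0"
    using v(2) by (simp add: mult_le_cancel_right)
  then have "v = (\<Sum>f\<in>F. cinner f v *\<^sub>C f)"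
    by (simp add: w_def p_def)
  then show ?thesis
    by (simp only: cspan_orthonormal_iff[OF fin on])
qed

text \<open>Every eigenvector above \<open>r\<close> lies in the span of \<open>F\<close>, so the
  spectral projection is the projection onto that span. Its trace is the sum of the squared norms of
  \<open>F\<close>, by Parseval in the basis that \<open>trace_op\<close> chooses.\<close>

lemma
  fixes A :: "'a :: chilbert_space \<Rightarrow> 'a"
  assumes sa: "self_adjoint A" and F: "eigenset r A F" "form_le r A F"
  shows counting_pos_eq_card: "counting_pos r A = card F"
    and trace_spectral_proj_above: "trace_op (spectral_proj_above r A) = of_nat (card F)"
proof -
  have fin: "finite F" and on: "orthonormal F" and eig: "\<And>f. f \<in> F \<Longrightarrow> \<exists>\<kappa>>r. A f = \<kappa> *\<^sub>R f"
    using F by (auto simp: eigenset_def)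
  let ?U = "\<Union>\<kappa>\<in>{r<..}. eigenspace A \<kappa>"
  have "?U \<subseteq> cspan F"
    using eigenvector_in_cspan[OF sa F] by (auto simp: eigenspace_def)
  then have "cspan ?U \<subseteq> cspan F"
    by (rule complex_vector.span_minimal) simp
  moreover have "F \<subseteq> ?U"
    using eig by (auto simp: eigenspace_def)
  then have "cspan F \<subseteq> cspan ?U"
    by (rule complex_vector.span_mono)
  ultimately have "cspan ?U = cspan F"
    by blast
  then have cl: "closure (cspan ?U) = cspan F"
    by (simp add: closure_closed closed_cspan_orthonormal[OF fin on])
  then have eq: "spectral_proj_above r A = orth_proj (cspan F)"
    by (simp add: spectral_proj_above_def)
  note proj = orth_proj_cspan_orthonormal[OF fin on]
  have "range (orth_proj (cspan F)) = cspan F"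
  proof (intro subset_antisym subsetI)
    fix x
    assume "x \<in> cspan F"
    then have "x = orth_proj (cspan F) x"
      using cspan_orthonormal_iff[OF fin on] by (simp add: proj)
    then show "x \<in> range (orth_proj (cspan F))"
      by blast
  qed (auto intro: orth_proj_in closed_cspan_orthonormal[OF fin on])
  then show "counting_pos r A = card F"
    by (simp add: counting_pos_def eq complex_vector.dim_eq_card_independent
        orthonormal_independent[OF fin on])
  let ?E = "SOME E :: 'a set. is_onb E"
  have "((\<lambda>e. \<Sum>f\<in>F. (cmod (cinner e f))\<^sup>2) has_sum (\<Sum>f\<in>F. (norm f)\<^sup>2)) ?E"
    unfolding has_sum_def sum.swap[of _ F]
    using parseval[OF is_onb_some] by (intro tendsto_sum) (simp add: has_sum_def)
  moreover have "(\<Sum>f\<in>F. (norm f)\<^sup>2) = real (card F)"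
    by (simp add: orthonormal_norm[OF on])
  ultimately have "((\<lambda>e. complex_of_real (\<Sum>f\<in>F. (cmod (cinner e f))\<^sup>2)) has_sum
      complex_of_real (real (card F))) ?E"
    by (intro has_sum_of_real) simp
  moreover have "cinner e (orth_proj (cspan F) e) = complex_of_real (\<Sum>f\<in>F. (cmod (cinner e f))\<^sup>2)" for e
    unfolding proj cinner.sum_right of_real_sum complex_norm_square
    by (intro sum.cong refl) (metis cinner_commute cinner_scaleC_right mult.commute)
  ultimately show "trace_op (spectral_proj_above r A) = of_nat (card F)"
    unfolding trace_op_def eq by (simp only: infsumI of_real_of_nat_eq)
qed

lemma counting_pos_cases:
  assumes "hsa A" "0 < r"
  obtains F where "eigenset r A F" "form_le r A F" "counting_pos r A = card F"
  using eigenset_exists[OF assms] counting_pos_eq_card[OF hsa_self_adjoint[OF assms(1)]] by metis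

lemma trace_above_one_eq:
  assumes "hsa A"
  shows "trace_above_one A = real (counting_pos 1 A)"
proof -
  obtain F where "eigenset 1 A F" "form_le 1 A F"
    using eigenset_exists[OF assms, of 1] by auto
  from trace_spectral_proj_above[OF hsa_self_adjoint[OF assms] this]
    counting_pos_eq_card[OF hsa_self_adjoint[OF assms] this]
  show ?thesis
    by (simp add: trace_above_one_def)
qed

text \<open>The min-max principle: \<open>counting_pos r A\<close> is the least codimension of a subspace on which \<open>A \<le> r\<close>.\<close>

lemma counting_pos_le:
  assumes A: "hsa A" and r: "0 < r" and G: "finite G" "form_le r A G"
  shows "counting_pos r A \<le> card G"
proof (rule ccontr)
  assume less: "\<not> counting_pos r A \<le> card G"
  obtain F where F: "eigenset r A F" and "counting_pos r A = card F"
    using counting_pos_cases[OF A r] .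
  then have "card G < card F"
    using less by simp
  have fin: "finite F" and on: "orthonormal F"
    using F by (auto simp: eigenset_def)
  obtain \<kappa> where \<kappa>: "\<And>f. f \<in> F \<Longrightarrow> r < \<kappa> f \<and> A f = \<kappa> f *\<^sub>R f"
    using F unfolding eigenset_def by metis
  \<comment> \<open>More eigenvectors than constraints: some nonzero combination of \<open>F\<close>
    is orthogonal to \<open>G\<close>, and there the form exceeds \<open>r\<close>.\<close>
  obtain c where c: "\<exists>f\<in>F. c f \<noteq> 0" "\<forall>g\<in>G. (\<Sum>f\<in>F. cinner g f * c f) = 0"
    using homogeneous_system_nontrivial[OF G(1) fin \<open>card G < card F\<close>] by blast
  define x where "x = (\<Sum>f\<in>F. c f *\<^sub>C f)"
  note bA = self_adjoint_bounded_clinear[OF hsa_self_adjoint[OF A]]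
  have Ax: "A x = (\<Sum>f\<in>F. (\<kappa> f * c f) *\<^sub>C f)"
    unfolding x_def bounded_clinear_sum[OF bA] bounded_clinear_scaleC[OF bA]
    using \<kappa> by (intro sum.cong refl) (simp add: scaleC_scaleC mult.commute flip: scaleC_of_real)
  have xAx: "Re (cinner x (A x)) = (\<Sum>f\<in>F. \<kappa> f * (cmod (c f))\<^sup>2)"
  proof -
    have "Re (cinner x (A x)) = (\<Sum>f\<in>F. Re (cinner (c f *\<^sub>C f) (A x)))"
      by (subst x_def, subst cinner.sum_left) simp
    also have "\<dots> = (\<Sum>f\<in>F. \<kappa> f * (cmod (c f))\<^sup>2)"
      unfolding Ax
      by (intro sum.cong refl) (simp add: cinner_scaleC_left cinner_orthonormal_comb[OF fin on]
          cmod_power2 power2_eq_square[of "Re _"] power2_eq_square[of "Im _"] algebra_simps)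
    finally show ?thesis .
  qed
  have "cinner g x = 0" if "g \<in> G" for g
    using c(2) that by (simp add: x_def cinner.sum_right cinner_scaleC_right mult.commute)
  then have "Re (cinner x (A x)) \<le> r * (norm x)\<^sup>2"
    by (rule form_leD[OF G(2)])
  also have "\<dots> = (\<Sum>f\<in>F. r * (cmod (c f))\<^sup>2)"
    by (simp add: x_def norm_orthonormal_comb[OF fin on] sum_distrib_left)
  also have "\<dots> < (\<Sum>f\<in>F. \<kappa> f * (cmod (c f))\<^sup>2)"
  proof (rule sum_strict_mono_ex1[OF fin])
    show "\<forall>f\<in>F. r * (cmod (c f))\<^sup>2 \<le> \<kappa> f * (cmod (c f))\<^sup>2"
      by (intro ballI mult_right_mono) (simp_all add: \<kappa> less_imp_le)
    show "\<exists>f\<in>F. r * (cmod (c f))\<^sup>2 < \<kappa> f * (cmod (c f))\<^sup>2"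
      using \<kappa> c(1) by (metis mult_strict_right_mono zero_less_norm_iff zero_less_power)
  qed
  finally show False
    by (simp add: xAx)
qed

section \<open>Weyl's inequality, monotonicity and interchange of factors\<close>

lemma counting_pos_form_le:
  assumes "hsa A" "0 < r"
  obtains F where "finite F" "form_le r A F" "counting_pos r A = card F"
  using counting_pos_cases[OF assms] unfolding eigenset_def by metis

text \<open>Weyl's inequality: on the intersection of the two subspaces both form bounds hold, and
  codimensions add.\<close>

lemma counting_pos_add_le:
  assumes A: "hsa A" and B: "hsa B" and "0 < r" "0 < s"
  shows "counting_pos (r + s) (\<lambda>x. A x + B x) \<le> counting_pos r A + counting_pos s B"
proof -
  obtain F where F: "finite F" "form_le r A F" "counting_pos r A = card F"
    using counting_pos_form_le[OF A \<open>0 < r\<close>] .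
  obtain G where G: "finite G" "form_le s B G" "counting_pos s B = card G"
    using counting_pos_form_le[OF B \<open>0 < s\<close>] .
  have "form_le (r + s) (\<lambda>x. A x + B x) (F \<union> G)"
    using F(2) G(2) by (fastforce simp: form_le_def cinner.add_right distrib_right)
  then have "counting_pos (r + s) (\<lambda>x. A x + B x) \<le> card (F \<union> G)"
    using assms F(1) G(1) by (intro counting_pos_le hsa_add) auto
  also have "\<dots> \<le> card F + card G"
    by (rule card_Un_le)
  finally show ?thesis
    using F(3) G(3) by simp
qed

lemma counting_pos_mono:
  assumes A: "hsa A" and B: "hsa B" and "0 < r" "r \<le> s"
    and le: "\<And>x. Re (cinner x (A x)) \<le> Re (cinner x (B x))"
  shows "counting_pos s A \<le> counting_pos r B"
proof -
  obtain F where F: "finite F" "form_le r B F" "counting_pos r B = card F"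
    using counting_pos_form_le[OF B \<open>0 < r\<close>] .
  have "form_le s A F"
    unfolding form_le_def
  proof (intro allI impI)
    fix x
    assume "\<forall>f\<in>F. cinner f x = 0"
    then have "Re (cinner x (B x)) \<le> r * (norm x)\<^sup>2"
      using F(2) by (simp add: form_le_def)
    also have "\<dots> \<le> s * (norm x)\<^sup>2"
      using \<open>r \<le> s\<close> by (intro mult_right_mono) auto
    finally show "Re (cinner x (A x)) \<le> s * (norm x)\<^sup>2"
      using le[of x] by linarith
  qed
  then have "counting_pos s A \<le> card F"
    using assms F(1) by (intro counting_pos_le) auto
  then show ?thesis
    using F(3) by simp
qed

lemma counting_pos_nonpos:
  assumes "hsa A" "0 < r" "\<And>x. Re (cinner x (A x)) \<le> 0"
  shows "counting_pos r A = 0"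
proof -
  have "form_le r A {}"
    unfolding form_le_def using assms(2,3) by (meson mult_nonneg_nonneg order.trans less_imp_le zero_le_power2)
  then show ?thesis
    using counting_pos_le[OF assms(1,2), of "{}"] by simp
qed

lemma counting_pos_hs_le:
  assumes "self_adjoint A" "hs A C" "0 < r"
  shows "real (counting_pos r A) \<le> C\<^sup>2 / r\<^sup>2"
proof -
  have "hsa A"
    using assms by (auto simp: hsa_def)
  then obtain F where "eigenset r A F" "counting_pos r A = card F"
    using counting_pos_cases[OF _ assms(3)] by metis
  then show ?thesis
    using eigenset_card_le[OF assms(2) _ assms(3)] assms(3) by (simp add: field_simps)
qed

lemma counting_pos_scaleR_le:
  assumes A: "hsa A" and "0 < r" "0 < c"
  shows "counting_pos r (\<lambda>x. c *\<^sub>R A x) \<le> counting_pos (r / c) A"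
proof -
  obtain F where F: "finite F" "form_le (r / c) A F" "counting_pos (r / c) A = card F"
    using counting_pos_form_le[OF A, of "r / c"] assms by auto
  have "form_le r (\<lambda>x. c *\<^sub>R A x) F"
    using F(2) \<open>0 < c\<close> by (simp add: form_le_def cinner.scaleR_right field_simps)
  then show ?thesis
    using counting_pos_le[OF hsa_scaleR[OF A] \<open>0 < r\<close> F(1)] F(3) by simp
qed

lemma counting_pos_scaleR:
  assumes A: "hsa A" and "0 < r" "0 < c"
  shows "counting_pos r (\<lambda>x. c *\<^sub>R A x) = counting_pos (r / c) A"
proof (rule antisym)
  show "counting_pos (r / c) A \<le> counting_pos r (\<lambda>x. c *\<^sub>R A x)"
    using counting_pos_scaleR_le[OF hsa_scaleR[OF A, of c], of "r / c" "1 / c"] assms by simp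
qed (rule counting_pos_scaleR_le[OF assms])

text \<open>Orthogonality of \<open>x\<close> to \<open>adj Y f\<close> is orthogonality of
  \<open>u = Y x\<close> to \<open>f\<close>, so constraints transfer, and Cauchy-Schwarz gives
  (norm u)^4 <= r (norm x)^2 (norm u)^2. Used for \<open>Y\<close> and \<open>adj Y\<close>, it
  moves counts from the lattice space to the space of the effective operator.\<close>

lemma counting_pos_adj_comp_le:
  fixes Y :: "'a :: chilbert_space \<Rightarrow> 'b :: chilbert_space"
  assumes Y: "hs Y C" and r: "0 < r"
  shows "counting_pos r (\<lambda>x. adj Y (Y x)) \<le> counting_pos r (\<lambda>y. Y (adj Y y))"
proof -
  note bY = hs_bounded_clinear[OF Y]
  have "hsa (\<lambda>y. Y (adj Y y))"
    using hsa_adj_comp[OF hs_adj[OF Y]] by (simp add: adj_adj[OF bY])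
  then obtain F where F: "finite F" "form_le r (\<lambda>y. Y (adj Y y)) F"
    "counting_pos r (\<lambda>y. Y (adj Y y)) = card F"
    using counting_pos_form_le[OF _ r] by metis
  have "form_le r (\<lambda>x. adj Y (Y x)) (adj Y ` F)"
    unfolding form_le_def
  proof (intro allI impI)
    fix x
    assume orth: "\<forall>g\<in>adj Y ` F. cinner g x = 0"
    define u where "u = Y x"
    have "cinner f u = 0" if "f \<in> F" for f
      using orth that by (simp add: u_def cinner_adj_left[OF bY])
    then have "Re (cinner u (Y (adj Y u))) \<le> r * (norm u)\<^sup>2"
      by (rule form_leD[OF F(2)])
    then have 1: "(norm (adj Y u))\<^sup>2 \<le> r * (norm u)\<^sup>2"
      by (simp flip: cinner_adj_left[OF bY])
    have "(norm u)\<^sup>2 = Re (cinner x (adj Y u))"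
      by (simp add: cinner_adj_right[OF bY] u_def)
    also have "\<dots> \<le> norm x * norm (adj Y u)"
      using complex_Re_le_cmod norm_cinner_le order_trans by blast
    finally have "((norm u)\<^sup>2)\<^sup>2 \<le> (norm x * norm (adj Y u))\<^sup>2"
      by (intro power_mono) auto
    also have "\<dots> \<le> (norm x)\<^sup>2 * (r * (norm u)\<^sup>2)"
      unfolding power_mult_distrib by (intro mult_left_mono 1) simp
    finally have "(norm u)\<^sup>2 * (norm u)\<^sup>2 \<le> (r * (norm x)\<^sup>2) * (norm u)\<^sup>2"
      by (simp add: power2_eq_square mult_ac)
    then have "(norm u)\<^sup>2 \<le> r * (norm x)\<^sup>2"
      if "u \<noteq> 0"
      by (rule mult_right_le_imp_le) (use that in simp)
    then have "(norm u)\<^sup>2 \<le> r * (norm x)\<^sup>2"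
      using r by (cases "u = 0") auto
    then show "Re (cinner x (adj Y (Y x))) \<le> r * (norm x)\<^sup>2"
      by (simp add: Re_cinner_adj_comp[OF bY] u_def)
  qed
  then have "counting_pos r (\<lambda>x. adj Y (Y x)) \<le> card (adj Y ` F)"
    using F(1) by (intro counting_pos_le hsa_adj_comp[OF Y] r) auto
  also have "\<dots> \<le> card F"
    using F(1) by (rule card_image_le)
  finally show ?thesis
    using F(3) by simp
qed

lemma counting_pos_adj_comp:
  fixes Y :: "'a :: chilbert_space \<Rightarrow> 'b :: chilbert_space"
  assumes Y: "hs Y C" and r: "0 < r"
  shows "counting_pos r (\<lambda>x. adj Y (Y x)) = counting_pos r (\<lambda>y. Y (adj Y y))"
  using counting_pos_adj_comp_le[OF Y r] counting_pos_adj_comp_le[OF hs_adj[OF Y] r]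
  by (simp add: adj_adj[OF hs_bounded_clinear[OF Y]])


subsection \<open>Averaging counting functions against the Cauchy density\<close>

lemma nn_integral_lborel_uminus:
  assumes [measurable]: "f \<in> borel_measurable borel"
  shows "(\<integral>\<^sup>+t. f (- t :: real) \<partial>lborel) = (\<integral>\<^sup>+t. f t \<partial>lborel)"
  using nn_integral_real_affine[OF assms, of "- 1" 0] by simp

lemma nn_integral_inverse_square_tail:
  assumes "0 < a"
  shows "(\<integral>\<^sup>+t. ennreal (1 / t\<^sup>2) * indicator {a..} t \<partial>lborel) = ennreal (1 / a)"
proof -
  have "((\<lambda>t :: real. - 1 / t) \<longlongrightarrow> 0) at_top"
    by real_asymp
  moreover have "((\<lambda>t. - 1 / t) has_real_derivative 1 / t\<^sup>2) (at t)" if "a \<le> t" for t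
    using that assms by (auto intro!: derivative_eq_intros simp: power2_eq_square)
  ultimately show ?thesis
    using nn_integral_FTC_atLeast[of "\<lambda>t. 1 / t\<^sup>2" a "\<lambda>t. - 1 / t" 0] by simp
qed

lemma nn_integral_Cauchy_tail_le:
  assumes "0 < a"
  shows "(\<integral>\<^sup>+t. ennreal (1 / (1 + t\<^sup>2)) * indicator {t. a \<le> \<bar>t\<bar>} t \<partial>lborel) \<le> ennreal (2 / a)"
proof -
  define g where "g t = ennreal (1 / t\<^sup>2) * indicator {a..} t" for t :: real
  have [measurable]: "g \<in> borel_measurable borel"
    unfolding g_def by measurable
  have "(\<integral>\<^sup>+t. ennreal (1 / (1 + t\<^sup>2)) * indicator {t. a \<le> \<bar>t\<bar>} t \<partial>lborel) \<le>
      (\<integral>\<^sup>+t. g t + g (- t) \<partial>lborel)"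
  proof (rule nn_integral_mono)
    fix t :: real
    have "ennreal (1 / (1 + t\<^sup>2)) \<le> ennreal (1 / t\<^sup>2)" if "a \<le> \<bar>t\<bar>"
      using that assms
      by (intro ennreal_leI divide_left_mono mult_pos_pos) (auto simp: add_pos_nonneg)
    then show "ennreal (1 / (1 + t\<^sup>2)) * indicator {t. a \<le> \<bar>t\<bar>} t \<le> g t + g (- t)"
      using assms by (auto simp: g_def indicator_def abs_if)
  qed
  also have "\<dots> = (\<integral>\<^sup>+t. g t \<partial>lborel) + (\<integral>\<^sup>+t. g (- t) \<partial>lborel)"
    by (rule nn_integral_add) auto
  also have "\<dots> = ennreal (1 / a) + ennreal (1 / a)"
    unfolding nn_integral_lborel_uminus[of g, simplified] 
    using nn_integral_inverse_square_tail[OF assms] by (simp add: g_def[abs_def])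
  also have "\<dots> = ennreal (2 / a)"
    using assms by (subst ennreal_plus[symmetric]) auto
  finally show ?thesis .
qed

lemma
  shows integrable_Cauchy: "integrable lborel (\<lambda>t :: real. 1 / (1 + t\<^sup>2))"
    and integral_Cauchy: "(LINT t|lborel. 1 / (1 + t\<^sup>2)) = pi"
proof -
  define g where "g t = ennreal (1 / (1 + t\<^sup>2)) * indicator {0..} t" for t :: real
  have [measurable]: "g \<in> borel_measurable borel"
    unfolding g_def by measurable
  have "(arctan \<longlongrightarrow> pi / 2) at_top"
    by (rule tendsto_arctan_at_top)
  moreover have "(arctan has_real_derivative 1 / (1 + t\<^sup>2)) (at t)" for t
    using DERIV_arctan[of t] by (simp add: inverse_eq_divide)
  ultimately have half: "(\<integral>\<^sup>+t. g t \<partial>lborel) = ennreal (pi / 2)"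
    unfolding g_def using nn_integral_FTC_atLeast[of "\<lambda>t. 1 / (1 + t\<^sup>2)" 0 arctan "pi / 2"]
    by simp
  have "AE t in lborel. t \<noteq> (0 :: real)"
    by (rule AE_lborel_singleton)
  then have "(\<integral>\<^sup>+t. ennreal (1 / (1 + t\<^sup>2)) \<partial>lborel) = (\<integral>\<^sup>+t. g t + g (- t) \<partial>lborel)"
    by (intro nn_integral_cong_AE) (auto simp: g_def indicator_def)
  also have "\<dots> = (\<integral>\<^sup>+t. g t \<partial>lborel) + (\<integral>\<^sup>+t. g (- t) \<partial>lborel)"
    by (rule nn_integral_add) auto
  also have "\<dots> = ennreal pi"
    unfolding nn_integral_lborel_uminus[of g, simplified] half
    by (subst ennreal_plus[symmetric]) auto
  finally have nn: "(\<integral>\<^sup>+t. ennreal (1 / (1 + t\<^sup>2)) \<partial>lborel) = ennreal pi" .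
  have "has_bochner_integral lborel (\<lambda>t. 1 / (1 + t\<^sup>2)) pi"
    by (rule has_bochner_integral_nn_integral) (auto simp: nn)
  then show "integrable lborel (\<lambda>t :: real. 1 / (1 + t\<^sup>2))"
    "(LINT t|lborel. 1 / (1 + t\<^sup>2)) = pi"
    by (auto simp: has_bochner_integral_iff)
qed

section \<open>The Cauchy average of the count of \<open>\<bar>t\<bar> *\<^sub>R B\<close>\<close>

lemma eigenvector_orth:
  assumes sa: "self_adjoint A" and "A x = \<kappa> *\<^sub>R x" "A y = \<rho> *\<^sub>R y" "\<kappa> \<noteq> \<rho>"
  shows "cinner x y = 0"
proof -
  have "\<kappa> *\<^sub>R cinner x y = \<rho> *\<^sub>R cinner x y"
    using self_adjoint_cinner[OF sa, of x y] assms(2,3)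
    by (simp add: cinner.scaleR_left cinner.scaleR_right)
  then show ?thesis
    using assms(4) by simp
qed

lemma counting_pos_pencil_mono:
  assumes A: "hsa A" and B: "hsa B" "\<And>x. 0 \<le> Re (cinner x (B x))" and "0 < r"
  shows "mono (\<lambda>t. counting_pos r (\<lambda>x. A x + t *\<^sub>R B x))"
proof (rule monoI)
  fix s t :: real
  assume "s \<le> t"
  have "Re (cinner x (A x + s *\<^sub>R B x)) \<le> Re (cinner x (A x + t *\<^sub>R B x))" for x
    using \<open>s \<le> t\<close> B(2)[of x]
    by (simp add: cinner.add_right cinner.scaleR_right mult_right_mono)
  then show "counting_pos r (\<lambda>x. A x + s *\<^sub>R B x) \<le> counting_pos r (\<lambda>x. A x + t *\<^sub>R B x)"
    using \<open>0 < r\<close> by (intro counting_pos_mono hsa_add hsa_scaleR A B) auto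
qed

text \<open>Measurability in \<open>t\<close> is a consequence of monotonicity, as \<open>B\<close>
  is nonnegative.\<close>

lemma measurable_counting_pos_pencil:
  assumes A: "hsa A" and B: "hsa B" "\<And>x. 0 \<le> Re (cinner x (B x))" and "0 < r"
  shows "(\<lambda>t. real (counting_pos r (\<lambda>x. A x + t *\<^sub>R B x))) \<in> borel_measurable borel"
  by (rule borel_measurable_mono) (use counting_pos_pencil_mono[OF assms] in \<open>auto simp: mono_def\<close>)

lemma hsa_0: "hsa (\<lambda>x. 0)"
  unfolding hsa_def self_adjoint_def using hs_0 by (auto intro: bounded_clinear_const_0)

lemma measurable_counting_pos_abs:
  assumes B: "hsa B" "\<And>x. 0 \<le> Re (cinner x (B x))" and "0 < r"
  shows "(\<lambda>t. real (counting_pos r (\<lambda>x. \<bar>t\<bar> *\<^sub>R B x))) \<in> borel_measurable borel"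
proof -
  have [measurable]: "(\<lambda>t. real (counting_pos r (\<lambda>x. t *\<^sub>R B x))) \<in> borel_measurable borel"
    using measurable_counting_pos_pencil[OF hsa_0 assms] by simp
  show ?thesis
    by (rule measurable_compose[of abs borel borel "\<lambda>t. real (counting_pos r (\<lambda>x. t *\<^sub>R B x))"])
      measurable
qed

text \<open>One finite diagonalization above \<open>\<delta>\<close> serves all levels
  \<open>r \<ge> \<delta>\<close>: an eigenvector with eigenvalue above \<open>r\<close> expands in
  \<open>F\<close> and is orthogonal to the members with eigenvalue at most
  \<open>r\<close>.\<close>

lemma counting_pos_le_eigenvalues:
  assumes B: "hsa B" and F: "eigenset \<delta> B F" "form_le \<delta> B F"
    and \<kappa>: "\<And>f. f \<in> F \<Longrightarrow> B f = \<kappa> f *\<^sub>R f" and r: "0 < r" "\<delta> \<le> r"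
  shows "counting_pos r B \<le> card {f \<in> F. r < \<kappa> f}"
proof -
  have sa: "self_adjoint B"
    using B by (rule hsa_self_adjoint)
  have fin: "finite F" and on: "orthonormal F"
    using F by (auto simp: eigenset_def)
  obtain G where G: "eigenset r B G" "counting_pos r B = card G"
    using counting_pos_cases[OF B r(1)] by metis
  have "G \<subseteq> cspan {f \<in> F. r < \<kappa> f}"
  proof
    fix g
    assume "g \<in> G"
    then obtain \<rho> where \<rho>: "r < \<rho>" "B g = \<rho> *\<^sub>R g"
      using G(1) by (auto simp: eigenset_def)
    then have "g \<in> cspan F"
      using r(2) by (intro eigenvector_in_cspan[OF sa F]) auto
    then have "g = (\<Sum>f\<in>F. cinner f g *\<^sub>C f)"
      by (simp only: cspan_orthonormal_iff[OF fin on])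
    also have "\<dots> = (\<Sum>f\<in>{f \<in> F. r < \<kappa> f}. cinner f g *\<^sub>C f)"
    proof (rule sum.mono_neutral_right[OF fin])
      have "cinner f g = 0" if "f \<in> F" "\<not> r < \<kappa> f" for f
        using that \<kappa> \<rho> by (intro eigenvector_orth[OF sa, of f "\<kappa> f" g \<rho>]) auto
      then show "\<forall>f\<in>F - {f \<in> F. r < \<kappa> f}. cinner f g *\<^sub>C f = 0" by simp
    qed auto
    finally show "g \<in> cspan {f \<in> F. r < \<kappa> f}"
      by (metis (no_types, lifting) complex_vector.span_base complex_vector.span_scale
          complex_vector.span_sum)
  qed
  moreover have "complex_vector.independent G"
    using G(1) by (intro orthonormal_independent) (auto simp: eigenset_def)
  ultimately show ?thesis
    using complex_vector.independent_span_bound[of "{f \<in> F. r < \<kappa> f}" G] fin G(2) by simp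
qed

text \<open>
  With the eigenvalues \<open>\<kappa>\<^sub>j\<close> of \<open>B\<close> the counting function is the number of \<open>j\<close> with
  \<open>\<bar>t\<bar> > r / \<kappa>\<^sub>j\<close>, and each of these events has weight at most \<open>2 \<kappa>\<^sub>j / r\<close>.
\<close>

lemma nn_integral_counting_pos_truncated:
  assumes B: "hsa B" "\<And>x. 0 \<le> Re (cinner x (B x))" and r: "0 < r"
    and trace: "\<And>F. finite F \<Longrightarrow> orthonormal F \<Longrightarrow> (\<Sum>f\<in>F. Re (cinner f (B f))) \<le> \<tau>"
  shows "(\<integral>\<^sup>+t. ennreal (real (counting_pos r (\<lambda>x. \<bar>t\<bar> *\<^sub>R B x)) / (1 + t\<^sup>2)) *
      indicator {t. \<bar>t\<bar> \<le> real N} t \<partial>lborel) \<le> ennreal (2 * \<tau> / r)"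
proof -
  \<comment> \<open>For \<open>\<bar>t\<bar> \<le> real N\<close> only eigenvalues above
    \<open>r / \<bar>t\<bar>\<close> are counted, and these exceed \<open>\<delta>\<close>; the
    summand 1 keeps the quotient meaningful for \<open>N = 0\<close>.\<close>
  define \<delta> where "\<delta> = r / (real N + 1)"
  have \<delta>: "0 < \<delta>"
    using r by (simp add: \<delta>_def)
  obtain F where F: "eigenset \<delta> B F" "form_le \<delta> B F"
    using eigenset_exists[OF B(1) \<delta>] .
  have fin: "finite F" and on: "orthonormal F"
    using F by (auto simp: eigenset_def)
  obtain \<kappa> where \<kappa>: "\<And>f. f \<in> F \<Longrightarrow> \<delta> < \<kappa> f \<and> B f = \<kappa> f *\<^sub>R f"
    using F(1) unfolding eigenset_def by metis
  have \<kappa>pos: "0 < \<kappa> f" if "f \<in> F" for f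
    using \<kappa>[OF that] \<delta> by simp
  have count: "counting_pos r (\<lambda>x. \<bar>t\<bar> *\<^sub>R B x) \<le> card {f \<in> F. r / \<kappa> f \<le> \<bar>t\<bar>}"
    if "\<bar>t\<bar> \<le> real N" for t
  proof (cases "t = 0")
    case True
    then show ?thesis
      using counting_pos_nonpos[OF hsa_0[where 'a = 'a] r] by simp
  next
    case False
    have "\<delta> \<le> r / \<bar>t\<bar>"
      unfolding \<delta>_def using that False r by (intro divide_left_mono) auto
    have "counting_pos r (\<lambda>x. \<bar>t\<bar> *\<^sub>R B x) = counting_pos (r / \<bar>t\<bar>) B"
      using False r by (intro counting_pos_scaleR B) auto
    also have "\<dots> \<le> card {f \<in> F. r / \<bar>t\<bar> < \<kappa> f}"
      using False r \<kappa> \<open>\<delta> \<le> r / \<bar>t\<bar>\<close> by (intro counting_pos_le_eigenvalues[OF B(1) F]) auto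
    also have "\<dots> \<le> card {f \<in> F. r / \<kappa> f \<le> \<bar>t\<bar>}"
      using fin False \<kappa>pos by (intro card_mono) (auto simp: field_simps intro: less_imp_le)
    finally show ?thesis .
  qed
  have "(\<integral>\<^sup>+t. ennreal (real (counting_pos r (\<lambda>x. \<bar>t\<bar> *\<^sub>R B x)) / (1 + t\<^sup>2)) *
      indicator {t. \<bar>t\<bar> \<le> real N} t \<partial>lborel) \<le>
      (\<integral>\<^sup>+t. (\<Sum>f\<in>F. ennreal (1 / (1 + t\<^sup>2)) * indicator {t. r / \<kappa> f \<le> \<bar>t\<bar>} t) \<partial>lborel)"
  proof (rule nn_integral_mono)
    fix t :: real
    have "(\<Sum>f\<in>F. ennreal (1 / (1 + t\<^sup>2)) * indicator {t. r / \<kappa> f \<le> \<bar>t\<bar>} t) =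
        (\<Sum>f\<in>F. ennreal (if r / \<kappa> f \<le> \<bar>t\<bar> then 1 / (1 + t\<^sup>2) else 0))"
      by (intro sum.cong) (auto simp: indicator_def)
    also have "\<dots> = ennreal (\<Sum>f\<in>F. if r / \<kappa> f \<le> \<bar>t\<bar> then 1 / (1 + t\<^sup>2) else 0)"
      by (rule sum_ennreal) simp
    also have "(\<Sum>f\<in>F. if r / \<kappa> f \<le> \<bar>t\<bar> then 1 / (1 + t\<^sup>2) else 0) =
        real (card {f \<in> F. r / \<kappa> f \<le> \<bar>t\<bar>}) / (1 + t\<^sup>2)"
      using fin by (simp add: sum.If_cases Int_def)
    finally show "ennreal (real (counting_pos r (\<lambda>x. \<bar>t\<bar> *\<^sub>R B x)) / (1 + t\<^sup>2)) *
        indicator {t. \<bar>t\<bar> \<le> real N} t \<le>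
        (\<Sum>f\<in>F. ennreal (1 / (1 + t\<^sup>2)) * indicator {t. r / \<kappa> f \<le> \<bar>t\<bar>} t)"
      using count[of t]
      by (auto simp: indicator_def add_nonneg_pos intro!: ennreal_leI divide_right_mono)
  qed
  also have "\<dots> = (\<Sum>f\<in>F. \<integral>\<^sup>+t. ennreal (1 / (1 + t\<^sup>2)) * indicator {t. r / \<kappa> f \<le> \<bar>t\<bar>} t \<partial>lborel)"
    by (rule nn_integral_sum) measurable
  also have "\<dots> \<le> (\<Sum>f\<in>F. ennreal (2 / (r / \<kappa> f)))"
    using r \<kappa>pos by (intro sum_mono nn_integral_Cauchy_tail_le) simp
  also have "\<dots> = ennreal (\<Sum>f\<in>F. 2 / (r / \<kappa> f))"
    using r \<kappa>pos by (intro sum_ennreal) (simp add: less_imp_le)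
  also have "(\<Sum>f\<in>F. 2 / (r / \<kappa> f)) = 2 * (\<Sum>f\<in>F. Re (cinner f (B f))) / r"
  proof -
    have "Re (cinner f (B f)) = \<kappa> f" if "f \<in> F" for f
      using \<kappa>[OF that] orthonormal_norm[OF on that] by (simp add: cinner.scaleR_right)
    then show ?thesis
      by (simp add: sum_distrib_left sum_divide_distrib)
  qed
  also have "ennreal (2 * (\<Sum>f\<in>F. Re (cinner f (B f))) / r) \<le> ennreal (2 * \<tau> / r)"
    using r trace[OF fin on] by (intro ennreal_leI divide_right_mono) auto
  finally show ?thesis .
qed

text \<open>The truncated bound does not depend on \<open>N\<close>, so monotone convergence removes
  the truncation. The trace suffices because the tail of the Cauchy density beyond
  \<open>r / \<kappa>\<close> is at most linear in the eigenvalue \<open>\<kappa>\<close>.\<close>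

lemma
  assumes B: "hsa B" "\<And>x. 0 \<le> Re (cinner x (B x))" and r: "0 < r"
    and trace: "\<And>F. finite F \<Longrightarrow> orthonormal F \<Longrightarrow> (\<Sum>f\<in>F. Re (cinner f (B f))) \<le> \<tau>"
  shows integrable_counting_pos_abs:
      "integrable lborel (\<lambda>t. real (counting_pos r (\<lambda>x. \<bar>t\<bar> *\<^sub>R B x)) / (1 + t\<^sup>2))"
    and integral_counting_pos_abs:
      "(LINT t|lborel. real (counting_pos r (\<lambda>x. \<bar>t\<bar> *\<^sub>R B x)) / (1 + t\<^sup>2)) \<le> 2 * \<tau> / r"
proof -
  define n where "n t = real (counting_pos r (\<lambda>x. \<bar>t\<bar> *\<^sub>R B x)) / (1 + t\<^sup>2)" for t
  have n_meas [measurable]: "n \<in> borel_measurable borel"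
    unfolding n_def using measurable_counting_pos_abs[OF B r] by measurable
  have nonneg: "0 \<le> n t" for t
    by (simp add: n_def add_nonneg_nonneg)
  have \<tau>: "0 \<le> \<tau>"
    using trace[of "{}"] by (simp add: orthonormal_def)
  have "ennreal (n t) = (SUP N. ennreal (n t) * indicator {t. \<bar>t\<bar> \<le> real N} t)" for t
  proof (rule antisym)
    obtain N where "\<bar>t\<bar> \<le> real N"
      using real_arch_simple by blast
    then show "ennreal (n t) \<le> (SUP N. ennreal (n t) * indicator {t. \<bar>t\<bar> \<le> real N} t)"
      by (intro SUP_upper2[of N]) auto
  qed (auto intro!: SUP_least simp: indicator_def)
  then have "(\<integral>\<^sup>+t. ennreal (n t) \<partial>lborel) =
      (\<integral>\<^sup>+t. (SUP N. ennreal (n t) * indicator {t. \<bar>t\<bar> \<le> real N} t) \<partial>lborel)"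
    by simp
  also have "\<dots> = (SUP N. \<integral>\<^sup>+t. ennreal (n t) * indicator {t. \<bar>t\<bar> \<le> real N} t \<partial>lborel)"
    by (rule nn_integral_monotone_convergence_SUP)
      (auto simp: incseq_def le_fun_def indicator_def)
  also have "\<dots> \<le> ennreal (2 * \<tau> / r)"
    using nn_integral_counting_pos_truncated[OF B r trace]
    by (auto intro!: SUP_least simp: n_def)
  finally have le: "(\<integral>\<^sup>+t. ennreal (n t) \<partial>lborel) \<le> ennreal (2 * \<tau> / r)" .
  have int: "integrable lborel n"
    by (rule integrableI_nonneg) (use le nonneg in \<open>auto simp: ennreal_less_top le_less_trans\<close>)
  moreover have "(LINT t|lborel. n t) \<le> 2 * \<tau> / r"
  proof -
    have "ennreal (LINT t|lborel. n t) \<le> ennreal (2 * \<tau> / r)"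
      using le nn_integral_eq_integral[OF int] nonneg by simp
    then show ?thesis
      using \<tau> r by (simp add: ennreal_le_iff)
  qed
  ultimately show "integrable lborel (\<lambda>t. real (counting_pos r (\<lambda>x. \<bar>t\<bar> *\<^sub>R B x)) / (1 + t\<^sup>2))"
    "(LINT t|lborel. real (counting_pos r (\<lambda>x. \<bar>t\<bar> *\<^sub>R B x)) / (1 + t\<^sup>2)) \<le> 2 * \<tau> / r"
    by (simp_all add: n_def[abs_def])
qed

text \<open>With \<open>\<sigma> = 1\<close> this is minus the spectral shift function of the minus
  sign; with \<open>\<sigma> = - 1\<close> and \<open>A\<close> negated it is that of the plus sign,
  whose pencil is negated as a whole.\<close>

definition averaged_counting ::
    "real \<Rightarrow> ('a :: chilbert_space \<Rightarrow> 'a) \<Rightarrow> ('a \<Rightarrow> 'a) \<Rightarrow> real"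
  where "averaged_counting \<sigma> A B =
    (1 / pi) * (LINT t|lborel. real (counting_pos 1 (\<lambda>x. A x + (\<sigma> * t) *\<^sub>R B x)) / (1 + t\<^sup>2))"

text \<open>Since \<open>t B\<close> and \<open>- t B\<close> are at most
  \<open>\<bar>t\<bar> B\<close>, Weyl's inequality compares the pencil with \<open>A\<close> at the
  price of the count of \<open>\<bar>t\<bar> B\<close> above \<open>\<delta>\<close>, whose average
  the trace controls. The Cauchy density divided by pi has total mass 1.\<close>

lemma averaged_counting_bounds:
  assumes A: "hsa A" and B: "hsa B" "\<And>x. 0 \<le> Re (cinner x (B x))"
    and trace: "\<And>F. finite F \<Longrightarrow> orthonormal F \<Longrightarrow> (\<Sum>f\<in>F. Re (cinner f (B f))) \<le> \<tau>"
    and \<sigma>: "\<bar>\<sigma>\<bar> = 1" and \<delta>: "0 < \<delta>" "\<delta> < 1"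
  shows "averaged_counting \<sigma> A B \<le> real (counting_pos (1 - \<delta>) A) + 2 * \<tau> / \<delta>"
    and "real (counting_pos (1 + \<delta>) A) - 2 * \<tau> / \<delta> \<le> averaged_counting \<sigma> A B"
    and "0 \<le> averaged_counting \<sigma> A B"
proof -
  define n where "n t = real (counting_pos \<delta> (\<lambda>x. \<bar>t\<bar> *\<^sub>R B x))" for t
  define f where "f t = real (counting_pos 1 (\<lambda>x. A x + (\<sigma> * t) *\<^sub>R B x))" for t
  have n_int: "integrable lborel (\<lambda>t. n t / (1 + t\<^sup>2))"
    and n_le: "(LINT t|lborel. n t / (1 + t\<^sup>2)) \<le> 2 * \<tau> / \<delta>"
    unfolding n_def
    using integrable_counting_pos_abs[OF B \<delta>(1) trace] integral_counting_pos_abs[OF B \<delta>(1) trace]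
    by auto
  have c_int: "integrable lborel (\<lambda>t :: real. c / (1 + t\<^sup>2))"
    and c_eq: "(LINT t|lborel. c / (1 + t\<^sup>2)) = c * pi" for c :: real
    using integrable_mult_right[OF integrable_Cauchy, of c] integral_Cauchy
      integral_mult_right_zero[of lborel c "\<lambda>t. 1 / (1 + t\<^sup>2)"]
    by auto
  define a where "a = real (counting_pos (1 - \<delta>) A)"
  define b where "b = real (counting_pos (1 + \<delta>) A)"
  have B_le: "(\<rho> * t) * Re (cinner x (B x)) \<le> \<bar>t\<bar> * Re (cinner x (B x))"
    if "\<bar>\<rho>\<bar> = 1" for \<rho> t x
  proof (rule mult_right_mono[OF _ B(2)])
    have "\<rho> * t \<le> \<bar>\<rho> * t\<bar>" by simp
    then show "\<rho> * t \<le> \<bar>t\<bar>" by (simp add: abs_mult that)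
  qed
  have up: "f t \<le> a + n t" for t
  proof -
    have "counting_pos 1 (\<lambda>x. A x + (\<sigma> * t) *\<^sub>R B x) \<le> counting_pos 1 (\<lambda>x. A x + \<bar>t\<bar> *\<^sub>R B x)"
      using B_le[OF \<sigma>]
      by (intro counting_pos_mono hsa_add hsa_scaleR A B)
        (auto simp: cinner.add_right cinner.scaleR_right)
    also have "\<dots> \<le> counting_pos (1 - \<delta>) A + counting_pos \<delta> (\<lambda>x. \<bar>t\<bar> *\<^sub>R B x)"
      using counting_pos_add_le[OF A hsa_scaleR[OF B(1)], of "1 - \<delta>" \<delta> "\<bar>t\<bar>"] \<delta> by simp
    finally show ?thesis
      by (simp add: f_def a_def n_def)
  qed
  have low: "b \<le> f t + n t" for t
  proof -
    \<comment> \<open>\<open>A\<close> is the pencil minus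
      \<open>(\<sigma> * t) *\<^sub>R B\<close>, and the correction is enlarged to
      \<open>\<bar>t\<bar> *\<^sub>R B\<close>.\<close>
    have "counting_pos (1 + \<delta>) A \<le> counting_pos (1 + \<delta>) (\<lambda>x. (A x + (\<sigma> * t) *\<^sub>R B x) + \<bar>t\<bar> *\<^sub>R B x)"
    proof (intro counting_pos_mono hsa_add hsa_scaleR A B)
      fix x
      show "Re (cinner x (A x)) \<le> Re (cinner x ((A x + (\<sigma> * t) *\<^sub>R B x) + \<bar>t\<bar> *\<^sub>R B x))"
        using B_le[of "- \<sigma>" t x] \<sigma> by (simp add: cinner.add_right cinner.scaleR_right)
    qed (use \<delta> in auto)
    also have "\<dots> \<le> counting_pos 1 (\<lambda>x. A x + (\<sigma> * t) *\<^sub>R B x) + counting_pos \<delta> (\<lambda>x. \<bar>t\<bar> *\<^sub>R B x)"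
      using \<delta> by (intro counting_pos_add_le hsa_add hsa_scaleR A B) auto
    finally show ?thesis
      by (simp add: f_def b_def n_def)
  qed
  have pos: "0 < 1 + t\<^sup>2" for t :: real
    by (simp add: add_pos_nonneg)
  have f_meas: "f \<in> borel_measurable borel"
  proof -
    have [measurable]: "(\<lambda>t. real (counting_pos 1 (\<lambda>x. A x + t *\<^sub>R B x))) \<in> borel_measurable borel"
      by (rule measurable_counting_pos_pencil[OF A B]) simp
    show ?thesis
      unfolding f_def
      by (rule measurable_compose[of "\<lambda>t. \<sigma> * t" borel borel
            "\<lambda>t. real (counting_pos 1 (\<lambda>x. A x + t *\<^sub>R B x))"]) measurable
  qed
  have sum_int: "integrable lborel (\<lambda>t. a / (1 + t\<^sup>2) + n t / (1 + t\<^sup>2))"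
    by (intro Bochner_Integration.integrable_add c_int n_int)
  have f_int: "integrable lborel (\<lambda>t. f t / (1 + t\<^sup>2))"
  proof (rule Bochner_Integration.integrable_bound[OF sum_int])
    show "(\<lambda>t. f t / (1 + t\<^sup>2)) \<in> borel_measurable lborel"
      using f_meas by measurable
    have "norm (f t / (1 + t\<^sup>2)) \<le> norm (a / (1 + t\<^sup>2) + n t / (1 + t\<^sup>2))" for t
      using up[of t] pos[of t]
      by (simp add: f_def a_def n_def divide_right_mono flip: add_divide_distrib)
    then show "AE t in lborel. norm (f t / (1 + t\<^sup>2)) \<le> norm (a / (1 + t\<^sup>2) + n t / (1 + t\<^sup>2))"
      by simp
  qed
  have "(LINT t|lborel. f t / (1 + t\<^sup>2)) \<le> (LINT t|lborel. a / (1 + t\<^sup>2) + n t / (1 + t\<^sup>2))"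
    using up pos by (intro integral_mono f_int sum_int)
      (simp add: divide_right_mono less_imp_le flip: add_divide_distrib)
  also have "\<dots> = a * pi + (LINT t|lborel. n t / (1 + t\<^sup>2))"
    by (subst Bochner_Integration.integral_add[OF c_int n_int]) (simp only: c_eq)
  finally have 1: "(LINT t|lborel. f t / (1 + t\<^sup>2)) \<le> a * pi + 2 * \<tau> / \<delta>"
    using n_le by linarith
  have "b * pi = (LINT t|lborel. b / (1 + t\<^sup>2))"
    by (simp only: c_eq)
  also have "\<dots> \<le> (LINT t|lborel. f t / (1 + t\<^sup>2) + n t / (1 + t\<^sup>2))"
    using low pos by (intro integral_mono c_int Bochner_Integration.integrable_add f_int n_int)
      (simp add: divide_right_mono less_imp_le flip: add_divide_distrib)
  also have "\<dots> = (LINT t|lborel. f t / (1 + t\<^sup>2)) + (LINT t|lborel. n t / (1 + t\<^sup>2))"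
    by (rule Bochner_Integration.integral_add[OF f_int n_int])
  finally have 2: "b * pi - 2 * \<tau> / \<delta> \<le> (LINT t|lborel. f t / (1 + t\<^sup>2))"
    using n_le by linarith
  have "0 \<le> \<tau>"
    using trace[of "{}"] by (simp add: orthonormal_def)
  then have "(2 * \<tau> / \<delta>) / pi \<le> 2 * \<tau> / \<delta>"
    using \<delta> pi_gt3 by (simp add: divide_le_eq mult_le_cancel_left1)
  moreover have "averaged_counting \<sigma> A B = (LINT t|lborel. f t / (1 + t\<^sup>2)) / pi"
    by (simp add: averaged_counting_def f_def)
  moreover have "(LINT t|lborel. f t / (1 + t\<^sup>2)) / pi \<le> (a * pi + 2 * \<tau> / \<delta>) / pi"
    "(b * pi - 2 * \<tau> / \<delta>) / pi \<le> (LINT t|lborel. f t / (1 + t\<^sup>2)) / pi"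
    using 1 2 by (simp_all only: divide_right_mono pi_ge_zero)
  ultimately show "averaged_counting \<sigma> A B \<le> real (counting_pos (1 - \<delta>) A) + 2 * \<tau> / \<delta>"
    "real (counting_pos (1 + \<delta>) A) - 2 * \<tau> / \<delta> \<le> averaged_counting \<sigma> A B"
    by (simp_all add: a_def b_def add_divide_distrib diff_divide_distrib)
  have "0 \<le> (LINT t|lborel. f t / (1 + t\<^sup>2))"
    using pos by (intro integral_nonneg_AE AE_I2) (simp add: f_def less_imp_le)
  then show "0 \<le> averaged_counting \<sigma> A B"
    by (simp add: averaged_counting_def f_def)
qed


section \<open>Operators on the lattice\<close>

lemma ell2_eqI: "(\<And>n. Rep_ell2 u n = Rep_ell2 v n) \<Longrightarrow> u = v"
  by (simp add: Rep_ell2_inject[symmetric] fun_eq_iff)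

lemma Rep_ell2_sum: "Rep_ell2 (\<Sum>i\<in>I. u i) n = (\<Sum>i\<in>I. Rep_ell2 (u i) n)"
  by (induction I rule: infinite_finite_induct) (simp_all add: zero_ell2.rep_eq plus_ell2.rep_eq)

lemma Rep_Abs_ell2:
  assumes "\<And>F. finite F \<Longrightarrow> (\<Sum>n\<in>F. (norm (f n))\<^sup>2) \<le> C"
  shows "Rep_ell2 (Abs_ell2 f) = f"
  by (rule Abs_ell2_inverse)
    (auto intro!: nonneg_bdd_above_summable_on bdd_aboveI2[where M = C] assms)

lemma norm_ell2_le:
  assumes "\<And>F. finite F \<Longrightarrow> (\<Sum>n\<in>F. (norm (Rep_ell2 u n))\<^sup>2) \<le> C\<^sup>2" "0 \<le> C"
  shows "norm u \<le> C"
proof -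
  have "(norm u)\<^sup>2 \<le> C\<^sup>2"
    unfolding norm_ell2_square
    by (rule infsum_le_finite_sums[OF square_summable_Rep_ell2]) (use assms in auto)
  then show ?thesis
    using assms(2) by (rule power2_le_imp_le)
qed

lemma hs_ell2I:
  fixes T :: "'a :: chilbert_space \<Rightarrow> 'g :: chilbert_space ell2"
  assumes T: "\<And>x n. Rep_ell2 (T x) n = t n x" and t: "\<And>n. hs (t n) (c n)"
    and c: "\<And>G. finite G \<Longrightarrow> (\<Sum>n\<in>G. (c n)\<^sup>2) \<le> C\<^sup>2" and "0 \<le> C"
  shows "hs T C"
proof (rule hsI)
  show "bounded_clinear T"
  proof (rule bounded_clinearI[where C = C])
    show "T (x + y) = T x + T y" for x y
      by (rule ell2_eqI)
        (simp add: T plus_ell2.rep_eq bounded_clinear_plus[OF hs_bounded_clinear[OF t]])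
    show "T (a *\<^sub>C x) = a *\<^sub>C T x" for a x
      by (rule ell2_eqI)
        (simp add: T scaleC_ell2.rep_eq bounded_clinear_scaleC[OF hs_bounded_clinear[OF t]])
    show "norm (T x) \<le> C * norm x" for x
    proof (rule norm_ell2_le)
      fix F :: "int set"
      assume F: "finite F"
      have "(\<Sum>n\<in>F. (norm (Rep_ell2 (T x) n))\<^sup>2) \<le> (\<Sum>n\<in>F. (c n)\<^sup>2 * (norm x)\<^sup>2)"
        unfolding T power_mult_distrib[symmetric]
        by (intro sum_mono power_mono hs_norm_le[OF t]) simp
      also have "\<dots> = (\<Sum>n\<in>F. (c n)\<^sup>2) * (norm x)\<^sup>2"
        by (simp add: sum_distrib_right)
      also have "\<dots> \<le> C\<^sup>2 * (norm x)\<^sup>2"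
        by (intro mult_right_mono c F) simp
      finally show "(\<Sum>n\<in>F. (norm (Rep_ell2 (T x) n))\<^sup>2) \<le> (C * norm x)\<^sup>2"
        by (simp add: power_mult_distrib)
    qed (use \<open>0 \<le> C\<close> in simp)
  qed
  fix F :: "'a set"
  assume F: "finite F" "orthonormal F"
  have "((\<lambda>G. \<Sum>f\<in>F. \<Sum>n\<in>G. (norm (Rep_ell2 (T f) n))\<^sup>2) \<longlongrightarrow> (\<Sum>f\<in>F. (norm (T f))\<^sup>2))
      (finite_subsets_at_top UNIV)"
    unfolding norm_ell2_square
    using has_sum_infsum[OF square_summable_Rep_ell2] unfolding has_sum_def by (intro tendsto_sum)
  then show "(\<Sum>f\<in>F. (norm (T f))\<^sup>2) \<le> C\<^sup>2"
  proof (rule tendsto_upperbound)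
    have "(\<Sum>f\<in>F. \<Sum>n\<in>G. (norm (Rep_ell2 (T f) n))\<^sup>2) \<le> C\<^sup>2" if "finite G" for G
    proof -
      have "(\<Sum>f\<in>F. \<Sum>n\<in>G. (norm (Rep_ell2 (T f) n))\<^sup>2) = (\<Sum>n\<in>G. \<Sum>f\<in>F. (norm (t n f))\<^sup>2)"
        unfolding T by (rule sum.swap)
      also have "\<dots> \<le> (\<Sum>n\<in>G. (c n)\<^sup>2)"
        by (intro sum_mono hs_sum_le[OF t] F)
      finally show ?thesis
        using c[OF that] by linarith
    qed
    then show "\<forall>\<^sub>F G in finite_subsets_at_top UNIV.
        (\<Sum>f\<in>F. \<Sum>n\<in>G. (norm (Rep_ell2 (T f) n))\<^sup>2) \<le> C\<^sup>2"
      by (intro eventually_finite_subsets_at_top_weakI)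
  qed simp
qed (use \<open>0 \<le> C\<close> in simp)

lemma
  fixes L :: "'g :: chilbert_space \<Rightarrow> 'g"
  assumes f: "\<And>n. cmod (f n) \<le> M" and L: "bounded_clinear L"
  shows Rep_mult_tensor: "Rep_ell2 (mult_tensor f L u) n = f n *\<^sub>C L (Rep_ell2 u n)"
    and bounded_clinear_mult_tensor: "bounded_clinear (mult_tensor f L)"
proof -
  obtain l where l: "0 < l" "\<And>x. norm (L x) \<le> l * norm x"
    using bounded_clinear_bound[OF L] by blast
  have M: "0 \<le> M"
    using f[of 0] norm_ge_zero order_trans by blast
  have b: "(\<Sum>n\<in>F. (norm (f n *\<^sub>C L (Rep_ell2 u n)))\<^sup>2) \<le> (M * l * norm u)\<^sup>2"
    if "finite F" for F u
  proof -
    have "(\<Sum>n\<in>F. (norm (f n *\<^sub>C L (Rep_ell2 u n)))\<^sup>2) \<le>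
        (\<Sum>n\<in>F. (M * l)\<^sup>2 * (norm (Rep_ell2 u n))\<^sup>2)"
      unfolding power_mult_distrib[symmetric] norm_scaleC mult.assoc
      using M l by (intro sum_mono power_mono mult_mono f) auto
    also have "\<dots> = (M * l)\<^sup>2 * (\<Sum>n\<in>F. (norm (Rep_ell2 u n))\<^sup>2)"
      by (simp add: sum_distrib_left)
    also have "\<dots> \<le> (M * l)\<^sup>2 * (norm u)\<^sup>2"
      by (intro mult_left_mono sum_le_norm_ell2_square that) simp
    finally show ?thesis
      by (simp add: power_mult_distrib)
  qed
  have Rep: "Rep_ell2 (mult_tensor f L u) n = f n *\<^sub>C L (Rep_ell2 u n)" for u n
    unfolding mult_tensor_def using Rep_Abs_ell2[OF b] by metis
  then show "Rep_ell2 (mult_tensor f L u) n = f n *\<^sub>C L (Rep_ell2 u n)" .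
  show "bounded_clinear (mult_tensor f L)"
  proof (rule bounded_clinearI[where C = "M * l"])
    show "mult_tensor f L (x + y) = mult_tensor f L x + mult_tensor f L y" for x y
      by (rule ell2_eqI)
        (simp add: Rep plus_ell2.rep_eq bounded_clinear_plus[OF L] scaleC_add_right)
    show "mult_tensor f L (c *\<^sub>C x) = c *\<^sub>C mult_tensor f L x" for c x
      by (rule ell2_eqI)
        (simp add: Rep scaleC_ell2.rep_eq bounded_clinear_scaleC[OF L] scaleC_scaleC mult.commute)
    show "norm (mult_tensor f L x) \<le> M * l * norm x" for x
      using M l by (intro norm_ell2_le) (auto simp: Rep b)
  qed
qed

lemma adj_mult_tensor:
  fixes L :: "'g :: chilbert_space \<Rightarrow> 'g"
  assumes f: "\<And>n. cmod (f n) \<le> M" and L: "bounded_clinear L"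
  shows "adj (mult_tensor f L) = mult_tensor (\<lambda>n. cnj (f n)) (adj L)"
proof (rule adj_eqI)
  have f': "cmod (cnj (f n)) \<le> M" for n
    using f by simp
  fix x y
  show "cinner (mult_tensor (\<lambda>n. cnj (f n)) (adj L) y) x = cinner y (mult_tensor f L x)"
    by (simp add: cinner_ell2.rep_eq Rep_mult_tensor[OF f L]
        Rep_mult_tensor[OF f' bounded_clinear_adj[OF L]] cinner_scaleC_left cinner_scaleC_right
        cinner_adj_left[OF L])
qed


subsection \<open>Rows and integral kernels\<close>

definition l2_le :: "(int \<Rightarrow> complex) \<Rightarrow> real \<Rightarrow> bool"
  where "l2_le b C \<longleftrightarrow> 0 \<le> C \<and> (\<forall>F. finite F \<longrightarrow> L2_set (\<lambda>m. cmod (b m)) F \<le> C)"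

lemma l2_leI:
  assumes "0 \<le> C" "\<And>F. finite F \<Longrightarrow> (\<Sum>m\<in>F. (cmod (b m))\<^sup>2) \<le> C\<^sup>2"
  shows "l2_le b C"
  using assms by (simp add: l2_le_def L2_set_le_iff)

lemma l2_le_sum: "l2_le b C \<Longrightarrow> finite F \<Longrightarrow> (\<Sum>m\<in>F. (cmod (b m))\<^sup>2) \<le> C\<^sup>2"
  by (simp add: l2_le_def flip: L2_set_le_iff)

lemma l2_le_mono:
  assumes "l2_le b C" "\<And>m. cmod (a m) \<le> c * cmod (b m)" "0 \<le> c"
  shows "l2_le a (c * C)"
proof (rule l2_leI)
  fix F :: "int set"
  assume F: "finite F"
  have "(\<Sum>m\<in>F. (cmod (a m))\<^sup>2) \<le> (\<Sum>m\<in>F. c\<^sup>2 * (cmod (b m))\<^sup>2)"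
    unfolding power_mult_distrib[symmetric] by (intro sum_mono power_mono assms) simp
  also have "\<dots> \<le> c\<^sup>2 * C\<^sup>2"
    unfolding sum_distrib_left[symmetric] by (intro mult_left_mono l2_le_sum[OF assms(1) F]) simp
  finally show "(\<Sum>m\<in>F. (cmod (a m))\<^sup>2) \<le> (c * C)\<^sup>2"
    by (simp add: power_mult_distrib)
qed (use assms in \<open>auto simp: l2_le_def\<close>)

lemma l2_le_cnj: "l2_le b C \<Longrightarrow> l2_le (\<lambda>m. cnj (b m)) C"
  by (simp add: l2_le_def)

text \<open>The functional with coefficients \<open>b\<close>, tensored with the identity of the
  fibre.\<close>

definition row :: "(int \<Rightarrow> complex) \<Rightarrow> 'g :: chilbert_space ell2 \<Rightarrow> 'g"
  where "row b u = (\<Sum>\<^sub>\<infinity>m. b m *\<^sub>C Rep_ell2 u m)"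

lemma
  assumes b: "l2_le b C"
  shows has_sum_row: "((\<lambda>m. b m *\<^sub>C Rep_ell2 u m) has_sum row b u) UNIV"
    and norm_row_le: "norm (row b u) \<le> C * norm u"
proof -
  have le: "(\<Sum>m\<in>F. norm (b m *\<^sub>C Rep_ell2 u m)) \<le> C * norm u" if F: "finite F" for F
  proof -
    have "(\<Sum>m\<in>F. norm (b m *\<^sub>C Rep_ell2 u m)) = (\<Sum>m\<in>F. \<bar>cmod (b m)\<bar> * \<bar>norm (Rep_ell2 u m)\<bar>)"
      by (simp add: norm_scaleC)
    also have "\<dots> \<le> L2_set (\<lambda>m. cmod (b m)) F * L2_set (\<lambda>m. norm (Rep_ell2 u m)) F"
      by (rule L2_set_mult_ineq)
    also have "\<dots> \<le> C * norm u"
    proof (intro mult_mono L2_set_nonneg)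
      show "L2_set (\<lambda>m. cmod (b m)) F \<le> C" "0 \<le> C"
        using b F by (auto simp: l2_le_def)
      show "L2_set (\<lambda>m. norm (Rep_ell2 u m)) F \<le> norm u"
        by (rule L2_set_le_iff[THEN iffD2]) (simp_all add: sum_le_norm_ell2_square F)
    qed
    finally show ?thesis .
  qed
  have abs: "(\<lambda>m. b m *\<^sub>C Rep_ell2 u m) abs_summable_on UNIV"
  proof (rule nonneg_bdd_above_summable_on)
    show "bdd_above (sum (\<lambda>m. norm (b m *\<^sub>C Rep_ell2 u m)) ` {F. F \<subseteq> UNIV \<and> finite F})"
      by (rule bdd_aboveI2[where M = "C * norm u"]) (use le in blast)
  qed simp
  then show "((\<lambda>m. b m *\<^sub>C Rep_ell2 u m) has_sum row b u) UNIV"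
    unfolding row_def by (rule has_sum_infsum[OF abs_summable_summable])
  show "norm (row b u) \<le> C * norm u"
    unfolding row_def
    by (rule order_trans[OF norm_infsum_bound[OF abs] infsum_le_finite_sums[OF abs le]])
qed

lemma row_eqI: "((\<lambda>m. b m *\<^sub>C Rep_ell2 u m) has_sum x) UNIV \<Longrightarrow> row b u = x"
  unfolding row_def by (rule infsumI)

lemma bounded_clinear_row:
  assumes b: "l2_le b C"
  shows "bounded_clinear (row b)"
proof (rule bounded_clinearI)
  show "row b (x + y) = row b x + row b y" for x y
    using has_sum_add[OF has_sum_row[OF b, of x] has_sum_row[OF b, of y]]
    by (intro row_eqI) (simp add: plus_ell2.rep_eq scaleC_add_right)
  show "row b (c *\<^sub>C x) = c *\<^sub>C row b x" for c x
    using has_sum_bounded_linear[OF scaleC.bounded_linear_right has_sum_row[OF b, of x]]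
    by (intro row_eqI) (simp add: scaleC_ell2.rep_eq scaleC_scaleC mult.commute)
qed (rule norm_row_le[OF b])

lemma row_apply:
  assumes b: "l2_le b C" and A: "bounded_clinear A"
    and v: "\<And>m. a m *\<^sub>C Rep_ell2 v m = b m *\<^sub>C A (Rep_ell2 u m)"
  shows "row a v = A (row b u)"
  using has_sum_bounded_linear[OF bounded_clinear_bounded_linear[OF A] has_sum_row[OF b, of u]]
  by (intro row_eqI) (simp add: v bounded_clinear_scaleC[OF A])

lemma row_add:
  assumes "l2_le a C" "l2_le b D"
  shows "row (\<lambda>m. a m + b m) u = row a u + row b u"
  using has_sum_add[OF has_sum_row[OF assms(1), of u] has_sum_row[OF assms(2), of u]]
  by (intro row_eqI) (simp add: scaleC_add_left)

lemma row_cmult: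
  assumes "l2_le b C"
  shows "row (\<lambda>m. c * b m) u = c *\<^sub>C row b u"
  using has_sum_bounded_linear[OF scaleC.bounded_linear_right has_sum_row[OF assms, of u]]
  by (intro row_eqI) (simp add: scaleC_scaleC)

lemma has_sum_cinner_row:
  assumes "l2_le b C"
  shows "((\<lambda>m. b m * cinner x (Rep_ell2 u m)) has_sum cinner x (row b u)) UNIV"
  using has_sum_bounded_linear[OF cinner.bounded_linear_right has_sum_row[OF assms]]
  by (simp add: cinner_scaleC_right)

text \<open>The elementary tensor of \<open>p\<close> and \<open>g\<close>; adjoint to
  \<open>row\<close> up to conjugation of the coefficients.\<close>

definition emb :: "(int \<Rightarrow> complex) \<Rightarrow> 'g :: chilbert_space \<Rightarrow> 'g ell2"
  where "emb p g = Abs_ell2 (\<lambda>n. p n *\<^sub>C g)"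

lemma Rep_emb:
  assumes "l2_le p C"
  shows "Rep_ell2 (emb p g) n = p n *\<^sub>C g"
proof -
  have "(\<Sum>n\<in>F. (norm (p n *\<^sub>C g))\<^sup>2) \<le> C\<^sup>2 * (norm g)\<^sup>2" if "finite F" for F
    unfolding norm_scaleC power_mult_distrib sum_distrib_right[symmetric]
    by (intro mult_right_mono l2_le_sum[OF assms that]) simp
  from Rep_Abs_ell2[OF this] show ?thesis
    by (simp add: emb_def)
qed

lemma cinner_emb:
  assumes "l2_le p C"
  shows "cinner (emb p g) u = cinner g (row (\<lambda>n. cnj (p n)) u)"
  unfolding cinner_ell2.rep_eq Rep_emb[OF assms] cinner_scaleC_left
  by (rule infsumI, rule has_sum_cinner_row, rule l2_le_cnj, rule assms)

lemma adj_row: "l2_le b C \<Longrightarrow> adj (row b) = emb (\<lambda>n. cnj (b n))"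
  by (rule adj_eqI) (simp add: cinner_emb[OF l2_le_cnj])

lemma l2_le_delta: "l2_le (\<lambda>k. if k = n then 1 else 0) 1"
proof (rule l2_leI)
  fix F :: "int set"
  assume "finite F"
  have "(\<Sum>m\<in>F. (cmod (if m = n then 1 else 0))\<^sup>2) = (\<Sum>m\<in>F. if m = n then 1 else (0 :: real))"
    by (intro sum.cong) auto
  then show "(\<Sum>m\<in>F. (cmod (if m = n then 1 else 0))\<^sup>2) \<le> 1\<^sup>2"
    using \<open>finite F\<close> by simp
qed simp

lemma cinner_delta: "cinner (emb (\<lambda>k. if k = n then 1 else 0) g) u = cinner g (Rep_ell2 u n)"
  unfolding cinner_ell2.rep_eq
  by (rule infsumI, rule has_sum_finite_neutralI[of "{n}"]) (auto simp: Rep_emb[OF l2_le_delta])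

text \<open>The tensor product of the scalar integral operator with kernel \<open>b\<close> and the
  operator \<open>N\<close>.\<close>

definition ker_op ::
    "(int \<Rightarrow> int \<Rightarrow> complex) \<Rightarrow> ('g :: chilbert_space \<Rightarrow> 'g) \<Rightarrow> 'g ell2 \<Rightarrow> 'g ell2"
  where "ker_op b N u = Abs_ell2 (\<lambda>n. N (row (b n) u))"

text \<open>Kernels are controlled by a fixed weight \<open>\<sigma> \<in> \<ell>\<^sup>2\<close> in each variable.\<close>

locale weight =
  fixes \<sigma> :: "int \<Rightarrow> real" and S :: real
  assumes weight_nonneg: "\<And>n. 0 \<le> \<sigma> n" and weight_l2: "l2_le (\<lambda>n. complex_of_real (\<sigma> n)) S"
begin

definition kbound :: "(int \<Rightarrow> int \<Rightarrow> complex) \<Rightarrow> real \<Rightarrow> bool"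
  where "kbound b C \<longleftrightarrow> 0 \<le> C \<and> (\<forall>n m. cmod (b n m) \<le> C * \<sigma> n * \<sigma> m)"

lemma S_nonneg: "0 \<le> S"
  using weight_l2 by (simp add: l2_le_def)

lemma kbound_row: "kbound b C \<Longrightarrow> l2_le (b n) (C * \<sigma> n * S)"
  using weight_nonneg by (intro l2_le_mono[OF weight_l2]) (auto simp: kbound_def)

lemma kbound_add:
  assumes "kbound a C" "kbound b D"
  shows "kbound (\<lambda>n m. a n m + b n m) (C + D)"
  unfolding kbound_def
proof (intro conjI allI)
  fix n m
  have "cmod (a n m + b n m) \<le> cmod (a n m) + cmod (b n m)"
    by (rule norm_triangle_ineq)
  also have "\<dots> \<le> C * \<sigma> n * \<sigma> m + D * \<sigma> n * \<sigma> m"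
    using assms by (intro add_mono) (auto simp: kbound_def)
  finally show "cmod (a n m + b n m) \<le> (C + D) * \<sigma> n * \<sigma> m"
    by (simp add: distrib_right)
qed (use assms in \<open>auto simp: kbound_def\<close>)

lemma kbound_cmult:
  assumes "kbound b C"
  shows "kbound (\<lambda>n m. c * b n m) (cmod c * C)"
  using assms by (auto simp: kbound_def norm_mult mult.assoc intro!: mult_left_mono)

lemma kbound_adj: "kbound b C \<Longrightarrow> kbound (\<lambda>n m. cnj (b m n)) C"
  by (auto simp: kbound_def) (metis mult.assoc mult.commute)

lemma weight_l2_sum: "finite F \<Longrightarrow> (\<Sum>n\<in>F. (C * \<sigma> n)\<^sup>2) \<le> (C * S)\<^sup>2"
  using l2_le_sum[OF weight_l2, of F]
  by (simp add: power_mult_distrib mult_left_mono flip: sum_distrib_left)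

lemma kbound_rank_one:
  assumes "\<And>n. cmod (p n) \<le> \<sigma> n"
  shows "kbound (\<lambda>n m. cnj (p n) * p m) 1"
  unfolding kbound_def using weight_nonneg assms
  by (auto simp: norm_mult intro!: mult_mono)

lemma kbound_l2: "(\<And>n. cmod (p n) \<le> \<sigma> n) \<Longrightarrow> l2_le p S"
  using l2_le_mono[OF weight_l2, of p 1] weight_nonneg by simp

lemma
  fixes N :: "'g :: chilbert_space \<Rightarrow> 'g"
  assumes b: "kbound b C" and N: "bounded_clinear N"
  shows Rep_ker_op: "Rep_ell2 (ker_op b N u) n = N (row (b n) u)"
proof -
  obtain l where l: "0 < l" "\<And>x. norm (N x) \<le> l * norm x"
    using bounded_clinear_bound[OF N] by blast
  have C: "0 \<le> C"
    using b by (simp add: kbound_def)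
  have "(\<Sum>n\<in>F. (norm (N (row (b n) u)))\<^sup>2) \<le> (l * norm u * C * S * S)\<^sup>2" if F: "finite F" for F
  proof -
    have "(\<Sum>n\<in>F. (norm (N (row (b n) u)))\<^sup>2) \<le> (\<Sum>n\<in>F. ((l * norm u * C * S) * \<sigma> n)\<^sup>2)"
    proof (intro sum_mono power_mono)
      fix n
      have "norm (N (row (b n) u)) \<le> l * norm (row (b n) u)"
        by (rule l)
      also have "\<dots> \<le> l * (C * \<sigma> n * S * norm u)"
        using l by (intro mult_left_mono norm_row_le kbound_row b) auto
      finally show "norm (N (row (b n) u)) \<le> l * norm u * C * S * \<sigma> n"
        by (simp add: mult_ac)
    qed simp
    also have "\<dots> \<le> (l * norm u * C * S * S)\<^sup>2"
      by (rule weight_l2_sum[OF F])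
    finally show ?thesis .
  qed
  from Rep_Abs_ell2[OF this] show ?thesis
    by (simp add: ker_op_def)
qed

lemma hs_ker_op:
  fixes N :: "'g :: chilbert_space \<Rightarrow> 'g"
  assumes b: "kbound b C" and N: "hs N D"
  shows "hs (ker_op b N) (C * (S * S * D))"
proof (rule hs_ell2I[OF Rep_ker_op[OF b hs_bounded_clinear[OF N]]])
  have pos: "0 \<le> C" "0 \<le> S" "0 \<le> D"
    using b hs_nonneg[OF N] S_nonneg by (auto simp: kbound_def)
  show "hs (\<lambda>u. N (row (b n) u)) (C * S * D * \<sigma> n)" for n
    using hs_compose_right[OF bounded_clinear_row[OF kbound_row[OF b]]
        norm_row_le[OF kbound_row[OF b]] _ N] pos weight_nonneg[of n]
    by (simp add: mult_ac)
  show "(\<Sum>n\<in>G. (C * S * D * \<sigma> n)\<^sup>2) \<le> (C * (S * S * D))\<^sup>2" if "finite G" for G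
    using weight_l2_sum[OF that, of "C * S * D"] by (simp add: mult_ac)
  show "0 \<le> C * (S * S * D)"
    using pos by simp
qed

lemma ker_op_add:
  fixes N :: "'g :: chilbert_space \<Rightarrow> 'g"
  assumes a: "kbound a C" and b: "kbound b D" and N: "bounded_clinear N"
  shows "ker_op (\<lambda>n m. a n m + b n m) N u = ker_op a N u + ker_op b N u"
  by (rule ell2_eqI)
    (simp add: plus_ell2.rep_eq Rep_ker_op[OF _ N, OF a] Rep_ker_op[OF _ N, OF b]
      Rep_ker_op[OF _ N, OF kbound_add[OF a b]] row_add[OF kbound_row[OF a] kbound_row[OF b]]
      bounded_clinear_plus[OF N])

lemma ker_op_cmult:
  fixes N :: "'g :: chilbert_space \<Rightarrow> 'g"
  assumes b: "kbound b C" and N: "bounded_clinear N"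
  shows "ker_op (\<lambda>n m. c * b n m) N u = c *\<^sub>C ker_op b N u"
  by (rule ell2_eqI)
    (simp add: scaleC_ell2.rep_eq Rep_ker_op[OF _ N, OF b]
      Rep_ker_op[OF _ N, OF kbound_cmult[OF b]] row_cmult[OF kbound_row[OF b]]
      bounded_clinear_scaleC[OF N])

text \<open>A product kernel with fibre operator \<open>L L\<^sup>*\<close> factors as
  \<open>Y\<^sup>* Y\<close> with \<open>Y = L\<^sup>* \<circ> row p\<close>, which makes positivity
  visible.\<close>

lemma ker_op_rank_one:
  fixes L :: "'g :: chilbert_space \<Rightarrow> 'g"
  assumes p: "\<And>n. cmod (p n) \<le> \<sigma> n" and L: "bounded_clinear L"
  shows "ker_op (\<lambda>n m. cnj (p n) * p m) (\<lambda>x. L (adj L x)) u =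
    adj (\<lambda>u. adj L (row p u)) (adj L (row p u))"
proof -
  note pl = kbound_l2[OF p]
  have N: "bounded_clinear (\<lambda>x. L (adj L x))"
    by (rule bounded_clinear_compose[OF L bounded_clinear_adj[OF L]])
  have adj: "adj (\<lambda>u. adj L (row p u)) = (\<lambda>x. emb (\<lambda>n. cnj (p n)) (L x))"
    unfolding adj_compose[OF bounded_clinear_adj[OF L] bounded_clinear_row[OF pl]] adj_adj[OF L]
      adj_row[OF pl] ..
  show ?thesis
  proof (rule ell2_eqI)
    fix n
    show "Rep_ell2 (ker_op (\<lambda>n m. cnj (p n) * p m) (\<lambda>x. L (adj L x)) u) n =
        Rep_ell2 (adj (\<lambda>u. adj L (row p u)) (adj L (row p u))) n"
      unfolding Rep_ker_op[OF kbound_rank_one[OF p] N] row_cmult[OF pl] adj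
        Rep_emb[OF l2_le_cnj[OF pl]]
      by (rule bounded_clinear_scaleC[OF N])
  qed
qed

lemma adj_ker_op:
  fixes N :: "'g :: chilbert_space \<Rightarrow> 'g"
  assumes b: "kbound b C" and N: "hs N D"
  shows "adj (ker_op b N) = ker_op (\<lambda>n m. cnj (b m n)) (adj N)"
proof (intro ext ell2_eqI, rule cinner_eqI)
  fix v :: "'g ell2" and n and g :: 'g
  note bN = hs_bounded_clinear[OF N]
  \<comment> \<open>Testing against a point mass at \<open>n\<close> with value \<open>g\<close>
    turns row \<open>n\<close> of the adjoint into column \<open>n\<close> of the kernel.\<close>
  define e where "e = emb (\<lambda>k. if k = n then 1 else 0) g"
  have l2: "l2_le (\<lambda>k. cnj (b k n)) (C * \<sigma> n * S)"
    by (rule kbound_row[OF kbound_adj[OF b]])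
  from l2_le_cnj[OF this] have l2': "l2_le (\<lambda>k. b k n) (C * \<sigma> n * S)"
    by simp
  have "row (b k) e = b k n *\<^sub>C g" for k
    by (rule row_eqI, rule has_sum_finite_neutralI[of "{n}"])
      (auto simp: e_def Rep_emb[OF l2_le_delta])
  then have "ker_op b N e = emb (\<lambda>k. b k n) (N g)"
    by (intro ell2_eqI)
      (simp add: Rep_ker_op[OF b bN] bounded_clinear_scaleC[OF bN] Rep_emb[OF l2'])
  then have "cinner e (adj (ker_op b N) v) = cinner (emb (\<lambda>k. b k n) (N g)) v"
    by (simp add: cinner_adj_right[OF hs_bounded_clinear[OF hs_ker_op[OF b N]]])
  also have "\<dots> = cinner (N g) (row (\<lambda>k. cnj (b k n)) v)"
    by (rule cinner_emb[OF l2'])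
  also have "\<dots> = cinner g (Rep_ell2 (ker_op (\<lambda>n m. cnj (b m n)) (adj N) v) n)"
    by (simp add: Rep_ker_op[OF kbound_adj[OF b] bounded_clinear_adj[OF bN]] cinner_adj_right[OF bN])
  finally show "cinner g (Rep_ell2 (adj (ker_op b N) v) n) =
      cinner g (Rep_ell2 (ker_op (\<lambda>n m. cnj (b m n)) (adj N) v) n)"
    by (simp add: e_def cinner_delta)
qed

end


section \<open>Perturbation of a large positive operator\<close>

text \<open>Weyl's inequality removes \<open>P\<close> at the cost of one \<open>\<delta>\<close>
  and a count bounded by \<open>E\<^sup>2 / \<delta>\<^sup>2\<close>; the average over
  \<open>t\<close> costs the second \<open>\<delta>\<close>. With the opposite sign the large term
  is nonpositive, so \<open>- A \<le> - P\<close>, and apart from the averaging error only the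
  remainder is counted.\<close>

lemma averaged_counting_perturbed:
  fixes Y :: "'a :: chilbert_space \<Rightarrow> 'b :: chilbert_space"
  assumes Y: "hs Y D" and c: "0 \<le> c" and P: "self_adjoint P" "hs P E"
    and A: "\<And>x. A x = c *\<^sub>R adj Y (Y x) + P x"
    and B: "hsa B" "\<And>x. 0 \<le> Re (cinner x (B x))"
    and trace: "\<And>F. finite F \<Longrightarrow> orthonormal F \<Longrightarrow> (\<Sum>f\<in>F. Re (cinner f (B f))) \<le> \<tau>"
    and \<sigma>: "\<bar>\<sigma>\<bar> = 1" and \<delta>: "0 < \<delta>" "\<delta> < 1 / 2"
  shows "averaged_counting \<sigma> A B \<le>
      real (counting_pos (1 - 2 * \<delta>) (\<lambda>x. c *\<^sub>R Y (adj Y x))) + (E\<^sup>2 / \<delta>\<^sup>2 + 2 * \<tau> / \<delta>)"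
    and "real (counting_pos (1 + 2 * \<delta>) (\<lambda>x. c *\<^sub>R Y (adj Y x))) - (E\<^sup>2 / \<delta>\<^sup>2 + 2 * \<tau> / \<delta>) \<le>
      averaged_counting \<sigma> A B"
    and "averaged_counting \<sigma> (\<lambda>x. - A x) B \<le> E\<^sup>2 / \<delta>\<^sup>2 + 2 * \<tau> / \<delta>"
    and "0 \<le> averaged_counting \<sigma> (\<lambda>x. - A x) B"
proof -
  note bY = hs_bounded_clinear[OF Y]
  have hsaP: "hsa P"
    using P by (auto simp: hsa_def)
  have hsaY: "hsa (\<lambda>x. c *\<^sub>R adj Y (Y x))"
    by (intro hsa_scaleR hsa_adj_comp[OF Y])
  have A_eq: "A = (\<lambda>x. c *\<^sub>R adj Y (Y x) + P x)"
    using A by blast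
  have hsaA: "hsa A"
    unfolding A_eq by (intro hsa_add hsaY hsaP)
  have swap: "counting_pos r (\<lambda>x. c *\<^sub>R adj Y (Y x)) = counting_pos r (\<lambda>x. c *\<^sub>R Y (adj Y x))"
    if "0 < r" for r
  proof (cases "c = 0")
    case True
    have "counting_pos r (\<lambda>x :: 'a. 0) = 0" "counting_pos r (\<lambda>x :: 'b. 0) = 0"
      using \<open>0 < r\<close> by (auto intro!: counting_pos_nonpos hsa_0)
    then show ?thesis
      by (simp add: True)
  next
    case False
    have "hsa (\<lambda>x. Y (adj Y x))"
      using hsa_adj_comp[OF hs_adj[OF Y]] by (simp add: adj_adj[OF bY])
    then show ?thesis
      using False c that
      by (simp add: counting_pos_scaleR hsa_adj_comp[OF Y] counting_pos_adj_comp[OF Y])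
  qed
  have nP: "real (counting_pos \<delta> P) \<le> E\<^sup>2 / \<delta>\<^sup>2"
    by (rule counting_pos_hs_le[OF P \<delta>(1)])
  have nP': "real (counting_pos r (\<lambda>x. - P x)) \<le> E\<^sup>2 / \<delta>\<^sup>2" if "\<delta> \<le> r" for r
  proof -
    have "real (counting_pos r (\<lambda>x. - P x)) \<le> real (counting_pos \<delta> (\<lambda>x. - P x))"
      using \<delta> that by (intro of_nat_mono counting_pos_mono hsa_uminus hsaP) auto
    also have "\<dots> \<le> E\<^sup>2 / \<delta>\<^sup>2"
      using P by (intro counting_pos_hs_le self_adjoint_uminus hs_uminus \<delta>)
    finally show ?thesis .
  qed
  have "counting_pos (1 - \<delta>) A \<le> counting_pos (1 - 2 * \<delta>) (\<lambda>x. c *\<^sub>R adj Y (Y x)) + counting_pos \<delta> P"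
    unfolding A_eq
    using counting_pos_add_le[OF hsaY hsaP, of "1 - 2 * \<delta>" \<delta>] \<delta> by simp
  then have "real (counting_pos (1 - \<delta>) A) \<le>
      real (counting_pos (1 - 2 * \<delta>) (\<lambda>x. c *\<^sub>R Y (adj Y x))) + E\<^sup>2 / \<delta>\<^sup>2"
    using nP swap[of "1 - 2 * \<delta>"] \<delta> by linarith
  then show "averaged_counting \<sigma> A B \<le>
      real (counting_pos (1 - 2 * \<delta>) (\<lambda>x. c *\<^sub>R Y (adj Y x))) + (E\<^sup>2 / \<delta>\<^sup>2 + 2 * \<tau> / \<delta>)"
    using averaged_counting_bounds(1)[OF hsaA B trace \<sigma>, of \<delta>] \<delta> by linarith
  have "counting_pos (1 + 2 * \<delta>) (\<lambda>x. A x + - P x) \<le>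
      counting_pos (1 + \<delta>) A + counting_pos \<delta> (\<lambda>x. - P x)"
    using counting_pos_add_le[OF hsaA hsa_uminus[OF hsaP], of "1 + \<delta>" \<delta>] \<delta>
    by (simp add: add_ac)
  moreover have "(\<lambda>x. A x + - P x) = (\<lambda>x. c *\<^sub>R adj Y (Y x))"
    by (simp add: A_eq)
  ultimately have "real (counting_pos (1 + 2 * \<delta>) (\<lambda>x. c *\<^sub>R Y (adj Y x))) \<le>
      real (counting_pos (1 + \<delta>) A) + E\<^sup>2 / \<delta>\<^sup>2"
    using nP'[of \<delta>] swap[of "1 + 2 * \<delta>"] \<delta> by simp
  then show "real (counting_pos (1 + 2 * \<delta>) (\<lambda>x. c *\<^sub>R Y (adj Y x))) - (E\<^sup>2 / \<delta>\<^sup>2 + 2 * \<tau> / \<delta>) \<le>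
      averaged_counting \<sigma> A B"
    using averaged_counting_bounds(2)[OF hsaA B trace \<sigma>, of \<delta>] \<delta> by linarith
  have "Re (cinner x (- A x)) \<le> Re (cinner x (- P x))" for x
    using c by (simp add: A_eq cinner.add_right cinner.diff_right cinner.minus_right
        cinner.scaleR_right Re_cinner_adj_comp[OF bY])
  then have "counting_pos (1 - \<delta>) (\<lambda>x. - A x) \<le> counting_pos (1 - \<delta>) (\<lambda>x. - P x)"
    using \<delta> by (intro counting_pos_mono hsa_uminus hsaA hsaP) auto
  then have "real (counting_pos (1 - \<delta>) (\<lambda>x. - A x)) \<le> E\<^sup>2 / \<delta>\<^sup>2"
    using nP'[of "1 - \<delta>"] \<delta> by simp
  then show "averaged_counting \<sigma> (\<lambda>x. - A x) B \<le> E\<^sup>2 / \<delta>\<^sup>2 + 2 * \<tau> / \<delta>"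
    using averaged_counting_bounds(1)[OF hsa_uminus[OF hsaA] B trace \<sigma>, of \<delta>] \<delta> by linarith
  show "0 \<le> averaged_counting \<sigma> (\<lambda>x. - A x) B"
    using averaged_counting_bounds(3)[OF hsa_uminus[OF hsaA] B trace \<sigma>, of \<delta>] \<delta> by simp
qed

section \<open>The spectral shift function as an average; the boundary value as a limit\<close>

lemma ssf_minus_eq_averaged_counting:
  "ssf_minus H M lam =
    - averaged_counting 1 (re_op (boundary_value H M lam)) (im_op (boundary_value H M lam))"
  by (simp add: ssf_minus_def averaged_counting_def pencil_def[abs_def])

lemma ssf_plus_eq_averaged_counting:
  "ssf_plus H M lam =
    averaged_counting (- 1) (\<lambda>x. - re_op (boundary_value H M lam) x) (im_op (boundary_value H M lam))"
  by (simp add: ssf_plus_def averaged_counting_def counting_neg_def pencil_def[abs_def])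

text \<open>The definite description is resolved by a candidate with an explicit error
  \<open>e\<close>. The limit is unique because the Hilbert-Schmidt norm dominates the operator
  norm, so two limits agree at every vector.\<close>

lemma boundary_value_eqI:
  fixes L :: "'a :: chilbert_space \<Rightarrow> 'a"
  assumes L: "hs L C"
    and T: "\<forall>\<^sub>F \<epsilon> in at_right 0. hs (\<lambda>u. sandwiched_resolvent H M (Complex lam \<epsilon>) u - L u) (e \<epsilon>)"
    and e: "(e \<longlongrightarrow> 0) (at_right 0)"
  shows "boundary_value H M lam = L"
proof -
  define T where "T \<epsilon> = sandwiched_resolvent H M (Complex lam \<epsilon>)" for \<epsilon>
  have T': "\<forall>\<^sub>F \<epsilon> in at_right 0. hs (\<lambda>u. T \<epsilon> u - L u) (e \<epsilon>)"
    using T by (simp add: T_def)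
  have sT: "\<forall>\<^sub>F \<epsilon> in at_right 0. schatten2 (T \<epsilon>)"
    using T'
  proof eventually_elim
    case (elim \<epsilon>)
    from hs_add[OF elim L] show ?case
      by (auto simp: schatten2_iff_hs)
  qed
  have nonneg: "0 \<le> schatten2_norm (\<lambda>u. S u - S' u)" if "schatten2 S" "schatten2 S'" for S S' :: "'a \<Rightarrow> 'a"
    using that hs_diff hs_nonneg[OF hs_schatten2_norm, of "\<lambda>u. S u - S' u"]
    unfolding schatten2_iff_hs by blast
  have sL: "schatten2 L"
    using L by (auto simp: schatten2_iff_hs)
  have lim: "((\<lambda>\<epsilon>. schatten2_norm (\<lambda>u. T \<epsilon> u - L u)) \<longlongrightarrow> 0) (at_right 0)"
  proof (rule tendsto_sandwich[OF _ _ tendsto_const e])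
    show "\<forall>\<^sub>F \<epsilon> in at_right 0. 0 \<le> schatten2_norm (\<lambda>u. T \<epsilon> u - L u)"
      using sT by eventually_elim (rule nonneg[OF _ sL])
    show "\<forall>\<^sub>F \<epsilon> in at_right 0. schatten2_norm (\<lambda>u. T \<epsilon> u - L u) \<le> e \<epsilon>"
      using T' by eventually_elim (rule schatten2_norm_le)
  qed
  show ?thesis
    unfolding boundary_value_def T_def[symmetric]
  proof (rule the_equality)
    show "schatten2 L \<and> (\<forall>\<^sub>F \<epsilon> in at_right 0. schatten2 (T \<epsilon>)) \<and>
        ((\<lambda>\<epsilon>. schatten2_norm (\<lambda>u. T \<epsilon> u - L u)) \<longlongrightarrow> 0) (at_right 0)"
      using sL sT lim by blast
    fix L'
    assume L': "schatten2 L' \<and> (\<forall>\<^sub>F \<epsilon> in at_right 0. schatten2 (T \<epsilon>)) \<and>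
        ((\<lambda>\<epsilon>. schatten2_norm (\<lambda>u. T \<epsilon> u - L' u)) \<longlongrightarrow> 0) (at_right 0)"
    show "L' = L"
    proof
      fix u
      have "\<forall>\<^sub>F \<epsilon> in at_right 0. norm (L' u - L u) \<le>
          (schatten2_norm (\<lambda>u. T \<epsilon> u - L u) + schatten2_norm (\<lambda>u. T \<epsilon> u - L' u)) * norm u"
        using sT
      proof eventually_elim
        case (elim \<epsilon>)
        have "schatten2 (\<lambda>u. T \<epsilon> u - L u)" "schatten2 (\<lambda>u. T \<epsilon> u - L' u)"
          using elim sL L' hs_diff unfolding schatten2_iff_hs by blast+
        then have "norm (T \<epsilon> u - L u) \<le> schatten2_norm (\<lambda>u. T \<epsilon> u - L u) * norm u"
          "norm (T \<epsilon> u - L' u) \<le> schatten2_norm (\<lambda>u. T \<epsilon> u - L' u) * norm u"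
          using hs_norm_le[OF hs_schatten2_norm] by blast+
        moreover have "norm (L' u - L u) \<le> norm (T \<epsilon> u - L u) + norm (T \<epsilon> u - L' u)"
          using norm_triangle_ineq4[of "T \<epsilon> u - L u" "T \<epsilon> u - L' u"] by simp
        ultimately show ?case
          by (simp add: distrib_right)
      qed
      moreover have "((\<lambda>\<epsilon>. (schatten2_norm (\<lambda>u. T \<epsilon> u - L u) +
          schatten2_norm (\<lambda>u. T \<epsilon> u - L' u)) * norm u) \<longlongrightarrow> (0 + 0) * norm u) (at_right 0)"
        using lim L' by (intro tendsto_intros) auto
      ultimately have "norm (L' u - L u) \<le> (0 + 0) * norm u"
        by (intro tendsto_lowerbound[of _ _ "at_right 0"]) auto
      then show "L' u = L u" by simp
    qed
  qed
qed


subsection \<open>Sums of kernel operators\<close>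

text \<open>Setting for T(lam + i0): \<open>R\<close> becomes the square root of the bounded factor
  of the perturbation, \<open>I\<close> indexes the channels, and \<open>L s\<close> becomes
  \<open>K\<close> times the spectral projection.\<close>

locale kernel_ops = weight \<sigma> S for \<sigma> :: "int \<Rightarrow> real" and S :: real +
  fixes R :: "'g :: chilbert_space ell2 \<Rightarrow> 'g ell2" and \<rho> :: real
    and I :: "nat set" and L :: "nat \<Rightarrow> 'g \<Rightarrow> 'g" and D :: real
  assumes finite_I: "finite I" and R: "self_adjoint R" "\<And>u. norm (R u) \<le> \<rho> * norm u" "0 \<le> \<rho>"
    and L: "\<And>s. s \<in> I \<Longrightarrow> hs (L s) D"
begin

abbreviation N :: "nat \<Rightarrow> 'g \<Rightarrow> 'g"
  where "N s \<equiv> (\<lambda>x. L s (adj (L s) x))"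

definition kop :: "(nat \<Rightarrow> int \<Rightarrow> int \<Rightarrow> complex) \<Rightarrow> 'g ell2 \<Rightarrow> 'g ell2"
  where "kop b u = R (\<Sum>s\<in>I. ker_op (b s) (N s) (R u))"

definition kb :: "(nat \<Rightarrow> int \<Rightarrow> int \<Rightarrow> complex) \<Rightarrow> real \<Rightarrow> bool"
  where "kb b C \<longleftrightarrow> (\<forall>s\<in>I. kbound (b s) C)"

definition M :: real
  where "M = \<rho> * (\<rho> * (real (card I) * (S * S * (D * D))))"

lemma bounded_clinear_R: "bounded_clinear R"
  using R(1) by (rule self_adjoint_bounded_clinear)

lemma bounded_clinear_L: "s \<in> I \<Longrightarrow> bounded_clinear (L s)"
  using L hs_bounded_clinear by blast

lemma hs_N:
  assumes "s \<in> I"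
  shows "hs (N s) (D * D)"
  by (rule hs_compose_left[OF bounded_clinear_L[OF assms] hs_norm_le[OF L[OF assms]]
        hs_nonneg[OF L[OF assms]] hs_adj[OF L[OF assms]]])

lemma bounded_clinear_N: "s \<in> I \<Longrightarrow> bounded_clinear (N s)"
  using hs_N hs_bounded_clinear by blast

lemma adj_N: "s \<in> I \<Longrightarrow> adj (N s) = N s"
  using self_adjoint_adj_comp[OF bounded_clinear_adj[OF bounded_clinear_L]]
  by (intro self_adjoint_adj) (simp add: adj_adj bounded_clinear_L)

lemma hs_kop:
  assumes "kb b C"
  shows "hs (kop b) (C * M)"
proof -
  have "hs (\<lambda>u. \<Sum>s\<in>I. ker_op (b s) (N s) u) (\<Sum>s\<in>I. C * (S * S * (D * D)))"
    using assms by (intro hs_setsum hs_ker_op hs_N) (auto simp: kb_def)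
  then have "hs (\<lambda>u. \<Sum>s\<in>I. ker_op (b s) (N s) u) (real (card I) * (C * (S * S * (D * D))))"
    by simp
  from hs_compose_left[OF bounded_clinear_R R(2,3)
      hs_compose_right[OF bounded_clinear_R R(2,3) this]]
  show ?thesis
    by (simp add: kop_def[abs_def] M_def mult_ac)
qed

lemma kop_add:
  assumes "kb a C" "kb b C'"
  shows "kop (\<lambda>s n m. a s n m + b s n m) u = kop a u + kop b u"
proof -
  have "(\<Sum>s\<in>I. ker_op (\<lambda>n m. a s n m + b s n m) (N s) (R u)) =
      (\<Sum>s\<in>I. ker_op (a s) (N s) (R u) + ker_op (b s) (N s) (R u))"
    using assms by (intro sum.cong refl ker_op_add[where C = C and D = C'] bounded_clinear_N)
      (auto simp: kb_def)
  then show ?thesis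
    by (simp add: kop_def sum.distrib bounded_clinear_plus[OF bounded_clinear_R])
qed

lemma kop_cmult:
  assumes "kb b C"
  shows "kop (\<lambda>s n m. c * b s n m) u = c *\<^sub>C kop b u"
proof -
  have "(\<Sum>s\<in>I. ker_op (\<lambda>n m. c * b s n m) (N s) (R u)) = (\<Sum>s\<in>I. c *\<^sub>C ker_op (b s) (N s) (R u))"
    using assms by (intro sum.cong refl ker_op_cmult[where C = C] bounded_clinear_N)
      (auto simp: kb_def)
  then show ?thesis
    by (simp add: kop_def bounded_clinear_scaleC[OF bounded_clinear_R]
        flip: complex_vector.scale_sum_right)
qed

lemma kb_cmult: "kb b C \<Longrightarrow> kb (\<lambda>s n m. c * b s n m) (cmod c * C)"
  by (auto simp: kb_def intro: kbound_cmult)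

lemma kb_add: "kb a C \<Longrightarrow> kb b C' \<Longrightarrow> kb (\<lambda>s n m. a s n m + b s n m) (C + C')"
  by (auto simp: kb_def intro: kbound_add)

lemma adj_kop:
  assumes b: "kb b C"
  shows "adj (kop b) = kop (\<lambda>s n m. cnj (b s m n))"
proof (rule adj_eqI)
  fix u v
  have 1: "cinner (ker_op (\<lambda>n m. cnj (b s m n)) (N s) x) y = cinner x (ker_op (b s) (N s) y)"
    if s: "s \<in> I" for s x y
  proof -
    have bs: "kbound (b s) C"
      using b s by (simp add: kb_def)
    show ?thesis
      using cinner_adj_left[OF hs_bounded_clinear[OF hs_ker_op[OF bs hs_N[OF s]]], of x y]
      by (simp add: adj_ker_op[OF bs hs_N[OF s]] adj_N[OF s])
  qed
  have "cinner (kop (\<lambda>s n m. cnj (b s m n)) v) u =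
      cinner (\<Sum>s\<in>I. ker_op (\<lambda>n m. cnj (b s m n)) (N s) (R v)) (R u)"
    unfolding kop_def by (rule self_adjoint_cinner[OF R(1)])
  also have "\<dots> = cinner (R v) (\<Sum>s\<in>I. ker_op (b s) (N s) (R u))"
    by (simp add: cinner.sum_left cinner.sum_right 1)
  also have "\<dots> = cinner v (kop b u)"
    unfolding kop_def by (rule self_adjoint_cinner[OF R(1)])
  finally show "cinner (kop (\<lambda>s n m. cnj (b s m n)) v) u = cinner v (kop b u)" .
qed

text \<open>For a symmetric kernel the adjoint has the entrywise conjugate kernel, so real and
  imaginary parts of the operator are taken entry by entry.\<close>

lemma
  assumes b: "kb b C" and sym: "\<And>s n m. b s n m = b s m n"
  shows re_op_kop: "re_op (kop b) = kop (\<lambda>s n m. complex_of_real (Re (b s n m)))"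
    and im_op_kop: "im_op (kop b) = kop (\<lambda>s n m. complex_of_real (Im (b s n m)))"
proof -
  have b': "kb (\<lambda>s n m. cnj (b s n m)) C"
    using b by (simp add: kb_def kbound_def)
  have adj: "adj (kop b) = kop (\<lambda>s n m. cnj (b s n m))"
    unfolding adj_kop[OF b] by (subst sym) (rule refl)
  have Re: "(\<lambda>s n m. complex_of_real (Re (b s n m))) = (\<lambda>s n m. (1 / 2) * (b s n m + cnj (b s n m)))"
    and Im: "(\<lambda>s n m. complex_of_real (Im (b s n m))) =
      (\<lambda>s n m. (1 / (2 * \<i>)) * (b s n m + (- 1) * cnj (b s n m)))"
    by (intro ext; simp add: complex_eq_iff)+
  show "re_op (kop b) = kop (\<lambda>s n m. complex_of_real (Re (b s n m)))"
    unfolding Re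
    by (rule ext) (simp only: re_op_def adj kop_cmult[OF kb_add[OF b b']] kop_add[OF b b'])
  show "im_op (kop b) = kop (\<lambda>s n m. complex_of_real (Im (b s n m)))"
    unfolding Im
    by (rule ext) (simp only: im_op_def adj kop_cmult[OF kb_add[OF b kb_cmult[OF b']]]
        kop_add[OF b kb_cmult[OF b']] kop_cmult[OF b'] scaleC.minus_left scaleC_1
        diff_conv_add_uminus)
qed

lemma self_adjoint_kop:
  assumes "kb b C" "\<And>s n m. b s n m = cnj (b s m n)"
  shows "self_adjoint (kop b)"
proof -
  have bk: "bounded_clinear (kop b)"
    using hs_bounded_clinear[OF hs_kop[OF assms(1)]] .
  have "adj (kop b) = kop b"
    unfolding adj_kop[OF assms(1)] by (simp flip: assms(2))
  then show ?thesis
    using cinner_adj_left[OF bk] bk by (simp add: self_adjoint_def)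
qed

text \<open>The factor of a product kernel in one channel: \<open>Y\<^sup>* Y\<close> is the kernel
  operator on the lattice, \<open>Y Y\<^sup>*\<close> is, up to a scalar, the effective operator on
  the fibre.\<close>

definition Y :: "nat \<Rightarrow> (int \<Rightarrow> complex) \<Rightarrow> 'g ell2 \<Rightarrow> 'g"
  where "Y s p u = adj (L s) (row p (R u))"

lemma hs_Y:
  assumes s: "s \<in> I" and p: "\<And>n. cmod (p n) \<le> \<sigma> n"
  shows "hs (Y s p) (\<rho> * (S * D))"
  using hs_compose_right[OF bounded_clinear_R R(2,3) hs_compose_right[OF
        bounded_clinear_row[OF kbound_l2[OF p]] norm_row_le[OF kbound_l2[OF p]] S_nonneg
        hs_adj[OF L[OF s]]]]
  by (simp add: Y_def[abs_def])

lemma ker_op_rank_one_sandwich: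
  assumes s: "s \<in> I" and p: "\<And>n. cmod (p n) \<le> \<sigma> n"
  shows "R (ker_op (\<lambda>n m. cnj (p n) * p m) (N s) (R u)) = adj (Y s p) (Y s p u)"
proof -
  note bp = bounded_clinear_row[OF kbound_l2[OF p]]
  have "bounded_clinear (\<lambda>u. adj (L s) (row p u))"
    by (rule bounded_clinear_compose[OF bounded_clinear_adj[OF bounded_clinear_L[OF s]] bp])
  from adj_compose[OF this bounded_clinear_R]
  have "adj (Y s p) = (\<lambda>x. R (adj (\<lambda>u. adj (L s) (row p u)) x))"
    by (simp add: Y_def[abs_def] self_adjoint_adj[OF R(1)])
  then show ?thesis
    by (simp add: ker_op_rank_one[OF p bounded_clinear_L[OF s]] Y_def)
qed

lemma kop_rank_one:
  assumes s: "s \<in> I" and p: "\<And>n. cmod (p n) \<le> \<sigma> n"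
  shows "kop (\<lambda>t n m. if t = s then cnj (p n) * p m else 0) u = adj (Y s p) (Y s p u)"
proof -
  have 0: "ker_op (\<lambda>n m. 0) (N t) v = 0" if "t \<in> I" for t v
    using ker_op_cmult[OF kbound_rank_one[of "\<lambda>_. 0"] bounded_clinear_N[OF that], of 0 v] weight_nonneg
    by simp
  have "(\<Sum>t\<in>I. ker_op (\<lambda>n m. if t = s then cnj (p n) * p m else 0) (N t) (R u)) =
      (\<Sum>t\<in>I. if t = s then ker_op (\<lambda>n m. cnj (p n) * p m) (N s) (R u) else 0)"
    by (intro sum.cong refl) (simp add: 0)
  then show ?thesis
    using s finite_I by (simp add: kop_def ker_op_rank_one_sandwich[OF s p])
qed

lemma kop_rank_two:
  assumes p: "\<And>s n. cmod (p s n) \<le> \<sigma> n" and q: "\<And>s n. cmod (q s n) \<le> \<sigma> n"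
  shows "kop (\<lambda>s n m. complex_of_real (\<gamma> s) * (cnj (p s n) * p s m + cnj (q s n) * q s m)) u =
    (\<Sum>s\<in>I. \<gamma> s *\<^sub>R (adj (Y s (p s)) (Y s (p s) u) + adj (Y s (q s)) (Y s (q s) u)))"
proof -
  have "R (ker_op (\<lambda>n m. complex_of_real (\<gamma> s) * (cnj (p s n) * p s m + cnj (q s n) * q s m)) (N s) (R u)) =
      \<gamma> s *\<^sub>R (adj (Y s (p s)) (Y s (p s) u) + adj (Y s (q s)) (Y s (q s) u))" if s: "s \<in> I" for s
    by (simp add: ker_op_cmult[OF kbound_add[OF kbound_rank_one[OF p] kbound_rank_one[OF q]] bounded_clinear_N[OF s]]
        ker_op_add[OF kbound_rank_one[OF p] kbound_rank_one[OF q] bounded_clinear_N[OF s]]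
        bounded_clinear_plus[OF bounded_clinear_R] bounded_clinear_scaleR[OF bounded_clinear_R]
        ker_op_rank_one_sandwich[OF s p] ker_op_rank_one_sandwich[OF s q] scaleC_of_real)
  then show ?thesis
    by (simp add: kop_def bounded_clinear_sum[OF bounded_clinear_R])
qed

text \<open>Each term is a nonnegative multiple of \<open>Y\<^sup>* Y\<close> with \<open>Y\<close>
  Hilbert-Schmidt, so its trace is controlled by a squared Hilbert-Schmidt norm; two such terms per
  channel give the factor 2.\<close>

lemma
  assumes p: "\<And>s n. cmod (p s n) \<le> \<sigma> n" and q: "\<And>s n. cmod (q s n) \<le> \<sigma> n"
    and \<gamma>: "\<And>s. s \<in> I \<Longrightarrow> 0 \<le> \<gamma> s \<and> \<gamma> s \<le> C"
  defines "B \<equiv> kop (\<lambda>s n m. complex_of_real (\<gamma> s) * (cnj (p s n) * p s m + cnj (q s n) * q s m))"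
  shows hsa_kop_rank_two: "hsa B"
    and kop_rank_two_nonneg: "\<And>u. 0 \<le> Re (cinner u (B u))"
    and kop_rank_two_trace: "\<And>F. finite F \<Longrightarrow> orthonormal F \<Longrightarrow>
      (\<Sum>f\<in>F. Re (cinner f (B f))) \<le> C * (2 * real (card I) * (\<rho> * (S * D))\<^sup>2)"
proof -
  note B = kop_rank_two[of p q \<gamma>, OF p q, folded B_def]
  have Yp: "hs (Y s (p s)) (\<rho> * (S * D))" and Yq: "hs (Y s (q s)) (\<rho> * (S * D))" if "s \<in> I" for s
    by (intro hs_Y[OF that] p q)+
  have form: "Re (cinner u (B u)) = (\<Sum>s\<in>I. \<gamma> s * ((norm (Y s (p s) u))\<^sup>2 + (norm (Y s (q s) u))\<^sup>2))" for u
    unfolding B cinner.sum_right Re_sum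
    by (intro sum.cong refl) (simp add: cinner.scaleR_right cinner.add_right
        Re_cinner_adj_comp[OF hs_bounded_clinear[OF Yp]] Re_cinner_adj_comp[OF hs_bounded_clinear[OF Yq]])
  show "0 \<le> Re (cinner u (B u))" for u
    unfolding form using \<gamma> by (intro sum_nonneg mult_nonneg_nonneg) auto
  have "hsa (\<lambda>u. \<Sum>s\<in>J. \<gamma> s *\<^sub>R (adj (Y s (p s)) (Y s (p s) u) + adj (Y s (q s)) (Y s (q s) u)))"
    if "finite J" "J \<subseteq> I" for J
    using that
  proof (induction J rule: finite_induct)
    case (insert s J)
    then show ?case
      by (simp add: hsa_add hsa_scaleR hsa_adj_comp[OF Yp] hsa_adj_comp[OF Yq])
  qed (simp add: hsa_0)
  from this[OF finite_I subset_refl] show "hsa B"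
    unfolding B[symmetric] by simp
  show "(\<Sum>f\<in>F. Re (cinner f (B f))) \<le> C * (2 * real (card I) * (\<rho> * (S * D))\<^sup>2)"
    if F: "finite F" "orthonormal F" for F
  proof -
    have "(\<Sum>f\<in>F. Re (cinner f (B f))) =
        (\<Sum>s\<in>I. \<gamma> s * ((\<Sum>f\<in>F. (norm (Y s (p s) f))\<^sup>2) + (\<Sum>f\<in>F. (norm (Y s (q s) f))\<^sup>2)))"
      unfolding form by (subst sum.swap) (simp add: sum.distrib flip: sum_distrib_left)
    also have "\<dots> \<le> (\<Sum>s\<in>I. C * ((\<rho> * (S * D))\<^sup>2 + (\<rho> * (S * D))\<^sup>2))"
    proof (intro sum_mono mult_mono add_mono)
      fix s
      assume s: "s \<in> I"
      show "\<gamma> s \<le> C" "0 \<le> C"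
        using \<gamma>[OF s] by auto
      show "(\<Sum>f\<in>F. (norm (Y s (p s) f))\<^sup>2) \<le> (\<rho> * (S * D))\<^sup>2"
        "(\<Sum>f\<in>F. (norm (Y s (q s) f))\<^sup>2) \<le> (\<rho> * (S * D))\<^sup>2"
        by (intro hs_sum_le[OF Yp[OF s] F] hs_sum_le[OF Yq[OF s] F])+
    qed (auto intro!: add_nonneg_nonneg sum_nonneg)
    finally show ?thesis
      by (simp add: mult_ac)
  qed
qed

end


section \<open>The Green function of the discrete Laplacian\<close>

lemma summable_on_int_abs:
  fixes f :: "nat \<Rightarrow> real"
  assumes f: "\<And>n. 0 \<le> f n" "summable f"
  shows "(\<lambda>n :: int. f (nat \<bar>n\<bar>)) summable_on UNIV"
proof -
  let ?neg = "\<lambda>n. - int (Suc n)"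
  have "(\<lambda>n :: int. f (nat \<bar>n\<bar>)) summable_on range int"
    using f by (subst summable_on_reindex)
      (simp_all add: comp_def summable_on_UNIV_nonneg_real_iff)
  moreover have "(\<lambda>n :: int. f (nat \<bar>n\<bar>)) summable_on range ?neg"
  proof (subst summable_on_reindex)
    show "inj ?neg" by (rule injI) simp
    have "(\<lambda>n :: int. f (nat \<bar>n\<bar>)) \<circ> ?neg = (\<lambda>n. f (Suc n))"
      by (simp add: fun_eq_iff nat_add_distrib)
    then show "((\<lambda>n :: int. f (nat \<bar>n\<bar>)) \<circ> ?neg) summable_on UNIV"
      using f by (simp add: summable_on_UNIV_nonneg_real_iff summable_Suc_iff)
  qed
  moreover have "range int \<inter> range ?neg = {}"
    by auto
  ultimately have "(\<lambda>n :: int. f (nat \<bar>n\<bar>)) summable_on (range int \<union> range ?neg)"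
    by (rule summable_on_Un_disjoint)
  also have "range int \<union> range ?neg = UNIV"
  proof (intro equalityI subsetI)
    fix n :: int
    show "n \<in> range int \<union> range ?neg"
      by (cases n) auto
  qed simp
  finally show ?thesis .
qed

lemma l2_le_of_summable:
  assumes f: "(\<lambda>n. f n) summable_on (UNIV :: int set)" and b: "\<And>n. (cmod (b n))\<^sup>2 \<le> f n"
  obtains C where "l2_le b C"
proof
  have nonneg: "0 \<le> f n" for n
    using b[of n] zero_le_power2 order_trans by blast
  show "l2_le b (sqrt (infsum f UNIV))"
  proof (rule l2_leI)
    show "0 \<le> sqrt (infsum f UNIV)"
      using nonneg by (simp add: infsum_nonneg)
    fix F :: "int set"
    assume "finite F"
    have "(\<Sum>m\<in>F. (cmod (b m))\<^sup>2) \<le> sum f F"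
      by (intro sum_mono b)
    also have "\<dots> \<le> infsum f UNIV"
      using f \<open>finite F\<close> nonneg by (intro finite_sum_le_infsum) auto
    finally show "(\<Sum>m\<in>F. (cmod (b m))\<^sup>2) \<le> (sqrt (infsum f UNIV))\<^sup>2"
      using nonneg by (simp add: infsum_nonneg)
  qed
qed

lemma l2_le_geometric:
  assumes "cmod k < 1"
  obtains C where "l2_le (\<lambda>m. k ^ nat \<bar>m - n\<bar>) C"
proof -
  have "(\<lambda>m :: int. ((cmod k)\<^sup>2) ^ nat \<bar>m\<bar>) summable_on UNIV"
    using assms by (intro summable_on_int_abs summable_geometric) (simp_all add: power_less_one_iff abs_square_less_1)
  moreover have "bij_betw (\<lambda>m :: int. m - n) UNIV UNIV"
    by (rule bij_betw_byWitness[of _ "\<lambda>m. m + n"]) auto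
  ultimately have "(\<lambda>m. ((cmod k)\<^sup>2) ^ nat \<bar>m - n\<bar>) summable_on UNIV"
    using summable_on_reindex_bij_betw[of "\<lambda>m. m - n" UNIV UNIV "\<lambda>m. ((cmod k)\<^sup>2) ^ nat \<bar>m\<bar>"] by blast
  then show ?thesis
    by (rule l2_le_of_summable[of _ "\<lambda>m. k ^ nat \<bar>m - n\<bar>"])
      (auto simp: norm_power power_mult[symmetric] mult.commute intro: that)
qed

text \<open>The extra factor absorbs the linear growth of the Green kernel, because 1 + |n - m| <=
  (1 + |n|)(1 + |m|).\<close>

definition psi_weight :: "real \<Rightarrow> int \<Rightarrow> real"
  where "psi_weight \<nu> n = psi \<nu> n * (1 + \<bar>real_of_int n\<bar>)"

lemma psi_nonneg: "0 \<le> psi \<nu> n"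
  by (simp add: psi_def)

lemma psi_le_1:
  assumes "0 \<le> \<nu>"
  shows "psi \<nu> n \<le> 1"
proof -
  have "1 powr (- \<nu> / 2) \<ge> sqrt (1 + (of_int n)\<^sup>2) powr (- \<nu> / 2)"
    using assms by (intro powr_mono2') auto
  then show ?thesis
    by (simp add: psi_def)
qed

lemma psi_le_psi_weight: "psi \<nu> n \<le> psi_weight \<nu> n"
  using psi_nonneg[of \<nu> n] by (simp add: psi_weight_def mult_le_cancel_left1)

text \<open>The squared weight is of order |n|^(2 - nu), which is summable exactly for nu >
  3.\<close>

lemma psi_weight_l2:
  assumes "3 < \<nu>"
  obtains S where "weight (psi_weight \<nu>) S"
proof -
  define f where "f k = 2 powr \<nu> * (real (Suc k) powr (2 - \<nu>))" for k
  have "summable (\<lambda>k. real k powr (2 - \<nu>))"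
    using assms by (simp add: summable_real_powr_iff)
  then have "summable (\<lambda>k. real (Suc k) powr (2 - \<nu>))"
    by (subst summable_Suc_iff)
  then have "summable f"
    unfolding f_def by (rule summable_mult)
  then have "(\<lambda>n :: int. f (nat \<bar>n\<bar>)) summable_on UNIV"
    by (rule summable_on_int_abs[rotated]) (simp add: f_def)
  moreover have "(cmod (complex_of_real (psi_weight \<nu> n)))\<^sup>2 \<le> f (nat \<bar>n\<bar>)" for n
  proof -
    define a where "a = 1 + \<bar>real_of_int n\<bar>"
    have a: "1 \<le> a" "real (Suc (nat \<bar>n\<bar>)) = a"
      by (simp_all add: a_def)
    have "(a / 2)\<^sup>2 \<le> 1 + (real_of_int n)\<^sup>2"
    proof -
      have "a\<^sup>2 \<le> 2 + 2 * (real_of_int n)\<^sup>2"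
        using sum_squares_bound[of 1 "\<bar>real_of_int n\<bar>"] by (simp add: a_def power2_sum)
      moreover have "0 \<le> (real_of_int n)\<^sup>2" by simp
      ultimately have "a\<^sup>2 / 4 \<le> 1 + (real_of_int n)\<^sup>2"
        by linarith
      then show ?thesis
        by (simp add: power_divide)
    qed
    then have "a / 2 \<le> sqrt (1 + (real_of_int n)\<^sup>2)"
      by (rule real_le_rsqrt)
    then have "psi \<nu> n \<le> (a / 2) powr (- \<nu> / 2)"
      unfolding psi_def using assms a by (intro powr_mono2') auto
    then have "(psi \<nu> n)\<^sup>2 \<le> ((a / 2) powr (- \<nu> / 2))\<^sup>2"
      by (intro power_mono psi_nonneg)
    also have "\<dots> = (a / 2) powr (- \<nu>)"
      by (simp add: power2_eq_square flip: powr_add)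
    also have "\<dots> = 2 powr \<nu> * a powr (- \<nu>)"
      using a by (simp add: powr_divide powr_minus field_simps)
    finally have "(psi \<nu> n)\<^sup>2 * a\<^sup>2 \<le> 2 powr \<nu> * a powr (- \<nu>) * a\<^sup>2"
      by (intro mult_right_mono) auto
    also have "\<dots> = 2 powr \<nu> * a powr (2 - \<nu>)"
      using a by (simp add: powr_add[of a 2 "- \<nu>", simplified] powr_numeral)
    also have "\<dots> = f (nat \<bar>n\<bar>)"
      by (simp only: f_def a)
    also have "(psi \<nu> n)\<^sup>2 * a\<^sup>2 = (cmod (complex_of_real (psi_weight \<nu> n)))\<^sup>2"
      by (simp only: norm_of_real psi_weight_def a_def power2_abs power_mult_distrib)
    finally show ?thesis .
  qed
  ultimately obtain S where "l2_le (\<lambda>n. complex_of_real (psi_weight \<nu> n)) S"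
    by (rule l2_le_of_summable)
  then have "weight (psi_weight \<nu>) S"
    using psi_nonneg by unfold_locales (auto simp: psi_weight_def)
  then show ?thesis by (rule that)
qed

text \<open>The root \<open>k\<close> is the parameter instead of the energy, so that one formula
  covers complex energies and boundary values.\<close>

definition green :: "real \<Rightarrow> complex \<Rightarrow> nat \<Rightarrow> complex"
  where "green h k j = complex_of_real (h\<^sup>2) / (1 / k - k) * k ^ j"

text \<open>Off the origin a power of \<open>k\<close> solves the recurrence, as
  \<open>k + 1 / k = 2 - z * h\<^sup>2\<close>; at the origin both neighbours carry
  \<open>k\<close>, and the prefactor normalizes the resulting \<open>1 / k - k\<close> to
  1.\<close>

lemma green_equation:
  fixes z :: complex
  assumes h: "0 < h" and root: "k\<^sup>2 - 2 * (1 - z * complex_of_real (h\<^sup>2) / 2) * k + 1 = 0" and k: "k \<noteq> 0" "k\<^sup>2 \<noteq> 1"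
  shows "(1 / complex_of_real (h\<^sup>2)) * (2 * green h k (nat \<bar>n\<bar>) - green h k (nat \<bar>n + 1\<bar>) - green h k (nat \<bar>n - 1\<bar>)) -
    z * green h k (nat \<bar>n\<bar>) = (if n = 0 then 1 else 0)"
proof -
  define c where "c = complex_of_real (h\<^sup>2) / (1 / k - k)"
  have ne: "1 / k - k \<noteq> 0"
    using k by (simp add: field_simps power2_eq_square)
  have sym: "2 - z * complex_of_real (h\<^sup>2) = k + 1 / k"
  proof -
    define t where "t = 2 - z * complex_of_real (h\<^sup>2)"
    have "2 * (1 - z * complex_of_real (h\<^sup>2) / 2) = t"
      by (simp add: t_def)
    then have "k\<^sup>2 - t * k + 1 = 0"
      using root by simp
    then have "t = k + 1 / k"
      using k by (simp add: field_simps power2_eq_square)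
    then show ?thesis
      by (simp add: t_def)
  qed
  have step: "(1 / complex_of_real (h\<^sup>2)) * (2 * (c * k ^ Suc j) - c * k ^ Suc (Suc j) - c * k ^ j) - z * (c * k ^ Suc j) = 0" for j
  proof -
    have "(2 - z * complex_of_real (h\<^sup>2)) * k ^ Suc j - k ^ Suc (Suc j) - k ^ j = 0"
      unfolding sym using k by (simp add: field_simps)
    then have "c / complex_of_real (h\<^sup>2) * ((2 - z * complex_of_real (h\<^sup>2)) * k ^ Suc j - k ^ Suc (Suc j) - k ^ j) = 0"
      by simp
    then show ?thesis
      using h by (simp add: field_simps)
  qed
  consider "n = 0" | "0 < n" | "n < 0"
    by linarith
  then show ?thesis
  proof cases
    case 1
    have "(1 / complex_of_real (h\<^sup>2)) * (2 * c - c * k - c * k) - z * c = c / complex_of_real (h\<^sup>2) * ((2 - z * complex_of_real (h\<^sup>2)) - 2 * k)"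
      using h by (simp add: field_simps)
    also have "\<dots> = c / complex_of_real (h\<^sup>2) * (1 / k - k)"
      unfolding sym by simp
    also have "\<dots> = 1"
      using ne h by (simp add: c_def)
    finally show ?thesis
      using 1 by (simp add: green_def c_def)
  next
    case 2
    define j where "j = nat n - 1"
    from 2 have "nat \<bar>n\<bar> = Suc j" "nat \<bar>n + 1\<bar> = Suc (Suc j)" "nat \<bar>n - 1\<bar> = j"
      by (auto simp: j_def)
    then show ?thesis
      using step[of j] 2 unfolding green_def c_def by simp
  next
    case 3
    define j where "j = nat (- n) - 1"
    from 3 have "nat \<bar>n\<bar> = Suc j" "nat \<bar>n - 1\<bar> = Suc (Suc j)" "nat \<bar>n + 1\<bar> = j"
      by (auto simp: j_def)
    then show ?thesis
      using step[of j] 3 unfolding green_def c_def by (simp add: algebra_simps)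
  qed
qed

text \<open>The roots have product 1. Imaginary parts in \<open>k + 1 / k = 2 * \<zeta>\<close> give
  Im k (1 - 1/|k|^2) = 2 Im zeta: no root is on the unit circle, and one inside lies in the upper
  half-plane. Energies above the real axis correspond to \<open>Im \<zeta> < 0\<close>.\<close>

lemma root_exists:
  fixes \<zeta> :: complex
  assumes "Im \<zeta> < 0"
  shows "\<exists>k. k\<^sup>2 - 2 * \<zeta> * k + 1 = 0 \<and> k \<noteq> 0 \<and> cmod k < 1 \<and> 0 < Im k"
proof -
  have root: "\<exists>k'. k' * k = 1 \<and> k'\<^sup>2 - 2 * \<zeta> * k' + 1 = 0"
    if "k\<^sup>2 - 2 * \<zeta> * k + 1 = 0" for k
    using that by (intro exI[of _ "2 * \<zeta> - k"]) (auto simp: algebra_simps power2_eq_square)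
  define k1 where "k1 = \<zeta> + csqrt (\<zeta>\<^sup>2 - 1)"
  have r1: "k1\<^sup>2 - 2 * \<zeta> * k1 + 1 = 0"
  proof -
    have "k1\<^sup>2 - 2 * \<zeta> * k1 + 1 = (csqrt (\<zeta>\<^sup>2 - 1))\<^sup>2 - (\<zeta>\<^sup>2 - 1)"
      unfolding k1_def by (simp add: algebra_simps power2_eq_square del: csqrt_square)
    then show ?thesis by simp
  qed
  obtain k2 where k2: "k2 * k1 = 1" "k2\<^sup>2 - 2 * \<zeta> * k2 + 1 = 0"
    using root[OF r1] by blast
  have Im: "Im k * (1 - 1 / (cmod k)\<^sup>2) = 2 * Im \<zeta>" if k: "k\<^sup>2 - 2 * \<zeta> * k + 1 = 0" for k
  proof -
    have "k \<noteq> 0"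
      using k by auto
    then have "k + 1 / k = 2 * \<zeta>"
      using k by (simp add: field_simps power2_eq_square)
    then have "Im (k + 1 / k) = 2 * Im \<zeta>"
      by simp
    moreover have "Im (1 / k) = - Im k / (cmod k)\<^sup>2"
      by (simp add: Im_divide cmod_power2)
    ultimately show ?thesis
      by (simp add: algebra_simps)
  qed
  have ne1: "cmod k \<noteq> 1" if "k\<^sup>2 - 2 * \<zeta> * k + 1 = 0" for k
    using Im[OF that] assms by auto
  have "cmod k2 * cmod k1 = 1"
    using k2(1) by (metis norm_mult norm_one)
  have "cmod k1 < 1 \<or> cmod k2 < 1"
  proof (rule ccontr)
    assume "\<not> (cmod k1 < 1 \<or> cmod k2 < 1)"
    then have "1 * 1 < cmod k2 * cmod k1"
      using ne1[OF r1] ne1[OF k2(2)] by (intro mult_strict_mono) auto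
    then show False
      using \<open>cmod k2 * cmod k1 = 1\<close> by simp
  qed
  then obtain k where k: "k\<^sup>2 - 2 * \<zeta> * k + 1 = 0" "cmod k < 1"
    using r1 k2(2) by blast
  have "k \<noteq> 0"
    using k by auto
  then have "1 / (cmod k)\<^sup>2 > 1"
    using k(2) by (simp add: abs_square_less_1)
  then have "0 < Im k"
    using Im[OF k(1)] assms by (smt (verit) mult_nonpos_nonpos)
  with k \<open>k \<noteq> 0\<close> show ?thesis by blast
qed

text \<open>The limit, from the lower half-plane, of the root of \<open>k\<^sup>2 - 2 \<zeta> k + 1\<close> in the unit disc.\<close>

definition kbdry :: "real \<Rightarrow> complex"
  where "kbdry \<zeta> = (if \<bar>\<zeta>\<bar> < 1 then Complex \<zeta> (sqrt (1 - \<zeta>\<^sup>2))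
    else complex_of_real (if \<zeta> > 1 then \<zeta> - sqrt (\<zeta>\<^sup>2 - 1) else \<zeta> + sqrt (\<zeta>\<^sup>2 - 1)))"

section \<open>Boundary values of the root\<close>

lemma kbdry_uminus: "1 < \<zeta> \<Longrightarrow> kbdry (- \<zeta>) = - kbdry \<zeta>"
  by (simp add: kbdry_def)

lemma kbdry_gt_1:
  assumes "1 < \<zeta>"
  defines "\<kappa> \<equiv> \<zeta> - sqrt (\<zeta>\<^sup>2 - 1)"
  shows "kbdry \<zeta> = complex_of_real \<kappa>" "0 < \<kappa>" "\<kappa> < 1" "\<kappa>\<^sup>2 - 2 * \<zeta> * \<kappa> + 1 = 0"
    "1 / \<kappa> - \<kappa> = 2 * sqrt (\<zeta>\<^sup>2 - 1)" "cmod (kbdry \<zeta>) < 1"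
proof -
  have sq: "1 < \<zeta>\<^sup>2"
    using assms by (simp add: one_less_power)
  then have s: "(sqrt (\<zeta>\<^sup>2 - 1))\<^sup>2 = \<zeta>\<^sup>2 - 1"
    by simp
  show kb: "kbdry \<zeta> = complex_of_real \<kappa>"
    using assms by (simp add: kbdry_def)
  have "sqrt (\<zeta>\<^sup>2 - 1) < \<zeta>"
    using assms by (intro real_less_lsqrt) auto
  then show pos: "0 < \<kappa>"
    by (simp add: \<kappa>_def)
  show root: "\<kappa>\<^sup>2 - 2 * \<zeta> * \<kappa> + 1 = 0"
    unfolding \<kappa>_def using s by (simp add: power2_eq_square algebra_simps)
  have "(\<zeta> - 1)\<^sup>2 < \<zeta>\<^sup>2 - 1"
    using assms by (simp add: power2_eq_square algebra_simps)
  then have "\<zeta> - 1 < sqrt (\<zeta>\<^sup>2 - 1)"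
    by (rule real_less_rsqrt)
  then show "\<kappa> < 1"
    by (simp add: \<kappa>_def)
  then show "cmod (kbdry \<zeta>) < 1"
    using pos by (simp only: kb norm_of_real)
  have "1 / \<kappa> = \<zeta> + sqrt (\<zeta>\<^sup>2 - 1)"
    using pos s unfolding \<kappa>_def by (simp add: field_simps power2_eq_square)
  then show "1 / \<kappa> - \<kappa> = 2 * sqrt (\<zeta>\<^sup>2 - 1)"
    by (simp add: \<kappa>_def)
qed

lemma kbdry_lt_1:
  assumes "\<bar>\<zeta>\<bar> < 1"
  shows "cmod (kbdry \<zeta>) = 1" "Re (kbdry \<zeta>) = \<zeta>" "Im (kbdry \<zeta>) = sqrt (1 - \<zeta>\<^sup>2)" "0 < Im (kbdry \<zeta>)"
    "(kbdry \<zeta>)\<^sup>2 - 2 * complex_of_real \<zeta> * kbdry \<zeta> + 1 = 0" "1 / kbdry \<zeta> = cnj (kbdry \<zeta>)"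
proof -
  have sq: "\<zeta>\<^sup>2 < 1"
    using assms by (simp add: abs_square_less_1)
  show re: "Re (kbdry \<zeta>) = \<zeta>" and im: "Im (kbdry \<zeta>) = sqrt (1 - \<zeta>\<^sup>2)"
    using assms by (simp_all add: kbdry_def)
  then show "0 < Im (kbdry \<zeta>)"
    using sq by simp
  show n: "cmod (kbdry \<zeta>) = 1"
    using sq by (simp add: cmod_def re im)
  show inv: "1 / kbdry \<zeta> = cnj (kbdry \<zeta>)"
    using n by (simp add: divide_conv_cnj)
  show "(kbdry \<zeta>)\<^sup>2 - 2 * complex_of_real \<zeta> * kbdry \<zeta> + 1 = 0"
    using sq by (simp add: complex_eq_iff re im power2_eq_square)
qed

lemma
  assumes "\<bar>\<zeta>\<bar> \<noteq> 1"
  shows kbdry_root: "(kbdry \<zeta>)\<^sup>2 - 2 * complex_of_real \<zeta> * kbdry \<zeta> + 1 = 0"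
    and kbdry_norm: "cmod (kbdry \<zeta>) \<le> 1" and kbdry_nonzero: "kbdry \<zeta> \<noteq> 0"
    and kbdry_diff: "cmod (1 / kbdry \<zeta> - kbdry \<zeta>) = 2 * sqrt \<bar>\<zeta>\<^sup>2 - 1\<bar>"
proof -
  have pos: "(kbdry \<zeta>)\<^sup>2 - 2 * complex_of_real \<zeta> * kbdry \<zeta> + 1 = 0 \<and> cmod (kbdry \<zeta>) \<le> 1" if "1 < \<zeta>" for \<zeta>
  proof -
    have "complex_of_real ((\<zeta> - sqrt (\<zeta>\<^sup>2 - 1))\<^sup>2 - 2 * \<zeta> * (\<zeta> - sqrt (\<zeta>\<^sup>2 - 1)) + 1) = 0"
      using kbdry_gt_1(4)[OF that] by simp
    then show ?thesis
      using kbdry_gt_1(6)[OF that] by (simp add: kbdry_gt_1(1)[OF that])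
  qed
  consider "\<bar>\<zeta>\<bar> < 1" | "1 < \<zeta>" | "1 < - \<zeta>"
    using assms by linarith
  then have "(kbdry \<zeta>)\<^sup>2 - 2 * complex_of_real \<zeta> * kbdry \<zeta> + 1 = 0 \<and> cmod (kbdry \<zeta>) \<le> 1"
  proof cases
    case 1
    then show ?thesis
      using kbdry_lt_1 by simp
  next
    case 2
    then show ?thesis by (rule pos)
  next
    case 3
    then show ?thesis
      using pos[OF 3] kbdry_uminus[OF 3] by simp
  qed
  then show root: "(kbdry \<zeta>)\<^sup>2 - 2 * complex_of_real \<zeta> * kbdry \<zeta> + 1 = 0" and "cmod (kbdry \<zeta>) \<le> 1"
    by auto
  then show ne: "kbdry \<zeta> \<noteq> 0"
    by auto
  have "kbdry \<zeta> + 1 / kbdry \<zeta> = 2 * \<zeta>"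
    using root ne by (simp add: field_simps power2_eq_square)
  \<comment> \<open>This determines the modulus of the prefactor from the sum of the two roots, on
    and off the band alike.\<close>
  moreover have "(1 / kbdry \<zeta> - kbdry \<zeta>)\<^sup>2 = (kbdry \<zeta> + 1 / kbdry \<zeta>)\<^sup>2 - 4"
    using ne by (simp add: power2_eq_square field_simps)
  ultimately have "(1 / kbdry \<zeta> - kbdry \<zeta>)\<^sup>2 = complex_of_real (4 * (\<zeta>\<^sup>2 - 1))"
    by (simp add: power2_eq_square)
  then have "(cmod (1 / kbdry \<zeta> - kbdry \<zeta>))\<^sup>2 = 4 * \<bar>\<zeta>\<^sup>2 - 1\<bar>"
    by (metis abs_mult abs_numeral norm_of_real norm_power)
  then have "cmod (1 / kbdry \<zeta> - kbdry \<zeta>) = sqrt (4 * \<bar>\<zeta>\<^sup>2 - 1\<bar>)"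
    by (metis norm_ge_zero real_sqrt_unique)
  then show "cmod (1 / kbdry \<zeta> - kbdry \<zeta>) = 2 * sqrt \<bar>\<zeta>\<^sup>2 - 1\<bar>"
    by (simp add: real_sqrt_mult)
qed

text \<open>\<open>(k - k\<^sub>0) (k - 1 / k\<^sub>0) = 2 (w - \<zeta>) k\<close>, and \<open>k\<close> stays away from the other root \<open>1 / k\<^sub>0\<close>.\<close>

lemma kbdry_approx:
  assumes "\<bar>\<zeta>\<bar> \<noteq> 1"
  obtains \<delta> where "0 < \<delta>"
    "\<And>w k. k\<^sup>2 - 2 * w * k + 1 = 0 \<Longrightarrow> cmod k < 1 \<Longrightarrow> 0 < Im k \<Longrightarrow>
      cmod (k - kbdry \<zeta>) \<le> 2 * cmod (w - \<zeta>) / \<delta>"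
proof -
  note ne = kbdry_nonzero[OF assms] and root = kbdry_root[OF assms]
  have approx: "cmod (k - kbdry \<zeta>) \<le> 2 * cmod (w - \<zeta>) / \<delta>"
    if k: "k\<^sup>2 - 2 * w * k + 1 = 0" "cmod k < 1" and \<delta>: "0 < \<delta>" "\<delta> \<le> cmod (k - 1 / kbdry \<zeta>)" for k w \<delta>
  proof -
    have sum: "kbdry \<zeta> + 1 / kbdry \<zeta> = 2 * \<zeta>"
      using root ne by (simp add: field_simps power2_eq_square)
    have "(k - kbdry \<zeta>) * (k - 1 / kbdry \<zeta>) = k\<^sup>2 - (kbdry \<zeta> + 1 / kbdry \<zeta>) * k + 1"
      using ne by (simp add: field_simps power2_eq_square)
    also have "\<dots> = 2 * (w - \<zeta>) * k"
      unfolding sum using k(1) by (simp add: algebra_simps)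
    finally have "cmod (k - kbdry \<zeta>) * cmod (k - 1 / kbdry \<zeta>) = 2 * cmod (w - \<zeta>) * cmod k"
      by (metis norm_mult norm_numeral)
    also have "\<dots> \<le> 2 * cmod (w - \<zeta>) * 1"
      using k(2) by (intro mult_left_mono) auto
    finally have "cmod (k - kbdry \<zeta>) * \<delta> \<le> 2 * cmod (w - \<zeta>)"
      using \<delta> mult_left_mono[OF \<delta>(2), of "cmod (k - kbdry \<zeta>)"] by simp
    then show ?thesis
      using \<delta> by (simp add: field_simps)
  qed
  show ?thesis
  proof (cases "\<bar>\<zeta>\<bar> < 1")
    case True
    \<comment> \<open>The other root is the conjugate, below the real axis, while \<open>k\<close>
      is above it.\<close>
    have "Im (kbdry \<zeta>) \<le> cmod (k - 1 / kbdry \<zeta>)" if "0 < Im k" for k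
      using abs_Im_le_cmod[of "k - 1 / kbdry \<zeta>"] that
      by (simp add: kbdry_lt_1(6)[OF True])
    then show ?thesis
      using approx kbdry_lt_1(4)[OF True] by (intro that[of "Im (kbdry \<zeta>)"]) auto
  next
    case False
    have "cmod (kbdry \<zeta>) < 1"
    proof (cases "1 < \<zeta>")
      case True
      then show ?thesis
        by (rule kbdry_gt_1(6))
    next
      case False
      then have neg: "1 < - \<zeta>"
        using assms \<open>\<not> \<bar>\<zeta>\<bar> < 1\<close> by linarith
      show ?thesis
        using kbdry_gt_1(6)[OF neg] kbdry_uminus[OF neg] by simp
    qed
    then have gt: "1 < cmod (1 / kbdry \<zeta>)"
      using ne by (simp add: norm_divide)
    \<comment> \<open>Off the band the other root lies outside the closed unit disc.\<close>
    have "cmod (1 / kbdry \<zeta>) - 1 \<le> cmod (k - 1 / kbdry \<zeta>)" if "cmod k < 1" for k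
      using norm_triangle_ineq2[of "1 / kbdry \<zeta>" k] that by (simp add: norm_minus_commute)
    then show ?thesis
      using approx gt by (intro that[of "cmod (1 / kbdry \<zeta>) - 1"]) auto
  qed
qed

text \<open>The factor \<open>1 + real j\<close> is a source of the growth that the weight must
  absorb: powers of two numbers of modulus at most 1 differ by at most \<open>j\<close> times the
  distance of the bases.\<close>

lemma norm_green_diff_le:
  assumes "cmod k \<le> 1" "cmod k' \<le> 1"
  shows "cmod (green h k j - green h k' j) \<le>
    (cmod (complex_of_real (h\<^sup>2) / (1 / k - k) - complex_of_real (h\<^sup>2) / (1 / k' - k')) +
      cmod (complex_of_real (h\<^sup>2) / (1 / k' - k')) * cmod (k - k')) * (1 + real j)"
proof -
  define c where "c = complex_of_real (h\<^sup>2) / (1 / k - k)"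
  define c' where "c' = complex_of_real (h\<^sup>2) / (1 / k' - k')"
  have "green h k j = c * k ^ j" "green h k' j = c' * k' ^ j"
    by (simp_all add: green_def c_def c'_def)
  then have "green h k j - green h k' j = (c - c') * k ^ j + c' * (k ^ j - k' ^ j)"
    by (simp add: algebra_simps)
  then have "cmod (green h k j - green h k' j) \<le> cmod (c - c') * cmod k ^ j + cmod c' * cmod (k ^ j - k' ^ j)"
    by (metis norm_mult norm_power norm_triangle_ineq)
  also have "\<dots> \<le> cmod (c - c') * (1 + real j) + cmod c' * (cmod (k - k') * (1 + real j))"
  proof (intro add_mono mult_left_mono)
    show "cmod k ^ j \<le> 1 + real j"
      using power_le_one[OF norm_ge_zero assms(1), of j] by linarith
    have "cmod (k ^ j - k' ^ j) \<le> real j * cmod (k - k')"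
      by (rule norm_power_diff[OF assms])
    also have "\<dots> \<le> cmod (k - k') * (1 + real j)"
      by (simp add: mult.commute mult_right_mono)
    finally show "cmod (k ^ j - k' ^ j) \<le> cmod (k - k') * (1 + real j)" .
  qed auto
  finally show ?thesis
    by (simp add: c_def c'_def distrib_right mult.assoc)
qed

section \<open>Size, imaginary part and threshold behaviour of the Green function\<close>

lemma norm_green_kbdry_le:
  assumes "\<bar>\<zeta>\<bar> \<noteq> 1"
  shows "cmod (green h (kbdry \<zeta>) j) \<le> h\<^sup>2 / (2 * sqrt \<bar>\<zeta>\<^sup>2 - 1\<bar>)"
proof -
  have "cmod (green h (kbdry \<zeta>) j) = h\<^sup>2 / (2 * sqrt \<bar>\<zeta>\<^sup>2 - 1\<bar>) * cmod (kbdry \<zeta>) ^ j"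
    unfolding green_def by (simp only: norm_mult norm_divide norm_power norm_of_real kbdry_diff[OF assms]) simp
  also have "\<dots> \<le> h\<^sup>2 / (2 * sqrt \<bar>\<zeta>\<^sup>2 - 1\<bar>) * 1"
    using kbdry_norm[OF assms] by (intro mult_left_mono power_le_one) auto
  finally show ?thesis by simp
qed

text \<open>Inside the band \<open>kbdry \<zeta> = exp (\<i> \<theta>)\<close> with \<open>\<theta> = arccos \<zeta>\<close>; outside it is real.\<close>

definition band_density :: "real \<Rightarrow> real \<Rightarrow> real"
  where "band_density h \<zeta> = (if \<bar>\<zeta>\<bar> < 1 then h\<^sup>2 / (2 * sqrt (1 - \<zeta>\<^sup>2)) else 0)"

lemma Im_green_kbdry:
  "Im (green h (kbdry \<zeta>) j) = band_density h \<zeta> * cos (arccos \<zeta> * real j)"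
proof (cases "\<bar>\<zeta>\<bar> < 1")
  case True
  note k = kbdry_lt_1[OF True]
  have "kbdry \<zeta> = cis (arccos \<zeta>)"
    using True k by (simp add: complex_eq_iff cos_arccos_abs sin_arccos_abs)
  then have pow: "kbdry \<zeta> ^ j = cis (arccos \<zeta> * real j)"
    by (simp only: Complex.DeMoivre mult.commute)
  \<comment> \<open>On the unit circle \<open>1 / k\<close> is the conjugate, so the prefactor is
    purely imaginary and the imaginary part selects the cosine of the power.\<close>
  have "1 / kbdry \<zeta> - kbdry \<zeta> = - 2 * \<i> * Im (kbdry \<zeta>)"
    by (simp add: k(6) complex_eq_iff)
  then have "complex_of_real (h\<^sup>2) / (1 / kbdry \<zeta> - kbdry \<zeta>) = \<i> * (h\<^sup>2 / (2 * Im (kbdry \<zeta>)))"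
    using k(4) by (simp only:) (simp add: field_simps)
  then have "Im (green h (kbdry \<zeta>) j) = h\<^sup>2 / (2 * Im (kbdry \<zeta>)) * cos (arccos \<zeta> * real j)"
    unfolding green_def pow by (simp add: Im_complex_of_real flip: of_real_mult of_real_divide)
  then show ?thesis
    using True by (simp add: band_density_def k(3))
next
  case False
  then obtain x where x: "kbdry \<zeta> = complex_of_real x"
    by (auto simp: kbdry_def)
  have "green h (kbdry \<zeta>) j = complex_of_real (h\<^sup>2 / (1 / x - x) * x ^ j)"
    by (simp add: green_def x)
  then have "Im (green h (kbdry \<zeta>) j) = 0"
    by (metis Im_complex_of_real)
  then show ?thesis
    using False by (simp add: band_density_def)
qed

text \<open>
  With \<open>\<kappa> = kbdry (1 + x h\<^sup>2 / 2)\<close> the prefactor of the Green function is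
  \<open>(h / (2 \<surd>x)) / \<surd>(1 + x h\<^sup>2 / 4)\<close>, and \<open>1 - \<kappa>\<^sup>j \<le> j (1 - \<kappa>)\<close> by Bernoulli's inequality.
\<close>

lemma green_threshold:
  assumes h: "0 < h" and x: "0 < x"
  shows "cmod (green h (kbdry (1 + x * h\<^sup>2 / 2)) j - complex_of_real (h / (2 * sqrt x))) \<le>
    h\<^sup>2 * (1 + real j)"
proof -
  define \<zeta> where "\<zeta> = 1 + x * h\<^sup>2 / 2"
  have \<zeta>: "1 < \<zeta>"
    using h x by (simp add: \<zeta>_def)
  define \<kappa> where "\<kappa> = \<zeta> - sqrt (\<zeta>\<^sup>2 - 1)"
  note k = kbdry_gt_1[OF \<zeta>, folded \<kappa>_def]
  define y where "y = x * h\<^sup>2 / 4"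
  have y: "0 < y"
    using h x by (simp add: y_def)
  define c0 where "c0 = h / (2 * sqrt x)"
  define c where "c = h\<^sup>2 / (1 / \<kappa> - \<kappa>)"
  have "\<zeta>\<^sup>2 - 1 = x * h\<^sup>2 * (1 + y)"
    by (simp add: \<zeta>_def y_def power2_eq_square field_simps)
  then have "sqrt (\<zeta>\<^sup>2 - 1) = sqrt x * h * sqrt (1 + y)"
    using h by (simp add: real_sqrt_mult)
  then have c_eq: "c = c0 / sqrt (1 + y)"
    using h x by (simp add: c_def c0_def k(5) power2_eq_square field_simps)
  have c0: "0 < c0"
    using h x by (simp add: c0_def)
  \<comment> \<open>\<open>c0\<close> grows like the inverse square root of \<open>x\<close>. The
    estimate of the relative error by \<open>sqrt y\<close> cancels this growth, since
    \<open>c0 * sqrt y = h\<^sup>2 / 4\<close>.\<close>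
  have "1 - 1 / sqrt (1 + y) \<le> sqrt y"
  proof -
    have "sqrt (1 + y) \<le> 1 + sqrt y"
      using sqrt_add_le_add_sqrt[of 1 y] y by simp
    then have "1 / (1 + sqrt y) \<le> 1 / sqrt (1 + y)"
      using y by (intro divide_left_mono) (auto intro!: mult_pos_pos add_pos_nonneg)
    moreover have "1 - sqrt y \<le> 1 / (1 + sqrt y)"
      by (rule pos_le_divide_eq[THEN iffD2]) (use y in \<open>simp_all add: add_pos_nonneg algebra_simps\<close>)
    ultimately show ?thesis by linarith
  qed
  then have "c0 * (1 - 1 / sqrt (1 + y)) \<le> c0 * sqrt y"
    using c0 by (intro mult_left_mono) auto
  also have "c0 * sqrt y = h\<^sup>2 / 4"
    using h x by (simp add: c0_def y_def real_sqrt_mult real_sqrt_divide power2_eq_square)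
  finally have "c0 * (1 - 1 / sqrt (1 + y)) \<le> h\<^sup>2 / 4" .
  moreover have "c0 - c = c0 * (1 - 1 / sqrt (1 + y))"
    by (simp add: c_eq right_diff_distrib)
  moreover have "h\<^sup>2 / 4 \<le> h\<^sup>2"
    by simp
  ultimately have up: "c0 - c \<le> h\<^sup>2"
    by linarith
  have "1 / sqrt (1 + y) \<le> 1"
    using y by simp
  then have "c0 * (1 / sqrt (1 + y)) \<le> c0 * 1"
    using c0 by (intro mult_left_mono) auto
  then have low: "c \<le> c0"
    by (simp add: c_eq)
  have cpos: "0 \<le> c"
    using c0 y by (simp add: c_eq)
  have "1 + real j * (\<kappa> - 1) \<le> (1 + (\<kappa> - 1)) ^ j"
    using k(2) by (intro Bernoulli_inequality) simp
  then have bern: "1 - \<kappa> ^ j \<le> real j * (1 - \<kappa>)"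
    by (simp add: algebra_simps)
  \<comment> \<open>The factor \<open>1 - \<kappa>\<close> cancels the zero of
    \<open>1 / \<kappa> - \<kappa>\<close> at the threshold.\<close>
  have "c * (1 - \<kappa>) = h\<^sup>2 * (\<kappa> / (1 + \<kappa>))"
  proof -
    have "1 / \<kappa> - \<kappa> = (1 - \<kappa>) * (1 + \<kappa>) / \<kappa>"
      using k(2) by (simp add: field_simps)
    then show ?thesis
      using k(2,3) by (simp add: c_def)
  qed
  also have "\<dots> \<le> h\<^sup>2 * 1"
    using k(2) by (intro mult_left_mono) auto
  finally have "real j * (c * (1 - \<kappa>)) \<le> real j * h\<^sup>2"
    by (intro mult_left_mono) auto
  then have "c * (1 - \<kappa> ^ j) \<le> real j * h\<^sup>2"
    using mult_left_mono[OF bern cpos] by (simp add: mult_ac)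
  then have "c0 - c * \<kappa> ^ j \<le> h\<^sup>2 * (1 + real j)"
    using up by (simp add: algebra_simps)
  moreover have "c * \<kappa> ^ j \<le> c0"
    using low mult_left_mono[OF power_le_one[of \<kappa> j] cpos] k(2,3) by simp
  ultimately have "\<bar>c * \<kappa> ^ j - c0\<bar> \<le> h\<^sup>2 * (1 + real j)"
    by simp
  moreover have "green h (kbdry \<zeta>) j - complex_of_real c0 = complex_of_real (c * \<kappa> ^ j - c0)"
    by (simp add: green_def k(1) c_def)
  ultimately show ?thesis
    by (metis \<zeta>_def c0_def norm_of_real)
qed

lemma green_uminus: "green h (- k) j = - ((- 1) ^ j * green h k j)"
proof -
  have "complex_of_real (h\<^sup>2) / (1 / (- k) - (- k)) = - (complex_of_real (h\<^sup>2) / (1 / k - k))"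
    by (metis (no_types, opaque_lifting) minus_diff_eq divide_minus_right diff_minus_eq_add add.commute
        minus_diff_commute uminus_add_conv_diff)
  then show ?thesis
    unfolding green_def by (simp add: power_minus[of k])
qed

text \<open>The reflection \<open>k \<mapsto> - k\<close> carries the lower edge to the upper one
  and multiplies the Green function by \<open>- ((- 1) ^ j)\<close>.\<close>

lemma green_upper_threshold:
  assumes h: "0 < h" and x: "0 < x"
  shows "cmod (green h (kbdry (- (1 + x * h\<^sup>2 / 2))) j + (- 1) ^ j * complex_of_real (h / (2 * sqrt x))) \<le>
    h\<^sup>2 * (1 + real j)"
proof -
  have "green h (kbdry (- (1 + x * h\<^sup>2 / 2))) j = - ((- 1) ^ j * green h (kbdry (1 + x * h\<^sup>2 / 2)) j)"
    using h x by (subst kbdry_uminus) (simp_all only: green_uminus, simp)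
  then have "green h (kbdry (- (1 + x * h\<^sup>2 / 2))) j + (- 1) ^ j * complex_of_real (h / (2 * sqrt x)) =
      - ((- 1) ^ j * (green h (kbdry (1 + x * h\<^sup>2 / 2)) j - complex_of_real (h / (2 * sqrt x))))"
    by (simp only: right_diff_distrib) simp
  then show ?thesis
    using green_threshold[OF assms, of j] by (simp only: norm_minus_cancel norm_mult norm_power) simp
qed


section \<open>The resolvent of the free operator\<close>

text \<open>\<open>resolvent\<close> is an inverse function, so the claim is surjectivity of
  \<open>T\<close>. The bound below by \<open>\<bar>Im z\<bar>\<close> gives a closed range, and the
  same bound at \<open>cnj z\<close> shows that only 0 is orthogonal to it.\<close>

lemma resolvent_solves:
  fixes H :: "'a :: chilbert_space \<Rightarrow> 'a"
  assumes H: "self_adjoint H" and z: "Im z \<noteq> 0"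
  shows "H (resolvent H z v) - z *\<^sub>C resolvent H z v = v"
proof -
  note bH = self_adjoint_bounded_clinear[OF H]
  have below: "\<bar>Im z\<bar> * norm u \<le> norm (H u - z *\<^sub>C u)" if z: "Im z \<noteq> 0" for z u
  proof (cases "u = 0")
    case False
    have "Im (cinner u (H u)) = 0"
      by (metis H Im_complex_of_real self_adjoint_cinner_real)
    then have "Im (cinner u (H u - z *\<^sub>C u)) = - (Im z * (norm u)\<^sup>2)"
      by (simp add: cinner.diff_right cinner_scaleC_right cinner_self)
    then have "\<bar>Im z\<bar> * (norm u)\<^sup>2 = \<bar>Im (cinner u (H u - z *\<^sub>C u))\<bar>"
      by (simp add: abs_mult)
    also have "\<dots> \<le> norm u * norm (H u - z *\<^sub>C u)"
      using abs_Im_le_cmod norm_cinner_le order_trans by blast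
    finally have "norm u * (\<bar>Im z\<bar> * norm u) \<le> norm u * norm (H u - z *\<^sub>C u)"
      by (simp add: power2_eq_square mult_ac)
    then show ?thesis
      using False by (simp add: mult_le_cancel_left)
  qed simp
  define T where "T u = H u - z *\<^sub>C u" for u
  have bT: "bounded_clinear T"
    unfolding T_def by (intro bounded_clinear_diff bH bounded_clinear_cmult bounded_clinear_id)
  have "complete (T ` UNIV)"
    by (rule complete_isometric_image[of "\<bar>Im z\<bar>"])
      (use z below[OF z] bounded_clinear_bounded_linear[OF bT] in \<open>auto simp: T_def complete_UNIV\<close>)
  then have closed: "closed (range T)"
    by (simp add: complete_eq_closed)
  have sub: "complex_vector.subspace (range T)"
    unfolding complex_vector.subspace_def
  proof (intro conjI ballI allI)
    show "0 \<in> range T"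
      using bounded_clinear_zero[OF bT] by (metis rangeI)
    fix x c
    assume "x \<in> range T"
    then obtain a where a: "x = T a" by blast
    show "c *\<^sub>C x \<in> range T"
      unfolding a bounded_clinear_scaleC[OF bT, symmetric] by blast
    fix y
    assume "y \<in> range T"
    then obtain b where b: "y = T b" by blast
    show "x + y \<in> range T"
      unfolding a b bounded_clinear_plus[OF bT, symmetric] by blast
  qed
  have "surj T"
  proof (intro set_eqI iffI UNIV_I)
    fix y
    obtain p where p: "p \<in> range T" "\<forall>x\<in>range T. cinner x (y - p) = 0"
      using orth_proj_exists[OF sub closed] by blast
    define e where "e = y - p"
    have "cinner u (H e - cnj z *\<^sub>C e) = cinner (T u) e" for u
      by (simp add: T_def cinner.diff_left cinner.diff_right cinner_scaleC_left cinner_scaleC_right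
          self_adjoint_cinner[OF H])
    then have "cinner u (H e - cnj z *\<^sub>C e) = cinner u 0" for u
      using p(2) by (simp add: e_def)
    then have "H e - cnj z *\<^sub>C e = 0"
      by (rule cinner_eqI)
    then have "e = 0"
      using below[of "cnj z" e] z by (simp add: mult_le_0_iff)
    then show "y \<in> range T"
      using p(1) by (simp add: e_def)
  qed
  then have "T (inv T v) = v"
    by (rule surj_f_inv_f)
  then show ?thesis
    by (simp add: resolvent_def T_def[abs_def])
qed

section \<open>Shifts and self-adjointness of the free operator\<close>

definition shift :: "int \<Rightarrow> 'g :: chilbert_space ell2 \<Rightarrow> 'g ell2"
  where "shift j u = Abs_ell2 (\<lambda>n. Rep_ell2 u (n + j))"

lemma bij_add_int: "bij_betw (\<lambda>n :: int. n + j) UNIV UNIV"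
  by (rule bij_betw_byWitness[of _ "\<lambda>m. m - j"]) auto

lemma Rep_shift: "Rep_ell2 (shift j u) n = Rep_ell2 u (n + j)"
proof -
  have "(\<lambda>n. (norm (Rep_ell2 u (n + j)))\<^sup>2) summable_on UNIV"
    using summable_on_reindex_bij_betw[OF bij_add_int, of "\<lambda>n. (norm (Rep_ell2 u n))\<^sup>2" j]
      square_summable_Rep_ell2[of u] by blast
  then show ?thesis
    by (simp add: shift_def Abs_ell2_inverse)
qed

lemma norm_shift: "norm (shift j u) = norm u"
proof -
  have "(norm (shift j u))\<^sup>2 = (norm u)\<^sup>2"
    unfolding norm_ell2_square Rep_shift
    by (rule infsum_reindex_bij_betw[OF bij_add_int, of "\<lambda>n. (norm (Rep_ell2 u n))\<^sup>2"])
  then show ?thesis by simp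
qed

lemma bounded_clinear_shift: "bounded_clinear (shift j)"
  by (rule bounded_clinearI[where C = 1])
    (auto intro!: ell2_eqI simp: Rep_shift plus_ell2.rep_eq scaleC_ell2.rep_eq norm_shift)

lemma cinner_shift: "cinner (shift j u) v = cinner u (shift (- j) v)"
  using infsum_reindex_bij_betw[OF bij_add_int, of "\<lambda>n. cinner (Rep_ell2 u n) (Rep_ell2 v (n - j))" j]
  by (simp add: cinner_ell2.rep_eq Rep_shift)

lemma neg_laplacian_eq:
  "neg_laplacian h u = (1 / h\<^sup>2) *\<^sub>R (2 *\<^sub>R u - shift 1 u - shift (- 1) u)" (is "_ = ?X")
proof -
  have "(\<lambda>n. (1 / h\<^sup>2) *\<^sub>R (2 *\<^sub>R Rep_ell2 u n - Rep_ell2 u (n + 1) - Rep_ell2 u (n - 1))) = Rep_ell2 ?X"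
    by (simp add: fun_eq_iff scaleR_ell2.rep_eq minus_ell2.rep_eq Rep_shift)
  then show ?thesis
    unfolding neg_laplacian_def by (simp only: Rep_ell2_inverse)
qed

lemma Rep_neg_laplacian:
  "Rep_ell2 (neg_laplacian h u) n =
    (1 / h\<^sup>2) *\<^sub>R (2 *\<^sub>R Rep_ell2 u n - Rep_ell2 u (n + 1) - Rep_ell2 u (n - 1))"
  by (simp add: neg_laplacian_eq scaleR_ell2.rep_eq minus_ell2.rep_eq Rep_shift)

lemma self_adjoint_neg_laplacian:
  "self_adjoint (neg_laplacian h :: 'g :: chilbert_space ell2 \<Rightarrow> 'g ell2)"
  unfolding self_adjoint_def
proof (intro conjI allI)
  show "bounded_clinear (neg_laplacian h :: 'g ell2 \<Rightarrow> 'g ell2)"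
    unfolding neg_laplacian_eq[abs_def]
    by (intro bounded_clinear_rmult bounded_clinear_diff bounded_clinear_shift bounded_clinear_id)
  show "cinner (neg_laplacian h x) y = cinner x (neg_laplacian h y)" for x y :: "'g ell2"
    by (simp add: neg_laplacian_eq cinner.scaleR_left cinner.scaleR_right cinner.diff_left
        cinner.diff_right cinner_shift)
qed

lemma self_adjoint_H_Q:
  assumes Q: "self_adjoint Q"
  shows "self_adjoint (H_Q h Q)"
proof -
  have 1: "cmod 1 \<le> 1" by simp
  note bQ = self_adjoint_bounded_clinear[OF Q]
  have bm: "bounded_clinear (mult_tensor (\<lambda>_. 1) Q)"
    by (rule bounded_clinear_mult_tensor[OF 1 bQ])
  have "adj (mult_tensor (\<lambda>_. 1) Q) = mult_tensor (\<lambda>_. 1) Q"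
    using adj_mult_tensor[OF 1 bQ] by (simp add: self_adjoint_adj[OF Q])
  then have "self_adjoint (mult_tensor (\<lambda>_. 1) Q)"
    using bm cinner_adj_left[OF bm] by (simp add: self_adjoint_def)
  from self_adjoint_add[OF self_adjoint_neg_laplacian this] show ?thesis
    by (simp add: H_Q_def[abs_def])
qed

lemma Rep_H_Q:
  assumes Q: "self_adjoint Q"
  shows "Rep_ell2 (H_Q h Q u) n =
    (1 / h\<^sup>2) *\<^sub>R (2 *\<^sub>R Rep_ell2 u n - Rep_ell2 u (n + 1) - Rep_ell2 u (n - 1)) + Q (Rep_ell2 u n)"
  using Rep_mult_tensor[of "\<lambda>_. 1" 1 Q, OF _ self_adjoint_bounded_clinear[OF Q]]
  by (simp add: H_Q_def plus_ell2.rep_eq Rep_neg_laplacian)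


subsection \<open>Spectral decomposition of \<open>Q\<close>\<close>

text \<open>\<open>eigenvalue_enum\<close> provides some decomposition into eigenvectors.
  Eigenspaces of distinct eigenvalues are orthogonal by self-adjointness, which identifies its
  summands with the orthogonal projections.\<close>

lemma
  fixes Q :: "'g :: chilbert_space \<Rightarrow> 'g"
  assumes Q: "bounded_clinear Q"
  shows csubspace_eigenspace: "complex_vector.subspace (eigenspace Q \<kappa>)"
    and closed_eigenspace: "closed (eigenspace Q \<kappa>)"
proof -
  show "complex_vector.subspace (eigenspace Q \<kappa>)"
    by (auto simp: complex_vector.subspace_def eigenspace_def bounded_clinear_zero[OF Q]
        bounded_clinear_plus[OF Q] bounded_clinear_scaleC[OF Q] scaleC_add_right
        scaleC_scaleC mult.commute simp flip: scaleC_of_real)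
  show "closed (eigenspace Q \<kappa>)"
    unfolding eigenspace_def using bounded_clinear_bounded_linear[OF Q]
    by (intro closed_Collect_eq linear_continuous_on continuous_intros)
qed

lemma
  fixes Q :: "'g :: chilbert_space \<Rightarrow> 'g"
  assumes Q: "self_adjoint Q" and enum: "eigenvalue_enum Q d \<mu>"
  shows finite_I_Q: "finite (I_Q Q d)"
    and inj_on_mu: "inj_on \<mu> (I_Q Q d)"
    and self_adjoint_eigenproj: "self_adjoint (eigenproj Q \<mu> s)"
    and norm_eigenproj_le: "norm (eigenproj Q \<mu> s x) \<le> norm x"
    and eigenproj_idem: "eigenproj Q \<mu> s (eigenproj Q \<mu> s x) = eigenproj Q \<mu> s x"
    and Q_eigenproj: "s \<in> I_Q Q d \<Longrightarrow> Q (eigenproj Q \<mu> s x) = \<mu> s *\<^sub>R eigenproj Q \<mu> s x"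
    and sum_eigenproj: "(\<Sum>s\<in>I_Q Q d. eigenproj Q \<mu> s x) = x"
proof -
  note S = csubspace_eigenspace[OF self_adjoint_bounded_clinear[OF Q]]
    closed_eigenspace[OF self_adjoint_bounded_clinear[OF Q]]
  show "finite (I_Q Q d)"
    by (simp add: I_Q_def)
  show inj: "inj_on \<mu> (I_Q Q d)"
    using enum by (auto simp: I_Q_def eigenvalue_enum_def bij_betw_def split: if_splits)
  have "self_adjoint (id :: 'g \<Rightarrow> 'g)"
    by (simp add: self_adjoint_def id_def bounded_clinear_id)
  then show "self_adjoint (eigenproj Q \<mu> s)"
    using self_adjoint_orth_proj[OF S] by (simp add: eigenproj_def)
  show "norm (eigenproj Q \<mu> s x) \<le> norm x"
    and "eigenproj Q \<mu> s (eigenproj Q \<mu> s x) = eigenproj Q \<mu> s x"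
    using self_adjoint_orth_proj[OF S] by (simp_all add: eigenproj_def)
  show "Q (eigenproj Q \<mu> s x) = \<mu> s *\<^sub>R eigenproj Q \<mu> s x" if "s \<in> I_Q Q d"
  proof (cases "Q = (\<lambda>_. 0)")
    case True
    then show ?thesis
      using enum that by (auto simp: eigenvalue_enum_def I_Q_def)
  next
    case False
    then have "eigenproj Q \<mu> s x \<in> eigenspace Q (\<mu> s)"
      using orth_proj_in[OF S] by (simp add: eigenproj_def)
    then show ?thesis
      by (simp add: eigenspace_def)
  qed
  show "(\<Sum>s\<in>I_Q Q d. eigenproj Q \<mu> s x) = x"
  proof (cases "Q = (\<lambda>_. 0)")
    case True
    then show ?thesis
      by (simp add: eigenproj_def I_Q_def)
  next
    case False
    then have I: "I_Q Q d = {1..d}"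
      by (simp add: I_Q_def)
    obtain v where v: "\<And>s. s \<in> {1..d} \<Longrightarrow> v s \<in> eigenspace Q (\<mu> s)" "x = (\<Sum>s\<in>{1..d}. v s)"
      using enum False unfolding eigenvalue_enum_def by metis
    have "orth_proj (eigenspace Q (\<mu> s)) x = v s" if s: "s \<in> {1..d}" for s
    proof (rule orth_proj_eqI[OF S(1) v(1)[OF s]])
      fix y
      assume y: "y \<in> eigenspace Q (\<mu> s)"
      have "cinner y (v t) = 0" if t: "t \<in> {1..d} - {s}" for t
      proof (rule eigenvector_orth[OF Q])
        show "\<mu> s \<noteq> \<mu> t"
          using inj_onD[OF inj[unfolded I], of s t] s t by blast
      qed (use y v(1)[of t] t in \<open>auto simp: eigenspace_def\<close>)
      then have "(\<Sum>t\<in>{1..d}. cinner y (v t)) = cinner y (v s)"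
        by (subst sum.remove[OF _ s]) simp_all
      then show "cinner y (x - v s) = 0"
        by (simp add: v(2) cinner.diff_right cinner.sum_right)
    qed
    then show ?thesis
      using False v(2) by (simp add: I eigenproj_def)
  qed
qed


subsection \<open>The sandwiched resolvent and its boundary values\<close>

locale lattice_model =
  fixes h \<nu> :: real and Q K :: "'g :: chilbert_space \<Rightarrow> 'g" and W :: "'g ell2 \<Rightarrow> 'g ell2"
    and d :: nat and \<mu> :: "nat \<Rightarrow> real" and S \<rho> D :: real
  assumes h: "0 < h" and \<nu>: "3 < \<nu>" and Q: "self_adjoint Q" and enum: "eigenvalue_enum Q d \<mu>"
    and W: "positive_op W" and K: "hs K D" and wt: "weight (psi_weight \<nu>) S"
    and \<rho>: "0 \<le> \<rho>" "\<And>u. norm (op_sqrt W u) \<le> \<rho> * norm u"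
begin

abbreviation "I \<equiv> I_Q Q d"

abbreviation proj :: "nat \<Rightarrow> 'g \<Rightarrow> 'g"
  where "proj s \<equiv> eigenproj Q \<mu> s"

definition L :: "nat \<Rightarrow> 'g \<Rightarrow> 'g"
  where "L s x = K (proj s x)"

lemmas finite_I' = finite_I_Q[OF Q enum]
  and proj_sa = self_adjoint_eigenproj[OF Q enum]
  and proj_norm = norm_eigenproj_le[OF Q enum]
  and proj_idem = eigenproj_idem[OF Q enum]
  and Q_proj = Q_eigenproj[OF Q enum]
  and sum_proj = sum_eigenproj[OF Q enum]

lemma bounded_clinear_proj: "bounded_clinear (proj s)"
  by (rule self_adjoint_bounded_clinear[OF proj_sa])

lemma bounded_clinear_K: "bounded_clinear K"
  by (rule hs_bounded_clinear[OF K])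

lemma hs_L: "hs (L s) D"
  using hs_compose_right[OF bounded_clinear_proj, of s 1, OF _ _ K] proj_norm
  by (simp add: L_def[abs_def])

lemma adj_L: "adj (L s) x = proj s (adj K x)"
  using adj_compose[OF bounded_clinear_K bounded_clinear_proj, of s]
  by (simp add: L_def[abs_def] self_adjoint_adj[OF proj_sa])

end

sublocale lattice_model \<subseteq> kernel_ops "psi_weight \<nu>" S "op_sqrt W" \<rho> I L D
  using wt by (auto simp: kernel_ops_def kernel_ops_axioms_def finite_I' hs_L \<rho>
      intro: positive_op_self_adjoint positive_op_sqrt[OF W])

context lattice_model
begin

lemma N_eq: "N s x = K (proj s (adj K x))"
  by (simp add: adj_L) (simp add: L_def proj_idem)

abbreviation psi_c :: "int \<Rightarrow> complex"
  where "psi_c n \<equiv> complex_of_real (psi \<nu> n)"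

lemma norm_psi_c: "cmod (psi_c n) \<le> 1"
  using \<nu> by (simp add: psi_nonneg psi_le_1)

definition kern :: "(nat \<Rightarrow> nat \<Rightarrow> complex) \<Rightarrow> nat \<Rightarrow> int \<Rightarrow> int \<Rightarrow> complex"
  where "kern G s n m = psi_c n * G s (nat \<bar>n - m\<bar>) * psi_c m"

lemma kern_sym: "kern G s n m = kern G s m n"
  by (simp add: kern_def abs_minus_commute mult_ac)

text \<open>The linear growth in the distance is bounded by a product, one factor of which goes to
  each \<open>psi\<close> and turns it into \<open>psi_weight\<close>.\<close>

lemma kb_kern:
  assumes "\<And>s j. s \<in> I \<Longrightarrow> cmod (G s j) \<le> C * (1 + real j)" "0 \<le> C"
  shows "kb (kern G) C"
  unfolding kb_def kbound_def
proof (intro ballI conjI allI assms(2))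
  fix s n m
  assume s: "s \<in> I"
  have "real (nat \<bar>n - m\<bar>) \<le> \<bar>real_of_int n\<bar> + \<bar>real_of_int m\<bar>"
    by simp
  then have "1 + real (nat \<bar>n - m\<bar>) \<le> (1 + \<bar>real_of_int n\<bar>) * (1 + \<bar>real_of_int m\<bar>)"
    using mult_nonneg_nonneg[of "\<bar>real_of_int n\<bar>" "\<bar>real_of_int m\<bar>", OF abs_ge_zero abs_ge_zero]
    unfolding distrib_left distrib_right mult_1_left mult_1_right by linarith
  then have j: "C * (1 + real (nat \<bar>n - m\<bar>)) \<le> C * ((1 + \<bar>real_of_int n\<bar>) * (1 + \<bar>real_of_int m\<bar>))"
    by (intro mult_left_mono assms(2))
  have "cmod (kern G s n m) = psi \<nu> n * psi \<nu> m * cmod (G s (nat \<bar>n - m\<bar>))"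
    by (simp add: kern_def norm_mult psi_nonneg mult_ac)
  also have "\<dots> \<le> psi \<nu> n * psi \<nu> m * (C * ((1 + \<bar>real_of_int n\<bar>) * (1 + \<bar>real_of_int m\<bar>)))"
    using psi_nonneg by (intro mult_left_mono order_trans[OF assms(1)[OF s] j]) simp
  finally show "cmod (kern G s n m) \<le> C * psi_weight \<nu> n * psi_weight \<nu> m"
    by (simp add: psi_weight_def mult_ac)
qed

text \<open>Testing \<open>(H - z) u = v\<close> against \<open>G(\<sqdot> - n) g\<close> isolates the value of \<open>u\<close> at \<open>n\<close>.\<close>

lemma resolvent_component:
  assumes s: "s \<in> I" and u: "H_Q h Q u - z *\<^sub>C u = v"
    and root: "k\<^sup>2 - 2 * (1 - (z - \<mu> s) * complex_of_real (h\<^sup>2) / 2) * k + 1 = 0" and k: "k \<noteq> 0" "cmod k < 1"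
  shows "proj s (Rep_ell2 u n) = proj s (row (\<lambda>m. green h k (nat \<bar>n - m\<bar>)) v)"
    and "\<exists>C. l2_le (\<lambda>m. green h k (nat \<bar>n - m\<bar>)) C"
proof -
  obtain C0 where C0: "l2_le (\<lambda>m. k ^ nat \<bar>m - n\<bar>) C0"
    using l2_le_geometric[OF k(2)] .
  have "l2_le (\<lambda>m. green h k (nat \<bar>n - m\<bar>)) (cmod (complex_of_real (h\<^sup>2) / (1 / k - k)) * C0)"
    by (rule l2_le_mono[OF C0])
      (simp_all only: green_def norm_mult abs_minus_commute order_refl norm_ge_zero)
  then obtain C where l2: "l2_le (\<lambda>m. green h k (nat \<bar>n - m\<bar>)) C" ..
  then show "\<exists>C. l2_le (\<lambda>m. green h k (nat \<bar>n - m\<bar>)) C" ..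
  have "cmod (k\<^sup>2) < 1"
    using k(2) by (simp add: norm_power abs_square_less_1)
  then have "k\<^sup>2 \<noteq> 1"
    by auto
  note geq = green_equation[OF h root k(1) this]
  show "proj s (Rep_ell2 u n) = proj s (row (\<lambda>m. green h k (nat \<bar>n - m\<bar>)) v)"
  proof (rule cinner_eqI)
    fix g
    \<comment> \<open>The test function is conjugated because the scalar product is antilinear on
      the left; it solves the equation at \<open>cnj z\<close> with a point mass at \<open>n\<close>
      on the right.\<close>
    define p where "p m = cnj (green h k (nat \<bar>n - m\<bar>))" for m
    define w where "w = emb p (proj s g)"
    have pl2: "l2_le p C"
      using l2 by (simp add: p_def[abs_def] l2_le_cnj)
    have Rw: "Rep_ell2 w m = p m *\<^sub>C proj s g" for m
      unfolding w_def by (rule Rep_emb[OF pl2])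
    have eq: "(1 / complex_of_real (h\<^sup>2)) * (2 * p m - p (m + 1) - p (m - 1)) - cnj (z - \<mu> s) * p m = (if m = n then 1 else 0)" for m
    proof -
      have "nat \<bar>n - m\<bar> = nat \<bar>m - n\<bar>" "nat \<bar>n - (m + 1)\<bar> = nat \<bar>(m - n) + 1\<bar>"
        "nat \<bar>n - (m - 1)\<bar> = nat \<bar>(m - n) - 1\<bar>"
        by (simp_all add: abs_if algebra_simps)
      then have "(1 / complex_of_real (h\<^sup>2)) * (2 * p m - p (m + 1) - p (m - 1)) - cnj (z - \<mu> s) * p m =
          cnj ((1 / complex_of_real (h\<^sup>2)) * (2 * green h k (nat \<bar>m - n\<bar>) - green h k (nat \<bar>(m - n) + 1\<bar>) -
            green h k (nat \<bar>(m - n) - 1\<bar>)) - (z - \<mu> s) * green h k (nat \<bar>m - n\<bar>))"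
        by (simp add: p_def)
      then show ?thesis
        unfolding geq by simp
    qed
    have "H_Q h Q w - cnj z *\<^sub>C w = emb (\<lambda>m. if m = n then 1 else 0) (proj s g)"
    proof (rule ell2_eqI)
      fix m
      have "Q (p m *\<^sub>C proj s g) = (p m * \<mu> s) *\<^sub>C proj s g"
        by (simp add: bounded_clinear_scaleC[OF self_adjoint_bounded_clinear[OF Q]] Q_proj[OF s]
            scaleC_scaleC flip: scaleC_of_real)
      then have "Rep_ell2 (H_Q h Q w - cnj z *\<^sub>C w) m =
          ((1 / complex_of_real (h\<^sup>2)) * (2 * p m - p (m + 1) - p (m - 1)) - cnj (z - \<mu> s) * p m) *\<^sub>C proj s g"
        by (simp add: minus_ell2.rep_eq scaleC_ell2.rep_eq Rep_H_Q[OF Q] Rw scaleC.diff_left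
            scaleC_add_left scaleC_scaleC left_diff_distrib right_diff_distrib mult_ac
            scaleC.diff_right flip: scaleC_of_real)
      then show "Rep_ell2 (H_Q h Q w - cnj z *\<^sub>C w) m =
          Rep_ell2 (emb (\<lambda>m. if m = n then 1 else 0) (proj s g)) m"
        unfolding eq by (simp add: Rep_emb[OF l2_le_delta])
    qed
    then have "cinner (proj s g) (Rep_ell2 u n) = cinner (H_Q h Q w - cnj z *\<^sub>C w) u"
      by (simp add: cinner_delta)
    also have "\<dots> = cinner w v"
      by (simp add: cinner.diff_left cinner.diff_right cinner_scaleC_left cinner_scaleC_right
          self_adjoint_cinner[OF self_adjoint_H_Q[OF Q]] flip: u)
    also have "\<dots> = cinner (proj s g) (row (\<lambda>m. green h k (nat \<bar>n - m\<bar>)) v)"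
      unfolding w_def cinner_emb[OF pl2] by (simp add: p_def)
    finally show "cinner g (proj s (Rep_ell2 u n)) =
        cinner g (proj s (row (\<lambda>m. green h k (nat \<bar>n - m\<bar>)) v))"
      by (simp add: self_adjoint_cinner[OF proj_sa])
  qed
qed

abbreviation factor :: "'g ell2 \<Rightarrow> 'g ell2"
  where "factor \<equiv> perturbation_factor \<nu> K W"

lemma adj_factor: "adj factor = (\<lambda>y. mult_tensor psi_c (adj K) (op_sqrt W y))"
proof -
  have "adj factor = adj (\<lambda>u. op_sqrt W (mult_tensor psi_c K u))"
    by (simp add: perturbation_factor_def comp_def)
  also have "\<dots> = (\<lambda>y. adj (mult_tensor psi_c K) (op_sqrt W y))"
    by (subst adj_compose[OF bounded_clinear_R bounded_clinear_mult_tensor[OF norm_psi_c bounded_clinear_K]])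
      (simp add: self_adjoint_adj[OF R(1)])
  finally show ?thesis
    by (simp add: adj_mult_tensor[OF norm_psi_c bounded_clinear_K])
qed

text \<open>The projections sum to the identity, so \<open>u\<close> splits into channels, each with
  its own root. The two factors \<open>psi\<close> join the scalar Green kernel, and
  \<open>K\<close> and \<open>adj K\<close> around the projection form \<open>N s\<close>.\<close>

lemma sandwiched_resolvent_eq:
  assumes z: "Im z \<noteq> 0"
    and root: "\<And>s. s \<in> I \<Longrightarrow> (k s)\<^sup>2 - 2 * (1 - (z - \<mu> s) * complex_of_real (h\<^sup>2) / 2) * k s + 1 = 0"
    and k: "\<And>s. s \<in> I \<Longrightarrow> k s \<noteq> 0 \<and> cmod (k s) < 1"
    and kb: "kb (kern (\<lambda>s. green h (k s))) C"
  shows "sandwiched_resolvent (H_Q h Q) factor z = kop (kern (\<lambda>s. green h (k s)))"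
proof
  fix y
  define x where "x = op_sqrt W y"
  define v where "v = mult_tensor psi_c (adj K) x"
  define u where "u = resolvent (H_Q h Q) z v"
  have u: "H_Q h Q u - z *\<^sub>C u = v"
    unfolding u_def by (rule resolvent_solves[OF self_adjoint_H_Q[OF Q] z])
  note bK' = bounded_clinear_adj[OF bounded_clinear_K]
  have kb_s: "kbound (kern (\<lambda>s. green h (k s)) s) C" if "s \<in> I" for s
    using kb that by (simp add: kb_def)
  have "mult_tensor psi_c K u = (\<Sum>s\<in>I. ker_op (kern (\<lambda>s. green h (k s)) s) (N s) x)"
  proof (rule ell2_eqI)
    fix n
    have comp: "psi_c n *\<^sub>C K (proj s (Rep_ell2 u n)) = N s (row (kern (\<lambda>s. green h (k s)) s n) x)"
      if s: "s \<in> I" for s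
    proof -
      define g where "g m = green h (k s) (nat \<bar>n - m\<bar>)" for m
      have "proj s (Rep_ell2 u n) = proj s (row g v)" and "\<exists>C. l2_le g C"
        unfolding g_def[abs_def] using resolvent_component[OF s u root[OF s]] k[OF s] by auto
      then obtain C' where pr: "proj s (Rep_ell2 u n) = proj s (row g v)" and "l2_le g C'"
        by blast
      then have l2: "l2_le (\<lambda>m. g m * psi_c m) (1 * C')"
        using norm_psi_c by (intro l2_le_mono[where b = g]) (auto simp: norm_mult mult_left_le)
      have "row g v = adj K (row (\<lambda>m. g m * psi_c m) x)"
        by (rule row_apply[OF l2 bK'])
          (simp add: v_def Rep_mult_tensor[OF norm_psi_c bK'] scaleC_scaleC)
      then have "psi_c n *\<^sub>C K (proj s (Rep_ell2 u n)) = psi_c n *\<^sub>C N s (row (\<lambda>m. g m * psi_c m) x)"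
        unfolding pr N_eq by simp
      also have "\<dots> = N s (row (\<lambda>m. psi_c n * (g m * psi_c m)) x)"
        unfolding row_cmult[OF l2] by (rule bounded_clinear_scaleC[OF bounded_clinear_N[OF s], symmetric])
      also have "(\<lambda>m. psi_c n * (g m * psi_c m)) = kern (\<lambda>s. green h (k s)) s n"
        by (simp add: kern_def g_def fun_eq_iff mult.assoc)
      finally show ?thesis .
    qed
    have "Rep_ell2 (mult_tensor psi_c K u) n = psi_c n *\<^sub>C K (\<Sum>s\<in>I. proj s (Rep_ell2 u n))"
      by (simp add: Rep_mult_tensor[OF norm_psi_c bounded_clinear_K] sum_proj)
    also have "\<dots> = (\<Sum>s\<in>I. psi_c n *\<^sub>C K (proj s (Rep_ell2 u n)))"
      by (simp add: bounded_clinear_sum[OF bounded_clinear_K] scaleC.sum_right)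
    also have "\<dots> = (\<Sum>s\<in>I. Rep_ell2 (ker_op (kern (\<lambda>s. green h (k s)) s) (N s) x) n)"
      by (intro sum.cong refl) (simp add: comp Rep_ker_op[OF kb_s bounded_clinear_N])
    finally show "Rep_ell2 (mult_tensor psi_c K u) n =
        Rep_ell2 (\<Sum>s\<in>I. ker_op (kern (\<lambda>s. green h (k s)) s) (N s) x) n"
      by (simp add: Rep_ell2_sum)
  qed
  then show "sandwiched_resolvent (H_Q h Q) factor z y = kop (kern (\<lambda>s. green h (k s))) y"
    unfolding sandwiched_resolvent_def adj_factor comp_apply
    by (simp add: perturbation_factor_def kop_def u_def v_def x_def)
qed

text \<open>Half of \<open>k + 1 / k\<close> in channel \<open>s\<close>: the values 1 and -1 are
  the lower and the upper threshold of the channel, modulus below 1 is its band.\<close>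

definition zeta :: "real \<Rightarrow> nat \<Rightarrow> real"
  where "zeta lam s = 1 - (lam - \<mu> s) * h\<^sup>2 / 2"

definition bgreen :: "real \<Rightarrow> nat \<Rightarrow> nat \<Rightarrow> complex"
  where "bgreen lam s = green h (kbdry (zeta lam s))"

lemma norm_bgreen_le_prefactor:
  assumes "\<bar>zeta lam s\<bar> \<noteq> 1"
  shows "cmod (bgreen lam s j) \<le> h\<^sup>2 / (2 * sqrt \<bar>(zeta lam s)\<^sup>2 - 1\<bar>)"
  unfolding bgreen_def by (rule norm_green_kbdry_le[OF assms])

text \<open>This constant is not uniform near the thresholds and serves to make the operators well
  defined; uniform bounds appear after the rank one term is subtracted.\<close>

lemma kb_bgreen:
  assumes nz: "\<And>s. s \<in> I \<Longrightarrow> \<bar>zeta lam s\<bar> \<noteq> 1"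
  obtains C where "kb (kern (bgreen lam)) C"
proof -
  define c where "c s = h\<^sup>2 / (2 * sqrt \<bar>(zeta lam s)\<^sup>2 - 1\<bar>)" for s
  have "cmod (bgreen lam s j) \<le> (\<Sum>s\<in>I. c s) * (1 + real j)" if s: "s \<in> I" for s j
  proof -
    have "cmod (bgreen lam s j) \<le> c s"
      unfolding c_def by (rule norm_bgreen_le_prefactor[OF nz[OF s]])
    also have "\<dots> \<le> (\<Sum>s\<in>I. c s)"
      using s finite_I by (intro member_le_sum) (auto simp: c_def)
    also have "\<dots> \<le> (\<Sum>s\<in>I. c s) * (1 + real j)"
      using mult_left_mono[of 1 "1 + real j" "\<Sum>s\<in>I. c s"] by (simp add: sum_nonneg c_def)
    finally show ?thesis .
  qed
  then have "kb (kern (bgreen lam)) (\<Sum>s\<in>I. c s)"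
    by (rule kb_kern) (auto intro!: sum_nonneg simp: c_def)
  then show ?thesis by (rule that)
qed

text \<open>The roots converge to their boundary values, so the Green functions converge with error
  at most \<open>E \<epsilon> s * (1 + real j)\<close>; against the weight this is convergence in
  Hilbert-Schmidt norm.\<close>

lemma boundary_value_eq:
  assumes nz: "\<And>s. s \<in> I \<Longrightarrow> \<bar>zeta lam s\<bar> \<noteq> 1"
  shows "boundary_value (H_Q h Q) factor lam = kop (kern (bgreen lam))"
proof -
  define w where "w \<epsilon> s = 1 - (Complex lam \<epsilon> - \<mu> s) * complex_of_real (h\<^sup>2) / 2" for \<epsilon> s
  \<comment> \<open>The deviation is purely imaginary: an energy above the real axis moves the
    parameter into the lower half-plane, where \<open>root_exists\<close> applies.\<close>
  have w: "w \<epsilon> s - zeta lam s = - (\<i> * (\<epsilon> * h\<^sup>2 / 2))" for \<epsilon> s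
    by (simp add: w_def zeta_def complex_eq_iff power2_eq_square)
  have "\<exists>k. 0 < \<epsilon> \<longrightarrow> k\<^sup>2 - 2 * w \<epsilon> s * k + 1 = 0 \<and> k \<noteq> 0 \<and> cmod k < 1 \<and> 0 < Im k" for \<epsilon> s
  proof (cases "0 < \<epsilon>")
    case True
    have "Im (w \<epsilon> s) = Im (w \<epsilon> s - zeta lam s)"
      by simp
    also have "\<dots> < 0"
      unfolding w using True h by simp
    finally show ?thesis
      using root_exists by blast
  qed simp
  then obtain k where k: "\<And>\<epsilon> s. 0 < \<epsilon> \<Longrightarrow> (k \<epsilon> s)\<^sup>2 - 2 * w \<epsilon> s * k \<epsilon> s + 1 = 0"
    "\<And>\<epsilon> s. 0 < \<epsilon> \<Longrightarrow> k \<epsilon> s \<noteq> 0" "\<And>\<epsilon> s. 0 < \<epsilon> \<Longrightarrow> cmod (k \<epsilon> s) < 1" "\<And>\<epsilon> s. 0 < \<epsilon> \<Longrightarrow> 0 < Im (k \<epsilon> s)"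
    by metis
  define k0 where "k0 s = kbdry (zeta lam s)" for s
  have k_lim: "((\<lambda>\<epsilon>. k \<epsilon> s) \<longlongrightarrow> k0 s) (at_right 0)" if s: "s \<in> I" for s
  proof -
    obtain \<delta> where \<delta>: "0 < \<delta>" "\<And>w k. k\<^sup>2 - 2 * w * k + 1 = 0 \<Longrightarrow> cmod k < 1 \<Longrightarrow> 0 < Im k \<Longrightarrow>
        cmod (k - k0 s) \<le> 2 * cmod (w - zeta lam s) / \<delta>"
      unfolding k0_def using kbdry_approx[OF nz[OF s]] by metis
    have "\<forall>\<^sub>F \<epsilon> in at_right 0. norm (k \<epsilon> s - k0 s) \<le> 2 * (\<epsilon> * h\<^sup>2 / 2) / \<delta>"
    proof (rule eventually_at_rightI[of 0 1])
      fix \<epsilon> :: real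
      assume "\<epsilon> \<in> {0<..<1}"
      then have "norm (k \<epsilon> s - k0 s) \<le> 2 * cmod (w \<epsilon> s - zeta lam s) / \<delta>"
        using k by (intro \<delta>(2)) auto
      also have "cmod (w \<epsilon> s - zeta lam s) = \<epsilon> * h\<^sup>2 / 2"
        unfolding w using \<open>\<epsilon> \<in> {0<..<1}\<close>
        by (simp only: norm_minus_cancel norm_mult norm_ii norm_of_real) simp
      finally show "norm (k \<epsilon> s - k0 s) \<le> 2 * (\<epsilon> * h\<^sup>2 / 2) / \<delta>" .
    qed simp
    moreover have "((\<lambda>\<epsilon>. 2 * (\<epsilon> * h\<^sup>2 / 2) / \<delta>) \<longlongrightarrow> 2 * (0 * h\<^sup>2 / 2) / \<delta>) (at_right 0)"
      using \<delta>(1) by (intro tendsto_intros) auto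
    then have "((\<lambda>\<epsilon>. 2 * (\<epsilon> * h\<^sup>2 / 2) / \<delta>) \<longlongrightarrow> 0) (at_right 0)"
      by simp
    ultimately show ?thesis
      by (rule LIM_zero_cancel[OF Lim_null_comparison])
  qed
  define h2 where "h2 = complex_of_real (h\<^sup>2)"
  \<comment> \<open>The constant of \<open>norm_green_diff_le\<close>; its terms measure the change
    of the prefactor and of the base.\<close>
  define E where "E \<epsilon> s = cmod (h2 / (1 / k \<epsilon> s - k \<epsilon> s) - h2 / (1 / k0 s - k0 s)) +
    cmod (h2 / (1 / k0 s - k0 s)) * cmod (k \<epsilon> s - k0 s)" for \<epsilon> s
  have E0: "0 \<le> E \<epsilon> s" for \<epsilon> s
    by (simp add: E_def)
  have E_lim: "((\<lambda>\<epsilon>. E \<epsilon> s) \<longlongrightarrow> 0) (at_right 0)" if s: "s \<in> I" for s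
  proof -
    have "(zeta lam s)\<^sup>2 \<noteq> 1"
      using nz[OF s] by (auto simp: power2_eq_1_iff)
    then have ne: "k0 s \<noteq> 0" "1 / k0 s - k0 s \<noteq> 0"
      using kbdry_nonzero[OF nz[OF s]] kbdry_diff[OF nz[OF s]] unfolding k0_def by auto
    have "((\<lambda>\<epsilon>. E \<epsilon> s) \<longlongrightarrow> cmod (h2 / (1 / k0 s - k0 s) - h2 / (1 / k0 s - k0 s)) +
        cmod (h2 / (1 / k0 s - k0 s)) * cmod (k0 s - k0 s)) (at_right 0)"
      unfolding E_def by (intro tendsto_intros k_lim[OF s] ne)
    then show ?thesis by simp
  qed
  obtain C where C: "kb (kern (bgreen lam)) C"
    using kb_bgreen[OF nz] by metis
  show ?thesis
  proof (rule boundary_value_eqI[OF hs_kop[OF C]])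
    show "((\<lambda>\<epsilon>. (\<Sum>s\<in>I. E \<epsilon> s) * M) \<longlongrightarrow> 0) (at_right 0)"
      using tendsto_mult_right[OF tendsto_sum[of I "\<lambda>s \<epsilon>. E \<epsilon> s" "\<lambda>_. 0"], of _ M] E_lim by simp
    show "\<forall>\<^sub>F \<epsilon> in at_right 0. hs (\<lambda>u. sandwiched_resolvent (H_Q h Q) factor (Complex lam \<epsilon>) u -
        kop (kern (bgreen lam)) u) ((\<Sum>s\<in>I. E \<epsilon> s) * M)"
    proof (rule eventually_at_rightI[of 0 1])
      fix \<epsilon> :: real
      assume "\<epsilon> \<in> {0<..<1}"
      then have \<epsilon>: "0 < \<epsilon>" by simp
      define G where "G s j = green h (k \<epsilon> s) j - bgreen lam s j" for s j
      have "cmod (G s j) \<le> (\<Sum>s\<in>I. E \<epsilon> s) * (1 + real j)" if s: "s \<in> I" for s j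
      proof -
        have "cmod (G s j) \<le> E \<epsilon> s * (1 + real j)"
          unfolding G_def bgreen_def E_def k0_def h2_def
          using k(3)[OF \<epsilon>, of s] kbdry_norm[OF nz[OF s]] by (intro norm_green_diff_le) auto
        also have "\<dots> \<le> (\<Sum>s\<in>I. E \<epsilon> s) * (1 + real j)"
          using s finite_I E0 by (intro mult_right_mono member_le_sum) auto
        finally show ?thesis .
      qed
      then have kbG: "kb (kern G) (\<Sum>s\<in>I. E \<epsilon> s)"
        by (rule kb_kern) (auto intro: sum_nonneg E0)
      have kern_eq: "kern (\<lambda>s. green h (k \<epsilon> s)) = (\<lambda>s n m. kern G s n m + kern (bgreen lam) s n m)"
        by (simp add: kern_def fun_eq_iff G_def algebra_simps)
      have "sandwiched_resolvent (H_Q h Q) factor (Complex lam \<epsilon>) = kop (kern (\<lambda>s. green h (k \<epsilon> s)))"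
      proof (rule sandwiched_resolvent_eq)
        show "kb (kern (\<lambda>s. green h (k \<epsilon> s))) ((\<Sum>s\<in>I. E \<epsilon> s) + C)"
          unfolding kern_eq by (rule kb_add[OF kbG C])
        show "Im (Complex lam \<epsilon>) \<noteq> 0"
          using \<epsilon> by simp
        show "(k \<epsilon> s)\<^sup>2 - 2 * (1 - (Complex lam \<epsilon> - \<mu> s) * complex_of_real (h\<^sup>2) / 2) * k \<epsilon> s + 1 = 0" for s
          using k(1)[OF \<epsilon>, of s] unfolding w_def .
        show "k \<epsilon> s \<noteq> 0 \<and> cmod (k \<epsilon> s) < 1" for s
          using k(2,3)[OF \<epsilon>, of s] by simp
      qed
      then have "(\<lambda>u. sandwiched_resolvent (H_Q h Q) factor (Complex lam \<epsilon>) u -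
          kop (kern (bgreen lam)) u) = kop (kern G)"
        by (simp add: fun_eq_iff kern_eq kop_add[OF kbG C])
      then show "hs (\<lambda>u. sandwiched_resolvent (H_Q h Q) factor (Complex lam \<epsilon>) u -
          kop (kern (bgreen lam)) u) ((\<Sum>s\<in>I. E \<epsilon> s) * M)"
        using hs_kop[OF kbG] by simp
    qed simp
  qed
qed

end


section \<open>The spectral shift function near a threshold\<close>

context kernel_ops
begin

lemma adj_Y:
  assumes s: "s \<in> I" and p: "\<And>n. cmod (p n) \<le> \<sigma> n"
  shows "adj (Y s p) g = R (emb (\<lambda>n. cnj (p n)) (L s g))"
proof -
  note pl = kbound_l2[OF p]
  note bp = bounded_clinear_row[OF pl] and bL = bounded_clinear_adj[OF bounded_clinear_L[OF s]]
  show ?thesis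
    unfolding Y_def[abs_def] adj_compose[OF bL bounded_clinear_compose[OF bp bounded_clinear_R]]
      adj_compose[OF bp bounded_clinear_R] adj_adj[OF bounded_clinear_L[OF s]] adj_row[OF pl]
      self_adjoint_adj[OF R(1)] ..
qed

end

section \<open>Identification of the effective operators\<close>

lemma mult_tensor_emb:
  assumes f: "\<And>n. cmod (f n) \<le> M" and L: "bounded_clinear L"
    and p: "l2_le p C" and fp: "l2_le (\<lambda>n. f n * p n) C'"
  shows "mult_tensor f L (emb p x) = emb (\<lambda>n. f n * p n) (L x)"
  by (rule ell2_eqI)
    (simp add: Rep_mult_tensor[OF f L] Rep_emb[OF p] Rep_emb[OF fp] bounded_clinear_scaleC[OF L]
      scaleC_scaleC)

lemma row_mult_tensor:
  assumes f: "\<And>n. cmod (f n) \<le> M" and L: "bounded_clinear L" and fp: "l2_le (\<lambda>n. p n * f n) C'"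
  shows "row p (mult_tensor f L u) = L (row (\<lambda>n. p n * f n) u)"
  by (rule row_apply[OF fp L]) (simp add: Rep_mult_tensor[OF f L] scaleC_scaleC)

context lattice_model
begin

lemma psi_c_le_weight: "cmod (psi_c n) \<le> psi_weight \<nu> n"
  by (simp add: psi_nonneg psi_le_psi_weight)

lemma P_op_eq: "P_op \<nu> Q \<mu> s u = proj s (row psi_c u)"
  unfolding P_op_def
  using has_sum_bounded_linear[OF bounded_clinear_bounded_linear[OF bounded_clinear_proj]
      has_sum_row[OF kbound_l2[OF psi_c_le_weight]], of s u]
  by (intro infsumI) (simp add: bounded_clinear_scaleR[OF bounded_clinear_proj] scaleC_of_real)

lemma adj_P_op: "adj (P_op \<nu> Q \<mu> s) g = emb psi_c (proj s g)"
proof -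
  note pl = kbound_l2[OF psi_c_le_weight]
  have "adj (P_op \<nu> Q \<mu> s) = (\<lambda>g. adj (row psi_c) (adj (proj s) g))"
    using adj_compose[OF bounded_clinear_proj bounded_clinear_row[OF pl]]
    by (simp add: P_op_eq[abs_def])
  then show ?thesis
    by (simp add: adj_row[OF pl] self_adjoint_adj[OF proj_sa])
qed

text \<open>The two square roots in \<open>Y\<close> and its adjoint meet and form \<open>W\<close>;
  the function \<open>p\<close> is real, so conjugation leaves no trace.\<close>

lemma effective_form:
  assumes s: "s \<in> I" and p: "\<And>n. cmod (p n) \<le> psi_weight \<nu> n" "\<And>n. cnj (p n) = p n"
  shows "Y s p (adj (Y s p) g) = proj s (row p (V_eff K W (emb p (proj s g))))"
proof -
  note pl = kbound_l2[OF p(1)]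
  note bK' = bounded_clinear_adj[OF bounded_clinear_K]
  have 1: "cmod 1 \<le> 1" by simp
  have pl': "l2_le (\<lambda>n. 1 * p n) S" "l2_le (\<lambda>n. p n * 1) S"
    using pl by simp_all
  have "V_eff K W (emb p (proj s g)) = mult_tensor (\<lambda>_. 1) (adj K) (W (emb p (L s g)))"
    using mult_tensor_emb[OF 1 bounded_clinear_K pl pl'(1)] by (simp add: V_eff_def L_def)
  then have "row p (V_eff K W (emb p (proj s g))) = adj K (row p (W (emb p (L s g))))"
    using row_mult_tensor[OF 1 bK' pl'(2)] by simp
  then show ?thesis
    by (simp add: adj_Y[OF s p(1)] p(2)) (simp add: Y_def adj_L op_sqrt_op_sqrt[OF W])
qed

lemma V_eff_scaleR: "V_eff K (\<lambda>u. r *\<^sub>R W u) x = r *\<^sub>R V_eff K W x"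
proof -
  have "bounded_clinear (mult_tensor (\<lambda>_. 1) (adj K))"
    by (rule bounded_clinear_mult_tensor[of _ 1])
      (simp_all add: bounded_clinear_adj bounded_clinear_K)
  then show ?thesis
    by (simp add: V_eff_def bounded_clinear_scaleR)
qed

text \<open>Scaling \<open>W\<close> by \<open>r\<close> scales the effective operator while
  \<open>Y\<close> remains that of the unscaled \<open>W\<close>, so the square root of a scaled
  operator never has to be compared.\<close>

lemma omega_lower_eq:
  assumes s: "s \<in> I"
  shows "omega_lower h Q \<mu> \<nu> K s (\<lambda>u. r *\<^sub>R W u) lam =
    (\<lambda>g. r *\<^sub>R (h / 2 / sqrt \<bar>lam - \<mu> s\<bar>) *\<^sub>R Y s psi_c (adj (Y s psi_c) g))"
  using effective_form[OF s psi_c_le_weight]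
  by (simp add: omega_lower_def[abs_def] P_op_eq adj_P_op V_eff_scaleR
      bounded_clinear_scaleR[OF bounded_clinear_row[OF kbound_l2[OF psi_c_le_weight]]]
      bounded_clinear_scaleR[OF bounded_clinear_proj] mult.commute)

definition alt :: "int \<Rightarrow> complex"
  where "alt n = (- 1) powi n"

lemma alt_eq: "alt n = (if even n then 1 else - 1)"
  by (auto simp: alt_def power_int_def minus_one_power_iff even_nat_iff)

lemma norm_alt: "cmod (alt n) \<le> 1"
  by (simp add: alt_eq)

lemma cnj_alt: "cnj (alt n) = alt n"
  by (simp add: alt_eq)

lemma alt_mult: "alt n * alt m = (- 1) ^ nat \<bar>n - m\<bar>"
  by (auto simp: alt_eq minus_one_power_iff even_nat_iff)

abbreviation psi_alt :: "int \<Rightarrow> complex"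
  where "psi_alt n \<equiv> alt n * psi_c n"

lemma psi_alt_le_weight: "cmod (psi_alt n) \<le> psi_weight \<nu> n"
  using mult_mono[OF norm_alt psi_c_le_weight, of n n] by (simp add: norm_mult)

text \<open>\<open>J_op\<close> acts on the lattice variable alone, so it passes through
  \<open>K\<close> and is absorbed into \<open>psi\<close>; the minus sign in
  \<open>omega_upper\<close> cancels.\<close>

lemma omega_upper_eq:
  assumes s: "s \<in> I"
  shows "(\<lambda>g. - omega_upper h Q \<mu> \<nu> K s (\<lambda>u. r *\<^sub>R W u) lam g) =
    (\<lambda>g. r *\<^sub>R (h / 2 / sqrt \<bar>4 / h\<^sup>2 + \<mu> s - lam\<bar>) *\<^sub>R Y s psi_alt (adj (Y s psi_alt) g))"
proof
  fix g
  note pl = kbound_l2[OF psi_c_le_weight] and al = kbound_l2[OF psi_alt_le_weight]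
  have al': "l2_le (\<lambda>n. psi_c n * alt n) S"
    using al by (simp add: mult.commute)
  have bid: "bounded_clinear (id :: 'g \<Rightarrow> 'g)"
    by (simp add: id_def bounded_clinear_id)
  have J: "J_op = mult_tensor alt (id :: 'g \<Rightarrow> 'g)"
    by (simp add: J_op_def alt_def[abs_def])
  have "adj (id :: 'g \<Rightarrow> 'g) = id"
    by (rule adj_eqI) simp
  then have J': "adj J_op = (J_op :: 'g ell2 \<Rightarrow> _)"
    by (simp add: J adj_mult_tensor[OF norm_alt bid] cnj_alt)
  have "V_eff_J K (\<lambda>u. r *\<^sub>R W u) (emb psi_c (proj s g)) = J_op (r *\<^sub>R V_eff K W (emb psi_alt (proj s g)))"
    using mult_tensor_emb[OF norm_alt bid pl al]
    by (simp add: V_eff_J_def J' V_eff_scaleR) (simp add: J)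
  then have "row psi_c (V_eff_J K (\<lambda>u. r *\<^sub>R W u) (emb psi_c (proj s g))) =
      row psi_alt (r *\<^sub>R V_eff K W (emb psi_alt (proj s g)))"
    using row_mult_tensor[OF norm_alt bid al'] by (simp add: J mult.commute[of "alt _"])
  then have "P_op \<nu> Q \<mu> s (V_eff_J K (\<lambda>u. r *\<^sub>R W u) (adj (P_op \<nu> Q \<mu> s) g)) =
      r *\<^sub>R Y s psi_alt (adj (Y s psi_alt) g)"
    using effective_form[OF s psi_alt_le_weight, of g]
    by (simp add: P_op_eq adj_P_op cnj_alt bounded_clinear_scaleR[OF bounded_clinear_row[OF al]]
      bounded_clinear_scaleR[OF bounded_clinear_proj])
  then show "- omega_upper h Q \<mu> \<nu> K s (\<lambda>u. r *\<^sub>R W u) lam g =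
    r *\<^sub>R (h / 2 / sqrt \<bar>4 / h\<^sup>2 + \<mu> s - lam\<bar>) *\<^sub>R Y s psi_alt (adj (Y s psi_alt) g)"
    by (simp add: omega_upper_def mult.commute)
qed

text \<open>
  At energy \<open>lam\<close> the boundary value of the Green function in channel \<open>s\<^sub>0\<close> is the rank one kernel
  \<open>\<tau> c \<epsilon>(\<bar>n - m\<bar>)\<close>, with sign \<open>\<tau>\<close> and \<open>\<epsilon> = 1\<close> or \<open>\<epsilon>(j) = (-1)\<^sup>j\<close>, up to an error \<open>C (1 + \<bar>n - m\<bar>)\<close>;
  all other contributions are bounded by \<open>C\<close>.
\<close>

definition near_threshold :: "nat \<Rightarrow> real \<Rightarrow> (nat \<Rightarrow> real) \<Rightarrow> real \<Rightarrow> real \<Rightarrow> real \<Rightarrow> bool"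
  where "near_threshold s0 \<tau> eps c C lam \<longleftrightarrow>
    (\<forall>s\<in>I. \<bar>zeta lam s\<bar> \<noteq> 1 \<and> band_density h (zeta lam s) \<le> C \<and>
      (\<forall>j. cmod (bgreen lam s j - (if s = s0 then complex_of_real (\<tau> * c * eps j) else 0)) \<le> C * (1 + real j)))"

text \<open>The addition formula for the cosine separates \<open>n\<close> and \<open>m\<close>; in
  the band \<open>arccos (zeta lam s)\<close> is the argument of the unimodular root.\<close>

lemma im_bgreen_kernel:
  fixes lam :: real
  defines "p s n \<equiv> complex_of_real (psi \<nu> n * cos (arccos (zeta lam s) * n))"
    and "q s n \<equiv> complex_of_real (psi \<nu> n * sin (arccos (zeta lam s) * n))"
  shows "complex_of_real (Im (kern (bgreen lam) s n m)) =
    complex_of_real (band_density h (zeta lam s)) * (cnj (p s n) * p s m + cnj (q s n) * q s m)"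
proof -
  define \<theta> where "\<theta> = arccos (zeta lam s)"
  have "cos (\<theta> * real (nat \<bar>n - m\<bar>)) = cos (\<theta> * n - \<theta> * m)"
  proof (cases "m \<le> n")
    case True
    then show ?thesis by (simp add: algebra_simps)
  next
    case False
    then have "\<theta> * real (nat \<bar>n - m\<bar>) = - (\<theta> * n - \<theta> * m)"
      by (simp add: algebra_simps)
    then show ?thesis by (simp only: cos_minus)
  qed
  then have "Im (kern (bgreen lam) s n m) = psi \<nu> n * psi \<nu> m * (band_density h (zeta lam s) *
      (cos (\<theta> * n) * cos (\<theta> * m) + sin (\<theta> * n) * sin (\<theta> * m)))"
    by (simp add: kern_def bgreen_def Im_green_kbdry cos_diff \<theta>_def mult_ac)
  then show ?thesis
    by (simp only: p_def q_def \<theta>_def[symmetric] complex_cnj_complex_of_real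
        of_real_mult[symmetric] of_real_add[symmetric] of_real_eq_iff) (simp add: algebra_simps)
qed

text \<open>\<open>\<tau>\<close> is the sign of the divergent term and \<open>ph\<close> the phase
  that factorizes \<open>eps\<close>: constant at a lower threshold, alternating at an upper one.
  The first two bounds concern the sign of the perturbation whose count follows the effective
  operator, the last two the other sign. \<open>\<kappa>\<close> does not involve
  \<open>lam\<close>.\<close>

lemma near_threshold_bounds:
  assumes s0: "s0 \<in> I" and \<tau>: "\<bar>\<tau>\<bar> = 1" and c: "0 \<le> c" and C: "0 \<le> C"
    and ph: "\<And>n. cmod (ph n) \<le> 1" "\<And>n m. cnj (ph n) * ph m = complex_of_real (eps (nat \<bar>n - m\<bar>))"
    and near: "near_threshold s0 \<tau> eps c C lam" and \<delta>: "0 < \<delta>" "\<delta> < 1 / 2"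
  defines "p0 \<equiv> \<lambda>n. ph n * psi_c n"
    and "A \<equiv> re_op (boundary_value (H_Q h Q) factor lam)"
    and "B \<equiv> im_op (boundary_value (H_Q h Q) factor lam)"
    and "\<kappa> \<equiv> (C * M)\<^sup>2 / \<delta>\<^sup>2 + 2 * (C * (2 * real (card I) * (\<rho> * (S * D))\<^sup>2)) / \<delta>"
  shows "averaged_counting \<tau> (\<lambda>x. \<tau> *\<^sub>R A x) B \<le>
      real (counting_pos (1 - 2 * \<delta>) (\<lambda>g. c *\<^sub>R Y s0 p0 (adj (Y s0 p0) g))) + \<kappa>"
    and "real (counting_pos (1 + 2 * \<delta>) (\<lambda>g. c *\<^sub>R Y s0 p0 (adj (Y s0 p0) g))) - \<kappa> \<le>
      averaged_counting \<tau> (\<lambda>x. \<tau> *\<^sub>R A x) B"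
    and "averaged_counting (- \<tau>) (\<lambda>x. - (\<tau> *\<^sub>R A x)) B \<le> \<kappa>"
    and "0 \<le> averaged_counting (- \<tau>) (\<lambda>x. - (\<tau> *\<^sub>R A x)) B"
proof -
  have nz: "\<bar>zeta lam s\<bar> \<noteq> 1" and band: "band_density h (zeta lam s) \<le> C"
    and green_le: "cmod (bgreen lam s j - (if s = s0 then complex_of_real (\<tau> * c * eps j) else 0)) \<le> C * (1 + real j)"
    if "s \<in> I" for s j
    using near that unfolding near_threshold_def by blast+
  obtain C1 where C1: "kb (kern (bgreen lam)) C1"
    using kb_bgreen[OF nz] by metis
  have bv: "boundary_value (H_Q h Q) factor lam = kop (kern (bgreen lam))"
    by (rule boundary_value_eq[OF nz])
  have A: "A = kop (\<lambda>s n m. complex_of_real (Re (kern (bgreen lam) s n m)))"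
    and B: "B = kop (\<lambda>s n m. complex_of_real (Im (kern (bgreen lam) s n m)))"
    unfolding A_def B_def bv by (rule re_op_kop[OF C1 kern_sym] im_op_kop[OF C1 kern_sym])+
  define p where "p s n = complex_of_real (psi \<nu> n * cos (arccos (zeta lam s) * n))" for s and n :: int
  define q where "q s n = complex_of_real (psi \<nu> n * sin (arccos (zeta lam s) * n))" for s and n :: int
  have B': "B = kop (\<lambda>s n m. complex_of_real (band_density h (zeta lam s)) *
      (cnj (p s n) * p s m + cnj (q s n) * q s m))"
    unfolding B im_bgreen_kernel p_def q_def ..
  have p: "cmod (p s n) \<le> psi_weight \<nu> n" and q: "cmod (q s n) \<le> psi_weight \<nu> n" for s n
  proof -
    have "psi \<nu> n * \<bar>x\<bar> \<le> psi_weight \<nu> n" if "\<bar>x\<bar> \<le> 1" for x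
      using mult_left_mono[OF that psi_nonneg[of \<nu> n]] psi_le_psi_weight[of \<nu> n] by linarith
    then show "cmod (p s n) \<le> psi_weight \<nu> n" "cmod (q s n) \<le> psi_weight \<nu> n"
      unfolding p_def q_def norm_of_real abs_mult
      by (simp_all only: abs_of_nonneg[OF psi_nonneg] abs_cos_le_one abs_sin_le_one)
  qed
  define \<gamma> where "\<gamma> s = band_density h (zeta lam s)" for s
  have band': "0 \<le> \<gamma> s \<and> \<gamma> s \<le> C" if "s \<in> I" for s
  proof -
    have "0 \<le> band_density h (zeta lam s)"
      by (auto simp: band_density_def abs_square_le_1 intro!: divide_nonneg_nonneg)
    then show ?thesis
      using band[OF that] by (simp add: \<gamma>_def)
  qed
  have B_hsa: "hsa B" and B_nonneg: "\<And>x. 0 \<le> Re (cinner x (B x))"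
    and B_trace: "\<And>F. finite F \<Longrightarrow> orthonormal F \<Longrightarrow>
      (\<Sum>f\<in>F. Re (cinner f (B f))) \<le> C * (2 * real (card I) * (\<rho> * (S * D))\<^sup>2)"
    unfolding B'[folded \<gamma>_def]
    by (rule hsa_kop_rank_two[OF p q band'] kop_rank_two_nonneg[OF p q band']
        kop_rank_two_trace[OF p q band']; assumption)+
  have p0: "cmod (p0 n) \<le> psi_weight \<nu> n" for n
    using mult_mono[OF ph(1) psi_c_le_weight, of n n] by (simp add: p0_def norm_mult)
  define G where "G s j = bgreen lam s j - (if s = s0 then complex_of_real (\<tau> * c * eps j) else 0)" for s j
  have kbG: "kb (kern G) C"
    by (rule kb_kern[OF _ C]) (use green_le in \<open>auto simp: G_def\<close>)
  define P where "P = kop (\<lambda>s n m. complex_of_real (Re (kern G s n m)))"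
  have kbP: "kb (\<lambda>s n m. complex_of_real (Re (kern G s n m))) C"
    using kbG abs_Re_le_cmod order_trans unfolding kb_def kbound_def norm_of_real by meson
  have "self_adjoint P"
    unfolding P_def by (rule self_adjoint_kop[OF kbP], subst kern_sym) simp
  moreover have "hs P (C * M)"
    unfolding P_def by (rule hs_kop[OF kbP])
  ultimately have P: "self_adjoint P" "hs P (C * M)" .
  have kb1: "kb (\<lambda>s n m. if s = s0 then cnj (p0 n) * p0 m else 0) 1"
    using kbound_rank_one[of p0, OF p0] weight_nonneg by (simp add: kb_def kbound_def)
  have kern_eq: "complex_of_real (Re (kern (bgreen lam) s n m)) = complex_of_real (Re (kern G s n m)) +
      complex_of_real (\<tau> * c) * (if s = s0 then cnj (p0 n) * p0 m else 0)" for s n m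
  proof -
    have "cnj (p0 n) * p0 m = cnj (ph n) * ph m * (psi_c n * psi_c m)"
      by (simp add: p0_def mult_ac)
    then have "cnj (p0 n) * p0 m = complex_of_real (eps (nat \<bar>n - m\<bar>) * (psi \<nu> n * psi \<nu> m))"
      by (simp add: ph(2))
    then show ?thesis
      by (simp add: kern_def G_def algebra_simps)
  qed
  have "A x = P x + complex_of_real (\<tau> * c) *\<^sub>C adj (Y s0 p0) (Y s0 p0 x)" for x
    unfolding A P_def kern_eq kop_add[OF kbP kb_cmult[OF kb1]] kop_cmult[OF kb1] kop_rank_one[OF s0 p0] ..
  then have "A x = P x + (\<tau> * c) *\<^sub>R adj (Y s0 p0) (Y s0 p0 x)" for x
    unfolding scaleC_of_real .
  moreover have "\<tau> * \<tau> = 1"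
    using \<tau> by (metis abs_mult_self_eq mult_1)
  ultimately have A': "\<tau> *\<^sub>R A x = c *\<^sub>R adj (Y s0 p0) (Y s0 p0 x) + \<tau> *\<^sub>R P x" for x
    by (simp add: scaleR_add_right mult.assoc[symmetric])
  have P': "self_adjoint (\<lambda>x. \<tau> *\<^sub>R P x)" "hs (\<lambda>x. \<tau> *\<^sub>R P x) (C * M)"
    using self_adjoint_scaleR[OF P(1)] hs_rmult[OF P(2), of \<tau>] \<tau> by auto
  have \<tau>': "\<bar>- \<tau>\<bar> = 1"
    using \<tau> by simp
  note avg = averaged_counting_perturbed[where A = "\<lambda>x. \<tau> *\<^sub>R A x",
      OF hs_Y[OF s0 p0] c P' A' B_hsa B_nonneg B_trace _ \<delta>, folded \<kappa>_def]
  show "averaged_counting \<tau> (\<lambda>x. \<tau> *\<^sub>R A x) B \<le>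
      real (counting_pos (1 - 2 * \<delta>) (\<lambda>g. c *\<^sub>R Y s0 p0 (adj (Y s0 p0) g))) + \<kappa>"
    "real (counting_pos (1 + 2 * \<delta>) (\<lambda>g. c *\<^sub>R Y s0 p0 (adj (Y s0 p0) g))) - \<kappa> \<le>
      averaged_counting \<tau> (\<lambda>x. \<tau> *\<^sub>R A x) B"
    by (rule avg(1,2)[OF _ _ \<tau>]; assumption)+
  show "averaged_counting (- \<tau>) (\<lambda>x. - (\<tau> *\<^sub>R A x)) B \<le> \<kappa>"
    "0 \<le> averaged_counting (- \<tau>) (\<lambda>x. - (\<tau> *\<^sub>R A x)) B"
    by (rule avg(3,4)[OF _ _ \<tau>']; assumption)+
qed

lemma hsa_effective:
  assumes "s \<in> I" "\<And>n. cmod (p n) \<le> psi_weight \<nu> n"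
  shows "hsa (\<lambda>g. c *\<^sub>R Y s p (adj (Y s p) g))"
  using hsa_adj_comp[OF hs_adj[OF hs_Y[OF assms]]]
  by (intro hsa_scaleR) (simp add: adj_adj[OF hs_bounded_clinear[OF hs_Y[OF assms]]])

lemma xi_minus_eq:
  "xi_minus h Q \<nu> K W lam = - averaged_counting 1
    (re_op (boundary_value (H_Q h Q) factor lam)) (im_op (boundary_value (H_Q h Q) factor lam))"
  by (simp add: xi_minus_def ssf_minus_eq_averaged_counting)

lemma xi_plus_eq:
  "xi_plus h Q \<nu> K W lam = averaged_counting (- 1)
    (\<lambda>x. - re_op (boundary_value (H_Q h Q) factor lam) x) (im_op (boundary_value (H_Q h Q) factor lam))"
  by (simp add: xi_plus_def ssf_plus_eq_averaged_counting)

text \<open>\<open>F2\<close> at \<open>W\<close> scaled by \<open>inverse r\<close> is minus the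
  count of \<open>X lam\<close> above \<open>r\<close>, so \<open>\<delta> = \<epsilon> / 2\<close>
  makes the two count bounds the two sides of the relation; negation exchanges upper and lower
  bound.\<close>

lemma sim_from_bounds:
  fixes F1 :: "real \<Rightarrow> real" and F2 :: "('g ell2 \<Rightarrow> 'g ell2) \<Rightarrow> real \<Rightarrow> real"
  assumes hsa: "\<And>lam. hsa (X lam)"
    and F2: "\<And>r lam. F2 (\<lambda>u. r *\<^sub>R W u) lam = - trace_above_one (\<lambda>g. r *\<^sub>R X lam g)"
    and bounds: "\<And>\<delta>. 0 < \<delta> \<Longrightarrow> \<delta> < 1 / 2 \<Longrightarrow> \<exists>\<kappa>. \<forall>\<^sub>F lam in flt.
      F1 lam \<le> real (counting_pos (1 - 2 * \<delta>) (X lam)) + \<kappa> \<and>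
      real (counting_pos (1 + 2 * \<delta>) (X lam)) - \<kappa> \<le> F1 lam"
    and F1': "\<And>lam. F1' W lam = - F1 lam"
  shows "functional_sim flt F1' F2 W"
  unfolding functional_sim_def
proof
  fix \<epsilon> :: real
  assume "\<epsilon> \<in> {0<..<1}"
  then have \<epsilon>: "0 < \<epsilon>" "\<epsilon> < 1" by auto
  have trace: "F2 (\<lambda>u. inverse r *\<^sub>R W u) lam = - real (counting_pos r (X lam))" if "0 < r" for r lam
    using that by (simp add: F2 trace_above_one_eq[OF hsa_scaleR[OF hsa]] counting_pos_scaleR[OF hsa]
        divide_inverse)
  obtain \<kappa> where ev: "\<forall>\<^sub>F lam in flt. F1 lam \<le> real (counting_pos (1 - \<epsilon>) (X lam)) + \<kappa> \<and>
      real (counting_pos (1 + \<epsilon>) (X lam)) - \<kappa> \<le> F1 lam"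
    using bounds[of "\<epsilon> / 2"] \<epsilon> by auto
  have "(\<lambda>_. - \<kappa>) \<in> O[flt](\<lambda>_. 1)" "(\<lambda>_. \<kappa>) \<in> O[flt](\<lambda>_. 1)"
    by simp_all
  moreover have "\<forall>\<^sub>F lam in flt. F2 (\<lambda>u. inverse (1 - \<epsilon>) *\<^sub>R W u) lam + - \<kappa> \<le> F1' W lam \<and>
      F1' W lam \<le> F2 (\<lambda>u. inverse (1 + \<epsilon>) *\<^sub>R W u) lam + \<kappa>"
    using ev by eventually_elim (use \<epsilon> in \<open>simp add: F1' trace\<close>)
  ultimately show "\<exists>r1\<in>O[flt](\<lambda>_. 1). \<exists>r2\<in>O[flt](\<lambda>_. 1). \<forall>\<^sub>F lam in flt.
      F2 (\<lambda>u. inverse (1 - \<epsilon>) *\<^sub>R W u) lam + r1 lam \<le> F1' W lam \<and>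
      F1' W lam \<le> F2 (\<lambda>u. inverse (1 + \<epsilon>) *\<^sub>R W u) lam + r2 lam"
    by (intro bexI[of _ "\<lambda>_. - \<kappa>"] bexI[of _ "\<lambda>_. \<kappa>"])
qed

lemma bigo_1_of_bounds:
  fixes f :: "real \<Rightarrow> real"
  assumes "\<forall>\<^sub>F lam in flt. \<bar>f lam\<bar> \<le> \<kappa>"
  shows "f \<in> O[flt](\<lambda>_. 1)"
  by (rule bigoI[where c = \<kappa>]) (use assms in simp)

section \<open>Uniform constants near a non-degenerate threshold\<close>

lemma eventually_other_channel:
  assumes flt: "flt \<le> nhds lam0" and nz: "\<bar>zeta lam0 s\<bar> \<noteq> 1"
  obtains C where "\<forall>\<^sub>F lam in flt. \<bar>zeta lam s\<bar> \<noteq> 1 \<and> h\<^sup>2 / (2 * sqrt \<bar>(zeta lam s)\<^sup>2 - 1\<bar>) \<le> C"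
proof -
  have "((\<lambda>lam. 1 - (lam - \<mu> s) * h\<^sup>2 / 2) \<longlongrightarrow> 1 - (lam0 - \<mu> s) * h\<^sup>2 / 2) (nhds lam0)"
    by (intro tendsto_intros filterlim_ident) simp
  then have z: "((\<lambda>lam. zeta lam s) \<longlongrightarrow> zeta lam0 s) flt"
    unfolding zeta_def by (rule tendsto_mono[OF flt])
  have "(zeta lam0 s)\<^sup>2 \<noteq> 1"
    using nz by (auto simp: power2_eq_1_iff)
  then have lim: "((\<lambda>lam. h\<^sup>2 / (2 * sqrt \<bar>(zeta lam s)\<^sup>2 - 1\<bar>)) \<longlongrightarrow>
      h\<^sup>2 / (2 * sqrt \<bar>(zeta lam0 s)\<^sup>2 - 1\<bar>)) flt"
    by (intro tendsto_intros z) simp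
  have "((\<lambda>lam. \<bar>zeta lam s\<bar>) \<longlongrightarrow> \<bar>zeta lam0 s\<bar>) flt"
    by (intro tendsto_intros z)
  then have "\<forall>\<^sub>F lam in flt. \<bar>zeta lam s\<bar> \<noteq> 1"
    using nz by (rule tendsto_imp_eventually_ne)
  moreover have "\<forall>\<^sub>F lam in flt. h\<^sup>2 / (2 * sqrt \<bar>(zeta lam s)\<^sup>2 - 1\<bar>) <
      h\<^sup>2 / (2 * sqrt \<bar>(zeta lam0 s)\<^sup>2 - 1\<bar>) + 1"
    by (rule order_tendstoD(2)[OF lim]) simp
  ultimately have "\<forall>\<^sub>F lam in flt. \<bar>zeta lam s\<bar> \<noteq> 1 \<and>
      h\<^sup>2 / (2 * sqrt \<bar>(zeta lam s)\<^sup>2 - 1\<bar>) \<le> h\<^sup>2 / (2 * sqrt \<bar>(zeta lam0 s)\<^sup>2 - 1\<bar>) + 1"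
    by eventually_elim simp
  then show ?thesis by (rule that)
qed

text \<open>In the other channels the parameter stays away from modulus 1, so Green functions and
  densities are bounded; in channel \<open>s0\<close> the energy is off the band, hence its density
  vanishes.\<close>

lemma eventually_near_threshold:
  assumes flt: "flt \<le> nhds lam0" and s0: "s0 \<in> I"
    and nz: "\<And>s. s \<in> I \<Longrightarrow> s \<noteq> s0 \<Longrightarrow> \<bar>zeta lam0 s\<bar> \<noteq> 1"
    and main: "\<forall>\<^sub>F lam in flt. 1 < \<bar>zeta lam s0\<bar> \<and>
      (\<forall>j. cmod (bgreen lam s0 j - complex_of_real (\<tau> * c lam * eps j)) \<le> h\<^sup>2 * (1 + real j))"
  shows "\<exists>C\<ge>0. \<forall>\<^sub>F lam in flt. near_threshold s0 \<tau> eps (c lam) C lam"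
proof -
  have "\<forall>s\<in>I - {s0}. \<exists>C. \<forall>\<^sub>F lam in flt. \<bar>zeta lam s\<bar> \<noteq> 1 \<and> h\<^sup>2 / (2 * sqrt \<bar>(zeta lam s)\<^sup>2 - 1\<bar>) \<le> C"
  proof
    fix s
    assume "s \<in> I - {s0}"
    then have "\<bar>zeta lam0 s\<bar> \<noteq> 1"
      by (intro nz) auto
    from eventually_other_channel[OF flt this]
    show "\<exists>C. \<forall>\<^sub>F lam in flt. \<bar>zeta lam s\<bar> \<noteq> 1 \<and> h\<^sup>2 / (2 * sqrt \<bar>(zeta lam s)\<^sup>2 - 1\<bar>) \<le> C"
      by blast
  qed
  from bchoice[OF this] obtain C where C: "\<forall>s\<in>I - {s0}.
      \<forall>\<^sub>F lam in flt. \<bar>zeta lam s\<bar> \<noteq> 1 \<and> h\<^sup>2 / (2 * sqrt \<bar>(zeta lam s)\<^sup>2 - 1\<bar>) \<le> C s" ..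
  \<comment> \<open>\<open>h\<^sup>2\<close> bounds the error in the critical channel, the sum
    covers the finitely many others.\<close>
  define C0 where "C0 = h\<^sup>2 + (\<Sum>s\<in>I - {s0}. \<bar>C s\<bar>)"
  have C0: "0 \<le> C0" "h\<^sup>2 \<le> C0"
    by (auto simp: C0_def sum_nonneg)
  have CC0: "C s \<le> C0" if "s \<in> I - {s0}" for s
  proof -
    have "\<bar>C s\<bar> \<le> (\<Sum>s\<in>I - {s0}. \<bar>C s\<bar>)"
      using that finite_I by (intro member_le_sum) auto
    then show ?thesis
      by (simp add: C0_def) (smt (verit) zero_le_power2)
  qed
  have "\<forall>\<^sub>F lam in flt. \<forall>s\<in>I - {s0}. \<bar>zeta lam s\<bar> \<noteq> 1 \<and> h\<^sup>2 / (2 * sqrt \<bar>(zeta lam s)\<^sup>2 - 1\<bar>) \<le> C s"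
    using finite_I C by (intro eventually_ball_finite) auto
  with main have "\<forall>\<^sub>F lam in flt. near_threshold s0 \<tau> eps (c lam) C0 lam"
  proof eventually_elim
    case (elim lam)
    show ?case
      unfolding near_threshold_def
    proof (intro ballI)
      fix s
      assume s: "s \<in> I"
      show "\<bar>zeta lam s\<bar> \<noteq> 1 \<and> band_density h (zeta lam s) \<le> C0 \<and>
          (\<forall>j. cmod (bgreen lam s j - (if s = s0 then complex_of_real (\<tau> * c lam * eps j) else 0)) \<le> C0 * (1 + real j))"
      proof (cases "s = s0")
        case True
        from elim(1) have gt: "1 < \<bar>zeta lam s0\<bar>"
          and le: "cmod (bgreen lam s0 j - complex_of_real (\<tau> * c lam * eps j)) \<le> h\<^sup>2 * (1 + real j)" for j
          by blast+
        have "h\<^sup>2 * (1 + real j) \<le> C0 * (1 + real j)" for j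
          using C0 by (intro mult_right_mono) auto
        from order_trans[OF le this] show ?thesis
          using gt C0(1) unfolding True by (simp add: band_density_def)
      next
        case False
        then have nz: "\<bar>zeta lam s\<bar> \<noteq> 1" and le: "h\<^sup>2 / (2 * sqrt \<bar>(zeta lam s)\<^sup>2 - 1\<bar>) \<le> C0"
          using elim(2) s CC0[of s] by force+
        have "band_density h (zeta lam s) \<le> h\<^sup>2 / (2 * sqrt \<bar>(zeta lam s)\<^sup>2 - 1\<bar>)"
        proof (cases "\<bar>zeta lam s\<bar> < 1")
          case True
          then have "(zeta lam s)\<^sup>2 < 1"
            by (simp add: abs_square_less_1)
          then show ?thesis
            using True by (simp add: band_density_def)
        qed (simp add: band_density_def)
        moreover have "cmod (bgreen lam s j) \<le> C0 * (1 + real j)" for j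
        proof -
          have "cmod (bgreen lam s j) \<le> C0 * 1"
            using norm_bgreen_le_prefactor[OF nz, of j] le by linarith
          also have "\<dots> \<le> C0 * (1 + real j)"
            using C0 by (intro mult_left_mono) auto
          finally show ?thesis .
        qed
        ultimately show ?thesis
          using False nz le by auto
      qed
    qed
  qed
  with C0(1) show ?thesis by blast
qed

lemma zeta_abs_eq_1_iff: "\<bar>zeta lam s\<bar> = 1 \<longleftrightarrow> lam = \<mu> s \<or> lam = 4 / h\<^sup>2 + \<mu> s"
proof -
  have "zeta lam s = 1 \<longleftrightarrow> lam = \<mu> s"
    using h by (simp add: zeta_def)
  moreover have "zeta lam s = - 1 \<longleftrightarrow> lam = 4 / h\<^sup>2 + \<mu> s"
    using h by (auto simp: zeta_def field_simps)
  ultimately show ?thesis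
    by (auto simp: abs_if)
qed

text \<open>Below the band the distance to the threshold is the \<open>x\<close> of
  \<open>green_threshold\<close> and the divergent term is positive, so the minus sign of the
  perturbation follows the effective operator.\<close>

lemma lower_threshold:
  assumes s0: "s0 \<in> I" and nd: "nondegenerate_lower h Q d \<mu> s0"
  shows "xi_plus h Q \<nu> K W \<in> O[at_left (\<mu> s0)](\<lambda>_. 1)"
    and "functional_sim (at_left (\<mu> s0)) (xi_minus h Q \<nu> K)
      (\<lambda>W lam. - trace_above_one (omega_lower h Q \<mu> \<nu> K s0 W lam)) W"
proof -
  define c where "c lam = h / 2 / sqrt \<bar>lam - \<mu> s0\<bar>" for lam
  have c: "0 \<le> c lam" for lam
    using h by (simp add: c_def)
  have "\<exists>C\<ge>0. \<forall>\<^sub>F lam in at_left (\<mu> s0). near_threshold s0 1 (\<lambda>_. 1) (c lam) C lam"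
  proof (rule eventually_near_threshold[OF _ s0])
    show "at_left (\<mu> s0) \<le> nhds (\<mu> s0)"
      by (rule at_within_le_nhds)
    \<comment> \<open>Another channel could have its lower edge at \<open>\<mu> s0\<close>, excluded
      by distinctness of the eigenvalues, or its upper edge, excluded by non-degeneracy.\<close>
    show "\<bar>zeta (\<mu> s0) s\<bar> \<noteq> 1" if "s \<in> I" "s \<noteq> s0" for s
      using nd that inj_onD[OF inj_on_mu[OF Q enum], of s s0] s0
      unfolding zeta_abs_eq_1_iff nondegenerate_lower_def by metis
    have "\<forall>\<^sub>F lam in at_left (\<mu> s0). lam < \<mu> s0"
      by (simp add: eventually_at_filter)
    then show "\<forall>\<^sub>F lam in at_left (\<mu> s0). 1 < \<bar>zeta lam s0\<bar> \<and>
        (\<forall>j. cmod (bgreen lam s0 j - complex_of_real (1 * c lam * 1)) \<le> h\<^sup>2 * (1 + real j))"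
    proof eventually_elim
      case (elim lam)
      define x where "x = \<mu> s0 - lam"
      have x: "0 < x"
        using elim by (simp add: x_def)
      have z: "zeta lam s0 = 1 + x * h\<^sup>2 / 2"
        by (simp add: zeta_def x_def algebra_simps diff_divide_distrib)
      have "c lam = h / (2 * sqrt x)"
        using x by (simp add: c_def x_def abs_minus_commute)
      moreover have "1 < \<bar>1 + x * h\<^sup>2 / 2\<bar>"
        using x h by simp
      ultimately show ?case
        using green_threshold[OF h x] by (simp only: bgreen_def z mult_1_left mult_1_right) simp
    qed
  qed
  then obtain C where C: "0 \<le> C"
    and near: "\<forall>\<^sub>F lam in at_left (\<mu> s0). near_threshold s0 1 (\<lambda>_. 1) (c lam) C lam"
    by blast
  define X where "X lam = (\<lambda>g. c lam *\<^sub>R Y s0 psi_c (adj (Y s0 psi_c) g))" for lam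
  define \<kappa> where "\<kappa> \<delta> = (C * M)\<^sup>2 / \<delta>\<^sup>2 + 2 * (C * (2 * real (card I) * (\<rho> * (S * D))\<^sup>2)) / \<delta>" for \<delta>
  have bounds: "- xi_minus h Q \<nu> K W lam \<le> real (counting_pos (1 - 2 * \<delta>) (X lam)) + \<kappa> \<delta>"
    "real (counting_pos (1 + 2 * \<delta>) (X lam)) - \<kappa> \<delta> \<le> - xi_minus h Q \<nu> K W lam" "\<bar>xi_plus h Q \<nu> K W lam\<bar> \<le> \<kappa> \<delta>"
    if "near_threshold s0 1 (\<lambda>_. 1) (c lam) C lam" "0 < \<delta>" "\<delta> < 1 / 2" for lam \<delta>
    using near_threshold_bounds[where ph = "\<lambda>_. 1", OF s0 _ c C _ _ that]
    by (simp_all add: xi_plus_eq xi_minus_eq X_def \<kappa>_def)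
  have "\<forall>\<^sub>F lam in at_left (\<mu> s0). \<bar>xi_plus h Q \<nu> K W lam\<bar> \<le> \<kappa> (1 / 4)"
    using near
  proof eventually_elim
    case (elim lam)
    show ?case
      by (rule bounds(3)[OF elim]) simp_all
  qed
  then show "xi_plus h Q \<nu> K W \<in> O[at_left (\<mu> s0)](\<lambda>_. 1)"
    by (rule bigo_1_of_bounds)
  show "functional_sim (at_left (\<mu> s0)) (xi_minus h Q \<nu> K)
      (\<lambda>W lam. - trace_above_one (omega_lower h Q \<mu> \<nu> K s0 W lam)) W"
  proof (rule sim_from_bounds[where X = X and ?F1.0 = "\<lambda>lam. - xi_minus h Q \<nu> K W lam"])
    show "hsa (X lam)" for lam
      unfolding X_def by (rule hsa_effective[OF s0 psi_c_le_weight])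
    show "- trace_above_one (omega_lower h Q \<mu> \<nu> K s0 (\<lambda>u. r *\<^sub>R W u) lam) =
        - trace_above_one (\<lambda>g. r *\<^sub>R X lam g)" for r lam
      unfolding omega_lower_eq[OF s0] X_def c_def ..
    fix \<delta> :: real
    assume \<delta>: "0 < \<delta>" "\<delta> < 1 / 2"
    show "\<exists>\<kappa>. \<forall>\<^sub>F lam in at_left (\<mu> s0).
        - xi_minus h Q \<nu> K W lam \<le> real (counting_pos (1 - 2 * \<delta>) (X lam)) + \<kappa> \<and>
        real (counting_pos (1 + 2 * \<delta>) (X lam)) - \<kappa> \<le> - xi_minus h Q \<nu> K W lam"
      by (rule exI[of _ "\<kappa> \<delta>"], use near in eventually_elim) (use bounds(1,2)[OF _ \<delta>] in blast)
  qed simp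
qed

text \<open>Above the band the root tends to -1: the divergent term is negative with alternating
  factor \<open>eps\<close>, so the two signs of the perturbation exchange roles and
  \<open>psi_alt\<close> replaces \<open>psi_c\<close>.\<close>

lemma upper_threshold:
  assumes s0: "s0 \<in> I" and nd: "nondegenerate_upper h Q d \<mu> s0"
  shows "functional_sim (at_right (4 / h\<^sup>2 + \<mu> s0)) (\<lambda>W lam. - xi_plus h Q \<nu> K W lam)
      (\<lambda>W lam. - trace_above_one (\<lambda>g. - omega_upper h Q \<mu> \<nu> K s0 W lam g)) W"
    and "xi_minus h Q \<nu> K W \<in> O[at_right (4 / h\<^sup>2 + \<mu> s0)](\<lambda>_. 1)"
proof -
  define lam0 where "lam0 = 4 / h\<^sup>2 + \<mu> s0"
  define c where "c lam = h / 2 / sqrt \<bar>lam0 - lam\<bar>" for lam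
  have c: "0 \<le> c lam" for lam
    using h by (simp add: c_def)
  define eps where "eps j = (- 1 :: real) ^ j" for j :: nat
  have alt_eps: "cnj (alt n) * alt m = complex_of_real (eps (nat \<bar>n - m\<bar>))" for n m
    by (simp add: cnj_alt alt_mult eps_def)
  have "\<exists>C\<ge>0. \<forall>\<^sub>F lam in at_right lam0. near_threshold s0 (- 1) eps (c lam) C lam"
  proof (rule eventually_near_threshold[OF _ s0])
    show "at_right lam0 \<le> nhds lam0"
      by (rule at_within_le_nhds)
    show "\<bar>zeta lam0 s\<bar> \<noteq> 1" if "s \<in> I" "s \<noteq> s0" for s
      using nd that inj_onD[OF inj_on_mu[OF Q enum], of s s0] s0
      unfolding zeta_abs_eq_1_iff nondegenerate_upper_def lam0_def by (metis add_left_cancel)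
    have "\<forall>\<^sub>F lam in at_right lam0. lam0 < lam"
      by (simp add: eventually_at_filter)
    then show "\<forall>\<^sub>F lam in at_right lam0. 1 < \<bar>zeta lam s0\<bar> \<and>
        (\<forall>j. cmod (bgreen lam s0 j - complex_of_real (- 1 * c lam * eps j)) \<le> h\<^sup>2 * (1 + real j))"
    proof eventually_elim
      case (elim lam)
      define x where "x = lam - lam0"
      have x: "0 < x"
        using elim by (simp add: x_def)
      have z: "zeta lam s0 = - (1 + x * h\<^sup>2 / 2)"
        using h by (simp add: zeta_def x_def lam0_def field_simps)
      have cx: "c lam = h / (2 * sqrt x)"
        using x by (simp add: c_def x_def abs_minus_commute)
      have "bgreen lam s0 j - complex_of_real (- 1 * c lam * eps j) =
          green h (kbdry (- (1 + x * h\<^sup>2 / 2))) j + (- 1) ^ j * complex_of_real (h / (2 * sqrt x))" for j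
        by (simp only: bgreen_def z cx eps_def) simp
      moreover have "1 < \<bar>- (1 + x * h\<^sup>2 / 2)\<bar>"
        using x h by (simp only: abs_minus_cancel) simp
      ultimately show ?case
        using green_upper_threshold[OF h x] by (simp only: z) simp
    qed
  qed
  then obtain C where C: "0 \<le> C"
    and near: "\<forall>\<^sub>F lam in at_right lam0. near_threshold s0 (- 1) eps (c lam) C lam"
    by blast
  define X where "X lam = (\<lambda>g. c lam *\<^sub>R Y s0 psi_alt (adj (Y s0 psi_alt) g))" for lam
  define \<kappa> where "\<kappa> \<delta> = (C * M)\<^sup>2 / \<delta>\<^sup>2 + 2 * (C * (2 * real (card I) * (\<rho> * (S * D))\<^sup>2)) / \<delta>" for \<delta>
  have bounds: "xi_plus h Q \<nu> K W lam \<le> real (counting_pos (1 - 2 * \<delta>) (X lam)) + \<kappa> \<delta>"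
    "real (counting_pos (1 + 2 * \<delta>) (X lam)) - \<kappa> \<delta> \<le> xi_plus h Q \<nu> K W lam" "\<bar>xi_minus h Q \<nu> K W lam\<bar> \<le> \<kappa> \<delta>"
    if "near_threshold s0 (- 1) eps (c lam) C lam" "0 < \<delta>" "\<delta> < 1 / 2" for lam \<delta>
    using near_threshold_bounds[where ph = alt, OF s0 _ c C norm_alt alt_eps that]
    by (simp_all add: xi_plus_eq xi_minus_eq X_def \<kappa>_def)
  have "\<forall>\<^sub>F lam in at_right lam0. \<bar>xi_minus h Q \<nu> K W lam\<bar> \<le> \<kappa> (1 / 4)"
    using near
  proof eventually_elim
    case (elim lam)
    show ?case
      by (rule bounds(3)[OF elim]) simp_all
  qed
  then show "xi_minus h Q \<nu> K W \<in> O[at_right (4 / h\<^sup>2 + \<mu> s0)](\<lambda>_. 1)"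
    unfolding lam0_def by (rule bigo_1_of_bounds)
  show "functional_sim (at_right (4 / h\<^sup>2 + \<mu> s0)) (\<lambda>W lam. - xi_plus h Q \<nu> K W lam)
      (\<lambda>W lam. - trace_above_one (\<lambda>g. - omega_upper h Q \<mu> \<nu> K s0 W lam g)) W"
  proof (rule sim_from_bounds[where X = X and ?F1.0 = "xi_plus h Q \<nu> K W"])
    show "hsa (X lam)" for lam
      unfolding X_def by (rule hsa_effective[OF s0 psi_alt_le_weight])
    show "- trace_above_one (\<lambda>g. - omega_upper h Q \<mu> \<nu> K s0 (\<lambda>u. r *\<^sub>R W u) lam g) =
        - trace_above_one (\<lambda>g. r *\<^sub>R X lam g)" for r lam
      unfolding omega_upper_eq[OF s0] X_def c_def lam0_def ..
    fix \<delta> :: real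
    assume \<delta>: "0 < \<delta>" "\<delta> < 1 / 2"
    show "\<exists>\<kappa>. \<forall>\<^sub>F lam in at_right (4 / h\<^sup>2 + \<mu> s0).
        xi_plus h Q \<nu> K W lam \<le> real (counting_pos (1 - 2 * \<delta>) (X lam)) + \<kappa> \<and>
        real (counting_pos (1 + 2 * \<delta>) (X lam)) - \<kappa> \<le> xi_plus h Q \<nu> K W lam"
      unfolding lam0_def[symmetric]
      by (rule exI[of _ "\<kappa> \<delta>"], use near in eventually_elim)
        (use bounds(1,2)[OF _ \<delta>] in blast)
  qed rule
qed

end

theorem theorem5p3:
  fixes h \<nu>\<^sub>0 :: real
    and Q K :: "'g :: chilbert_space \<Rightarrow> 'g"
    and \<V> :: "'g ell2 \<Rightarrow> 'g ell2"
    and d s :: nat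
    and \<mu> :: "nat \<Rightarrow> real"
  assumes "0 < h"
    and separable: "\<exists>D :: 'g set. countable D \<and> closure D = UNIV"
    and "self_adjoint Q"
    and "eigenvalue_enum Q d \<mu>"
    and "3 < \<nu>\<^sub>0"
    and "positive_op \<V>"
    and "schatten2 K"
    and "s \<in> I_Q Q d"
  shows "(nondegenerate_lower h Q d \<mu> s \<longrightarrow>
      xi_plus h Q \<nu>\<^sub>0 K \<V> \<in> O[at_left (\<mu> s)](\<lambda>_. 1) \<and>
      functional_sim (at_left (\<mu> s)) (xi_minus h Q \<nu>\<^sub>0 K)
        (\<lambda>W lam. - trace_above_one (omega_lower h Q \<mu> \<nu>\<^sub>0 K s W lam)) \<V>) \<and>
    (nondegenerate_upper h Q d \<mu> s \<longrightarrow>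
      functional_sim (at_right (4 / h\<^sup>2 + \<mu> s)) (\<lambda>W lam. - xi_plus h Q \<nu>\<^sub>0 K W lam)
        (\<lambda>W lam. - trace_above_one (\<lambda>g. - omega_upper h Q \<mu> \<nu>\<^sub>0 K s W lam g)) \<V> \<and>
      xi_minus h Q \<nu>\<^sub>0 K \<V> \<in> O[at_right (4 / h\<^sup>2 + \<mu> s)](\<lambda>_. 1))"
proof -
  obtain D where D: "hs K D"
    using assms by (auto simp: schatten2_iff_hs)
  obtain S where S: "weight (psi_weight \<nu>\<^sub>0) S"
    using psi_weight_l2[OF \<open>3 < \<nu>\<^sub>0\<close>] .
  have "bounded_clinear (op_sqrt \<V>)"
    using positive_op_sqrt[OF \<open>positive_op \<V>\<close>] by (simp add: positive_op_def)
  then obtain \<rho> where \<rho>: "0 < \<rho>" "\<And>u. norm (op_sqrt \<V> u) \<le> \<rho> * norm u"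
    using bounded_clinear_bound by blast
  \<comment> \<open>These constants are fixed by the data before the energy varies, which makes the
    bounds uniform in the energy.\<close>
  interpret lattice_model h \<nu>\<^sub>0 Q K \<V> d \<mu> S \<rho> D
    by (rule lattice_model.intro) (use assms D S \<rho> in \<open>auto intro: less_imp_le\<close>)
  show ?thesis
    using lower_threshold upper_threshold \<open>s \<in> I_Q Q d\<close> by blast
qed

end
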